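(* Let $k$ be a commutative ring, $\mathcal U$ a small category, $\mathcal A$ a prestack of $k$-linear categories on $\mathcal U$ and $M$ an $\mathcal A$-bimodule. Then the map $d:\mathbf C^{\bullet}_{\mathrm{GS}}(\mathcal A,M)\to\mathbf C^{\bullet+1}_{\mathrm{GS}}(\mathcal A,M)$ satisfies $d\circ d=0$.
   Context: **Prestacks.** A prestack $\mathcal A=(\mathcal A,m,f,c)$ on $\mathcal U$ consists of: for each object $U$ a $k$-linear category $\mathcal A(U)$ with composition written as juxtaposition; for each $u:V\to U$ a $k$-linear functor $u^*=f^u:\mathcal A(U)\to\mathcal A(V)$, with $(1_U)^*=1$; for $v:W\to V$, $u:V\to U$ a natural isomorphism $c^{u,v}:v^*u^*\to(uv)^*$, equal to the identity if $u$ or $v$ is an identity, such that $c^{u,vw}(c^{v,w}u^* )=c^{uv,w}(w^*c^{u,v})$ for all $w:T\to W$. **Bimodules.** An $\mathcal A$-bimodule $M$ consists of $k$-modules $M^U(A,B)$ for $A,B\in\mathcal A(U)$, $k$-linearly contravariant in $A$ and covariant in $B$ (actions written $b\,x\,a$), and $k$-linear maps $M^u:M^U(A,B)\to M^V(u^*A,u^*B)$ for $u:V\to U$ with $M^{1_U}=\mathrm{id}$, $M^u(bxa)=u^*(b)M^u(x)u^*(a)$ and $M^{uv}(x)\,c^{u,v,A}=c^{u,v,B}\,M^v(M^u(x))$. **Simplices.** A $p$-simplex of the nerve $\mathcal N_p(\mathcal U)$ is $\sigma=(u_1,\dots,u_p)$, $U_0\xrightarrow{u_1}U_1\to\cdots\xrightarrow{u_p}U_p$.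 Put $\sigma^*=(u_p\cdots u_1)^*$, $\sigma^\star=u_1^*\cdots u_p^*:\mathcal A(U_p)\to\mathcal A(U_0)$ (identities if $p=0$), $L_k\sigma=(u_1,\dots,u_k)$, $R_k\sigma=(u_{k+1},\dots,u_p)$, and let $\partial_0\sigma=(u_2,\dots,u_p)$, $\partial_i\sigma=(u_1,\dots,u_{i+1}u_i,\dots,u_p)$, $\partial_p\sigma=(u_1,\dots,u_{p-1})$. Put $c^{\sigma,k}=c^{u_p\cdots u_{k+1},\,u_k\cdots u_1}:(L_k\sigma)^*(R_k\sigma)^*\to\sigma^*$ (identity for $k=0,p$) and, for $1\le k\le p-1$, $\epsilon^{\sigma,k}=u_1^*\cdots u_{k-1}^*c^{u_{k+1},u_k}u_{k+2}^*\cdots u_p^*:\sigma^\star\to(\partial_k\sigma)^\star$; components at $A$ are written $c^{\sigma,k,A}$, $\epsilon^{\sigma,k,A}$. A $q$-simplex $a=(a_1,\dots,a_q)$ in a category is $A_0\xrightarrow{a_q}A_1\to\cdots\xrightarrow{a_1}A_q$, so $a_i:A_{q-i}\to A_{q-i+1}$. **Cochains.** $\mathbf C^{p,q}(\mathcal A,M)=\prod_{\sigma\in\mathcal N_p(\mathcal U)}\prod_{A_0,\dots,A_q\in\mathcal A(U_p)}\mathrm{Hom}_k\big(\mathcal A(U_p)(A_{q-1},A_q)\otimes\cdots\otimes\mathcal A(U_p)(A_0,A_1),M^{U_0}(\sigma^\star A_0,\sigma^*A_q)\big)$ (for $q=0$ just $M^{U_0}(\sigma^\star A_0,\sigma^*A_0)$),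 and $\mathbf C^n_{\mathrm{GS}}(\mathcal A,M)=\prod_{p+q=n}\mathbf C^{p,q}(\mathcal A,M)$. **Paths.** For $\sigma=(u_1,\dots,u_n)$, $n\ge1$, the paths $r=(r_1,\dots,r_{n-1})\in\mathcal P(\sigma)$ are chains of natural transformations $T_0\xrightarrow{r_{n-1}}T_1\to\cdots\xrightarrow{r_1}T_{n-1}$ from $T_0=\sigma^\star$ to $T_{n-1}=\sigma^*$, with a sign $(-1)^r$: $\mathcal P(u_1)$ has only the empty path (with $T_0=u_1^*$, sign $1$); for $n\ge2$, $\mathcal P(\sigma)=\{(r_1,\dots,r_{n-2},\epsilon^{\sigma,i}):1\le i\le n-1,\ r\in\mathcal P(\partial_i\sigma)\}$ with sign $(-1)^i(-1)^r$. Paths are indexed by the choices made ($(n-1)!$ of them). **Shuffles.** $S_{m,l}$ is the set of permutations $\beta$ of $\{1,\dots,m+l\}$ increasing on $\{1,\dots,m\}$ and on $\{m+1,\dots,m+l\}$; $(-1)^\beta$ is its sign. Given an $m$-simplex $a$ in $\mathcal A(U)$ and a chain $r=(r_1,\dots,r_l)$, $T_0\xrightarrow{r_l}\cdots\xrightarrow{r_1}T_l$, of natural transformations of functors $\mathcal A(U)\to\mathcal A(V)$, place the $i$-th entry of $(a_1,\dots,a_m,r_1,\dots,r_l)$ in position $\beta(i)$. Then $\beta(a,r)=(b_1,\dots,b_{m+l})$ is the simplex in $\mathcal A(V)$ from $T_0(A_0)$ to $T_l(A_m)$ with $b_x=T_{l-y}(a_i)$ if position $x$ holds $a_i$ and $y$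 of the $r$'s are in positions $<x$, and $b_x=r_i(A_{m-y})$ if position $x$ holds $r_i$ and $y$ of the $a$'s are in positions $<x$. **The map $d$.** For $\phi\in\mathbf C^{p,q}(\mathcal A,M)$, $p+q=n-1$, $d\phi=\sum_{j=0}^{q+1}d_j\phi$ with $d_j\phi\in\mathbf C^{p+j,q+1-j}(\mathcal A,M)$: $(d_0\phi)^\sigma(a_1,\dots,a_{q+1})=\sigma^*(a_1)\phi^\sigma(a_2,\dots,a_{q+1})+\sum_{i=1}^q(-1)^i\phi^\sigma(\dots,a_ia_{i+1},\dots)+(-1)^{q+1}\phi^\sigma(a_1,\dots,a_q)\sigma^\star(a_{q+1})$; $d_1\phi=(-1)^nd_{\mathrm{simp}}\phi$, $(d_{\mathrm{simp}}\phi)^\sigma(a)=c^{\sigma,1,A_q}M^{u_1}(\phi^{\partial_0\sigma}(a))+\sum_{i=1}^p(-1)^i\phi^{\partial_i\sigma}(a)\epsilon^{\sigma,i,A_0}+(-1)^{p+1}c^{\sigma,p,A_q}\phi^{\partial_{p+1}\sigma}(u_{p+1}^*a_1,\dots,u_{p+1}^*a_q)$ for a $(p+1)$-simplex $\sigma$; for $j\ge2$, $t=q+1-j$, $\sigma$ a $(p+j)$-simplex: $(d_j\phi)^\sigma(a_1,\dots,a_t)=\sum_{r\in\mathcal P(R_p\sigma),\,\beta\in S_{t,j-1}}(-1)^r(-1)^\beta(-1)^t\,c^{\sigma,p,A_t}\,\phi^{L_p\sigma}(\beta(a,r))$. *)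

theory Defs
  imports "HOL-Algebra.Module" "HOL-Combinatorics.Permutations" "HOL-Library.FuncSet"
begin

section \<open>Linear and multilinear maps\<close>

definition linear_maps ::
  "'k ring \<Rightarrow> ('k, 'a) module \<Rightarrow> ('k, 'b) module \<Rightarrow> ('a \<Rightarrow> 'b) set" where
  "linear_maps k M N = {f \<in> carrier M \<rightarrow> carrier N.
     (\<forall>x\<in>carrier M. \<forall>y\<in>carrier M. f (x \<oplus>\<^bsub>M\<^esub> y) = f x \<oplus>\<^bsub>N\<^esub> f y) \<and>
     (\<forall>r\<in>carrier k. \<forall>x\<in>carrier M. f (r \<odot>\<^bsub>M\<^esub> x) = r \<odot>\<^bsub>N\<^esub> f x)}"

definition tuples :: "('k, 'a) module list \<Rightarrow> 'a list set" where
  "tuples Ms = {xs. list_all2 (\<lambda>x M. x \<in> carrier M) xs Ms}"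

text \<open>The \<open>k\<close>-module homomorphisms out of the tensor product of \<open>Ms\<close>, i.e. the \<open>k\<close>-multilinear maps
  on tuples. If \<open>Ms\<close> is empty, the only tuple is \<open>[]\<close> and such a map is just an element of \<open>N\<close>.\<close>

definition multilinear_maps ::
  "'k ring \<Rightarrow> ('k, 'a) module list \<Rightarrow> ('k, 'b) module \<Rightarrow> ('a list \<Rightarrow> 'b) set" where
  "multilinear_maps k Ms N = {f \<in> tuples Ms \<rightarrow>\<^sub>E carrier N.
     \<forall>xs\<in>tuples Ms. \<forall>i<length Ms. (\<lambda>x. f (xs[i := x])) \<in> linear_maps k (Ms ! i) N}"


section \<open>Categories, linear categories, functors\<close>

record ('o, 'u) category =
  Obj :: "'o set"
  Arr :: "'u set"
  Dom :: "'u \<Rightarrow> 'o"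
  Cod :: "'u \<Rightarrow> 'o"
  Idn :: "'o \<Rightarrow> 'u"
  Cmp :: "'u \<Rightarrow> 'u \<Rightarrow> 'u"

text \<open>\<open>Cmp U u v\<close> is the composite ``\<open>u\<close> after \<open>v\<close>''.\<close>

locale small_category =
  fixes U :: "('o, 'u) category"
  assumes dom_closed: "u \<in> Arr U \<Longrightarrow> Dom U u \<in> Obj U"
    and cod_closed: "u \<in> Arr U \<Longrightarrow> Cod U u \<in> Obj U"
    and idn_closed: "X \<in> Obj U \<Longrightarrow> Idn U X \<in> Arr U \<and> Dom U (Idn U X) = X \<and> Cod U (Idn U X) = X"
    and cmp_closed: "\<lbrakk>u \<in> Arr U; v \<in> Arr U; Dom U u = Cod U v\<rbrakk> \<Longrightarrow>
        Cmp U u v \<in> Arr U \<and> Dom U (Cmp U u v) = Dom U v \<and> Cod U (Cmp U u v) = Cod U u"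
    and cmp_idn_left: "u \<in> Arr U \<Longrightarrow> Cmp U (Idn U (Cod U u)) u = u"
    and cmp_idn_right: "u \<in> Arr U \<Longrightarrow> Cmp U u (Idn U (Dom U u)) = u"
    and cmp_assoc: "\<lbrakk>u \<in> Arr U; v \<in> Arr U; w \<in> Arr U; Dom U u = Cod U v; Dom U v = Cod U w\<rbrakk> \<Longrightarrow>
        Cmp U (Cmp U u v) w = Cmp U u (Cmp U v w)"

record ('k, 'a, 'f) lincat =
  LOb :: "'a set"
  LHom :: "'a \<Rightarrow> 'a \<Rightarrow> ('k, 'f) module"
  LId :: "'a \<Rightarrow> 'f"
  LCmp :: "'f \<Rightarrow> 'f \<Rightarrow> 'f"

text \<open>Composition (and likewise the action of functors on morphisms and the bimodule operations
  below) takes no object arguments: as usual, a morphism is thought of as carrying its source and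
  target, so that distinct hom-modules may be taken disjoint. Disjointness is not required.\<close>

locale linear_category = cring k for k :: "'k ring" +
  fixes C :: "('k, 'a, 'f) lincat"
  assumes hom_module: "\<lbrakk>A \<in> LOb C; B \<in> LOb C\<rbrakk> \<Longrightarrow> module k (LHom C A B)"
    and id_closed: "A \<in> LOb C \<Longrightarrow> LId C A \<in> carrier (LHom C A A)"
    and comp_linear_left: "\<lbrakk>A \<in> LOb C; B \<in> LOb C; D \<in> LOb C; f \<in> carrier (LHom C A B)\<rbrakk> \<Longrightarrow>
        (\<lambda>g. LCmp C g f) \<in> linear_maps k (LHom C B D) (LHom C A D)"
    and comp_linear_right: "\<lbrakk>A \<in> LOb C; B \<in> LOb C; D \<in> LOb C; g \<in> carrier (LHom C B D)\<rbrakk> \<Longrightarrow>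
        (\<lambda>f. LCmp C g f) \<in> linear_maps k (LHom C A B) (LHom C A D)"
    and id_left: "\<lbrakk>A \<in> LOb C; B \<in> LOb C; f \<in> carrier (LHom C A B)\<rbrakk> \<Longrightarrow> LCmp C (LId C B) f = f"
    and id_right: "\<lbrakk>A \<in> LOb C; B \<in> LOb C; f \<in> carrier (LHom C A B)\<rbrakk> \<Longrightarrow> LCmp C f (LId C A) = f"
    and comp_assoc: "\<lbrakk>A \<in> LOb C; B \<in> LOb C; D \<in> LOb C; E \<in> LOb C;
          f \<in> carrier (LHom C A B); g \<in> carrier (LHom C B D); h \<in> carrier (LHom C D E)\<rbrakk> \<Longrightarrow>
        LCmp C (LCmp C h g) f = LCmp C h (LCmp C g f)"

record ('a, 'f) lfun =
  FOb :: "'a \<Rightarrow> 'a"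
  FMor :: "'f \<Rightarrow> 'f"

definition linear_functor ::
  "'k ring \<Rightarrow> ('k, 'a, 'f) lincat \<Rightarrow> ('k, 'a, 'f) lincat \<Rightarrow> ('a, 'f) lfun \<Rightarrow> bool" where
  "linear_functor k C D F \<longleftrightarrow>
     (\<forall>A\<in>LOb C. FOb F A \<in> LOb D) \<and>
     (\<forall>A\<in>LOb C. \<forall>B\<in>LOb C. FMor F \<in> linear_maps k (LHom C A B) (LHom D (FOb F A) (FOb F B))) \<and>
     (\<forall>A\<in>LOb C. FMor F (LId C A) = LId D (FOb F A)) \<and>
     (\<forall>A\<in>LOb C. \<forall>B\<in>LOb C. \<forall>E\<in>LOb C. \<forall>f\<in>carrier (LHom C A B). \<forall>g\<in>carrier (LHom C B E).
        FMor F (LCmp C g f) = LCmp D (FMor F g) (FMor F f))"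

definition natural_iso ::
  "('k, 'a, 'f) lincat \<Rightarrow> ('k, 'a, 'f) lincat \<Rightarrow> ('a, 'f) lfun \<Rightarrow> ('a, 'f) lfun \<Rightarrow> ('a \<Rightarrow> 'f) \<Rightarrow> bool"
  where
  "natural_iso C D F G \<eta> \<longleftrightarrow>
     (\<forall>A\<in>LOb C. \<eta> A \<in> carrier (LHom D (FOb F A) (FOb G A))) \<and>
     (\<forall>A\<in>LOb C. \<forall>B\<in>LOb C. \<forall>f\<in>carrier (LHom C A B).
        LCmp D (FMor G f) (\<eta> A) = LCmp D (\<eta> B) (FMor F f)) \<and>
     (\<forall>A\<in>LOb C. \<exists>\<theta>\<in>carrier (LHom D (FOb G A) (FOb F A)).
        LCmp D \<theta> (\<eta> A) = LId D (FOb F A) \<and> LCmp D (\<eta> A) \<theta> = LId D (FOb G A))"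

definition comp_lfun :: "('a, 'f) lfun \<Rightarrow> ('a, 'f) lfun \<Rightarrow> ('a, 'f) lfun" where
  "comp_lfun F G = \<lparr>FOb = FOb F \<circ> FOb G, FMor = FMor F \<circ> FMor G\<rparr>"

definition id_lfun :: "('a, 'f) lfun" where
  "id_lfun = \<lparr>FOb = (\<lambda>A. A), FMor = (\<lambda>f. f)\<rparr>"


section \<open>Prestacks and bimodules\<close>

text \<open>\<open>Pull A u\<close> is \<open>u\<^sup>*\<close>, and \<open>Twist A u v X\<close> is the component at \<open>X\<close> of
  \<open>c\<^sup>u\<^sup>,\<^sup>v : v\<^sup>* u\<^sup>* \<rightarrow> (u v)\<^sup>*\<close>.\<close>

record ('k, 'o, 'u, 'a, 'f) prestack_data =
  Cat :: "'o \<Rightarrow> ('k, 'a, 'f) lincat"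
  Pull :: "'u \<Rightarrow> ('a, 'f) lfun"
  Twist :: "'u \<Rightarrow> 'u \<Rightarrow> 'a \<Rightarrow> 'f"

locale prestack = cring k + small_category U
  for k :: "'k ring" and U :: "('o, 'u) category" +
  fixes A :: "('k, 'o, 'u, 'a, 'f) prestack_data"
  assumes cat: "X \<in> Obj U \<Longrightarrow> linear_category k (Cat A X)"
    and pull: "u \<in> Arr U \<Longrightarrow> linear_functor k (Cat A (Cod U u)) (Cat A (Dom U u)) (Pull A u)"
    and pull_id_ob: "\<lbrakk>X \<in> Obj U; B \<in> LOb (Cat A X)\<rbrakk> \<Longrightarrow> FOb (Pull A (Idn U X)) B = B"
    and pull_id_mor: "\<lbrakk>X \<in> Obj U; B \<in> LOb (Cat A X); D \<in> LOb (Cat A X);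
          f \<in> carrier (LHom (Cat A X) B D)\<rbrakk> \<Longrightarrow> FMor (Pull A (Idn U X)) f = f"
    and twist: "\<lbrakk>u \<in> Arr U; v \<in> Arr U; Dom U u = Cod U v\<rbrakk> \<Longrightarrow>
        natural_iso (Cat A (Cod U u)) (Cat A (Dom U v))
          (comp_lfun (Pull A v) (Pull A u)) (Pull A (Cmp U u v)) (Twist A u v)"
    and twist_id_left: "\<lbrakk>v \<in> Arr U; B \<in> LOb (Cat A (Cod U v))\<rbrakk> \<Longrightarrow>
        Twist A (Idn U (Cod U v)) v B = LId (Cat A (Dom U v)) (FOb (Pull A v) B)"
    and twist_id_right: "\<lbrakk>u \<in> Arr U; B \<in> LOb (Cat A (Cod U u))\<rbrakk> \<Longrightarrow>
        Twist A u (Idn U (Dom U u)) B = LId (Cat A (Dom U u)) (FOb (Pull A u) B)"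
    and twist_cocycle: "\<lbrakk>u \<in> Arr U; v \<in> Arr U; w \<in> Arr U; Dom U u = Cod U v; Dom U v = Cod U w;
          B \<in> LOb (Cat A (Cod U u))\<rbrakk> \<Longrightarrow>
        LCmp (Cat A (Dom U w)) (Twist A u (Cmp U v w) B) (Twist A v w (FOb (Pull A u) B)) =
        LCmp (Cat A (Dom U w)) (Twist A (Cmp U u v) w B) (FMor (Pull A w) (Twist A u v B))"

text \<open>\<open>Bim M X B D\<close> is \<open>M\<^sup>X(B, D)\<close>; \<open>lact M X b x\<close> is \<open>b x\<close> and \<open>ract M X x a\<close> is \<open>x a\<close> over the
  object \<open>X\<close>; \<open>Res M u\<close> is \<open>M\<^sup>u\<close>.\<close>

record ('k, 'o, 'u, 'a, 'f, 'm) bimodule_data =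
  Bim :: "'o \<Rightarrow> 'a \<Rightarrow> 'a \<Rightarrow> ('k, 'm) module"
  lact :: "'o \<Rightarrow> 'f \<Rightarrow> 'm \<Rightarrow> 'm"
  ract :: "'o \<Rightarrow> 'm \<Rightarrow> 'f \<Rightarrow> 'm"
  Res :: "'u \<Rightarrow> 'm \<Rightarrow> 'm"

locale prestack_bimodule = prestack k U A
  for k :: "'k ring" and U :: "('o, 'u) category"
    and A :: "('k, 'o, 'u, 'a, 'f) prestack_data" +
  fixes M :: "('k, 'o, 'u, 'a, 'f, 'm) bimodule_data"
  assumes bim_module: "\<lbrakk>X \<in> Obj U; B \<in> LOb (Cat A X); D \<in> LOb (Cat A X)\<rbrakk> \<Longrightarrow>
        module k (Bim M X B D)"
    and lact_linear_right: "\<lbrakk>X \<in> Obj U; B \<in> LOb (Cat A X); D \<in> LOb (Cat A X); E \<in> LOb (Cat A X);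
          b \<in> carrier (LHom (Cat A X) D E)\<rbrakk> \<Longrightarrow>
        (\<lambda>x. lact M X b x) \<in> linear_maps k (Bim M X B D) (Bim M X B E)"
    and lact_linear_left: "\<lbrakk>X \<in> Obj U; B \<in> LOb (Cat A X); D \<in> LOb (Cat A X); E \<in> LOb (Cat A X);
          x \<in> carrier (Bim M X B D)\<rbrakk> \<Longrightarrow>
        (\<lambda>b. lact M X b x) \<in> linear_maps k (LHom (Cat A X) D E) (Bim M X B E)"
    and ract_linear_left: "\<lbrakk>X \<in> Obj U; B \<in> LOb (Cat A X); D \<in> LOb (Cat A X); E \<in> LOb (Cat A X);
          a \<in> carrier (LHom (Cat A X) B D)\<rbrakk> \<Longrightarrow>
        (\<lambda>x. ract M X x a) \<in> linear_maps k (Bim M X D E) (Bim M X B E)"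
    and ract_linear_right: "\<lbrakk>X \<in> Obj U; B \<in> LOb (Cat A X); D \<in> LOb (Cat A X); E \<in> LOb (Cat A X);
          x \<in> carrier (Bim M X D E)\<rbrakk> \<Longrightarrow>
        (\<lambda>a. ract M X x a) \<in> linear_maps k (LHom (Cat A X) B D) (Bim M X B E)"
    and lact_id: "\<lbrakk>X \<in> Obj U; B \<in> LOb (Cat A X); D \<in> LOb (Cat A X); x \<in> carrier (Bim M X B D)\<rbrakk> \<Longrightarrow>
        lact M X (LId (Cat A X) D) x = x"
    and ract_id: "\<lbrakk>X \<in> Obj U; B \<in> LOb (Cat A X); D \<in> LOb (Cat A X); x \<in> carrier (Bim M X B D)\<rbrakk> \<Longrightarrow>
        ract M X x (LId (Cat A X) B) = x"
    and lact_comp: "\<lbrakk>X \<in> Obj U; B \<in> LOb (Cat A X); D \<in> LOb (Cat A X); E \<in> LOb (Cat A X);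
          F \<in> LOb (Cat A X); x \<in> carrier (Bim M X B D);
          b \<in> carrier (LHom (Cat A X) D E); b' \<in> carrier (LHom (Cat A X) E F)\<rbrakk> \<Longrightarrow>
        lact M X (LCmp (Cat A X) b' b) x = lact M X b' (lact M X b x)"
    and ract_comp: "\<lbrakk>X \<in> Obj U; B \<in> LOb (Cat A X); D \<in> LOb (Cat A X); E \<in> LOb (Cat A X);
          F \<in> LOb (Cat A X); x \<in> carrier (Bim M X E F);
          a \<in> carrier (LHom (Cat A X) B D); a' \<in> carrier (LHom (Cat A X) D E)\<rbrakk> \<Longrightarrow>
        ract M X x (LCmp (Cat A X) a' a) = ract M X (ract M X x a') a"
    and lact_ract: "\<lbrakk>X \<in> Obj U; B \<in> LOb (Cat A X); D \<in> LOb (Cat A X); E \<in> LOb (Cat A X);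
          F \<in> LOb (Cat A X); x \<in> carrier (Bim M X D E);
          a \<in> carrier (LHom (Cat A X) B D); b \<in> carrier (LHom (Cat A X) E F)\<rbrakk> \<Longrightarrow>
        ract M X (lact M X b x) a = lact M X b (ract M X x a)"
    and res_linear: "\<lbrakk>u \<in> Arr U; B \<in> LOb (Cat A (Cod U u)); D \<in> LOb (Cat A (Cod U u))\<rbrakk> \<Longrightarrow>
        Res M u \<in> linear_maps k (Bim M (Cod U u) B D)
          (Bim M (Dom U u) (FOb (Pull A u) B) (FOb (Pull A u) D))"
    and res_id: "\<lbrakk>X \<in> Obj U; B \<in> LOb (Cat A X); D \<in> LOb (Cat A X); x \<in> carrier (Bim M X B D)\<rbrakk> \<Longrightarrow>
        Res M (Idn U X) x = x"
    and res_act: "\<lbrakk>u \<in> Arr U; B \<in> LOb (Cat A (Cod U u)); D \<in> LOb (Cat A (Cod U u));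
          E \<in> LOb (Cat A (Cod U u)); F \<in> LOb (Cat A (Cod U u));
          a \<in> carrier (LHom (Cat A (Cod U u)) B D); x \<in> carrier (Bim M (Cod U u) D E);
          b \<in> carrier (LHom (Cat A (Cod U u)) E F)\<rbrakk> \<Longrightarrow>
        Res M u (lact M (Cod U u) b (ract M (Cod U u) x a)) =
        lact M (Dom U u) (FMor (Pull A u) b) (ract M (Dom U u) (Res M u x) (FMor (Pull A u) a))"
    and res_twist: "\<lbrakk>u \<in> Arr U; v \<in> Arr U; Dom U u = Cod U v;
          B \<in> LOb (Cat A (Cod U u)); D \<in> LOb (Cat A (Cod U u)); x \<in> carrier (Bim M (Cod U u) B D)\<rbrakk> \<Longrightarrow>
        ract M (Dom U v) (Res M (Cmp U u v) x) (Twist A u v B) =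
        lact M (Dom U v) (Twist A u v D) (Res M v (Res M u x))"


section \<open>Simplices of the nerve\<close>

text \<open>A simplex \<open>U\<^sub>0 \<rightarrow> U\<^sub>1 \<rightarrow> \<dots> \<rightarrow> U\<^sub>p\<close> is the pair \<open>(U\<^sub>0, [u\<^sub>1, \<dots>, u\<^sub>p])\<close>; the vertex \<open>U\<^sub>0\<close> is recorded
  so that \<open>0\<close>-simplices are objects. Note that \<open>u\<^sub>i\<close> is the list entry with index \<open>i - 1\<close>.\<close>

type_synonym ('o, 'u) simplex = "'o \<times> 'u list"

definition vertex :: "('o, 'u) category \<Rightarrow> ('o, 'u) simplex \<Rightarrow> nat \<Rightarrow> 'o" where
  "vertex U \<sigma> i = (if i = 0 then fst \<sigma> else Cod U (snd \<sigma> ! (i - 1)))"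

definition last_vertex :: "('o, 'u) category \<Rightarrow> ('o, 'u) simplex \<Rightarrow> 'o" where
  "last_vertex U \<sigma> = vertex U \<sigma> (length (snd \<sigma>))"

definition nerve :: "('o, 'u) category \<Rightarrow> nat \<Rightarrow> ('o, 'u) simplex set" where
  "nerve U p = {\<sigma>. fst \<sigma> \<in> Obj U \<and> length (snd \<sigma>) = p \<and> set (snd \<sigma>) \<subseteq> Arr U \<and>
     (\<forall>i<p. Dom U (snd \<sigma> ! i) = vertex U \<sigma> i)}"

text \<open>The composite \<open>u\<^sub>p \<cdots> u\<^sub>1\<close>.\<close>

definition total :: "('o, 'u) category \<Rightarrow> ('o, 'u) simplex \<Rightarrow> 'u" where
  "total U \<sigma> = foldl (\<lambda>v u. Cmp U u v) (Idn U (fst \<sigma>)) (snd \<sigma>)"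

definition Lpart :: "nat \<Rightarrow> ('o, 'u) simplex \<Rightarrow> ('o, 'u) simplex" where
  "Lpart i \<sigma> = (fst \<sigma>, take i (snd \<sigma>))"

definition Rpart :: "('o, 'u) category \<Rightarrow> nat \<Rightarrow> ('o, 'u) simplex \<Rightarrow> ('o, 'u) simplex" where
  "Rpart U i \<sigma> = (vertex U \<sigma> i, drop i (snd \<sigma>))"

definition face :: "('o, 'u) category \<Rightarrow> nat \<Rightarrow> ('o, 'u) simplex \<Rightarrow> ('o, 'u) simplex" where
  "face U i \<sigma> = (let us = snd \<sigma> in
     if i = 0 then (vertex U \<sigma> 1, tl us)
     else if i = length us then (fst \<sigma>, butlast us)
     else (fst \<sigma>, take (i - 1) us @ [Cmp U (us ! i) (us ! (i - 1))] @ drop (i + 1) us))"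

text \<open>\<open>pull_total\<close> is \<open>(u\<^sub>p \<cdots> u\<^sub>1)\<^sup>*\<close> and \<open>pull_list\<close> is \<open>u\<^sub>1\<^sup>* \<cdots> u\<^sub>p\<^sup>*\<close>.\<close>

definition pull_total ::
  "('o, 'u) category \<Rightarrow> ('k, 'o, 'u, 'a, 'f) prestack_data \<Rightarrow> ('o, 'u) simplex \<Rightarrow> ('a, 'f) lfun" where
  "pull_total U A \<sigma> = Pull A (total U \<sigma>)"

definition pull_list :: "('k, 'o, 'u, 'a, 'f) prestack_data \<Rightarrow> 'u list \<Rightarrow> ('a, 'f) lfun" where
  "pull_list A us = foldr (\<lambda>u F. comp_lfun (Pull A u) F) us id_lfun"

definition csplit ::
  "('o, 'u) category \<Rightarrow> ('k, 'o, 'u, 'a, 'f) prestack_data \<Rightarrow> ('o, 'u) simplex \<Rightarrow> nat \<Rightarrow> 'a \<Rightarrow> 'f" where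
  "csplit U A \<sigma> i B =
     (if i = 0 \<or> i = length (snd \<sigma>) then LId (Cat A (fst \<sigma>)) (FOb (pull_total U A \<sigma>) B)
      else Twist A (total U (Rpart U i \<sigma>)) (total U (Lpart i \<sigma>)) B)"

definition eps ::
  "('k, 'o, 'u, 'a, 'f) prestack_data \<Rightarrow> ('o, 'u) simplex \<Rightarrow> nat \<Rightarrow> 'a \<Rightarrow> 'f" where
  "eps A \<sigma> i B = (let us = snd \<sigma> in
     FMor (pull_list A (take (i - 1) us))
       (Twist A (us ! i) (us ! (i - 1)) (FOb (pull_list A (drop (i + 1) us)) B)))"


section \<open>Cochains\<close>

text \<open>A \<open>q\<close>-simplex \<open>A\<^sub>0 \<rightarrow> A\<^sub>1 \<rightarrow> \<dots> \<rightarrow> A\<^sub>q\<close> of a linear category with arrows \<open>a\<^sub>i : A\<^sub>q\<^sub>-\<^sub>i \<rightarrow> A\<^sub>q\<^sub>-\<^sub>i\<^sub>+\<^sub>1\<close> is given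
  by the two lists \<open>[A\<^sub>0, \<dots>, A\<^sub>q]\<close> and \<open>[a\<^sub>1, \<dots>, a\<^sub>q]\<close>.\<close>

definition objects :: "('k, 'a, 'f) lincat \<Rightarrow> nat \<Rightarrow> 'a list set" where
  "objects C q = {As. length As = Suc q \<and> set As \<subseteq> LOb C}"

definition homs :: "('k, 'a, 'f) lincat \<Rightarrow> 'a list \<Rightarrow> ('k, 'f) module list" where
  "homs C As = (let q = length As - 1 in
     map (\<lambda>i. LHom C (As ! (q - i)) (As ! (q - i + 1))) [1..<q + 1])"

text \<open>The module \<open>M(\<sigma>\<^sup>\<star> A\<^sub>0, \<sigma>\<^sup>* A\<^sub>q)\<close> over the vertex \<open>U\<^sub>0\<close>.\<close>

definition coeffs ::
  "('o, 'u) category \<Rightarrow> ('k, 'o, 'u, 'a, 'f) prestack_data \<Rightarrow> ('k, 'o, 'u, 'a, 'f, 'm) bimodule_data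
    \<Rightarrow> ('o, 'u) simplex \<Rightarrow> 'a list \<Rightarrow> ('k, 'm) module" where
  "coeffs U A M \<sigma> As =
     Bim M (fst \<sigma>) (FOb (pull_list A (snd \<sigma>)) (hd As)) (FOb (pull_total U A \<sigma>) (last As))"

type_synonym ('o, 'u, 'a, 'f, 'm) cochain = "('o, 'u) simplex \<Rightarrow> 'a list \<Rightarrow> 'f list \<Rightarrow> 'm"

definition Cpq ::
  "'k ring \<Rightarrow> ('o, 'u) category \<Rightarrow> ('k, 'o, 'u, 'a, 'f) prestack_data
    \<Rightarrow> ('k, 'o, 'u, 'a, 'f, 'm) bimodule_data \<Rightarrow> nat \<Rightarrow> nat \<Rightarrow> ('o, 'u, 'a, 'f, 'm) cochain set" where
  "Cpq k U A M p q =
     (\<Pi>\<^sub>E \<sigma>\<in>nerve U p. \<Pi>\<^sub>E As\<in>objects (Cat A (last_vertex U \<sigma>)) q.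
        multilinear_maps k (homs (Cat A (last_vertex U \<sigma>)) As) (coeffs U A M \<sigma> As))"

definition bidegrees :: "nat \<Rightarrow> (nat \<times> nat) set" where
  "bidegrees n = {(p, q). p + q = n}"

definition CGS ::
  "'k ring \<Rightarrow> ('o, 'u) category \<Rightarrow> ('k, 'o, 'u, 'a, 'f) prestack_data
    \<Rightarrow> ('k, 'o, 'u, 'a, 'f, 'm) bimodule_data \<Rightarrow> nat
    \<Rightarrow> (nat \<times> nat \<Rightarrow> ('o, 'u, 'a, 'f, 'm) cochain) set" where
  "CGS k U A M n = (\<Pi>\<^sub>E (p, q)\<in>bidegrees n. Cpq k U A M p q)"

text \<open>Elements of the products above are functions that are \<^const>\<open>undefined\<close> off their index sets;
  the following operator makes an arbitrary family of values such an extensional function.\<close>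

definition gs_restrict ::
  "('o, 'u) category \<Rightarrow> ('k, 'o, 'u, 'a, 'f) prestack_data \<Rightarrow> nat
    \<Rightarrow> (nat \<times> nat \<Rightarrow> ('o, 'u, 'a, 'f, 'm) cochain)
    \<Rightarrow> (nat \<times> nat \<Rightarrow> ('o, 'u, 'a, 'f, 'm) cochain)" where
  "gs_restrict U A n \<Phi> =
     (\<lambda>pq\<in>bidegrees n. \<lambda>\<sigma>\<in>nerve U (fst pq).
        \<lambda>As\<in>objects (Cat A (last_vertex U \<sigma>)) (snd pq).
        \<lambda>as\<in>tuples (homs (Cat A (last_vertex U \<sigma>)) As). \<Phi> pq \<sigma> As as)"

definition gs_zero ::
  "('o, 'u) category \<Rightarrow> ('k, 'o, 'u, 'a, 'f) prestack_data \<Rightarrow> ('k, 'o, 'u, 'a, 'f, 'm) bimodule_data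
    \<Rightarrow> nat \<Rightarrow> (nat \<times> nat \<Rightarrow> ('o, 'u, 'a, 'f, 'm) cochain)" where
  "gs_zero U A M n = gs_restrict U A n (\<lambda>pq \<sigma> As as. \<zero>\<^bsub>coeffs U A M \<sigma> As\<^esub>)"


section \<open>Paths\<close>

text \<open>A path is determined by the list of indices \<open>i\<close> of the \<open>\<epsilon>\<close>'s chosen successively, starting from
  \<open>\<sigma>\<^sup>\<star>\<close>. For \<open>\<sigma>\<close> an \<open>n\<close>-simplex, \<open>path_functors\<close> returns \<open>[T\<^sub>0, \<dots>, T\<^sub>n\<^sub>-\<^sub>1]\<close> and \<open>path_nats\<close> returns
  \<open>[r\<^sub>1, \<dots>, r\<^sub>n\<^sub>-\<^sub>1]\<close>; the first choice is the last entry \<open>r\<^sub>n\<^sub>-\<^sub>1\<close>.\<close>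

fun paths :: "nat \<Rightarrow> nat list set" where
  "paths 0 = {}"
| "paths (Suc 0) = {[]}"
| "paths (Suc (Suc n)) = (\<Union>i\<in>{1..Suc n}. (#) i ` paths (Suc n))"

fun path_sign :: "nat list \<Rightarrow> int" where
  "path_sign [] = 1"
| "path_sign (i # r) = (- 1) ^ i * path_sign r"

fun path_functors ::
  "('o, 'u) category \<Rightarrow> ('k, 'o, 'u, 'a, 'f) prestack_data \<Rightarrow> ('o, 'u) simplex \<Rightarrow> nat list
    \<Rightarrow> ('a, 'f) lfun list" where
  "path_functors U A \<sigma> [] = [pull_list A (snd \<sigma>)]"
| "path_functors U A \<sigma> (i # r) = pull_list A (snd \<sigma>) # path_functors U A (face U i \<sigma>) r"

fun path_nats ::
  "('o, 'u) category \<Rightarrow> ('k, 'o, 'u, 'a, 'f) prestack_data \<Rightarrow> ('o, 'u) simplex \<Rightarrow> nat list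
    \<Rightarrow> ('a \<Rightarrow> 'f) list" where
  "path_nats U A \<sigma> [] = []"
| "path_nats U A \<sigma> (i # r) = path_nats U A (face U i \<sigma>) r @ [eps A \<sigma> i]"


section \<open>Shuffles\<close>

definition shuffle_perms :: "nat \<Rightarrow> nat \<Rightarrow> (nat \<Rightarrow> nat) set" where
  "shuffle_perms m l = {\<beta>. \<beta> permutes {1..m + l} \<and>
     strict_mono_on {1..m} \<beta> \<and> strict_mono_on {m + 1..m + l} \<beta>}"

text \<open>The number of \<open>a\<close>'s, respectively \<open>r\<close>'s, in positions \<open>< x\<close>.\<close>

definition as_before :: "nat \<Rightarrow> (nat \<Rightarrow> nat) \<Rightarrow> nat \<Rightarrow> nat" where
  "as_before m \<beta> x = card {i \<in> {1..m}. \<beta> i < x}"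

definition rs_before :: "nat \<Rightarrow> nat \<Rightarrow> (nat \<Rightarrow> nat) \<Rightarrow> nat \<Rightarrow> nat" where
  "rs_before m l \<beta> x = card {i \<in> {m + 1..m + l}. \<beta> i < x}"

text \<open>The arrows \<open>b\<^sub>1, \<dots>, b\<^sub>m\<^sub>+\<^sub>l\<close> of \<open>\<beta>(a, r)\<close>, and its vertices \<open>B\<^sub>0, \<dots>, B\<^sub>m\<^sub>+\<^sub>l\<close>: the arrow \<open>b\<^sub>x\<close> has target
  \<open>B\<^sub>m\<^sub>+\<^sub>l\<^sub>-\<^sub>x\<^sub>+\<^sub>1\<close>, which is \<open>T\<^sub>l\<^sub>-\<^sub>y(A\<^sub>m\<^sub>-\<^sub>z)\<close> when \<open>y\<close> of the \<open>r\<close>'s and \<open>z\<close> of the \<open>a\<close>'s are in positions \<open>< x\<close>.\<close>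

definition shuffle_arrows ::
  "(nat \<Rightarrow> nat) \<Rightarrow> ('a, 'f) lfun list \<Rightarrow> ('a \<Rightarrow> 'f) list \<Rightarrow> 'a list \<Rightarrow> 'f list \<Rightarrow> 'f list" where
  "shuffle_arrows \<beta> Ts rs As as = (let m = length as; l = length rs in
     map (\<lambda>x. let i = inv_into UNIV \<beta> x in
            if i \<le> m then FMor (Ts ! (l - rs_before m l \<beta> x)) (as ! (i - 1))
            else (rs ! (i - m - 1)) (As ! (m - as_before m \<beta> x)))
       [1..<m + l + 1])"

definition shuffle_objects ::
  "(nat \<Rightarrow> nat) \<Rightarrow> ('a, 'f) lfun list \<Rightarrow> ('a \<Rightarrow> 'f) list \<Rightarrow> 'a list \<Rightarrow> 'f list \<Rightarrow> 'a list" where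
  "shuffle_objects \<beta> Ts rs As as = (let m = length as; l = length rs in
     map (\<lambda>j. let x = m + l - j + 1 in
            FOb (Ts ! (l - rs_before m l \<beta> x)) (As ! (m - as_before m \<beta> x)))
       [0..<m + l + 1])"


section \<open>The differential\<close>

text \<open>For \<open>\<phi>\<close> of bidegree \<open>(p, q)\<close>, \<open>d_comp U A M j p q \<phi>\<close> is \<open>d\<^sub>j \<phi>\<close>, of bidegree \<open>(p + j, q + 1 - j)\<close>;
  its values are only meaningful on the index sets of that bidegree.
  Integer multiples \<open>[z] \<cdot> x\<close> in the coefficient module supply the signs. The arrow \<open>a\<^sub>i\<close> starts at
  \<open>A\<^sub>q\<^sub>+\<^sub>1\<^sub>-\<^sub>i\<close> when there are \<open>q + 1\<close> arrows, so this vertex is omitted when \<open>a\<^sub>i\<close> and \<open>a\<^sub>i\<^sub>+\<^sub>1\<close> are composed.\<close>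

definition d_hoch ::
  "('o, 'u) category \<Rightarrow> ('k, 'o, 'u, 'a, 'f) prestack_data \<Rightarrow> ('k, 'o, 'u, 'a, 'f, 'm) bimodule_data
    \<Rightarrow> nat \<Rightarrow> ('o, 'u, 'a, 'f, 'm) cochain \<Rightarrow> ('o, 'u, 'a, 'f, 'm) cochain" where
  "d_hoch U A M q \<phi> \<sigma> As as = (let N = coeffs U A M \<sigma> As; C = Cat A (last_vertex U \<sigma>) in
     lact M (fst \<sigma>) (FMor (pull_total U A \<sigma>) (hd as)) (\<phi> \<sigma> (butlast As) (tl as))
     \<oplus>\<^bsub>N\<^esub> (\<Oplus>\<^bsub>N\<^esub>i\<in>{1..q}. [((- 1 :: int) ^ i)] \<cdot>\<^bsub>N\<^esub>
           \<phi> \<sigma> (take (q + 1 - i) As @ drop (q + 2 - i) As)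
               (take (i - 1) as @ [LCmp C (as ! (i - 1)) (as ! i)] @ drop (i + 1) as))
     \<oplus>\<^bsub>N\<^esub> [((- 1 :: int) ^ (q + 1))] \<cdot>\<^bsub>N\<^esub>
           ract M (fst \<sigma>) (\<phi> \<sigma> (tl As) (butlast as)) (FMor (pull_list A (snd \<sigma>)) (last as)))"

definition d_simp ::
  "('o, 'u) category \<Rightarrow> ('k, 'o, 'u, 'a, 'f) prestack_data \<Rightarrow> ('k, 'o, 'u, 'a, 'f, 'm) bimodule_data
    \<Rightarrow> nat \<Rightarrow> ('o, 'u, 'a, 'f, 'm) cochain \<Rightarrow> ('o, 'u, 'a, 'f, 'm) cochain" where
  "d_simp U A M p \<phi> \<sigma> As as = (let N = coeffs U A M \<sigma> As; X = fst \<sigma>; us = snd \<sigma> in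
     lact M X (csplit U A \<sigma> 1 (last As)) (Res M (us ! 0) (\<phi> (face U 0 \<sigma>) As as))
     \<oplus>\<^bsub>N\<^esub> (\<Oplus>\<^bsub>N\<^esub>i\<in>{1..p}. [((- 1 :: int) ^ i)] \<cdot>\<^bsub>N\<^esub>
           ract M X (\<phi> (face U i \<sigma>) As as) (eps A \<sigma> i (hd As)))
     \<oplus>\<^bsub>N\<^esub> [((- 1 :: int) ^ (p + 1))] \<cdot>\<^bsub>N\<^esub>
           lact M X (csplit U A \<sigma> p (last As))
             (\<phi> (face U (p + 1) \<sigma>) (map (FOb (Pull A (us ! p))) As) (map (FMor (Pull A (us ! p))) as)))"

definition d_high ::
  "('o, 'u) category \<Rightarrow> ('k, 'o, 'u, 'a, 'f) prestack_data \<Rightarrow> ('k, 'o, 'u, 'a, 'f, 'm) bimodule_data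
    \<Rightarrow> nat \<Rightarrow> nat \<Rightarrow> nat \<Rightarrow> ('o, 'u, 'a, 'f, 'm) cochain \<Rightarrow> ('o, 'u, 'a, 'f, 'm) cochain" where
  "d_high U A M j p q \<phi> \<sigma> As as =
    (let N = coeffs U A M \<sigma> As; t = q + 1 - j; \<rho> = Rpart U p \<sigma> in
     \<Oplus>\<^bsub>N\<^esub>r\<in>paths j. \<Oplus>\<^bsub>N\<^esub>\<beta>\<in>shuffle_perms t (j - 1).
       [(path_sign r * sign \<beta> * (- 1) ^ t)] \<cdot>\<^bsub>N\<^esub>
         lact M (fst \<sigma>) (csplit U A \<sigma> p (last As))
           (\<phi> (Lpart p \<sigma>)
              (shuffle_objects \<beta> (path_functors U A \<rho> r) (path_nats U A \<rho> r) As as)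
              (shuffle_arrows \<beta> (path_functors U A \<rho> r) (path_nats U A \<rho> r) As as)))"

definition d_comp ::
  "('o, 'u) category \<Rightarrow> ('k, 'o, 'u, 'a, 'f) prestack_data \<Rightarrow> ('k, 'o, 'u, 'a, 'f, 'm) bimodule_data
    \<Rightarrow> nat \<Rightarrow> nat \<Rightarrow> nat \<Rightarrow> ('o, 'u, 'a, 'f, 'm) cochain \<Rightarrow> ('o, 'u, 'a, 'f, 'm) cochain" where
  "d_comp U A M j p q \<phi> \<sigma> As as =
    (if j = 0 then d_hoch U A M q \<phi> \<sigma> As as
     else if j = 1 then [((- 1 :: int) ^ (p + q + 1))] \<cdot>\<^bsub>coeffs U A M \<sigma> As\<^esub> d_simp U A M p \<phi> \<sigma> As as
     else d_high U A M j p q \<phi> \<sigma> As as)"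

text \<open>The component of \<open>d \<Phi>\<close> in bidegree \<open>(p', q')\<close> collects the \<open>d\<^sub>j\<close> of the components of \<open>\<Phi>\<close> in
  bidegrees \<open>(p, q)\<close> with \<open>(p + j, q + 1 - j) = (p', q')\<close>.\<close>

definition gs_d ::
  "('o, 'u) category \<Rightarrow> ('k, 'o, 'u, 'a, 'f) prestack_data \<Rightarrow> ('k, 'o, 'u, 'a, 'f, 'm) bimodule_data
    \<Rightarrow> nat \<Rightarrow> (nat \<times> nat \<Rightarrow> ('o, 'u, 'a, 'f, 'm) cochain)
    \<Rightarrow> (nat \<times> nat \<Rightarrow> ('o, 'u, 'a, 'f, 'm) cochain)" where
  "gs_d U A M n \<Phi> = gs_restrict U A (n + 1) (\<lambda>(p', q') \<sigma> As as.
     finsum (coeffs U A M \<sigma> As) (\<lambda>(j, p, q). d_comp U A M j p q (\<Phi> (p, q)) \<sigma> As as)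
       {(j, p, q). j \<le> q + 1 \<and> p + j = p' \<and> q + 1 - j = q'})"

end

theory Submission
  imports Defs "HOL-Library.Poly_Mapping"
begin

text \<open>The differential \<open>d\<close> is the sum of the Hochschild differential (\<open>j = 0\<close>), the simplicial differential (\<open>j = 1\<close>)
  and the higher components (\<open>j \<ge> 2\<close>). The last simplicial face has the same form as the higher components: it cuts off the
  last arrow, whose only path is the empty one. So write $d = d_H + d_S + d_P$, where $d_S$ consists of all simplicial faces
  but the last and the path part $d_P$ evaluates a cochain on an initial part of the simplex, on shuffles of the given arrows with
  the paths of the remaining part.

  The products of $d_H$ and $d_S$ cancel for the usual reasons: associativity, functoriality, naturality and the cocycle
  condition (\<open>hoch_hoch\<close>, \<open>simp_simp\<close>, \<open>hoch_simp_first\<close>, \<open>hoch_simp_inner\<close>). For $d_P$, look at what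
  $d_H$ does to a shuffle of arrows and steps of a path.

    \<^item> It merges two neighbours. An arrow and a step can be exchanged by naturality, and the two shuffles have opposite
      signs; two arrows give $d_H$ before shuffling; two steps of a path give zero in the sum over all paths, since
      two consecutive merges can be done in two orders with opposite signs. These are the Leibniz rule
      \<open>shuffle_sum_inner_bd\<close> and \<open>path_sum_inner_bd\<close>, combined in \<open>path_part_hoch_inner\<close>.

    \<^item> It takes off an entry at the left end. An arrow gives $d_H$ outside. A step is the last step of a path, which is a
      structure isomorphism $c$ for some cut of the simplex, the rest of the path being a shuffle of paths of the two parts
      (\<open>path_sum_split\<close>). As shuffles are associative (\<open>shuffle_sum_assoc\<close>), what remains is a term
      of $d_P d_P$ with the opposite sign; see \<open>path_part_left_cancel\<close>.

    \<^item> It takes off an entry at the right end. An arrow again gives $d_H$ outside. A step is the first step of a path,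
      $\epsilon^{\sigma,i}$, which merges two arrows of the base; together with the inner faces of the initial part these are,
      with the opposite sign, the terms of $d_S d_P$ that come from inner faces; see \<open>path_part_right_cancel\<close>.

  Finally, the first simplicial face anticommutes with $d_P$ (\<open>path_part_simp_first\<close>).

  The values of a cochain lie in modules that vary with the simplex. To rearrange sums freely, the computation is done with
  formal sums of bimodule elements (\<open>formal_d_formal_d\<close>), and transferred by the homomorphism that evaluates a formal sum
  in its module (\<open>represents_gs_d\<close>). For this, permutations are translated to words (\<open>shuffle_perms_words\<close>)
  and simplices to lists of arrows paired with their sources. That \<open>d\<close> preserves multilinearity is checked piece by piece
  (\<open>multilinear_formal_d\<close>).\<close>

section \<open>Signed sums over shuffles\<close>

text \<open>Signs are written \<open>signed n x\<close> for $(-1)^n x$, so that they make sense in every abelian group type.\<close>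

definition signed :: "nat \<Rightarrow> 'g::ab_group_add \<Rightarrow> 'g" where
  "signed n x = (if even n then x else - x)"

lemma signed_0 [simp]: "signed 0 x = x"
  and signed_Suc [simp]: "signed (Suc n) x = - signed n x"
  and signed_zero [simp]: "signed n 0 = 0"
  and signed_uminus [simp]: "signed n (- x) = - signed n x"
  and signed_add: "signed n (x + y) = signed n x + signed n y"
  and signed_diff: "signed n (x - y) = signed n x - signed n y"
  by (auto simp: signed_def)

lemma signed_signed: "signed m (signed n x) = signed (m + n) x"
  by (auto simp: signed_def)

lemma signed_commute: "signed m (signed n x) = signed n (signed m x)"
  by (auto simp: signed_def)

lemma signed_twice [simp]: "signed n (signed n x) = x"
  by (auto simp: signed_def)

lemma signed_sum: "signed n (sum f S) = (\<Sum>i\<in>S. signed n (f i))"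
  by (auto simp: signed_def sum_negf)

lemma signed_cong_parity: "even m = even n \<Longrightarrow> signed m x = signed n x"
  by (auto simp: signed_def)

lemma signed_opposite: "even m \<noteq> even n \<Longrightarrow> signed m x + signed n x = 0"
  by (auto simp: signed_def)

text \<open>The identity behind $d^2 = 0$ for a simplicial object: the terms with \<open>i \<le> j\<close> and those with
  \<open>j < i\<close> are exchanged by \<open>(i, j) \<mapsto> (j + 1, i)\<close>, which changes the sign.\<close>

lemma simplicial_cancellation:
  fixes f :: "nat \<Rightarrow> nat \<Rightarrow> 'g::ab_group_add"
  assumes "\<And>i j. i \<le> j \<Longrightarrow> j < n \<Longrightarrow> f i j = f (Suc j) i"
  shows "(\<Sum>i<Suc n. \<Sum>j<n. signed (i + j) (f i j)) = 0"
proof -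
  define S where "S = {..<Suc n} \<times> {..<n}"
  define P where "P = {(i, j) \<in> S. i \<le> j}"
  define Q where "Q = {(i, j) \<in> S. j < i}"
  have fin: "finite P" "finite Q" by (auto simp: P_def Q_def S_def intro: finite_subset[of _ "{..<Suc n} \<times> {..<n}"])
  have un: "S = P \<union> Q" "P \<inter> Q = {}" by (auto simp: P_def Q_def)
  have "(\<Sum>i<Suc n. \<Sum>j<n. signed (i + j) (f i j)) = (\<Sum>(i, j)\<in>S. signed (i + j) (f i j))"
    unfolding S_def by (rule sum.cartesian_product)
  also have "\<dots> = (\<Sum>(i, j)\<in>P. signed (i + j) (f i j)) + (\<Sum>(i, j)\<in>Q. signed (i + j) (f i j))"
    unfolding un(1) by (rule sum.union_disjoint[OF fin un(2)])
  also have "(\<Sum>(i, j)\<in>Q. signed (i + j) (f i j)) = (\<Sum>(i, j)\<in>P. signed (Suc j + i) (f (Suc j) i))"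
    by (rule sum.reindex_bij_witness[where i = "\<lambda>(i, j). (Suc j, i)" and j = "\<lambda>(i, j). (j, i - 1)"])
       (auto simp: P_def Q_def S_def signed_def elim!: less_natE)
  also have "\<dots> = (\<Sum>(i, j)\<in>P. - signed (i + j) (f i j))"
    by (rule sum.cong) (auto simp: P_def S_def assms add.commute)
  also have "(\<Sum>(i, j)\<in>P. signed (i + j) (f i j)) + (\<Sum>(i, j)\<in>P. - signed (i + j) (f i j)) = 0"
    by (simp add: split_def sum_negf)
  finally show ?thesis .
qed

text \<open>Merges the entries in positions \<open>i\<close> and \<open>i + 1\<close>. Out of range the list is left unchanged; the
  uses below stay in range.\<close>

fun contract :: "('x \<Rightarrow> 'x \<Rightarrow> 'x) \<Rightarrow> nat \<Rightarrow> 'x list \<Rightarrow> 'x list" where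
  "contract m 0 (x # y # xs) = m x y # xs"
| "contract m (Suc i) (x # xs) = x # contract m i xs"
| "contract m 0 [x] = [x]"
| "contract m i [] = []"

lemma length_contract: "Suc i < length xs \<Longrightarrow> length (contract m i xs) = length xs - 1"
  by (induction m i xs rule: contract.induct) auto

lemma contract_append:
  "Suc i < length xs \<Longrightarrow> contract m i (xs @ ys) = contract m i xs @ ys"
  by (induction m i xs rule: contract.induct) auto

lemma contract_append2: "contract m (length xs + i) (xs @ ys) = xs @ contract m i ys"
  by (induction xs) auto

lemma contract_append2': "length xs \<le> i \<Longrightarrow> contract m i (xs @ ys) = xs @ contract m (i - length xs) ys"
  using contract_append2[of m xs "i - length xs" ys] by simp

lemma contract_junction: "contract m (length xs) (xs @ x # y # ys) = xs @ m x y # ys"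
  using contract_append2[of m xs 0 "x # y # ys"] by simp

lemma contract_contract:
  "i < j \<Longrightarrow> Suc (Suc j) < length xs \<Longrightarrow>
    contract m j (contract m i xs) = contract m i (contract m (Suc j) xs)"
proof (induction i arbitrary: j xs)
  case 0
  then obtain j' where "j = Suc j'" by (cases j) auto
  moreover obtain x y ys where "xs = x # y # ys" using 0 by (cases xs; cases "tl xs") auto
  ultimately show ?case by simp
next
  case (Suc i)
  then obtain j' where "j = Suc j'" by (cases j) auto
  moreover obtain x ys where "xs = x # ys" using Suc by (cases xs) auto
  ultimately show ?case using Suc by simp
qed

lemma contract_contract_same:
  "Suc (Suc i) < length xs \<Longrightarrow>
   m (m (xs ! i) (xs ! Suc i)) (xs ! Suc (Suc i)) = m (xs ! i) (m (xs ! Suc i) (xs ! Suc (Suc i))) \<Longrightarrow>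
    contract m i (contract m i xs) = contract m i (contract m (Suc i) xs)"
proof (induction i arbitrary: xs)
  case 0
  then obtain x y z ys where "xs = x # y # z # ys" by (cases xs; cases "tl xs"; cases "tl (tl xs)") auto
  then show ?case using 0 by simp
next
  case (Suc i)
  then obtain x ys where "xs = x # ys" by (cases xs) auto
  then show ?case using Suc by simp
qed

text \<open>The inner faces of the bar construction. The signs count faces from 1, while list positions are counted from 0.\<close>

definition inner_bd :: "('x \<Rightarrow> 'x \<Rightarrow> 'x) \<Rightarrow> ('x list \<Rightarrow> 'g::ab_group_add) \<Rightarrow> 'x list \<Rightarrow> 'g" where
  "inner_bd m F xs = (\<Sum>i<length xs - 1. signed (Suc i) (F (contract m i xs)))"

lemma inner_bd_Nil [simp]: "inner_bd m F [] = 0" and inner_bd_single [simp]: "inner_bd m F [x] = 0"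
  by (auto simp: inner_bd_def)

lemma inner_bd_Cons:
  "inner_bd m F (x # y # xs) = - F (m x y # xs) - inner_bd m (\<lambda>c. F (x # c)) (y # xs)"
  unfolding inner_bd_def by (simp add: sum.lessThan_Suc_shift sum_negf[symmetric] del: sum.lessThan_Suc)

text \<open>Only the last inner face of \<open>xs @ [z]\<close> touches \<open>z\<close>. This peels off the first step of a path, which is
  the last entry of its list.\<close>

lemma inner_bd_snoc:
  assumes "xs \<noteq> []"
  shows "inner_bd m F (xs @ [z]) =
    inner_bd m (\<lambda>c. F (c @ [z])) xs + signed (length xs) (F (butlast xs @ [m (last xs) z]))"
proof -
  obtain ys y where xs: "xs = ys @ [y]" using assms by (metis append_butlast_last_id)
  have "inner_bd m F (xs @ [z]) = (\<Sum>i<length ys. signed (Suc i) (F (contract m i (xs @ [z]))))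
      + signed (length xs) (F (contract m (length ys) (ys @ y # z # [])))"
    by (simp add: inner_bd_def xs)
  also have "contract m (length ys) (ys @ y # z # []) = ys @ m y z # []"
    by (rule contract_junction)
  also have "(\<Sum>i<length ys. signed (Suc i) (F (contract m i (xs @ [z])))) = inner_bd m (\<lambda>c. F (c @ [z])) xs"
    unfolding inner_bd_def by (rule sum.cong) (auto simp: xs contract_append[symmetric])
  finally show ?thesis by (simp add: xs)
qed

text \<open>A chain \<open>(D, [(x\<^sub>1, D\<^sub>1), (x\<^sub>2, D\<^sub>2), \<dots>])\<close> stands for the arrows \<open>D \<leftarrow> D\<^sub>1 \<leftarrow> D\<^sub>2 \<dots>\<close>, read from
  the target backwards, each arrow being stored together with its source. This is the order in which the arguments
  of a cochain are listed, and with it both simplices of a category and paths of natural transformations can be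
  recursed on from the front. \<open>V\<close> and \<open>H\<close> say what an object and an arrow from its first to its second argument are.\<close>

fun chain :: "('d \<Rightarrow> bool) \<Rightarrow> ('d \<Rightarrow> 'd \<Rightarrow> 'x \<Rightarrow> bool) \<Rightarrow> 'd \<Rightarrow> ('x \<times> 'd) list \<Rightarrow> bool" where
  "chain V H D [] = V D"
| "chain V H D ((x, D') # xs) = (V D \<and> H D' D x \<and> chain V H D' xs)"

text \<open>The far end of a chain, that is, the source of the composite of all its arrows.\<close>

definition start :: "'d \<Rightarrow> ('x \<times> 'd) list \<Rightarrow> 'd" where
  "start D xs = last (D # map snd xs)"

lemma start_Nil [simp]: "start D [] = D" and start_Cons [simp]: "start D ((x, D') # xs) = start D' xs"
  and start_snoc [simp]: "start D (xs @ [(x, D')]) = D'"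
  by (auto simp: start_def)

lemma chain_vertex: "chain V H D xs \<Longrightarrow> V D"
  by (cases xs) auto

lemma chain_append: "chain V H D (xs @ ys) \<longleftrightarrow> chain V H D xs \<and> chain V H (start D xs) ys"
  by (induction xs arbitrary: D) (auto dest: chain_vertex)

lemma chain_start: "chain V H D xs \<Longrightarrow> V (start D xs)"
  by (induction xs arbitrary: D) auto

definition paste :: "('x \<Rightarrow> 'x \<Rightarrow> 'x) \<Rightarrow> 'x \<times> 'd \<Rightarrow> 'x \<times> 'd \<Rightarrow> 'x \<times> 'd" where
  "paste m p q = (m (fst p) (fst q), snd q)"

lemma paste_pair [simp]: "paste m (x, D) (x', D') = (m x x', D')"
  by (simp add: paste_def)

text \<open>The signed sum of \<open>F\<close> over all shuffles of a chain \<open>xs\<close> of arrows with a chain \<open>ys\<close> of natural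
  transformations. The operations are parameters, because arrows are shuffled with paths
  (\<open>ob\<close>, \<open>ac\<close>, \<open>na\<close> evaluate a functor on an object, on an arrow, and a transformation at an object),
  and paths are shuffled with paths, by horizontal composition. The sum is built entry by entry,
  accumulating the chosen entries in the argument of \<open>F\<close>: choosing the first entry of \<open>ys\<close> moves it past all of
  \<open>xs\<close>, whence its sign. The current functor \<open>T\<close> and object \<open>D\<close> are updated along the way, so that every entry
  is evaluated at the right functor or object.\<close>

function shuffle_sum ::
  "('t \<Rightarrow> 'd \<Rightarrow> 'e) \<Rightarrow> ('t \<Rightarrow> 'x \<Rightarrow> 'z) \<Rightarrow> ('y \<Rightarrow> 'd \<Rightarrow> 'z) \<Rightarrow>
   (('z \<times> 'e) list \<Rightarrow> 'g::ab_group_add) \<Rightarrow> 'd \<Rightarrow> ('x \<times> 'd) list \<Rightarrow> 't \<Rightarrow> ('y \<times> 't) list \<Rightarrow> 'g" where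
  "shuffle_sum ob ac na F D [] T [] = F []"
| "shuffle_sum ob ac na F D ((x, D') # xs) T [] =
     shuffle_sum ob ac na (\<lambda>c. F ((ac T x, ob T D') # c)) D' xs T []"
| "shuffle_sum ob ac na F D [] T ((y, T') # ys) =
     shuffle_sum ob ac na (\<lambda>c. F ((na y D, ob T' D) # c)) D [] T' ys"
| "shuffle_sum ob ac na F D ((x, D') # xs) T ((y, T') # ys) =
     shuffle_sum ob ac na (\<lambda>c. F ((ac T x, ob T D') # c)) D' xs T ((y, T') # ys) +
     signed (Suc (length xs))
       (shuffle_sum ob ac na (\<lambda>c. F ((na y D, ob T' D) # c)) D ((x, D') # xs) T' ys)"
  by pat_completeness auto
termination by (relation "measure (\<lambda>(ob, ac, na, F, D, xs, T, ys). length xs + length ys)") auto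

lemma pair_list_induct2 [case_names Nil_Nil Cons_Nil Nil_Cons Cons_Cons]:
  assumes "\<And>D T. P D [] T []"
    and "\<And>D x D' xs T. P D' xs T [] \<Longrightarrow> P D ((x, D') # xs) T []"
    and "\<And>D T y T' ys. P D [] T' ys \<Longrightarrow> P D [] T ((y, T') # ys)"
    and "\<And>D x D' xs T y T' ys. P D' xs T ((y, T') # ys) \<Longrightarrow> P D ((x, D') # xs) T' ys
      \<Longrightarrow> P D ((x, D') # xs) T ((y, T') # ys)"
  shows "P D xs T ys"
proof (induction "length xs + length ys" arbitrary: D xs T ys rule: less_induct)
  case less
  show ?case
    using assms less by (cases xs; cases ys) auto
qed

text \<open>The individual shuffles over which \<^const>\<open>shuffle_sum\<close> runs, without their signs;
  they serve to transfer pointwise properties to the sum.\<close>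

inductive_set shuffles_of ::
  "('t \<Rightarrow> 'd \<Rightarrow> 'e) \<Rightarrow> ('t \<Rightarrow> 'x \<Rightarrow> 'z) \<Rightarrow> ('y \<Rightarrow> 'd \<Rightarrow> 'z) \<Rightarrow>
   ('d \<times> ('x \<times> 'd) list \<times> 't \<times> ('y \<times> 't) list \<times> ('z \<times> 'e) list) set"
  for ob ac na where
  "(D, [], T, [], []) \<in> shuffles_of ob ac na"
| "(D', xs, T, ys, c) \<in> shuffles_of ob ac na \<Longrightarrow>
    (D, (x, D') # xs, T, ys, (ac T x, ob T D') # c) \<in> shuffles_of ob ac na"
| "(D, xs, T', ys, c) \<in> shuffles_of ob ac na \<Longrightarrow>
    (D, xs, T, (y, T') # ys, (na y D, ob T' D) # c) \<in> shuffles_of ob ac na"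

lemma shuffle_sum_cong:
  assumes "\<And>c. (D, xs, T, ys, c) \<in> shuffles_of ob ac na \<Longrightarrow> F c = G c"
  shows "shuffle_sum ob ac na F D xs T ys = shuffle_sum ob ac na G D xs T ys"
  using assms
proof (induction D xs T ys arbitrary: F G rule: pair_list_induct2)
  case (Nil_Nil D T)
  show ?case by (simp, rule Nil_Nil.prems, rule shuffles_of.intros)
next
  case (Cons_Nil D x D' xs T)
  show ?case by (simp, rule Cons_Nil.IH, rule Cons_Nil.prems, rule shuffles_of.intros)
next
  case (Nil_Cons D T y T' ys)
  show ?case by (simp, rule Nil_Cons.IH, rule Nil_Cons.prems, rule shuffles_of.intros)
next
  case (Cons_Cons D x D' xs T y T' ys)
  have "shuffle_sum ob ac na (\<lambda>c. F ((ac T x, ob T D') # c)) D' xs T ((y, T') # ys) =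
      shuffle_sum ob ac na (\<lambda>c. G ((ac T x, ob T D') # c)) D' xs T ((y, T') # ys)"
    by (rule Cons_Cons.IH(1)) (auto intro!: Cons_Cons.prems shuffles_of.intros)
  moreover have "shuffle_sum ob ac na (\<lambda>c. F ((na y D, ob T' D) # c)) D ((x, D') # xs) T' ys =
      shuffle_sum ob ac na (\<lambda>c. G ((na y D, ob T' D) # c)) D ((x, D') # xs) T' ys"
    by (rule Cons_Cons.IH(2)) (auto intro!: Cons_Cons.prems shuffles_of.intros)
  ultimately show ?case by simp
qed

lemma shuffles_of_length: "(D, xs, T, ys, c) \<in> shuffles_of ob ac na \<Longrightarrow> length c = length xs + length ys"
  by (induction rule: shuffles_of.induct) auto

lemma shuffles_of_start:
  "(D, xs, T, ys, c) \<in> shuffles_of ob ac na \<Longrightarrow> start (ob T D) c = ob (start T ys) (start D xs)"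
  by (induction rule: shuffles_of.induct) auto

lemma shuffles_of_chain:
  assumes "(D, xs, T, ys, c) \<in> shuffles_of ob ac na"
    and "chain VD HD D xs" "chain VT HT T ys"
    and "\<And>D T. VD D \<Longrightarrow> VT T \<Longrightarrow> VE (ob T D)"
    and "\<And>D D' x T. VD D \<Longrightarrow> VD D' \<Longrightarrow> HD D' D x \<Longrightarrow> VT T \<Longrightarrow> HE (ob T D') (ob T D) (ac T x)"
    and "\<And>T T' y D. VT T \<Longrightarrow> VT T' \<Longrightarrow> HT T' T y \<Longrightarrow> VD D \<Longrightarrow> HE (ob T' D) (ob T D) (na y D)"
  shows "chain VE HE (ob T D) c"
  using assms(1-3)
  by (induction rule: shuffles_of.induct) (auto intro!: assms(4-) intro: chain_vertex)

lemma shuffle_sum_add: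
  "shuffle_sum ob ac na (\<lambda>c. F c + G c) D xs T ys =
    shuffle_sum ob ac na F D xs T ys + shuffle_sum ob ac na G D xs T ys"
  by (induction D xs T ys arbitrary: F G rule: pair_list_induct2) (auto simp: signed_add)

lemma shuffle_sum_hom:
  assumes "\<And>x y. h (x + y) = h x + h y"
  shows "h (shuffle_sum ob ac na F D xs T ys) = shuffle_sum ob ac na (\<lambda>c. h (F c)) D xs T ys"
proof -
  have h0: "h 0 = 0" using assms[of 0 0] by simp
  have "h (- x) = - h x" for x using assms[of x "- x"] h0 by (simp add: eq_neg_iff_add_eq_0 add.commute)
  moreover from this have "h (signed n x) = signed n (h x)" for n x by (auto simp: signed_def)
  moreover have "h (x - y) = h x - h y" for x y
    using assms[of x "- y"] \<open>\<And>x. h (- x) = - h x\<close> by simp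
  ultimately show ?thesis
    by (induction D xs T ys arbitrary: F rule: pair_list_induct2) (auto simp: assms)
qed

lemma shuffle_sum_uminus:
  "shuffle_sum ob ac na (\<lambda>c. - F c) D xs T ys = - shuffle_sum ob ac na F D xs T ys"
  by (rule shuffle_sum_hom[symmetric]) simp

lemma shuffle_sum_diff:
  "shuffle_sum ob ac na (\<lambda>c. F c - G c) D xs T ys =
    shuffle_sum ob ac na F D xs T ys - shuffle_sum ob ac na G D xs T ys"
  using shuffle_sum_add[of ob ac na F "\<lambda>c. - G c"] by (simp add: shuffle_sum_uminus)

lemma shuffle_sum_signed:
  "shuffle_sum ob ac na (\<lambda>c. signed n (F c)) D xs T ys = signed n (shuffle_sum ob ac na F D xs T ys)"
  by (rule shuffle_sum_hom[symmetric]) (simp add: signed_add)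

lemma shuffle_sum_zero [simp]: "shuffle_sum ob ac na (\<lambda>c. 0) D xs T ys = 0"
  by (induction D xs T ys rule: pair_list_induct2) auto

lemma shuffle_sum_sum:
  "shuffle_sum ob ac na (\<lambda>c. \<Sum>i\<in>S. F i c) D xs T ys = (\<Sum>i\<in>S. shuffle_sum ob ac na (F i) D xs T ys)"
  by (induction S rule: infinite_finite_induct) (auto simp: shuffle_sum_add)

text \<open>The defining equations in one formula, according to whether a shuffle begins with an arrow or
  with a transformation.\<close>

lemma shuffle_sum_front:
  "shuffle_sum ob ac na F D xs T ys =
    (if xs = [] \<and> ys = [] then F [] else 0) +
    (case xs of [] \<Rightarrow> 0 | (x, D') # xs' \<Rightarrow> shuffle_sum ob ac na (\<lambda>c. F ((ac T x, ob T D') # c)) D' xs' T ys) +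
    (case ys of [] \<Rightarrow> 0 | (y, T') # ys' \<Rightarrow>
      signed (length xs) (shuffle_sum ob ac na (\<lambda>c. F ((na y D, ob T' D) # c)) D xs T' ys'))"
  by (auto split: list.split)

lemma shuffle_sum_snoc_left:
  "shuffle_sum ob ac na F D (xs @ [(x, D')]) T [] =
     shuffle_sum ob ac na (\<lambda>c. F (c @ [(ac T x, ob T D')])) D xs T []"
  by (induction xs arbitrary: D F) auto

lemma shuffle_sum_snoc_right:
  "shuffle_sum ob ac na F D [] T (ys @ [(y, T')]) =
     shuffle_sum ob ac na (\<lambda>c. F (c @ [(na y D, ob T' D)])) D [] T ys"
  by (induction ys arbitrary: T F) auto

lemma shuffle_sum_snoc:
  "shuffle_sum ob ac na F D (xs @ [(x, D')]) T (ys @ [(y, T')]) =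
     signed (Suc (length ys))
       (shuffle_sum ob ac na (\<lambda>c. F (c @ [(ac T' x, ob T' D')])) D xs T (ys @ [(y, T')])) +
     shuffle_sum ob ac na (\<lambda>c. F (c @ [(na y D', ob T' D')])) D (xs @ [(x, D')]) T ys"
proof (induction D xs T ys arbitrary: F rule: pair_list_induct2)
  case (Cons_Nil D x1 D1 xs T)
  show ?case
    apply (simp only: append_Cons append_Nil shuffle_sum.simps Cons_Nil[unfolded append_Nil])
    apply (simp add: shuffle_sum_snoc_left signed_add)
    done
next
  case (Nil_Cons D T y1 T1 ys)
  show ?case
    apply (simp only: append_Cons append_Nil shuffle_sum.simps Nil_Cons[unfolded append_Nil])
    apply (simp add: shuffle_sum_snoc_right signed_add)
    done
next
  case (Cons_Cons D x1 D1 xs T y1 T1 ys)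
  show ?case
    apply (simp only: append_Cons shuffle_sum.simps Cons_Cons[unfolded append_Cons])
    apply (simp add: signed_add signed_diff signed_commute algebra_simps)
    done
qed simp

lemma inner_bd_Cons':
  "inner_bd m F (a # xs) =
    - (case xs of [] \<Rightarrow> 0 | b # ys \<Rightarrow> F (m a b # ys)) - inner_bd m (\<lambda>c. F (a # c)) xs"
  by (cases xs) (auto simp: inner_bd_Cons)

lemma inner_bd_cong:
  "(\<And>c. length c = length xs - 1 \<Longrightarrow> F c = G c) \<Longrightarrow> inner_bd m F xs = inner_bd m G xs"
  unfolding inner_bd_def by (rule sum.cong) (auto simp: length_contract)

lemma inner_bd_add: "inner_bd m (\<lambda>c. F c + G c) xs = inner_bd m F xs + inner_bd m G xs"
  by (simp only: inner_bd_def signed_add sum.distrib)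

lemma inner_bd_signed: "inner_bd m (\<lambda>c. signed n (F c)) xs = signed n (inner_bd m F xs)"
  by (simp add: inner_bd_def signed_sum signed_commute)

lemma inner_bd_uminus: "inner_bd m (\<lambda>c. - F c) xs = - inner_bd m F xs"
  using inner_bd_signed[of m "Suc 0" F] by simp

lemma inner_bd_length_signed:
  "inner_bd m (\<lambda>c. signed (Suc (length c)) (F c)) xs = signed (length xs) (inner_bd m F xs)"
proof (cases xs)
  case (Cons a list)
  have "inner_bd m (\<lambda>c. signed (Suc (length c)) (F c)) xs = inner_bd m (\<lambda>c. signed (length xs) (F c)) xs"
    by (rule inner_bd_cong) (simp add: Cons)
  then show ?thesis by (simp only: inner_bd_signed)
qed simp

lemma shuffle_sum_inner_bd_Cons:
  assumes "xs \<noteq> [] \<or> ys \<noteq> []"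
  shows "shuffle_sum ob ac na (\<lambda>c. inner_bd m F (p # c)) D xs T ys =
    - shuffle_sum ob ac na (\<lambda>c. F (m p (hd c) # tl c)) D xs T ys
    - shuffle_sum ob ac na (inner_bd m (\<lambda>c. F (p # c))) D xs T ys"
proof -
  have "shuffle_sum ob ac na (\<lambda>c. inner_bd m F (p # c)) D xs T ys =
    shuffle_sum ob ac na (\<lambda>c. - F (m p (hd c) # tl c) - inner_bd m (\<lambda>c. F (p # c)) c) D xs T ys"
  proof (rule shuffle_sum_cong)
    fix c assume "(D, xs, T, ys, c) \<in> shuffles_of ob ac na"
    then have "c \<noteq> []" using assms shuffles_of_length by fastforce
    then show "inner_bd m F (p # c) = - F (m p (hd c) # tl c) - inner_bd m (\<lambda>c. F (p # c)) c"
      by (cases c) (auto simp: inner_bd_Cons)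
  qed
  then show ?thesis by (simp add: shuffle_sum_diff shuffle_sum_uminus)
qed

text \<open>A Leibniz rule. An inner face of a shuffle merges two neighbours. If one is an arrow and the
  other a transformation, the shuffle with these two exchanged has the opposite sign and, by naturality, the same
  merged entry, so such faces cancel. If both are arrows, functoriality makes the face a shuffle of a face of \<open>xs\<close>;
  if both are transformations, it is a shuffle of a face of \<open>ys\<close>.\<close>

theorem shuffle_sum_inner_bd:
  fixes F :: "('z \<times> 'e) list \<Rightarrow> 'g::ab_group_add"
  assumes "chain VD HD D xs" "chain VT HT T ys"
    and functorial: "\<And>T D D' D'' x x'. VT T \<Longrightarrow> VD D \<Longrightarrow> VD D' \<Longrightarrow> VD D'' \<Longrightarrow> HD D' D x \<Longrightarrow> HD D'' D' x' \<Longrightarrow>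
      ac T (cA x x') = cB (ac T x) (ac T x')"
    and vert: "\<And>y y' D. na (cR y y') D = cB (na y D) (na y' D)"
    and nat: "\<And>T T' D D' x y. VT T \<Longrightarrow> VT T' \<Longrightarrow> VD D \<Longrightarrow> VD D' \<Longrightarrow> HD D' D x \<Longrightarrow> HT T' T y \<Longrightarrow>
      cB (ac T x) (na y D') = cB (na y D) (ac T' x)"
  shows "shuffle_sum ob ac na (inner_bd (paste cB) F) D xs T ys =
    inner_bd (paste cA) (\<lambda>xs'. shuffle_sum ob ac na F D xs' T ys) xs +
    signed (length xs) (inner_bd (paste cR) (\<lambda>ys'. shuffle_sum ob ac na F D xs T ys') ys)"
  using assms(1,2)
proof (induction D xs T ys arbitrary: F rule: pair_list_induct2)
  case (Nil_Nil D T)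
  then show ?case by simp
next
  case (Cons_Nil D x D1 xs T)
  show ?case
  proof (cases xs)
    case Nil
    then show ?thesis by simp
  next
    case (Cons p xs')
    obtain x2 D2 where p: "p = (x2, D2)" by (cases p)
    have "VT T" "VD D" "VD D1" "HD D1 D x" "HD D2 D1 x2" "VD D2"
      using Cons_Nil.prems unfolding Cons p by (auto dest: chain_vertex)
    then have f: "ac T (cA x x2) = cB (ac T x) (ac T x2)" by (intro functorial)
    have ih: "shuffle_sum ob ac na (inner_bd (paste cB) G) D1 xs T [] =
        inner_bd (paste cA) (\<lambda>xs'. shuffle_sum ob ac na G D1 xs' T []) xs" for G :: "('z \<times> 'e) list \<Rightarrow> 'g"
      using Cons_Nil by simp
    let ?p = "(ac T x, ob T D1)"
    have ne: "xs \<noteq> []" using Cons by simp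
    have "shuffle_sum ob ac na (inner_bd (paste cB) F) D ((x, D1) # xs) T [] =
        - shuffle_sum ob ac na (\<lambda>c. F (paste cB ?p (hd c) # tl c)) D1 xs T []
        - inner_bd (paste cA) (\<lambda>c. shuffle_sum ob ac na (\<lambda>c. F (?p # c)) D1 c T []) xs"
      by (simp only: shuffle_sum.simps shuffle_sum_inner_bd_Cons[OF disjI1[OF ne]] ih)
    also have "shuffle_sum ob ac na (\<lambda>c. F (paste cB ?p (hd c) # tl c)) D1 xs T [] =
        shuffle_sum ob ac na F D ((cA x x2, D2) # xs') T []"
      by (simp add: Cons p f)
    finally show ?thesis
      by (simp only: inner_bd_Cons') (simp add: Cons p del: shuffle_sum.simps(4))
  qed
next
  case (Nil_Cons D T y T1 ys)
  show ?case
  proof (cases ys)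
    case Nil
    then show ?thesis by simp
  next
    case (Cons p ys')
    obtain y2 T2 where p: "p = (y2, T2)" by (cases p)
    have ih: "shuffle_sum ob ac na (inner_bd (paste cB) G) D [] T1 ys =
        inner_bd (paste cR) (\<lambda>ys'. shuffle_sum ob ac na G D [] T1 ys') ys" for G :: "('z \<times> 'e) list \<Rightarrow> 'g"
      using Nil_Cons by simp
    let ?q = "(na y D, ob T1 D)"
    have ne: "ys \<noteq> []" using Cons by simp
    have "shuffle_sum ob ac na (inner_bd (paste cB) F) D [] T ((y, T1) # ys) =
        - shuffle_sum ob ac na (\<lambda>c. F (paste cB ?q (hd c) # tl c)) D [] T1 ys
        - inner_bd (paste cR) (\<lambda>c. shuffle_sum ob ac na (\<lambda>c. F (?q # c)) D [] T1 c) ys"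
      by (simp only: shuffle_sum.simps shuffle_sum_inner_bd_Cons[OF disjI2[OF ne]] ih)
    also have "shuffle_sum ob ac na (\<lambda>c. F (paste cB ?q (hd c) # tl c)) D [] T1 ys =
        shuffle_sum ob ac na F D [] T ((cR y y2, T2) # ys')"
      by (simp add: Cons p vert)
    finally show ?thesis
      by (simp only: inner_bd_Cons') (simp add: Cons p)
  qed
next
  case (Cons_Cons D x D1 xs T y T1 ys)
  have v: "VT T" "VT T1" "VD D" "VD D1" "HD D1 D x" "HT T1 T y" "chain VD HD D1 xs" "chain VT HT T1 ys"
    using Cons_Cons.prems by (auto dest: chain_vertex)
  (* The two mixed merges at the front agree; as ?N they enter below with opposite signs. *)
  have n: "cB (ac T x) (na y D1) = cB (na y D) (ac T1 x)" using v by (intro nat)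
  let ?A = "(x, D1) # xs" and ?B = "(y, T1) # ys"
  let ?p = "(ac T x, ob T D1)" and ?q = "(na y D, ob T1 D)"
  let ?S = "shuffle_sum ob ac na"
  let ?X = "case xs of [] \<Rightarrow> 0 | (x', D2) # xs' \<Rightarrow> ?S (\<lambda>c. F ((ac T (cA x x'), ob T D2) # c)) D2 xs' T ?B"
  let ?Y = "case ys of [] \<Rightarrow> 0 | (y', T2) # ys' \<Rightarrow> ?S (\<lambda>c. F ((na (cR y y') D, ob T2 D) # c)) D ?A T2 ys'"
  let ?N = "?S (\<lambda>c. F ((cB (ac T x) (na y D1), ob T1 D1) # c)) D1 xs T1 ys"
  let ?XQ = "case xs of [] \<Rightarrow> 0 | (x', D2) # xs' \<Rightarrow> ?S (\<lambda>c. F (?q # c)) D ((cA x x', D2) # xs') T1 ys"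
  let ?YP = "case ys of [] \<Rightarrow> 0 | (y', T2) # ys' \<Rightarrow> ?S (\<lambda>c. F (?p # c)) D1 xs T ((cR y y', T2) # ys')"
  have a: "?S (\<lambda>c. F (paste cB ?p (hd c) # tl c)) D1 xs T ?B = ?X + signed (length xs) ?N"
  proof (cases xs)
    case (Cons r xs')
    obtain x2 D2 where r: "r = (x2, D2)" by (cases r)
    have "ac T (cA x x2) = cB (ac T x) (ac T x2)"
      using v by (intro functorial[of _ D D1 D2]) (auto simp: Cons r dest: chain_vertex)
    then show ?thesis by (simp add: Cons r)
  qed simp
  have b: "?S (\<lambda>c. F (paste cB ?q (hd c) # tl c)) D ?A T1 ys = ?N + signed (Suc (length xs)) ?Y"
    by (cases ys) (auto simp: vert n split: prod.split)
  have i1: "?S (inner_bd (paste cB) (\<lambda>c. F (?p # c))) D1 xs T ?B =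
      inner_bd (paste cA) (\<lambda>c. ?S (\<lambda>c. F (?p # c)) D1 c T ?B) xs +
      signed (length xs) (- ?YP - inner_bd (paste cR) (\<lambda>c. ?S (\<lambda>c. F (?p # c)) D1 xs T ((y, T1) # c)) ys)"
    using Cons_Cons.IH(1)[of "\<lambda>c. F (?p # c)"] Cons_Cons.prems
    by (simp only: inner_bd_Cons') (auto split: list.split)
  have i2: "?S (inner_bd (paste cB) (\<lambda>c. F (?q # c))) D ?A T1 ys =
      - ?XQ - inner_bd (paste cA) (\<lambda>c. ?S (\<lambda>c. F (?q # c)) D ((x, D1) # c) T1 ys) xs +
      signed (Suc (length xs)) (inner_bd (paste cR) (\<lambda>c. ?S (\<lambda>c. F (?q # c)) D ?A T1 c) ys)"
    using Cons_Cons.IH(2)[of "\<lambda>c. F (?q # c)"] Cons_Cons.prems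
    by (simp only: inner_bd_Cons') (auto split: list.split)
  have r1: "inner_bd (paste cA) (\<lambda>c. ?S F D c T ?B) ?A =
      - (?X + signed (length xs) ?XQ)
      - (inner_bd (paste cA) (\<lambda>c. ?S (\<lambda>c. F (?p # c)) D1 c T ?B) xs +
         signed (length xs) (inner_bd (paste cA) (\<lambda>c. ?S (\<lambda>c. F (?q # c)) D ((x, D1) # c) T1 ys) xs))"
  proof -
    have "inner_bd (paste cA) (\<lambda>c. ?S F D ((x, D1) # c) T ?B) xs =
      inner_bd (paste cA) (\<lambda>c. ?S (\<lambda>c. F (?p # c)) D1 c T ?B) xs +
         signed (length xs) (inner_bd (paste cA) (\<lambda>c. ?S (\<lambda>c. F (?q # c)) D ((x, D1) # c) T1 ys) xs)"
      by (simp only: shuffle_sum.simps inner_bd_add inner_bd_length_signed)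
    then show ?thesis
      by (simp only: inner_bd_Cons') (auto split: list.split)
  qed
  have r2: "inner_bd (paste cR) (\<lambda>c. ?S F D ?A T c) ?B =
      - (?YP + signed (Suc (length xs)) ?Y)
      - (inner_bd (paste cR) (\<lambda>c. ?S (\<lambda>c. F (?p # c)) D1 xs T ((y, T1) # c)) ys +
         signed (Suc (length xs)) (inner_bd (paste cR) (\<lambda>c. ?S (\<lambda>c. F (?q # c)) D ?A T1 c) ys))"
  proof -
    have "inner_bd (paste cR) (\<lambda>c. ?S F D ?A T ((y, T1) # c)) ys =
      inner_bd (paste cR) (\<lambda>c. ?S (\<lambda>c. F (?p # c)) D1 xs T ((y, T1) # c)) ys +
         signed (Suc (length xs)) (inner_bd (paste cR) (\<lambda>c. ?S (\<lambda>c. F (?q # c)) D ?A T1 c) ys)"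
      by (simp only: shuffle_sum.simps inner_bd_add inner_bd_signed)
    then show ?thesis
      by (simp only: inner_bd_Cons') (auto split: list.split)
  qed
  have "?S (inner_bd (paste cB) F) D ?A T ?B =
      (- ?S (\<lambda>c. F (paste cB ?p (hd c) # tl c)) D1 xs T ?B - ?S (inner_bd (paste cB) (\<lambda>c. F (?p # c))) D1 xs T ?B)
      + signed (Suc (length xs))
        (- ?S (\<lambda>c. F (paste cB ?q (hd c) # tl c)) D ?A T1 ys - ?S (inner_bd (paste cB) (\<lambda>c. F (?q # c))) D ?A T1 ys)"
    by (simp add: shuffle_sum_inner_bd_Cons)
  also have "\<dots> = inner_bd (paste cA) (\<lambda>c. ?S F D c T ?B) ?A
      + signed (length ?A) (inner_bd (paste cR) (\<lambda>c. ?S F D ?A T c) ?B)"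
    unfolding a b i1 i2 r1 r2
    by (simp add: signed_add signed_diff algebra_simps)
  finally show ?case .
qed

text \<open>Both sides of the associativity law below satisfy the same recursion on the first entry; this
  lemma and the next one make the recursion explicit for the two sides.\<close>

lemma shuffle_sum_twice_front:
  "shuffle_sum ob ac na (\<lambda>c. shuffle_sum ob2 ac2 na2 F (ob T D) c T' zs) D xs T ys =
    (if xs = [] \<and> ys = [] \<and> zs = [] then F [] else 0) +
    (case xs of [] \<Rightarrow> 0 | (x, D1) # xs' \<Rightarrow>
      shuffle_sum ob ac na (\<lambda>c. shuffle_sum ob2 ac2 na2
        (\<lambda>c. F ((ac2 T' (ac T x), ob2 T' (ob T D1)) # c)) (ob T D1) c T' zs) D1 xs' T ys) +
    (case ys of [] \<Rightarrow> 0 | (y, T1) # ys' \<Rightarrow> signed (length xs)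
      (shuffle_sum ob ac na (\<lambda>c. shuffle_sum ob2 ac2 na2
        (\<lambda>c. F ((ac2 T' (na y D), ob2 T' (ob T1 D)) # c)) (ob T1 D) c T' zs) D xs T1 ys')) +
    (case zs of [] \<Rightarrow> 0 | (z, T1') # zs' \<Rightarrow> signed (length xs + length ys)
      (shuffle_sum ob ac na (\<lambda>c. shuffle_sum ob2 ac2 na2
        (\<lambda>c. F ((na2 z (ob T D), ob2 T1' (ob T D)) # c)) (ob T D) c T1' zs') D xs T ys))"
proof -
  let ?S1 = "shuffle_sum ob ac na" and ?S2 = "shuffle_sum ob2 ac2 na2"
  let ?E = "\<lambda>c. if c = [] \<and> zs = [] then F [] else 0"
  let ?H = "\<lambda>c. case c of [] \<Rightarrow> 0 | (b, B) # c' \<Rightarrow> ?S2 (\<lambda>c. F ((ac2 T' b, ob2 T' B) # c)) B c' T' zs"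
  let ?Z = "\<lambda>c. case zs of [] \<Rightarrow> 0 | (z, T1') # zs' \<Rightarrow>
      ?S2 (\<lambda>c. F ((na2 z (ob T D), ob2 T1' (ob T D)) # c)) (ob T D) c T1' zs'"
  have "?S1 (\<lambda>c. ?S2 F (ob T D) c T' zs) D xs T ys =
      ?S1 (\<lambda>c. ?E c + ?H c + signed (length xs + length ys) (?Z c)) D xs T ys"
  proof (rule shuffle_sum_cong)
    fix c assume "(D, xs, T, ys, c) \<in> shuffles_of ob ac na"
    then have "length c = length xs + length ys" by (rule shuffles_of_length)
    then show "?S2 F (ob T D) c T' zs = ?E c + ?H c + signed (length xs + length ys) (?Z c)"
      by (subst shuffle_sum_front) (auto split: list.split)
  qed
  also have "\<dots> = ?S1 ?E D xs T ys + ?S1 ?H D xs T ys + signed (length xs + length ys) (?S1 ?Z D xs T ys)"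
    by (simp only: shuffle_sum_add shuffle_sum_signed)
  also have "?S1 ?E D xs T ys = (if xs = [] \<and> ys = [] \<and> zs = [] then F [] else 0)"
    by (subst shuffle_sum_front) (auto split: list.split)
  also have "?S1 ?H D xs T ys =
    (case xs of [] \<Rightarrow> 0 | (x, D1) # xs' \<Rightarrow>
      ?S1 (\<lambda>c. ?S2 (\<lambda>c. F ((ac2 T' (ac T x), ob2 T' (ob T D1)) # c)) (ob T D1) c T' zs) D1 xs' T ys) +
    (case ys of [] \<Rightarrow> 0 | (y, T1) # ys' \<Rightarrow> signed (length xs)
      (?S1 (\<lambda>c. ?S2 (\<lambda>c. F ((ac2 T' (na y D), ob2 T' (ob T1 D)) # c)) (ob T1 D) c T' zs) D xs T1 ys'))"
    by (subst shuffle_sum_front) (auto split: list.split)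
  also have "signed (length xs + length ys) (?S1 ?Z D xs T ys) =
    (case zs of [] \<Rightarrow> 0 | (z, T1') # zs' \<Rightarrow> signed (length xs + length ys)
      (?S1 (\<lambda>c. ?S2 (\<lambda>c. F ((na2 z (ob T D), ob2 T1' (ob T D)) # c)) (ob T D) c T1' zs') D xs T ys))"
    by (auto split: list.split)
  finally show ?thesis by (simp only: add.assoc)
qed

lemma shuffle_sum_nested_front:
  "shuffle_sum oc acc nac (\<lambda>d. shuffle_sum ob ac na F D xs (oc T' T) d) T ys T' zs =
    (if xs = [] \<and> ys = [] \<and> zs = [] then F [] else 0) +
    (case xs of [] \<Rightarrow> 0 | (x, D1) # xs' \<Rightarrow>
      shuffle_sum oc acc nac (\<lambda>d. shuffle_sum ob ac na
        (\<lambda>c. F ((ac (oc T' T) x, ob (oc T' T) D1) # c)) D1 xs' (oc T' T) d) T ys T' zs) +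
    (case ys of [] \<Rightarrow> 0 | (y, T1) # ys' \<Rightarrow> signed (length xs)
      (shuffle_sum oc acc nac (\<lambda>d. shuffle_sum ob ac na
        (\<lambda>c. F ((na (acc T' y) D, ob (oc T' T1) D) # c)) D xs (oc T' T1) d) T1 ys' T' zs)) +
    (case zs of [] \<Rightarrow> 0 | (z, T1') # zs' \<Rightarrow> signed (length xs + length ys)
      (shuffle_sum oc acc nac (\<lambda>d. shuffle_sum ob ac na
        (\<lambda>c. F ((na (nac z T) D, ob (oc T1' T) D) # c)) D xs (oc T1' T) d) T ys T1' zs'))"
proof -
  let ?S3 = "shuffle_sum oc acc nac" and ?S4 = "shuffle_sum ob ac na"
  let ?E = "\<lambda>d. if xs = [] \<and> d = [] then F [] else 0"
  let ?X = "\<lambda>d. case xs of [] \<Rightarrow> 0 | (x, D1) # xs' \<Rightarrow>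
      ?S4 (\<lambda>c. F ((ac (oc T' T) x, ob (oc T' T) D1) # c)) D1 xs' (oc T' T) d"
  let ?H = "\<lambda>d. case d of [] \<Rightarrow> 0 | (y, T1) # d' \<Rightarrow> ?S4 (\<lambda>c. F ((na y D, ob T1 D) # c)) D xs T1 d'"
  have "?S3 (\<lambda>d. ?S4 F D xs (oc T' T) d) T ys T' zs =
      ?S3 (\<lambda>d. ?E d + ?X d + signed (length xs) (?H d)) T ys T' zs"
    by (rule shuffle_sum_cong, subst shuffle_sum_front) (auto split: list.split)
  also have "\<dots> = ?S3 ?E T ys T' zs + ?S3 ?X T ys T' zs + signed (length xs) (?S3 ?H T ys T' zs)"
    by (simp only: shuffle_sum_add shuffle_sum_signed)
  also have "?S3 ?E T ys T' zs = (if xs = [] \<and> ys = [] \<and> zs = [] then F [] else 0)"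
    by (subst shuffle_sum_front) (auto split: list.split)
  also have "?S3 ?X T ys T' zs = (case xs of [] \<Rightarrow> 0 | (x, D1) # xs' \<Rightarrow>
      ?S3 (\<lambda>d. ?S4 (\<lambda>c. F ((ac (oc T' T) x, ob (oc T' T) D1) # c)) D1 xs' (oc T' T) d) T ys T' zs)"
    by (auto split: list.split)
  also have "signed (length xs) (?S3 ?H T ys T' zs) =
    (case ys of [] \<Rightarrow> 0 | (y, T1) # ys' \<Rightarrow> signed (length xs)
      (?S3 (\<lambda>d. ?S4 (\<lambda>c. F ((na (acc T' y) D, ob (oc T' T1) D) # c)) D xs (oc T' T1) d) T1 ys' T' zs)) +
    (case zs of [] \<Rightarrow> 0 | (z, T1') # zs' \<Rightarrow> signed (length xs + length ys)
      (?S3 (\<lambda>d. ?S4 (\<lambda>c. F ((na (nac z T) D, ob (oc T1' T) D) # c)) D xs (oc T1' T) d) T ys T1' zs'))"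
    by (subst shuffle_sum_front) (auto split: list.split simp: signed_add signed_signed signed_diff)
  finally show ?thesis by (simp only: add.assoc)
qed

text \<open>Shuffling \<open>xs\<close> with \<open>ys\<close> and the result with \<open>zs\<close> is the same as shuffling \<open>xs\<close> with
  the shuffles of \<open>ys\<close> and \<open>zs\<close>: both sums run over the shuffles of three chains. The hypotheses say that the action of
  functors and transformations is compatible with the horizontal composition \<open>oc\<close>, \<open>acc\<close>, \<open>nac\<close>.\<close>

theorem shuffle_sum_assoc:
  assumes "\<And>T' T D. ob2 T' (ob T D) = ob4 (oc T' T) D"
    and "\<And>T' T x. ac2 T' (ac T x) = ac4 (oc T' T) x"
    and "\<And>T' y D. ac2 T' (na y D) = na4 (acc T' y) D"
    and "\<And>z T D. na2 z (ob T D) = na4 (nac z T) D"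
  shows "shuffle_sum ob ac na (\<lambda>c. shuffle_sum ob2 ac2 na2 F (ob T D) c T' zs) D xs T ys =
    shuffle_sum oc acc nac (\<lambda>d. shuffle_sum ob4 ac4 na4 F D xs (oc T' T) d) T ys T' zs"
proof (induction "length xs + length ys + length zs" arbitrary: D xs T ys T' zs F rule: less_induct)
  case less
  show ?case
    apply (subst shuffle_sum_twice_front)
    apply (subst shuffle_sum_nested_front)
    apply (intro arg_cong2[where f = "(+)"])
    subgoal by simp
    subgoal by (cases xs) (auto simp: less[symmetric] assms)
    subgoal by (cases ys) (auto simp: less[symmetric] assms)
    subgoal by (cases zs) (auto simp: less[symmetric] assms)
    done
qed

lemma signed_Suc_Suc [simp]: "signed (Suc (Suc n)) x = signed n x"
  by (simp add: signed_def)

declare signed_Suc [simp del] sum.lessThan_Suc [simp del]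

section \<open>Paths of structure isomorphisms\<close>

fun composable :: "('o, 'u) category \<Rightarrow> 'o \<Rightarrow> 'u list \<Rightarrow> bool" where
  "composable U X [] \<longleftrightarrow> X \<in> Obj U"
| "composable U X (u # us) \<longleftrightarrow> u \<in> Arr U \<and> Dom U u = X \<and> composable U (Cod U u) us"

fun target :: "('o, 'u) category \<Rightarrow> 'o \<Rightarrow> 'u list \<Rightarrow> 'o" where
  "target U X [] = X"
| "target U X (u # us) = target U (Cod U u) us"

fun composite :: "('o, 'u) category \<Rightarrow> 'o \<Rightarrow> 'u list \<Rightarrow> 'u" where
  "composite U X [] = Idn U X"
| "composite U X (u # us) = Cmp U (composite U (Cod U u) us) u"

abbreviation merge_arrows :: "('o, 'u) category \<Rightarrow> nat \<Rightarrow> 'u list \<Rightarrow> 'u list" where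
  "merge_arrows U \<equiv> contract (\<lambda>u v. Cmp U v u)"

text \<open>The transformation that composes the arrows in positions \<open>i\<close> and \<open>i + 1\<close> of a simplex: $u_1^*\cdots u_i^*\, c\, u_{i+3}^* \cdots$\<close>

fun twist_at :: "('k, 'o, 'u, 'a, 'f) prestack_data \<Rightarrow> nat \<Rightarrow> 'u list \<Rightarrow> 'a \<Rightarrow> 'f" where
  "twist_at A 0 (u # v # us) = (\<lambda>B. Twist A v u (FOb (pull_list A us) B))"
| "twist_at A (Suc i) (u # us) = (\<lambda>B. FMor (Pull A u) (twist_at A i us B))"

text \<open>The path with choices \<open>r\<close> as a chain of functors: its far end is the iterated pullback along \<open>us\<close>,
  and the entries list the transformations from the last step of the path to the first one. The sources recorded are
  the iterated pullbacks along the successively merged simplices, the one along \<open>us\<close> coming last.\<close>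

fun path_chain ::
  "('o, 'u) category \<Rightarrow> ('k, 'o, 'u, 'a, 'f) prestack_data \<Rightarrow> 'u list \<Rightarrow> nat list
    \<Rightarrow> (('a \<Rightarrow> 'f) \<times> ('a, 'f) lfun) list" where
  "path_chain U A us [] = []"
| "path_chain U A us (i # r) =
     path_chain U A (merge_arrows U (i - 1) us) r @ [(twist_at A (i - 1) us, pull_list A us)]"

definition path_sum ::
  "('o, 'u) category \<Rightarrow> ('k, 'o, 'u, 'a, 'f) prestack_data \<Rightarrow> 'u list
    \<Rightarrow> ((('a \<Rightarrow> 'f) \<times> ('a, 'f) lfun) list \<Rightarrow> 'g::ab_group_add) \<Rightarrow> 'g" where
  "path_sum U A us F = (\<Sum>r\<in>paths (length us). signed (sum_list r) (F (path_chain U A us r)))"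

lemma finite_paths [simp]: "finite (paths n)"
  by (induction n rule: paths.induct) auto

lemma length_paths: "r \<in> paths n \<Longrightarrow> length r = n - 1"
  by (induction n arbitrary: r rule: paths.induct) auto

lemma length_path_chain: "length (path_chain U A us r) = length r"
  by (induction U A us r rule: path_chain.induct) auto

lemma path_sum_cong:
  "(\<And>r. r \<in> paths (length us) \<Longrightarrow> F (path_chain U A us r) = G (path_chain U A us r)) \<Longrightarrow>
    path_sum U A us F = path_sum U A us G"
  unfolding path_sum_def by (rule sum.cong) auto

lemma path_sum_single [simp]: "path_sum U A [u] F = F []"
  by (simp add: path_sum_def)

lemma path_sum_Nil [simp]: "path_sum U A [] F = 0"
  by (simp add: path_sum_def)

lemma length_path_chain_paths: "r \<in> paths n \<Longrightarrow> length (path_chain U A us r) = n - 1"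
  by (simp add: length_path_chain length_paths)

lemma sum_paths:
  "(\<Sum>r\<in>paths (Suc (Suc n)). G r) = (\<Sum>i<Suc n. \<Sum>r\<in>paths (Suc n). G (Suc i # r))"
proof -
  have "(\<Sum>r\<in>paths (Suc (Suc n)). G r) = (\<Sum>i\<in>{1..Suc n}. \<Sum>r\<in>(#) i ` paths (Suc n). G r)"
    by (simp only: paths.simps, rule sum.UNION_disjoint) auto
  also have "\<dots> = (\<Sum>i\<in>{1..Suc n}. \<Sum>r\<in>paths (Suc n). G (i # r))"
    by (simp add: sum.reindex)
  also have "\<dots> = (\<Sum>i<Suc n. \<Sum>r\<in>paths (Suc n). G (Suc i # r))"
    by (rule sum.reindex_bij_witness[where i = Suc and j = "\<lambda>i. i - 1"]) auto
  finally show ?thesis .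
qed

text \<open>Splits the sum over paths according to the first step, which is the last entry of the chain.\<close>

lemma path_sum_rec:
  assumes "length us = Suc (Suc n)"
  shows "path_sum U A us F = (\<Sum>i<Suc n. signed (Suc i)
    (path_sum U A (merge_arrows U i us) (\<lambda>c. F (c @ [(twist_at A i us, pull_list A us)]))))"
proof -
  have "path_sum U A us F = (\<Sum>i<Suc n. \<Sum>r\<in>paths (Suc n). signed (sum_list (Suc i # r)) (F (path_chain U A us (Suc i # r))))"
    unfolding path_sum_def assms by (rule sum_paths)
  also have "\<dots> = (\<Sum>i<Suc n. signed (Suc i)
    (path_sum U A (merge_arrows U i us) (\<lambda>c. F (c @ [(twist_at A i us, pull_list A us)]))))"
    unfolding path_sum_def signed_sum
    by (intro sum.cong) (auto simp: assms length_contract signed_signed simp del: signed_Suc)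
  finally show ?thesis .
qed

lemma path_sum_add: "path_sum U A us (\<lambda>c. F c + G c) = path_sum U A us F + path_sum U A us G"
  by (simp add: path_sum_def signed_add sum.distrib)

lemma path_sum_hom:
  assumes "\<And>x y. h (x + y) = h x + h y"
  shows "h (path_sum U A us F) = path_sum U A us (\<lambda>c. h (F c))"
proof -
  have h0: "h 0 = 0" using assms[of 0 0] by simp
  have "h (- x) = - h x" for x using assms[of x "- x"] h0 by (simp add: eq_neg_iff_add_eq_0 add.commute)
  then have s: "h (signed n x) = signed n (h x)" for n x by (auto simp: signed_def)
  have "h (sum G S) = (\<Sum>i\<in>S. h (G i))" for G and S :: "nat list set"
    by (induction S rule: infinite_finite_induct) (auto simp: assms h0)
  then show ?thesis by (simp add: path_sum_def s)
qed

lemma path_sum_signed: "path_sum U A us (\<lambda>c. signed n (F c)) = signed n (path_sum U A us F)"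
  by (rule path_sum_hom[symmetric]) (simp add: signed_add)

lemma path_sum_zero [simp]: "path_sum U A us (\<lambda>c. 0) = 0"
  by (simp add: path_sum_def)

lemma path_sum_sum: "path_sum U A us (\<lambda>c. \<Sum>i\<in>S. F i c) = (\<Sum>i\<in>S. path_sum U A us (F i))"
  by (induction S rule: infinite_finite_induct) (auto simp: path_sum_add)

lemma path_sum_length_signed:
  "path_sum U A us (\<lambda>c. signed (length c) (F c)) = signed (length us - 1) (path_sum U A us F)"
proof -
  have "path_sum U A us (\<lambda>c. signed (length c) (F c)) = path_sum U A us (\<lambda>c. signed (length us - 1) (F c))"
    by (rule path_sum_cong) (simp add: length_path_chain length_paths)
  then show ?thesis by (simp only: path_sum_signed)
qed

lemma comp_lfun_assoc: "comp_lfun (comp_lfun F G) H = comp_lfun F (comp_lfun G H)"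
  by (simp add: comp_lfun_def comp_assoc)

lemma comp_lfun_id [simp]: "comp_lfun F id_lfun = F" "comp_lfun id_lfun F = F"
  by (cases F; simp add: comp_lfun_def id_lfun_def comp_def)+

lemma comp_lfun_sel [simp]:
  "FOb (comp_lfun F G) B = FOb F (FOb G B)" "FMor (comp_lfun F G) f = FMor F (FMor G f)"
  by (simp_all add: comp_lfun_def)

lemma id_lfun_sel [simp]: "FOb id_lfun B = B" "FMor id_lfun f = f"
  by (simp_all add: id_lfun_def)

lemma pull_list_Nil [simp]: "pull_list A [] = id_lfun"
  and pull_list_Cons [simp]: "pull_list A (u # us) = comp_lfun (Pull A u) (pull_list A us)"
  by (simp_all add: pull_list_def)

lemma pull_list_append: "pull_list A (us @ vs) = comp_lfun (pull_list A us) (pull_list A vs)"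
  by (induction us) (simp_all add: comp_lfun_assoc)

lemma twist_at_append1:
  "Suc i < length us \<Longrightarrow> twist_at A i (us @ vs) = (\<lambda>B. twist_at A i us (FOb (pull_list A vs) B))"
  by (induction A i us rule: twist_at.induct) (auto simp: pull_list_append)

lemma twist_at_append2:
  "twist_at A (length us + i) (us @ vs) = (\<lambda>B. FMor (pull_list A us) (twist_at A i vs B))"
  by (induction us) auto

text \<open>Naturality without invertibility: the composites and whiskerings along paths are used as
  transformations only.\<close>

definition natural_trans ::
  "('k, 'a, 'f) lincat \<Rightarrow> ('k, 'a, 'f) lincat \<Rightarrow> ('a, 'f) lfun \<Rightarrow> ('a, 'f) lfun \<Rightarrow> ('a \<Rightarrow> 'f) \<Rightarrow> bool"
  where
  "natural_trans C D F G \<eta> \<longleftrightarrow>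
     (\<forall>B\<in>LOb C. \<eta> B \<in> carrier (LHom D (FOb F B) (FOb G B))) \<and>
     (\<forall>B\<in>LOb C. \<forall>B'\<in>LOb C. \<forall>f\<in>carrier (LHom C B B').
        LCmp D (FMor G f) (\<eta> B) = LCmp D (\<eta> B') (FMor F f))"

lemma linear_functor_ob: "linear_functor k C D F \<Longrightarrow> B \<in> LOb C \<Longrightarrow> FOb F B \<in> LOb D"
  and linear_functor_mor: "linear_functor k C D F \<Longrightarrow> B \<in> LOb C \<Longrightarrow> B' \<in> LOb C \<Longrightarrow>
    f \<in> carrier (LHom C B B') \<Longrightarrow> FMor F f \<in> carrier (LHom D (FOb F B) (FOb F B'))"
  and linear_functor_cmp: "linear_functor k C D F \<Longrightarrow> B \<in> LOb C \<Longrightarrow> B' \<in> LOb C \<Longrightarrow> E \<in> LOb C \<Longrightarrow>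
    f \<in> carrier (LHom C B B') \<Longrightarrow> g \<in> carrier (LHom C B' E) \<Longrightarrow>
    FMor F (LCmp C g f) = LCmp D (FMor F g) (FMor F f)"
  and linear_functor_id: "linear_functor k C D F \<Longrightarrow> B \<in> LOb C \<Longrightarrow> FMor F (LId C B) = LId D (FOb F B)"
  and linear_functor_lin: "linear_functor k C D F \<Longrightarrow> B \<in> LOb C \<Longrightarrow> B' \<in> LOb C \<Longrightarrow>
    FMor F \<in> linear_maps k (LHom C B B') (LHom D (FOb F B) (FOb F B'))"
  unfolding linear_functor_def linear_maps_def by blast+

lemma linear_maps_compose:
  "f \<in> linear_maps k L M \<Longrightarrow> g \<in> linear_maps k M N \<Longrightarrow> (\<lambda>x. g (f x)) \<in> linear_maps k L N"
  unfolding linear_maps_def by (simp add: Pi_iff)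

lemma linear_functor_comp:
  assumes F: "linear_functor k C D F" and G: "linear_functor k D E G"
  shows "linear_functor k C E (comp_lfun G F)"
  unfolding linear_functor_def
proof (intro conjI ballI)
  note ob = linear_functor_ob[OF F] and mor = linear_functor_mor[OF F]
  fix A assume A: "A \<in> LOb C"
  show "FOb (comp_lfun G F) A \<in> LOb E"
    using A F G by (simp add: linear_functor_ob)
  show "FMor (comp_lfun G F) (LId C A) = LId E (FOb (comp_lfun G F) A)"
    using A F G by (simp add: linear_functor_id ob)
  fix B assume B: "B \<in> LOb C"
  show "FMor (comp_lfun G F) \<in> linear_maps k (LHom C A B) (LHom E (FOb (comp_lfun G F) A) (FOb (comp_lfun G F) B))"
    using linear_maps_compose[OF linear_functor_lin[OF F A B] linear_functor_lin[OF G ob[OF A] ob[OF B]]]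
    by (simp add: comp_lfun_def comp_def)
  fix X f g assume X: "X \<in> LOb C" and f: "f \<in> carrier (LHom C A B)" and g: "g \<in> carrier (LHom C B X)"
  show "FMor (comp_lfun G F) (LCmp C g f) = LCmp E (FMor (comp_lfun G F) g) (FMor (comp_lfun G F) f)"
    using linear_functor_cmp[OF F A B X f g]
      linear_functor_cmp[OF G ob[OF A] ob[OF B] ob[OF X] mor[OF A B f] mor[OF B X g]] by simp
qed

lemma linear_functor_id_lfun: "linear_functor k C C id_lfun"
  by (auto simp: linear_functor_def linear_maps_def)

lemma natural_transD:
  assumes "natural_trans C D F G \<eta>"
  shows "B \<in> LOb C \<Longrightarrow> \<eta> B \<in> carrier (LHom D (FOb F B) (FOb G B))"
    and "B \<in> LOb C \<Longrightarrow> B' \<in> LOb C \<Longrightarrow> f \<in> carrier (LHom C B B') \<Longrightarrow>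
        LCmp D (FMor G f) (\<eta> B) = LCmp D (\<eta> B') (FMor F f)"
  using assms unfolding natural_trans_def by blast+

lemma natural_trans_post:
  assumes "natural_trans C D F G \<eta>" "linear_functor k D E H" "linear_functor k C D F" "linear_functor k C D G"
  shows "natural_trans C E (comp_lfun H F) (comp_lfun H G) (\<lambda>B. FMor H (\<eta> B))"
  unfolding natural_trans_def
proof (intro conjI ballI)
  fix B assume B: "B \<in> LOb C"
  have ob: "FOb F B \<in> LOb D" "FOb G B \<in> LOb D" if "B \<in> LOb C" for B
    using that assms by (auto intro: linear_functor_ob)
  have cl: "\<eta> B \<in> carrier (LHom D (FOb F B) (FOb G B))" if "B \<in> LOb C" for B
    using natural_transD(1)[OF assms(1) that] .
  show "FMor H (\<eta> B) \<in> carrier (LHom E (FOb (comp_lfun H F) B) (FOb (comp_lfun H G) B))"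
    using linear_functor_mor[OF assms(2) ob[OF B] cl[OF B]] by simp
  fix B' f assume B': "B' \<in> LOb C" and f: "f \<in> carrier (LHom C B B')"
  have "FMor H (LCmp D (FMor G f) (\<eta> B)) = FMor H (LCmp D (\<eta> B') (FMor F f))"
    using natural_transD(2)[OF assms(1) B B' f] by simp
  then show "LCmp E (FMor (comp_lfun H G) f) (FMor H (\<eta> B)) =
      LCmp E (FMor H (\<eta> B')) (FMor (comp_lfun H F) f)"
    using linear_functor_cmp[OF assms(2) ob[OF B] ob(2)[OF B'] cl[OF B]
        linear_functor_mor[OF assms(4) B B' f]]
      linear_functor_cmp[OF assms(2) ob(1)[OF B] ob[OF B'] linear_functor_mor[OF assms(3) B B' f] cl[OF B']]
    by (simp add: ob B B')
qed

lemma natural_trans_pre: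
  assumes "natural_trans C D F G \<eta>" "linear_functor k E C H"
  shows "natural_trans E D (comp_lfun F H) (comp_lfun G H) (\<lambda>B. \<eta> (FOb H B))"
  using assms linear_functor_ob[OF assms(2)] linear_functor_mor[OF assms(2)]
  unfolding natural_trans_def by auto

context small_category
begin

lemma composable_source: "composable U X us \<Longrightarrow> X \<in> Obj U"
  by (cases us) (auto dest: dom_closed)

lemma composable_target: "composable U X us \<Longrightarrow> target U X us \<in> Obj U"
  by (induction us arbitrary: X) auto

lemma composable_append:
  "composable U X (us @ vs) \<longleftrightarrow> composable U X us \<and> composable U (target U X us) vs"
  by (induction us arbitrary: X) (auto dest: composable_source)

lemma target_append [simp]: "target U X (us @ vs) = target U (target U X us) vs"
  by (induction us arbitrary: X) auto

lemma composite_closed: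
  "composable U X us \<Longrightarrow> composite U X us \<in> Arr U"
  "composable U X us \<Longrightarrow> Dom U (composite U X us) = X"
  "composable U X us \<Longrightarrow> Cod U (composite U X us) = target U X us"
  by (induction us arbitrary: X) (auto simp: idn_closed cmp_closed)

lemma composite_single: "u \<in> Arr U \<Longrightarrow> composite U X [u] = u"
  by (simp add: cmp_idn_left)

lemma composite_append:
  "composable U X (us @ vs) \<Longrightarrow>
    composite U X (us @ vs) = Cmp U (composite U (target U X us) vs) (composite U X us)"
proof (induction us arbitrary: X)
  case Nil
  then show ?case using cmp_idn_right composite_closed by (auto simp: composite_closed) (metis cmp_idn_right composite_closed(1,2))
next
  case (Cons u us)
  then show ?case
    using cmp_assoc[of "composite U (target U (Cod U u) us) vs" "composite U (Cod U u) us" u]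
    by (simp add: composable_append composite_closed)
qed

lemma composable_merge:
  "Suc i < length us \<Longrightarrow> composable U X us \<Longrightarrow> composable U X (merge_arrows U i us)"
  by (induction "\<lambda>u v. Cmp U v u" i us arbitrary: X rule: contract.induct) (auto simp: cmp_closed)

lemma target_merge:
  "Suc i < length us \<Longrightarrow> composable U X us \<Longrightarrow> target U X (merge_arrows U i us) = target U X us"
  by (induction "\<lambda>u v. Cmp U v u" i us arbitrary: X rule: contract.induct) (auto simp: cmp_closed)

lemma composite_merge:
  "Suc i < length us \<Longrightarrow> composable U X us \<Longrightarrow> composite U X (merge_arrows U i us) = composite U X us"
proof (induction "\<lambda>u v. Cmp U v u" i us arbitrary: X rule: contract.induct)
  case (1 u v us)
  then show ?case
    using cmp_assoc[of "composite U (Cod U v) us" v u] by (simp add: composite_closed cmp_closed)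
qed auto

lemma merge_merge:
  assumes "i \<le> j" "Suc (Suc j) < length us" "composable U X us"
  shows "merge_arrows U j (merge_arrows U i us) = merge_arrows U i (merge_arrows U (Suc j) us)"
proof (cases "i = j")
  case True
  have "composable U X us \<Longrightarrow> Suc (Suc i) < length us \<Longrightarrow>
      us ! i \<in> Arr U \<and> us ! Suc i \<in> Arr U \<and> us ! Suc (Suc i) \<in> Arr U \<and>
      Dom U (us ! Suc i) = Cod U (us ! i) \<and> Dom U (us ! Suc (Suc i)) = Cod U (us ! Suc i)" for i us X
  proof (induction i arbitrary: us X)
    case 0
    then show ?case by (cases us; cases "tl us"; cases "tl (tl us)") auto
  next
    case (Suc i)
    then show ?case by (cases us) auto
  qed
  then show ?thesis using assms True by (auto intro!: contract_contract_same cmp_assoc[symmetric])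
next
  case False
  then show ?thesis using assms by (simp add: contract_contract)
qed

end

text \<open>Transformations are plain functions whose values matter on objects of the source category only.
  Identities between composites of them therefore hold up to this relation, and sums over paths are only
  compared for functions that respect it.\<close>

definition agree_on :: "'a set \<Rightarrow> (('a \<Rightarrow> 'f) \<times> ('a, 'f) lfun) list \<Rightarrow> (('a \<Rightarrow> 'f) \<times> ('a, 'f) lfun) list \<Rightarrow> bool" where
  "agree_on S = list_all2 (\<lambda>p q. snd p = snd q \<and> (\<forall>B\<in>S. fst p B = fst q B))"

lemma agree_on_refl [simp]: "agree_on S c c"
  by (simp add: agree_on_def list_all2_refl)

lemma agree_on_append: "agree_on S c c' \<Longrightarrow> agree_on S d d' \<Longrightarrow> agree_on S (c @ d) (c' @ d')"
  by (simp add: agree_on_def list_all2_appendI)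

context prestack
begin

abbreviation ob where "ob X \<equiv> LOb (Cat A X)"
abbreviation hom where "hom X B D \<equiv> carrier (LHom (Cat A X) B D)"
abbreviation cmp where "cmp X \<equiv> LCmp (Cat A X)"
abbreviation between where "between Y X \<equiv> linear_functor k (Cat A Y) (Cat A X)"
abbreviation natural where "natural Y X F G \<equiv> natural_trans (Cat A Y) (Cat A X) F G"

lemma cmp_hom:
  "X \<in> Obj U \<Longrightarrow> B \<in> ob X \<Longrightarrow> D \<in> ob X \<Longrightarrow> E \<in> ob X \<Longrightarrow> f \<in> hom X B D \<Longrightarrow> g \<in> hom X D E \<Longrightarrow>
    cmp X g f \<in> hom X B E"
  using linear_category.comp_linear_left[OF cat, of X B D E f] unfolding linear_maps_def by blast

lemma cmp_assoc_hom:
  "X \<in> Obj U \<Longrightarrow> B \<in> ob X \<Longrightarrow> D \<in> ob X \<Longrightarrow> E \<in> ob X \<Longrightarrow> F \<in> ob X \<Longrightarrow>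
    f \<in> hom X B D \<Longrightarrow> g \<in> hom X D E \<Longrightarrow> h \<in> hom X E F \<Longrightarrow>
    cmp X (cmp X h g) f = cmp X h (cmp X g f)"
  using linear_category.comp_assoc[OF cat] by blast

lemma between_pull_list: "composable U X us \<Longrightarrow> between (target U X us) X (pull_list A us)"
proof (induction us arbitrary: X)
  case Nil
  then show ?case by (simp add: linear_functor_id_lfun)
next
  case (Cons u us)
  then show ?case using linear_functor_comp[OF Cons.IH pull[of u]] by auto
qed

lemma between_pull_total:
  "composable U X us \<Longrightarrow> between (target U X us) X (Pull A (composite U X us))"
  using pull[of "composite U X us"] by (simp add: composite_closed)

lemma natural_twist:
  "u \<in> Arr U \<Longrightarrow> v \<in> Arr U \<Longrightarrow> Dom U u = Cod U v \<Longrightarrow>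
    natural (Cod U u) (Dom U v) (comp_lfun (Pull A v) (Pull A u)) (Pull A (Cmp U u v)) (Twist A u v)"
  using twist[of u v] unfolding natural_iso_def natural_trans_def by blast

lemma natural_twist_at:
  "Suc i < length us \<Longrightarrow> composable U X us \<Longrightarrow>
    natural (target U X us) X (pull_list A us) (pull_list A (merge_arrows U i us)) (twist_at A i us)"
proof (induction i arbitrary: X us)
  case 0
  then obtain u v ws where us: "us = u # v # ws" by (cases us; cases "tl us") auto
  show ?case
    using natural_trans_pre[OF natural_twist[of v u] between_pull_list[of "Cod U v" ws]] 0
    by (simp add: us comp_lfun_assoc)
next
  case (Suc i)
  then obtain u ws where us: "us = u # ws" by (cases us) auto
  have *: "composable U (Cod U u) ws" "Suc i < length ws" "u \<in> Arr U" "Dom U u = X" using Suc.prems us by auto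
  show ?case
    using natural_trans_post[OF Suc.IH[OF *(2,1)] pull[OF *(3)] between_pull_list[OF *(1)]]
      between_pull_list[OF composable_merge[OF *(2,1)]] *
    by (simp add: us target_merge)
qed

lemma twist_at_hom:
  "Suc i < length us \<Longrightarrow> composable U X us \<Longrightarrow> B \<in> ob (target U X us) \<Longrightarrow>
    twist_at A i us B \<in> hom X (FOb (pull_list A us) B) (FOb (pull_list A (merge_arrows U i us)) B)"
  by (rule natural_transD(1)[OF natural_twist_at])

lemma pull_list_ob: "composable U X us \<Longrightarrow> B \<in> ob (target U X us) \<Longrightarrow> FOb (pull_list A us) B \<in> ob X"
  by (rule linear_functor_ob[OF between_pull_list])

lemma pull_total_ob: "composable U X us \<Longrightarrow> B \<in> ob (target U X us) \<Longrightarrow> FOb (Pull A (composite U X us)) B \<in> ob X"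
  by (rule linear_functor_ob[OF between_pull_total])

text \<open>Merging at two places in either order gives the same composite. For \<open>j = i\<close> the three arrows involved
  overlap and this is the cocycle condition; for \<open>i < j\<close> the two isomorphisms act on disjoint parts of the simplex and
  it is naturality.\<close>

lemma twist_at_twist_at:
  assumes "i \<le> j" "Suc (Suc j) < length us" "composable U X us" "B \<in> ob (target U X us)"
  shows "cmp X (twist_at A j (merge_arrows U i us) B) (twist_at A i us B) =
    cmp X (twist_at A i (merge_arrows U (Suc j) us) B) (twist_at A (Suc j) us B)"
  using assms
proof (induction i arbitrary: j us X)
  case 0
  then obtain u v us' where us: "us = u # v # us'" by (cases us; cases "tl us") auto
  have uv: "u \<in> Arr U" "v \<in> Arr U" "Dom U v = Cod U u" "Dom U u = X" "composable U (Cod U v) us'"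
    using 0 us by auto
  have B: "B \<in> ob (target U (Cod U v) us')" using 0 us by simp
  show ?case
  proof (cases j)
    case 0
    then obtain w ws where us': "us' = w # ws" using \<open>Suc (Suc j) < length us\<close> us by (cases us') auto
    have w: "w \<in> Arr U" "Dom U w = Cod U v" "composable U (Cod U w) ws" using uv us' by auto
    show ?thesis
      using twist_cocycle[of w v u "FOb (pull_list A ws) B"] uv w pull_list_ob[OF w(3), of B] B
      by (simp add: us us' 0)
  next
    case (Suc j')
    have j': "Suc j' < length us'" using \<open>Suc (Suc j) < length us\<close> us Suc by simp
    show ?thesis
      using natural_transD(2)[OF natural_twist[of v u] _ _ twist_at_hom[OF j' uv(5) B]] uv B j'
        pull_list_ob[OF uv(5) B] pull_list_ob[OF composable_merge[OF j' uv(5)], of B]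
      by (simp add: us Suc target_merge)
  qed
next
  case (Suc i)
  then obtain j' where j: "j = Suc j'" by (cases j) auto
  from Suc obtain u us' where us: "us = u # us'" by (cases us) auto
  have u: "u \<in> Arr U" "Dom U u = X" "composable U (Cod U u) us'" using Suc.prems us by auto
  have B: "B \<in> ob (target U (Cod U u) us')" using Suc.prems us by simp
  have l: "Suc (Suc j') < length us'" "i \<le> j'" "Suc i < length us'" "Suc j' < length us'"
    using Suc.prems us j by auto
  note m1 = composable_merge[OF l(3) u(3)] and m2 = composable_merge[OF l(1) u(3)]
  have l1: "Suc j' < length (merge_arrows U i us')" "Suc i < length (merge_arrows U (Suc j') us')"
    using l by (auto simp: length_contract)
  note m3 = composable_merge[OF l1(1) m1] and m4 = composable_merge[OF l1(2) m2]
  have mm: "merge_arrows U j' (merge_arrows U i us') = merge_arrows U i (merge_arrows U (Suc j') us')"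
    by (rule merge_merge[OF l(2,1) u(3)])
  have t: "target U (Cod U u) (merge_arrows U i us') = target U (Cod U u) us'"
    "target U (Cod U u) (merge_arrows U (Suc j') us') = target U (Cod U u) us'"
    "target U (Cod U u) (merge_arrows U i (merge_arrows U (Suc j') us')) = target U (Cod U u) us'"
    using l l1 m2 u by (auto simp: target_merge)
  have ih: "cmp (Cod U u) (twist_at A j' (merge_arrows U i us') B) (twist_at A i us' B) =
    cmp (Cod U u) (twist_at A i (merge_arrows U (Suc j') us') B) (twist_at A (Suc j') us' B)"
    by (rule Suc.IH[OF l(2,1) u(3) B])
  note fc = linear_functor_cmp[OF pull[OF u(1)]]
  have "FMor (Pull A u) (cmp (Cod U u) (twist_at A j' (merge_arrows U i us') B) (twist_at A i us' B)) =
      cmp X (FMor (Pull A u) (twist_at A j' (merge_arrows U i us') B)) (FMor (Pull A u) (twist_at A i us' B))"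
    using fc[OF pull_list_ob[OF u(3) B] pull_list_ob[OF m1] pull_list_ob[OF m3]
        twist_at_hom[OF l(3) u(3) B] twist_at_hom[OF l1(1) m1]] B t u l l1 m1 mm by simp
  moreover have "FMor (Pull A u) (cmp (Cod U u) (twist_at A i (merge_arrows U (Suc j') us') B) (twist_at A (Suc j') us' B)) =
      cmp X (FMor (Pull A u) (twist_at A i (merge_arrows U (Suc j') us') B)) (FMor (Pull A u) (twist_at A (Suc j') us' B))"
    using fc[OF pull_list_ob[OF u(3) B] pull_list_ob[OF m2] pull_list_ob[OF m4]
        twist_at_hom[OF l(1) u(3) B] twist_at_hom[OF l1(2) m2]] B t u l l1 m1 mm by simp
  ultimately show ?case using ih by (simp add: us j)
qed

lemma composite_pull_single: "u \<in> Arr U \<Longrightarrow> Pull A (composite U X [u]) = pull_list A [u]"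
  using composite_single[of u X] by simp

lemma path_chain_chain:
  assumes "r \<in> paths (length us)" "composable U X us"
  shows "chain (between (target U X us) X) (natural (target U X us) X) (Pull A (composite U X us)) (path_chain U A us r)
    \<and> start (Pull A (composite U X us)) (path_chain U A us r) = pull_list A us"
  using assms
proof (induction r arbitrary: us)
  case Nil
  then have "length us = 1" using length_paths[OF Nil(1)] by (cases "length us") auto
  then obtain u where u: "us = [u]" by (cases us) auto
  show ?case
    using Nil(2) between_pull_total[OF Nil(2)] composite_pull_single[of u X] by (simp add: u)
next
  case (Cons i r)
  note r = Cons.prems(1) and c = Cons.prems(2)
  obtain n where n: "length us = Suc (Suc n)" using r by (cases "length us" rule: paths.cases) auto
  have i: "Suc (i - 1) < length us" using r n by auto
  have r': "r \<in> paths (length (merge_arrows U (i - 1) us))" using r n i by (auto simp: length_contract)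
  have c': "composable U X (merge_arrows U (i - 1) us)" using composable_merge[OF i c] .
  note ih = Cons.IH[OF r' c', unfolded target_merge[OF i c] composite_merge[OF i c]]
  show ?case
    using ih natural_twist_at[OF i c] between_pull_list[OF c] between_pull_list[OF c', unfolded target_merge[OF i c]]
    by (simp add: chain_append)
qed

definition vcomp :: "'o \<Rightarrow> ('a \<Rightarrow> 'f) \<Rightarrow> ('a \<Rightarrow> 'f) \<Rightarrow> 'a \<Rightarrow> 'f" where
  "vcomp X \<eta> \<theta> = (\<lambda>B. cmp X (\<eta> B) (\<theta> B))"

text \<open>The inner faces of all paths cancel: merging two consecutive steps of a path forgets in which
  order the two merges of the simplex were done, and exchanging them changes the sign of the path. By induction only
  the first two steps have to be treated, where the sum has the shape of a double simplicial boundary.\<close>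

theorem path_sum_inner_bd:
  assumes "composable U X us"
    and ext: "\<And>c c'. agree_on (ob (target U X us)) c c' \<Longrightarrow> F c = F c'"
  shows "path_sum U A us (inner_bd (paste (vcomp X)) F) = (0 :: 'g::ab_group_add)"
  using assms
proof (induction "length us" arbitrary: us F rule: less_induct)
  case less
  note c = less.prems(1) and ext = less.prems(2)
  consider "length us < 2" | "length us = 2" | N where "length us = Suc (Suc (Suc N))"
    by (metis One_nat_def Suc_1 less_2_cases_iff not0_implies_Suc)
  then show ?case
  proof cases
    case 1
    then show ?thesis by (cases us; cases "tl us") auto
  next
    case 2
    then obtain u v where "us = [u, v]" by (cases us; cases "tl us") auto
    then show ?thesis by (simp add: path_sum_rec)
  next
    case (3 N)
    let ?m = "merge_arrows U" and ?t = "\<lambda>i us. (twist_at A i us, pull_list A us)"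
    let ?bd = "inner_bd (paste (vcomp X))"
    (* f i j collects the paths that merge first at i and then at j, with these two steps composed. *)
    define f where "f i j = path_sum U A (?m j (?m i us))
      (\<lambda>c. F (c @ [(vcomp X (twist_at A j (?m i us)) (twist_at A i us), pull_list A us)]))" for i j
    have step: "path_sum U A (?m i us) (\<lambda>c. ?bd F (c @ [?t i us])) = (\<Sum>j<Suc N. signed (N + j) (f i j))"
      if i: "Suc i < length us" for i
    proof -
      have l: "length (?m i us) = Suc (Suc N)" using i 3 by (simp add: length_contract)
      have "path_sum U A (?m i us) (\<lambda>c. ?bd F (c @ [?t i us])) =
        path_sum U A (?m i us) (\<lambda>c. ?bd (\<lambda>c. F (c @ [?t i us])) c
          + signed (Suc N) (F (butlast c @ [paste (vcomp X) (last c) (?t i us)])))"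
      proof (rule path_sum_cong)
        fix r assume "r \<in> paths (length (?m i us))"
        then have "length (path_chain U A (?m i us) r) = Suc N" by (metis l length_path_chain_paths diff_Suc_1)
        then show "?bd F (path_chain U A (?m i us) r @ [?t i us]) =
            ?bd (\<lambda>c. F (c @ [?t i us])) (path_chain U A (?m i us) r) +
            signed (Suc N) (F (butlast (path_chain U A (?m i us) r) @
              [paste (vcomp X) (last (path_chain U A (?m i us) r)) (?t i us)]))"
          using inner_bd_snoc[of "path_chain U A (?m i us) r" "paste (vcomp X)" F "?t i us"]
            by (metis length_0_conv nat.distinct(1))
      qed
      also have "\<dots> = path_sum U A (?m i us) (?bd (\<lambda>c. F (c @ [?t i us])))
          + signed (Suc N) (path_sum U A (?m i us) (\<lambda>c. F (butlast c @ [paste (vcomp X) (last c) (?t i us)])))"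
        by (simp only: path_sum_add path_sum_signed)
      also have "path_sum U A (?m i us) (?bd (\<lambda>c. F (c @ [?t i us]))) = 0"
      proof (rule less.hyps)
        show "length (?m i us) < length us" using l 3 by simp
        show "composable U X (?m i us)" by (rule composable_merge[OF i c])
        fix c c' :: "(('a \<Rightarrow> 'f) \<times> ('a, 'f) lfun) list"
        assume "agree_on (ob (target U X (?m i us))) c c'"
        then show "F (c @ [?t i us]) = F (c' @ [?t i us])"
          by (intro ext agree_on_append) (auto simp: target_merge[OF i c])
      qed
      also have "path_sum U A (?m i us) (\<lambda>c. F (butlast c @ [paste (vcomp X) (last c) (?t i us)])) =
          (\<Sum>j<Suc N. signed (Suc j) (f i j))"
        unfolding path_sum_rec[OF l] by (simp add: f_def)
      also have "0 + signed (Suc N) (\<Sum>j<Suc N. signed (Suc j) (f i j)) = (\<Sum>j<Suc N. signed (N + j) (f i j))"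
        unfolding add_0 signed_sum by (rule sum.cong) (auto simp: signed_signed)
      finally show ?thesis .
    qed
    have swap: "f i j = f (Suc j) i" if ij: "i \<le> j" "j < Suc N" for i j
    proof -
      have l: "Suc (Suc j) < length us" using ij 3 by simp
      show ?thesis
        unfolding f_def merge_merge[OF ij(1) l c]
      proof (rule path_sum_cong, rule ext, rule agree_on_append)
        show "agree_on (ob (target U X us))
            [(vcomp X (twist_at A j (?m i us)) (twist_at A i us), pull_list A us)]
            [(vcomp X (twist_at A i (?m (Suc j) us)) (twist_at A (Suc j) us), pull_list A us)]"
          using twist_at_twist_at[OF ij(1) l c] by (simp add: agree_on_def vcomp_def)
      qed simp
    qed
    have "path_sum U A us (?bd F) = (\<Sum>i<Suc (Suc N). signed (Suc i) (\<Sum>j<Suc N. signed (N + j) (f i j)))"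
      unfolding path_sum_rec[OF 3] using step 3 by (intro sum.cong) auto
    also have "\<dots> = signed (Suc N) (\<Sum>i<Suc (Suc N). \<Sum>j<Suc N. signed (i + j) (f i j))"
      unfolding signed_sum by (intro sum.cong) (auto simp: signed_signed add.left_commute add.assoc)
    also have "(\<Sum>i<Suc (Suc N). \<Sum>j<Suc N. signed (i + j) (f i j)) = 0"
      by (rule simplicial_cancellation) (rule swap)
    finally show ?thesis by simp
  qed
qed

end

abbreviation whisker_act :: "('a, 'f) lfun \<Rightarrow> ('a \<Rightarrow> 'f) \<Rightarrow> 'a \<Rightarrow> 'f" where
  "whisker_act F \<eta> \<equiv> (\<lambda>B. FMor F (\<eta> B))"

abbreviation whisker_nat :: "('a \<Rightarrow> 'f) \<Rightarrow> ('a, 'f) lfun \<Rightarrow> 'a \<Rightarrow> 'f" where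
  "whisker_nat \<eta> F \<equiv> (\<lambda>B. \<eta> (FOb F B))"

abbreviation horizontal_shuffle_sum where
  "horizontal_shuffle_sum \<equiv> shuffle_sum comp_lfun whisker_act whisker_nat"

text \<open>Sums over the pairs of a path of \<open>us\<close> and a path of \<open>vs\<close> and over their shuffles under horizontal
  composition, that is, over the interleavings of both in which the merges take place on the two sides of a fixed cut.\<close>

definition split_path_sum ::
  "('o, 'u) category \<Rightarrow> ('k, 'o, 'u, 'a, 'f) prestack_data \<Rightarrow> ('a, 'f) lfun \<Rightarrow> ('a, 'f) lfun \<Rightarrow> 'u list \<Rightarrow> 'u list
    \<Rightarrow> ((('a \<Rightarrow> 'f) \<times> ('a, 'f) lfun) list \<Rightarrow> 'g::ab_group_add) \<Rightarrow> 'g" where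
  "split_path_sum U A S T us vs F =
    path_sum U A vs (\<lambda>s. path_sum U A us (\<lambda>r. horizontal_shuffle_sum F S s T r))"

text \<open>The first step of such an interleaving merges either two arrows of \<open>us\<close> or two arrows of \<open>vs\<close>. The
  hypotheses on \<open>S\<close> and \<open>T\<close> concern a part with a single arrow, which has no step to offer.\<close>

lemma split_path_sum_rec:
  fixes F :: "(('a \<Rightarrow> 'f) \<times> ('a, 'f) lfun) list \<Rightarrow> 'g::ab_group_add"
  assumes "us \<noteq> []" "vs \<noteq> []" "length us + length vs > 2"
    and S: "length vs = 1 \<Longrightarrow> S = pull_list A vs" and T: "length us = 1 \<Longrightarrow> T = pull_list A us"
  shows "split_path_sum U A S T us vs F =
    (\<Sum>i<length us - 1. signed (Suc i) (split_path_sum U A S T (merge_arrows U i us) vs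
       (\<lambda>c. F (c @ [(twist_at A i (us @ vs), pull_list A (us @ vs))])))) +
    (\<Sum>i<length vs - 1. signed (length us + i) (split_path_sum U A S T us (merge_arrows U i vs)
       (\<lambda>c. F (c @ [(twist_at A (length us + i) (us @ vs), pull_list A (us @ vs))]))))"
proof -
  let ?H = "horizontal_shuffle_sum" and ?m = "merge_arrows U"
  let ?yl = "\<lambda>i c. c @ [(twist_at A i (us @ vs), pull_list A (us @ vs))]"
  let ?zr = "\<lambda>i c. c @ [(twist_at A (length us + i) (us @ vs), pull_list A (us @ vs))]"
  let ?y = "\<lambda>i. (twist_at A i us, pull_list A us)" and ?z = "\<lambda>i. (twist_at A i vs, pull_list A vs)"
  consider (a) "length us = 1" "length vs > 1" | (b) "length us > 1" "length vs = 1"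
    | (c) "length us > 1" "length vs > 1"
    using assms(1-3) by (cases "length us"; cases "length vs"; fastforce)
  then show ?thesis
  proof cases
    case a
    then obtain n where n: "length vs = Suc (Suc n)" by (metis One_nat_def less_imp_Suc_add plus_1_eq_Suc)
    from a obtain u where u: "us = [u]" by (cases us) auto
    have "split_path_sum U A S T us vs F =
      (\<Sum>i<Suc n. signed (Suc i) (path_sum U A (?m i vs) (\<lambda>s. ?H F S (s @ [?z i]) T [])))"
      by (simp add: split_path_sum_def u path_sum_rec[OF n])
    also have "\<dots> = (\<Sum>i<Suc n. signed (Suc i) (path_sum U A (?m i vs) (\<lambda>s. ?H (\<lambda>c. F (?zr i c)) S s T [])))"
      using T[OF a(1)] u by (simp add: shuffle_sum_snoc_left)
    finally show ?thesis using u by (simp add: split_path_sum_def n)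
  next
    case b
    then obtain n where n: "length us = Suc (Suc n)" by (metis One_nat_def less_imp_Suc_add plus_1_eq_Suc)
    from b obtain v where v: "vs = [v]" by (cases vs) auto
    have "split_path_sum U A S T us vs F =
      (\<Sum>i<Suc n. signed (Suc i) (path_sum U A (?m i us) (\<lambda>r. ?H F S [] T (r @ [?y i]))))"
      by (simp add: split_path_sum_def v path_sum_rec[OF n])
    also have "\<dots> = (\<Sum>i<Suc n. signed (Suc i) (path_sum U A (?m i us) (\<lambda>r. ?H (\<lambda>c. F (?yl i c)) S [] T r)))"
      using S[OF b(2)] v n by (intro sum.cong) (auto simp: shuffle_sum_snoc_right twist_at_append1 pull_list_append)
    finally show ?thesis using v by (simp add: split_path_sum_def n)
  next
    case c
    then obtain m n where m: "length us = Suc (Suc m)" and n: "length vs = Suc (Suc n)"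
      by (metis One_nat_def less_imp_Suc_add plus_1_eq_Suc)
    let ?P = "\<lambda>i j. path_sum U A (?m j vs) (\<lambda>s. path_sum U A (?m i us)
      (\<lambda>r. ?H (\<lambda>c. F (?zr j c)) S s T (r @ [?y i])))"
    let ?Q = "\<lambda>i j. path_sum U A (?m j vs) (\<lambda>s. path_sum U A (?m i us)
      (\<lambda>r. ?H (\<lambda>c. F (?yl i c)) S (s @ [?z j]) T r))"
    have "split_path_sum U A S T us vs F =
      (\<Sum>i<Suc m. \<Sum>j<Suc n. signed (Suc i) (signed (Suc j) (path_sum U A (?m j vs) (\<lambda>s.
        path_sum U A (?m i us) (\<lambda>r. ?H F S (s @ [?z j]) T (r @ [?y i]))))))"
      by (simp only: split_path_sum_def path_sum_rec[OF n] path_sum_rec[OF m] path_sum_sum path_sum_signed signed_sum)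
    also have "\<dots> = (\<Sum>i<Suc m. \<Sum>j<Suc n. signed (Suc i) (signed (Suc j) (path_sum U A (?m j vs) (\<lambda>s.
        path_sum U A (?m i us) (\<lambda>r. signed (Suc m) (?H (\<lambda>c. F (?zr j c)) S s T (r @ [?y i]))
          + ?H (\<lambda>c. F (?yl i c)) S (s @ [?z j]) T r)))))"
    proof (intro sum.cong refl arg_cong[where f = "signed _"] path_sum_cong)
      fix i j r s assume "i \<in> {..<Suc m}" "r \<in> paths (length (?m i us))"
      then have "length (path_chain U A (?m i us) r) = m" "Suc i < length us"
        using m length_path_chain_paths[of r "length (?m i us)"] by (simp_all add: length_contract del: paths.simps)
      then show "?H F S (path_chain U A (?m j vs) s @ [?z j]) T (path_chain U A (?m i us) r @ [?y i]) =
          signed (Suc m) (?H (\<lambda>c. F (?zr j c)) S (path_chain U A (?m j vs) s) T (path_chain U A (?m i us) r @ [?y i]))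
          + ?H (\<lambda>c. F (?yl i c)) S (path_chain U A (?m j vs) s @ [?z j]) T (path_chain U A (?m i us) r)"
        unfolding shuffle_sum_snoc by (simp add: twist_at_append1 twist_at_append2 pull_list_append)
    qed
    also have "\<dots> = (\<Sum>i<Suc m. \<Sum>j<Suc n. signed (Suc i) (signed (Suc j) (signed (Suc m) (?P i j)))) +
        (\<Sum>i<Suc m. \<Sum>j<Suc n. signed (Suc i) (signed (Suc j) (?Q i j)))"
      by (simp only: path_sum_add path_sum_signed signed_add sum.distrib)
    also have "(\<Sum>i<Suc m. \<Sum>j<Suc n. signed (Suc i) (signed (Suc j) (signed (Suc m) (?P i j)))) =
        (\<Sum>j<Suc n. \<Sum>i<Suc m. signed (Suc j + Suc m) (signed (Suc i) (?P i j)))"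
      by (subst sum.swap) (simp only: signed_signed ac_simps)
    also have "\<dots> = (\<Sum>j<Suc n. signed (Suc j + Suc m) (path_sum U A (?m j vs) (\<lambda>s. \<Sum>i<Suc m. signed (Suc i)
          (path_sum U A (?m i us) (\<lambda>r. ?H (\<lambda>c. F (?zr j c)) S s T (r @ [?y i]))))))"
      by (simp only: path_sum_signed path_sum_sum signed_sum)
    also have "(\<Sum>i<Suc m. \<Sum>j<Suc n. signed (Suc i) (signed (Suc j) (?Q i j))) =
      (\<Sum>i<Suc m. signed (Suc i) (\<Sum>j<Suc n. signed (Suc j) (path_sum U A (?m j vs) (\<lambda>s.
          path_sum U A (?m i us) (\<lambda>r. ?H (\<lambda>c. F (?yl i c)) S (s @ [?z j]) T r)))))"
      by (simp only: signed_sum)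
    finally have "split_path_sum U A S T us vs F =
      (\<Sum>j<Suc n. signed (Suc j + Suc m) (split_path_sum U A S T us (?m j vs) (\<lambda>c. F (?zr j c)))) +
      (\<Sum>i<Suc m. signed (Suc i) (split_path_sum U A S T (?m i us) vs (\<lambda>c. F (?yl i c))))"
      by (simp only: split_path_sum_def path_sum_rec[OF n] path_sum_rec[OF m])
    then show ?thesis
      using m n by (simp add: add.commute)
  qed
qed

context prestack
begin

text \<open>Reindexing by the place of the cut in the original simplex: a merge to the left of the cut shifts
  it by one.\<close>

lemma sum_triangles:
  fixes a b :: "nat \<Rightarrow> nat \<Rightarrow> 'g::ab_group_add"
  shows "(\<Sum>i<Suc n. \<Sum>k\<in>{1..n}. if i < k then a i (Suc k) else b i k) =
    (\<Sum>k\<in>{1..Suc n}. (\<Sum>i<k - 1. a i k) + (\<Sum>i<Suc n - k. b (k + i) k))"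
proof -
  define S where "S = {..<Suc n} \<times> {1..n}"
  have "(\<Sum>i<Suc n. \<Sum>k\<in>{1..n}. if i < k then a i (Suc k) else b i k) =
      (\<Sum>(i, k)\<in>S. if i < k then a i (Suc k) else b i k)"
    unfolding S_def by (rule sum.cartesian_product)
  also have "\<dots> = (\<Sum>(i, k)\<in>S. if i < k then a i (Suc k) else 0) + (\<Sum>(i, k)\<in>S. if i < k then 0 else b i k)"
    unfolding sum.distrib[symmetric] by (rule sum.cong) auto
  also have "(\<Sum>(i, k)\<in>S. if i < k then a i (Suc k) else 0) = (\<Sum>(i, k)\<in>{(i, k) \<in> S. i < k}. a i (Suc k))"
    by (rule sum.mono_neutral_cong_right) (auto simp: S_def split: if_splits)
  also have "\<dots> = (\<Sum>(k, i)\<in>(SIGMA k:{1..Suc n}. {..<k - 1}). a i k)"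
    by (rule sum.reindex_bij_witness[where j = "\<lambda>(i, k). (Suc k, i)" and i = "\<lambda>(k, i). (i, k - 1)"])
       (auto simp: S_def)
  also have "\<dots> = (\<Sum>k\<in>{1..Suc n}. \<Sum>i<k - 1. a i k)"
    by (rule sum.Sigma[symmetric]) auto
  also have "(\<Sum>(i, k)\<in>S. if i < k then 0 else b i k) = (\<Sum>(i, k)\<in>{(i, k) \<in> S. \<not> i < k}. b i k)"
    by (rule sum.mono_neutral_cong_right) (auto simp: S_def split: if_splits)
  also have "\<dots> = (\<Sum>(k, i)\<in>(SIGMA k:{1..Suc n}. {..<Suc n - k}). b (k + i) k)"
    by (rule sum.reindex_bij_witness[where j = "\<lambda>(i, k). (k, i - k)" and i = "\<lambda>(k, i). (k + i, k)"])
       (auto simp: S_def)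
  also have "\<dots> = (\<Sum>k\<in>{1..Suc n}. \<Sum>i<Suc n - k. b (k + i) k)"
    by (rule sum.Sigma[symmetric]) auto
  finally show ?thesis by (simp only: sum.distrib)
qed

abbreviation split_head where
  "split_head X us vs \<equiv> (Twist A (composite U (target U X us) vs) (composite U X us),
     comp_lfun (Pull A (composite U X us)) (Pull A (composite U (target U X us) vs)))"

abbreviation split_sum where
  "split_sum X us vs \<equiv> split_path_sum U A (Pull A (composite U (target U X us) vs)) (Pull A (composite U X us)) us vs"

text \<open>The last step of a path of $u_1, \dots, u_N$ is $c^{u_N \cdots u_{k+1},\, u_k \cdots u_1}$ for some \<open>k\<close>, and the steps
  before it merge the first \<open>k\<close> and the last \<open>N - k\<close> arrows separately, in any interleaved order. So the sum over all paths is a sum over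
  the cuts \<open>k\<close> of split sums, and the last step, being the first entry of the chain, is prepended to each shuffle.\<close>

theorem path_sum_split:
  fixes F :: "(('a \<Rightarrow> 'f) \<times> ('a, 'f) lfun) list \<Rightarrow> 'g::ab_group_add"
  assumes "composable U X us" "length us = Suc (Suc n)"
  shows "path_sum U A us F = (\<Sum>k\<in>{1..Suc n}. signed (length us - k)
    (split_sum X (take k us) (drop k us) (\<lambda>c. F (split_head X (take k us) (drop k us) # c))))"
  using assms
proof (induction n arbitrary: us F)
  case 0
  then obtain u v where us: "us = [u, v]" by (cases us; cases "tl us") auto
  then show ?case
    using 0 composite_single[of u X] composite_single[of v "Cod U u"]
    by (simp add: path_sum_rec[of _ 0] split_path_sum_def sum.lessThan_Suc)
next
  case (Suc n)
  note c = Suc.prems(1) and len = Suc.prems(2)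
  let ?m = "merge_arrows U"
  let ?e = "\<lambda>i c. c @ [(twist_at A i us, pull_list A us)]"
  let ?h = "\<lambda>k. split_head X (take k us) (drop k us)"
  (* The paths of us whose last step cuts at k and whose first step merges at i, on the left (La) or right (Lb) of the cut. *)
  define La where "La i k = signed (Suc i + (length us - k)) (split_path_sum U A
     (Pull A (composite U (target U X (take k us)) (drop k us))) (Pull A (composite U X (take k us)))
      (?m i (take k us)) (drop k us) (\<lambda>c. F (?e i (?h k # c))))" for i k
  define Lb where "Lb i k = signed (i + (length us - k)) (split_path_sum U A
     (Pull A (composite U (target U X (take k us)) (drop k us))) (Pull A (composite U X (take k us)))
      (take k us) (?m (i - k) (drop k us)) (\<lambda>c. F (?e i (?h k # c))))" for i k
  have "path_sum U A us F = (\<Sum>i<Suc (Suc n). signed (Suc i) (path_sum U A (?m i us) (\<lambda>c. F (?e i c))))"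
    by (rule path_sum_rec[OF len])
  also have "\<dots> = (\<Sum>i<Suc (Suc n). \<Sum>k\<in>{1..Suc n}. if i < k then La i (Suc k) else Lb i k)"
  proof (rule sum.cong[OF refl])
    fix i assume "i \<in> {..<Suc (Suc n)}"
    then have i: "Suc i < length us" using len by simp
    have cm: "composable U X (?m i us)" by (rule composable_merge[OF i c])
    have lm: "length (?m i us) = Suc (Suc n)" using i len by (simp add: length_contract)
    have "signed (Suc i) (path_sum U A (?m i us) (\<lambda>c. F (?e i c))) =
      (\<Sum>k\<in>{1..Suc n}. signed (Suc i) (signed (length (?m i us) - k)
        (split_sum X (take k (?m i us)) (drop k (?m i us))
          (\<lambda>c. F (?e i (split_head X (take k (?m i us)) (drop k (?m i us)) # c))))))"
      by (simp only: Suc.IH[OF cm lm] signed_sum)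
    also have "\<dots> = (\<Sum>k\<in>{1..Suc n}. if i < k then La i (Suc k) else Lb i k)"
    proof (rule sum.cong[OF refl])
      fix k assume k: "k \<in> {1..Suc n}"
      show "signed (Suc i) (signed (length (?m i us) - k)
        (split_sum X (take k (?m i us)) (drop k (?m i us))
          (\<lambda>c. F (?e i (split_head X (take k (?m i us)) (drop k (?m i us)) # c))))) =
        (if i < k then La i (Suc k) else Lb i k)"
      proof (cases "i < k")
        case True
        have l: "Suc i < length (take (Suc k) us)" "length (?m i (take (Suc k) us)) = k"
          using True k len by (auto simp: length_contract)
        have ct: "composable U X (take (Suc k) us)"
          using c composable_append[of X "take (Suc k) us" "drop (Suc k) us"] by simp
        have "?m i us = ?m i (take (Suc k) us) @ drop (Suc k) us"
          using contract_append[OF l(1), of _ "drop (Suc k) us"] by simp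
        then have *: "take k (?m i us) = ?m i (take (Suc k) us)" "drop k (?m i us) = drop (Suc k) us"
          using l(2) by auto
        show ?thesis
          using True len lm unfolding * target_merge[OF l(1) ct] composite_merge[OF l(1) ct] La_def
          by (simp add: signed_signed)
      next
        case False
        have l: "length (take k us) = k" "Suc (i - k) < length (drop k us)" using False k i by auto
        have cd: "composable U (target U X (take k us)) (drop k us)"
          using c composable_append[of X "take k us" "drop k us"] by simp
        have "?m i us = take k us @ ?m (i - k) (drop k us)"
          using contract_append2'[of "take k us" i _ "drop k us"] False l(1) by simp
        then have *: "take k (?m i us) = take k us" "drop k (?m i us) = ?m (i - k) (drop k us)"
          using l(1) by auto
        have s: "length us - k = Suc (length (?m i us) - k)" using k lm len by auto
        show ?thesis
          using False unfolding * composite_merge[OF l(2) cd] Lb_def s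
          by (simp add: signed_signed)
      qed
    qed
    finally show "signed (Suc i) (path_sum U A (?m i us) (\<lambda>c. F (?e i c))) =
      (\<Sum>k\<in>{1..Suc n}. if i < k then La i (Suc k) else Lb i k)" .
  qed
  also have "\<dots> = (\<Sum>k\<in>{1..Suc (Suc n)}. (\<Sum>i<k - 1. La i k) + (\<Sum>i<Suc (Suc n) - k. Lb (k + i) k))"
    by (rule sum_triangles)
  also have "\<dots> = (\<Sum>k\<in>{1..Suc (Suc n)}. signed (length us - k)
    (split_sum X (take k us) (drop k us) (\<lambda>c. F (?h k # c))))"
  proof (rule sum.cong[OF refl])
    fix k assume k: "k \<in> {1..Suc (Suc n)}"
    have l: "length (take k us) = k" "length (drop k us) = Suc (Suc (Suc n)) - k" using k len by auto
    have ct: "composable U X (take k us)" and cd: "composable U (target U X (take k us)) (drop k us)"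
      using c composable_append[of X "take k us" "drop k us"] by simp_all
    have S: "length (drop k us) = 1 \<Longrightarrow> Pull A (composite U (target U X (take k us)) (drop k us)) = pull_list A (drop k us)"
      using composite_pull_single cd by (cases "drop k us") auto
    have T: "length (take k us) = 1 \<Longrightarrow> Pull A (composite U X (take k us)) = pull_list A (take k us)"
      using composite_pull_single ct by (cases "take k us") auto
    have "split_sum X (take k us) (drop k us) (\<lambda>c. F (?h k # c)) =
      (\<Sum>i<length (take k us) - 1. signed (Suc i) (split_path_sum U A
        (Pull A (composite U (target U X (take k us)) (drop k us))) (Pull A (composite U X (take k us)))
        (?m i (take k us)) (drop k us) (\<lambda>c. F (?h k # c @
          [(twist_at A i (take k us @ drop k us), pull_list A (take k us @ drop k us))])))) +
      (\<Sum>i<length (drop k us) - 1. signed (length (take k us) + i) (split_path_sum U A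
        (Pull A (composite U (target U X (take k us)) (drop k us))) (Pull A (composite U X (take k us)))
        (take k us) (?m i (drop k us)) (\<lambda>c. F (?h k # c @
          [(twist_at A (length (take k us) + i) (take k us @ drop k us), pull_list A (take k us @ drop k us))]))))"
      by (rule split_path_sum_rec[OF _ _ _ S T]) (use k len in auto)
    moreover have arith: "min k (length us) = k" "length us - Suc k = Suc (Suc n) - k" "k + (length us - k) = length us"
      using k len by auto
    ultimately show "(\<Sum>i<k - 1. La i k) + (\<Sum>i<Suc (Suc n) - k. Lb (k + i) k) = signed (length us - k)
      (split_sum X (take k us) (drop k us) (\<lambda>c. F (?h k # c)))"
      using arith by (simp add: l signed_add signed_sum signed_signed La_def Lb_def ac_simps)
  qed
  finally show ?case .
qed

end

section \<open>Formal sums of bimodule elements\<close>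

text \<open>The coefficient modules of a cochain vary with the simplex, and their addition is an operation on a
  carrier. All cancellations are therefore carried out with formal integral combinations of bimodule elements, which
  form one abelian group type; the bimodule operations extend linearly.\<close>

definition extend_linearly :: "('m \<Rightarrow> 'n) \<Rightarrow> ('m \<Rightarrow>\<^sub>0 int) \<Rightarrow> 'n \<Rightarrow>\<^sub>0 int" where
  "extend_linearly g = frag_extend (\<lambda>x. frag_of (g x))"

lemma lin_of [simp]: "extend_linearly g (frag_of x) = frag_of (g x)"
  and lin_zero [simp]: "extend_linearly g 0 = 0"
  and lin_add: "extend_linearly g (a + b) = extend_linearly g a + extend_linearly g b"
  and lin_uminus [simp]: "extend_linearly g (- a) = - extend_linearly g a"
  by (simp_all add: extend_linearly_def frag_extend_add frag_extend_minus)

lemma lin_signed: "extend_linearly g (signed n a) = signed n (extend_linearly g a)"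
  by (simp add: signed_def lin_uminus)

lemma lin_sum: "extend_linearly g (sum f I) = (\<Sum>i\<in>I. extend_linearly g (f i))"
  by (induction I rule: infinite_finite_induct) (auto simp: lin_add)

lemma lin_inner_bd: "extend_linearly g (inner_bd m F xs) = inner_bd m (\<lambda>c. extend_linearly g (F c)) xs"
  by (simp only: inner_bd_def lin_sum lin_signed)

lemma lin_shuffle_sum:
  "extend_linearly g (shuffle_sum ob ac na F D xs T ys) = shuffle_sum ob ac na (\<lambda>c. extend_linearly g (F c)) D xs T ys"
  by (rule shuffle_sum_hom) (rule lin_add)

lemma lin_path_sum:
  "extend_linearly g (path_sum U A us F) = path_sum U A us (\<lambda>c. extend_linearly g (F c))"
  by (rule path_sum_hom) (rule lin_add)

lemmas lin_simps = lin_add lin_signed lin_sum lin_inner_bd lin_shuffle_sum lin_path_sum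

lemma lin_lin: "extend_linearly g (extend_linearly h a) = extend_linearly (\<lambda>x. g (h x)) a"
  using frag_extend_compose[of "\<lambda>x. frag_of (g x)" h a] by (simp add: extend_linearly_def o_def)

lemma lin_cong: "(\<And>x. x \<in> Poly_Mapping.keys a \<Longrightarrow> g x = h x) \<Longrightarrow> extend_linearly g a = extend_linearly h a"
  unfolding extend_linearly_def by (rule frag_extend_eq) simp

lemma keys_lin: "Poly_Mapping.keys (extend_linearly g a) \<subseteq> g ` Poly_Mapping.keys a"
  unfolding extend_linearly_def using keys_frag_extend[of "\<lambda>x. frag_of (g x)" a] by auto

lemma signed_odd: "odd n \<Longrightarrow> signed n x = - x"
  by (simp add: signed_def)

lemma signed_even: "even n \<Longrightarrow> signed n x = x"
  by (simp add: signed_def)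

text \<open>Associativity of the merging operation makes the inner faces square to zero.\<close>

lemma inner_bd_inner_bd:
  assumes "\<And>i. Suc (Suc i) < length xs \<Longrightarrow>
    m (m (xs ! i) (xs ! Suc i)) (xs ! Suc (Suc i)) = m (xs ! i) (m (xs ! Suc i) (xs ! Suc (Suc i)))"
  shows "inner_bd m (inner_bd m F) xs = 0"
proof (cases "length xs < 2")
  case True
  then show ?thesis by (auto simp: inner_bd_def)
next
  case False
  then obtain n where n: "length xs = Suc (Suc n)" by (metis Suc_1 less_2_cases_iff not0_implies_Suc One_nat_def)
  have "inner_bd m (inner_bd m F) xs = (\<Sum>i<Suc n. \<Sum>j<n. signed (i + j) (F (contract m j (contract m i xs))))"
    unfolding inner_bd_def signed_sum
    by (intro sum.cong) (auto simp: n length_contract signed_signed)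
  also have "\<dots> = 0"
  proof (rule simplicial_cancellation)
    fix i j assume "i \<le> j" "j < n"
    then show "F (contract m j (contract m i xs)) = F (contract m i (contract m (Suc j) xs))"
      using contract_contract[of i j xs m] contract_contract_same[of i xs m] assms n by (cases "i = j") auto
  qed
  finally show ?thesis .
qed

text \<open>The counterpart of \<^const>\<open>shuffle_sum\<close> being recursive from the front: a shuffle ends with the last
  arrow, which has to pass all transformations, or with the last transformation.\<close>

lemma shuffle_sum_back:
  "shuffle_sum ob ac na F D xs T ys =
    (if xs = [] \<and> ys = [] then F [] else 0) +
    (if xs = [] then 0 else signed (length ys) (shuffle_sum ob ac na
      (\<lambda>c. F (c @ [(ac (start T ys) (fst (last xs)), ob (start T ys) (snd (last xs)))])) D (butlast xs) T ys)) +
    (if ys = [] then 0 else shuffle_sum ob ac na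
      (\<lambda>c. F (c @ [(na (fst (last ys)) (start D xs), ob (snd (last ys)) (start D xs))])) D xs T (butlast ys))"
proof -
  consider "xs = []" "ys = []" | xs' x D' where "xs = xs' @ [(x, D')]" "ys = []"
    | ys' y T' where "xs = []" "ys = ys' @ [(y, T')]"
    | xs' x D' ys' y T' where "xs = xs' @ [(x, D')]" "ys = ys' @ [(y, T')]"
    by (metis rev_exhaust surj_pair)
  then show ?thesis
    by cases (auto simp: shuffle_sum_snoc_left shuffle_sum_snoc_right shuffle_sum_snoc)
qed

abbreviation mor_shuffle_sum ("\<Sigma>sh") where
  "mor_shuffle_sum \<equiv> shuffle_sum FOb FMor (\<lambda>\<eta> B. \<eta> B)"

lemma shuffle_sum_agree:
  assumes "agree_on S r r'" "chain (\<lambda>B. B \<in> S) H D xs"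
  shows "\<Sigma>sh F D xs T r = \<Sigma>sh F D xs T r'"
proof -
  have "\<Sigma>sh F D xs T r = \<Sigma>sh F D xs T r'" if "chain (\<lambda>B. B \<in> S) H D xs" "agree_on S r r'" for F r'
    using that
  proof (induction D xs T r arbitrary: F r' rule: pair_list_induct2)
    case (Cons_Cons D x D1 xs T y T1 ys)
    obtain z r1 where r': "r' = (z, T1) # r1" "\<forall>B\<in>S. y B = z B" "agree_on S ys r1"
      using Cons_Cons.prems(2) by (auto simp: agree_on_def list_all2_Cons1)
    have "D \<in> S" using Cons_Cons.prems by simp
    then have "y D = z D" using r' by blast
    then show ?case using Cons_Cons.IH(1)[of r'] Cons_Cons.IH(2)[of r1] Cons_Cons.prems r' by simp
  next
    case (Nil_Cons D T y T1 ys)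
    obtain z r1 where r': "r' = (z, T1) # r1" "\<forall>B\<in>S. y B = z B" "agree_on S ys r1"
      using Nil_Cons.prems(2) by (auto simp: agree_on_def list_all2_Cons1)
    have "D \<in> S" using Nil_Cons.prems by simp
    then have "y D = z D" using r' by blast
    then show ?case using Nil_Cons.IH[of r1] Nil_Cons.prems r' by simp
  qed (auto simp: agree_on_def)
  then show ?thesis using assms by blast
qed

lemma start_contract: "Suc i < length xs \<Longrightarrow> start D (contract (paste m) i xs) = start D xs"
proof (induction i arbitrary: D xs)
  case 0
  then obtain x B y E ys where "xs = (x, B) # (y, E) # ys" by (cases xs; cases "tl xs") auto
  then show ?case by simp
next
  case (Suc i)
  then obtain x B ys where "xs = (x, B) # ys" by (cases xs) auto
  then show ?case using Suc by simp
qed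

type_synonym ('o, 'u, 'a, 'f, 'g) formal_cochain = "'o \<Rightarrow> 'u list \<Rightarrow> 'a \<Rightarrow> ('f \<times> 'a) list \<Rightarrow> 'g"

context prestack_bimodule
begin

text \<open>The left action, the right action and the restriction of the bimodule on formal sums.\<close>

abbreviation lf where "lf X b \<equiv> extend_linearly (lact M X b)"
abbreviation rf where "rf X c a \<equiv> extend_linearly (\<lambda>x. ract M X x a) c"
abbreviation mf where "mf u \<equiv> extend_linearly (Res M u)"

text \<open>Formal sums carry no type information about the module they come from, so it is recorded by this
  predicate.\<close>

definition valued :: "'o \<Rightarrow> 'a \<Rightarrow> 'a \<Rightarrow> ('m \<Rightarrow>\<^sub>0 int) \<Rightarrow> bool" where "valued X B D c \<longleftrightarrow> Poly_Mapping.keys c \<subseteq> carrier (Bim M X B D)"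

lemma valued_zero [simp]: "valued X B D 0"
  and valued_add: "valued X B D a \<Longrightarrow> valued X B D b \<Longrightarrow> valued X B D (a + b)"
  and valued_uminus: "valued X B D a \<Longrightarrow> valued X B D (- a)"
  using keys_add[of a b] by (auto simp: valued_def)

lemma valued_signed: "valued X B D a \<Longrightarrow> valued X B D (signed n a)"
  by (simp add: signed_def valued_uminus)

lemma valued_sum: "(\<And>i. i \<in> I \<Longrightarrow> valued X B D (f i)) \<Longrightarrow> valued X B D (sum f I)"
  by (induction I rule: infinite_finite_induct) (simp_all add: valued_add)

lemma valued_path_sum:
  "(\<And>r. r \<in> paths (length us) \<Longrightarrow> valued X B D (F (path_chain U A us r))) \<Longrightarrow> valued X B D (path_sum U A us F)"
  unfolding path_sum_def by (intro valued_sum valued_signed) auto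

lemma valued_shuffle_sum:
  assumes "\<And>c. (D', xs, T, ys, c) \<in> shuffles_of act_ob act_mor act_nat \<Longrightarrow> valued X B D (F c)"
  shows "valued X B D (shuffle_sum act_ob act_mor act_nat F D' xs T ys)"
  using assms
proof (induction D' xs T ys arbitrary: F rule: pair_list_induct2)
  case (Nil_Nil D' T)
  show ?case by (simp, rule Nil_Nil.prems, rule shuffles_of.intros)
next
  case (Cons_Nil D' x D1 xs T)
  show ?case by (simp, rule Cons_Nil.IH, rule Cons_Nil.prems, rule shuffles_of.intros)
next
  case (Nil_Cons D' T y T1 ys)
  show ?case by (simp, rule Nil_Cons.IH, rule Nil_Cons.prems, rule shuffles_of.intros)
next
  case (Cons_Cons D' x D1 xs T y T1 ys)
  have "valued X B D (shuffle_sum act_ob act_mor act_nat (\<lambda>c. F ((act_mor T x, act_ob T D1) # c)) D1 xs T ((y, T1) # ys))"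
    by (rule Cons_Cons.IH(1), rule Cons_Cons.prems, rule shuffles_of.intros)
  moreover have "valued X B D (shuffle_sum act_ob act_mor act_nat (\<lambda>c. F ((act_nat y D', act_ob T1 D') # c)) D' ((x, D1) # xs) T1 ys)"
    by (rule Cons_Cons.IH(2), rule Cons_Cons.prems, rule shuffles_of.intros)
  ultimately show ?case by (simp add: valued_add valued_signed del: signed_Suc)
qed

lemma lact_closed:
  "X \<in> Obj U \<Longrightarrow> B \<in> ob X \<Longrightarrow> D \<in> ob X \<Longrightarrow> E \<in> ob X \<Longrightarrow> b \<in> hom X D E \<Longrightarrow>
    x \<in> carrier (Bim M X B D) \<Longrightarrow> lact M X b x \<in> carrier (Bim M X B E)"
  using lact_linear_right[of X B D E b] unfolding linear_maps_def by blast

lemma ract_closed: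
  "X \<in> Obj U \<Longrightarrow> B \<in> ob X \<Longrightarrow> D \<in> ob X \<Longrightarrow> E \<in> ob X \<Longrightarrow> a \<in> hom X B D \<Longrightarrow>
    x \<in> carrier (Bim M X D E) \<Longrightarrow> ract M X x a \<in> carrier (Bim M X B E)"
  using ract_linear_left[of X B D E a] unfolding linear_maps_def by blast

lemma res_closed:
  "u \<in> Arr U \<Longrightarrow> B \<in> ob (Cod U u) \<Longrightarrow> D \<in> ob (Cod U u) \<Longrightarrow> x \<in> carrier (Bim M (Cod U u) B D) \<Longrightarrow>
    Res M u x \<in> carrier (Bim M (Dom U u) (FOb (Pull A u) B) (FOb (Pull A u) D))"
  using res_linear[of u B D] unfolding linear_maps_def by blast

lemma valued_lf:
  "X \<in> Obj U \<Longrightarrow> B \<in> ob X \<Longrightarrow> D \<in> ob X \<Longrightarrow> E \<in> ob X \<Longrightarrow> b \<in> hom X D E \<Longrightarrow> valued X B D c \<Longrightarrow>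
    valued X B E (lf X b c)"
  unfolding valued_def using keys_lin[of "lact M X b" c] lact_closed by blast

lemma valued_rf:
  "X \<in> Obj U \<Longrightarrow> B \<in> ob X \<Longrightarrow> D \<in> ob X \<Longrightarrow> E \<in> ob X \<Longrightarrow> a \<in> hom X B D \<Longrightarrow> valued X D E c \<Longrightarrow>
    valued X B E (rf X c a)"
  unfolding valued_def using keys_lin[of "\<lambda>x. ract M X x a" c] ract_closed by blast

lemma valued_mf:
  "u \<in> Arr U \<Longrightarrow> Dom U u = X \<Longrightarrow> B \<in> ob (Cod U u) \<Longrightarrow> D \<in> ob (Cod U u) \<Longrightarrow> valued (Cod U u) B D c \<Longrightarrow>
    valued X (FOb (Pull A u) B) (FOb (Pull A u) D) (mf u c)"
  unfolding valued_def using keys_lin[of "Res M u" c] res_closed by blast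

lemma lf_cmp:
  "X \<in> Obj U \<Longrightarrow> B \<in> ob X \<Longrightarrow> D \<in> ob X \<Longrightarrow> E \<in> ob X \<Longrightarrow> F \<in> ob X \<Longrightarrow> valued X B D c \<Longrightarrow>
    b \<in> hom X D E \<Longrightarrow> b' \<in> hom X E F \<Longrightarrow> lf X (cmp X b' b) c = lf X b' (lf X b c)"
  unfolding lin_lin valued_def by (rule lin_cong) (blast intro: lact_comp)

lemma rf_cmp:
  "X \<in> Obj U \<Longrightarrow> B \<in> ob X \<Longrightarrow> D \<in> ob X \<Longrightarrow> E \<in> ob X \<Longrightarrow> F \<in> ob X \<Longrightarrow> valued X E F c \<Longrightarrow>
    a \<in> hom X B D \<Longrightarrow> a' \<in> hom X D E \<Longrightarrow> rf X c (cmp X a' a) = rf X (rf X c a') a"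
  unfolding lin_lin valued_def by (rule lin_cong) (blast intro: ract_comp)

lemma rf_lf:
  "X \<in> Obj U \<Longrightarrow> B \<in> ob X \<Longrightarrow> D \<in> ob X \<Longrightarrow> E \<in> ob X \<Longrightarrow> F \<in> ob X \<Longrightarrow> valued X D E c \<Longrightarrow>
    a \<in> hom X B D \<Longrightarrow> b \<in> hom X E F \<Longrightarrow> rf X (lf X b c) a = lf X b (rf X c a)"
  unfolding lin_lin valued_def by (rule lin_cong) (blast intro: lact_ract)

lemma id_hom: "X \<in> Obj U \<Longrightarrow> B \<in> ob X \<Longrightarrow> LId (Cat A X) B \<in> hom X B B"
  using linear_category.id_closed[OF cat] by blast

lemma res_lact:
  assumes "u \<in> Arr U" "B \<in> ob (Cod U u)" "D \<in> ob (Cod U u)" "E \<in> ob (Cod U u)"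
    "x \<in> carrier (Bim M (Cod U u) B D)" "b \<in> hom (Cod U u) D E"
  shows "Res M u (lact M (Cod U u) b x) = lact M (Dom U u) (FMor (Pull A u) b) (Res M u x)"
  using res_act[OF assms(1,2,2,3,4) id_hom assms(5,6)] assms
  by (simp add: cod_closed dom_closed ract_id[of "Dom U u" "FOb (Pull A u) B" "FOb (Pull A u) D"] ract_id[of _ B D] linear_functor_id[OF pull] res_closed linear_functor_ob[OF pull])

lemma res_ract:
  assumes "u \<in> Arr U" "B \<in> ob (Cod U u)" "D \<in> ob (Cod U u)" "E \<in> ob (Cod U u)"
    "x \<in> carrier (Bim M (Cod U u) D E)" "a \<in> hom (Cod U u) B D"
  shows "Res M u (ract M (Cod U u) x a) = ract M (Dom U u) (Res M u x) (FMor (Pull A u) a)"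
proof -
  note ob = linear_functor_ob[OF pull[OF assms(1)]]
  have "ract M (Dom U u) (Res M u x) (FMor (Pull A u) a) \<in>
      carrier (Bim M (Dom U u) (FOb (Pull A u) B) (FOb (Pull A u) E))"
    using linear_functor_mor[OF pull[OF assms(1)] assms(2,3,6)] res_closed[OF assms(1,3,4,5)] assms
    by (intro ract_closed[of _ _ "FOb (Pull A u) D"]) (auto simp: dom_closed ob)
  then show ?thesis
    using res_act[OF assms(1,2,3,4,4,6,5) id_hom] assms ract_closed[OF _ assms(2,3,4,6,5)]
    by (simp add: cod_closed dom_closed linear_functor_id[OF pull] lact_id[of _ B E]
        lact_id[of _ "FOb (Pull A u) B" "FOb (Pull A u) E"] ob)
qed

lemma mf_lf:
  "u \<in> Arr U \<Longrightarrow> Dom U u = X \<Longrightarrow> B \<in> ob (Cod U u) \<Longrightarrow> D \<in> ob (Cod U u) \<Longrightarrow> E \<in> ob (Cod U u) \<Longrightarrow>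
    valued (Cod U u) B D c \<Longrightarrow> b \<in> hom (Cod U u) D E \<Longrightarrow>
    mf u (lf (Cod U u) b c) = lf X (FMor (Pull A u) b) (mf u c)"
  unfolding lin_lin valued_def by (rule lin_cong) (blast intro: res_lact)

lemma mf_rf:
  "u \<in> Arr U \<Longrightarrow> Dom U u = X \<Longrightarrow> B \<in> ob (Cod U u) \<Longrightarrow> D \<in> ob (Cod U u) \<Longrightarrow> E \<in> ob (Cod U u) \<Longrightarrow>
    valued (Cod U u) D E c \<Longrightarrow> a \<in> hom (Cod U u) B D \<Longrightarrow>
    mf u (rf (Cod U u) c a) = rf X (mf u c) (FMor (Pull A u) a)"
  unfolding lin_lin valued_def by (rule lin_cong) (blast intro: res_ract)

lemma mf_twist:
  "u \<in> Arr U \<Longrightarrow> v \<in> Arr U \<Longrightarrow> Dom U u = Cod U v \<Longrightarrow> Dom U v = X \<Longrightarrow>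
    B \<in> ob (Cod U u) \<Longrightarrow> D \<in> ob (Cod U u) \<Longrightarrow> valued (Cod U u) B D c \<Longrightarrow>
    rf X (mf (Cmp U u v) c) (Twist A u v B) = lf X (Twist A u v D) (mf v (mf u c))"
  unfolding lin_lin valued_def by (rule lin_cong) (blast intro: res_twist)

section \<open>The formal differential\<close>

abbreviation arrows where
  "arrows Y \<equiv> chain (\<lambda>B. B \<in> ob Y) (\<lambda>B' B x. x \<in> hom Y B' B)"

abbreviation total_pull where "total_pull X us \<equiv> Pull A (composite U X us)"

abbreviation split_twist where
  "split_twist X us vs \<equiv> Twist A (composite U (target U X us) vs) (composite U X us)"

text \<open>A formal cochain takes a simplex \<open>(X, us)\<close> of the base and a simplex \<open>(D, xs)\<close> of the category over
  its last vertex, listed from the target \<open>D\<close> backwards.\<close>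

definition cochain_values where
  "cochain_values F \<longleftrightarrow> (\<forall>X us D xs. composable U X us \<longrightarrow> arrows (target U X us) D xs \<longrightarrow>
     valued X (FOb (pull_list A us) (start D xs)) (FOb (total_pull X us) D) (F X us D xs))"

lemma cochain_valuesD:
  "cochain_values F \<Longrightarrow> composable U X us \<Longrightarrow> arrows (target U X us) D xs \<Longrightarrow>
     valued X (FOb (pull_list A us) (start D xs)) (FOb (total_pull X us) D) (F X us D xs)"
  unfolding cochain_values_def by blast

lemma arrows_contract:
  "Y \<in> Obj U \<Longrightarrow> Suc i < length xs \<Longrightarrow> arrows Y D xs \<Longrightarrow> arrows Y D (contract (paste (cmp Y)) i xs)"
proof (induction i arbitrary: D xs)
  case 0
  then obtain x B y E ys where "xs = (x, B) # (y, E) # ys" by (cases xs; cases "tl xs") auto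
  then show ?case using 0 cmp_hom[of Y E B D y x] by (auto dest: chain_vertex)
next
  case (Suc i)
  then obtain x B ys where "xs = (x, B) # ys" by (cases xs) auto
  then show ?case using Suc by simp
qed

lemma arrows_start: "arrows Y D xs \<Longrightarrow> start D xs \<in> ob Y"
  by (rule chain_start)

lemma arrows_vertex: "arrows Y D xs \<Longrightarrow> D \<in> ob Y"
  by (rule chain_vertex)

lemma paste_cmp_assoc:
  assumes "Y \<in> Obj U" "arrows Y D xs" "Suc (Suc i) < length xs"
  shows "paste (cmp Y) (paste (cmp Y) (xs ! i) (xs ! Suc i)) (xs ! Suc (Suc i)) =
    paste (cmp Y) (xs ! i) (paste (cmp Y) (xs ! Suc i) (xs ! Suc (Suc i)))"
  using assms
proof (induction i arbitrary: D xs)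
  case 0
  then obtain x B y E z F ys where "xs = (x, B) # (y, E) # (z, F) # ys"
    by (cases xs; cases "tl xs"; cases "tl (tl xs)") auto
  then show ?case using 0 cmp_assoc_hom[of Y F E B D z y x] by (auto dest: chain_vertex)
next
  case (Suc i)
  then obtain x B ys where "xs = (x, B) # ys" by (cases xs) auto
  then show ?case using Suc by auto
qed

lemma natural_split_twist:
  assumes "composable U X (us @ vs)"
  shows "natural (target U X (us @ vs)) X (comp_lfun (total_pull X us) (total_pull (target U X us) vs))
    (total_pull X (us @ vs)) (split_twist X us vs)"
  using assms natural_twist[of "composite U (target U X us) vs" "composite U X us"]
  by (simp add: composable_append composite_closed composite_append)

lemma split_twist_hom:
  assumes "composable U X (us @ vs)" "B \<in> ob (target U X (us @ vs))"
  shows "split_twist X us vs B \<in> hom X (FOb (total_pull X us) (FOb (total_pull (target U X us) vs) B))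
    (FOb (total_pull X (us @ vs)) B)"
  using natural_transD(1)[OF natural_split_twist[OF assms(1)] assms(2)] by simp

lemma split_twist_cocycle:
  assumes c: "composable U X (us @ vs @ ws)" and "B \<in> ob (target U X (us @ vs @ ws))"
  shows "cmp X (split_twist X (us @ vs) ws B) (split_twist X us vs (FOb (total_pull (target U X (us @ vs)) ws) B)) =
    cmp X (split_twist X us (vs @ ws) B) (FMor (total_pull X us) (split_twist (target U X us) vs ws B))"
proof -
  let ?Y = "target U X us" let ?Z = "target U ?Y vs"
  have c': "composable U X us" "composable U ?Y vs" "composable U ?Z ws" "composable U X (us @ vs)"
    "composable U ?Y (vs @ ws)" using c by (auto simp: composable_append)
  show ?thesis
    using twist_cocycle[of "composite U ?Z ws" "composite U ?Y vs" "composite U X us" B] c' assms(2)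
    by (simp add: composite_closed composite_append[OF c'(4)] composite_append[OF c'(5)])
qed

definition hoch_left where
  "hoch_left F X us D xs = (case xs of [] \<Rightarrow> 0 | (x, D') # xs' \<Rightarrow> lf X (FMor (total_pull X us) x) (F X us D' xs'))"

definition hoch_inner where
  "hoch_inner F X us D xs = inner_bd (paste (cmp (target U X us))) (F X us D) xs"

definition hoch_right where
  "hoch_right F X us D xs = (if xs = [] then 0 else
     signed (length xs) (rf X (F X us D (butlast xs)) (FMor (pull_list A us) (fst (last xs)))))"

definition simp_first where
  "simp_first F X us D xs = (case us of [] \<Rightarrow> 0 | u # us' \<Rightarrow>
     signed (length us + length xs) (lf X (split_twist X [u] us' D) (mf u (F (Cod U u) us' D xs))))"

definition simp_inner where
  "simp_inner F X us D xs = signed (length us + length xs)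
     (\<Sum>i<length us - 1. signed (Suc i) (rf X (F X (merge_arrows U i us) D xs) (twist_at A i us (start D xs))))"

text \<open>The contribution to the differential of the cochain evaluated on the initial part of length \<open>p\<close>; the
  rest of the simplex acts through its paths.\<close>

definition path_term where
  "path_term p F X us D xs = lf X (split_twist X (take p us) (drop p us) D)
     (path_sum U A (drop p us) (\<lambda>r. \<Sigma>sh
        (F X (take p us) (FOb (total_pull (target U X (take p us)) (drop p us)) D)) D xs
        (total_pull (target U X (take p us)) (drop p us)) r))"

text \<open>This comprises the last simplicial face, as the case of a remaining part with one arrow: that arrow has
  only the empty path, the shuffle sum is then the pullback of \<open>xs\<close>, and the sign $(-1)^n (-1)^{p+1}$ of the last face in
  total degree $n = p + 1 + q$ equals $(-1)^q$, the sign of the higher components.\<close>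

definition path_part where
  "path_part F X us D xs = signed (length xs) (\<Sum>p<length us. path_term p F X us D xs)"

text \<open>All components of the differential at once, grouped by the way in which they cancel: the
  Hochschild differential in three pieces, the simplicial faces except the last one in two, and the path part.\<close>

definition formal_d where
  "formal_d F X us D xs = hoch_left F X us D xs + hoch_inner F X us D xs + hoch_right F X us D xs
     + simp_first F X us D xs + simp_inner F X us D xs + path_part F X us D xs"

text \<open>The four groups are the cancellations in the square of the Hochschild differential: two entries taken off or
  merged on the left, in the middle, on both ends, and on the right.\<close>

lemma hoch_hoch:
  assumes F: "cochain_values F" and us: "composable U X us" and xs: "arrows (target U X us) D xs"
  shows "hoch_left (hoch_left F) X us D xs + hoch_left (hoch_inner F) X us D xs + hoch_inner (hoch_left F) X us D xs = 0"
    and "hoch_inner (hoch_inner F) X us D xs = 0"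
    and "hoch_left (hoch_right F) X us D xs + hoch_right (hoch_left F) X us D xs = 0"
    and "hoch_right (hoch_right F) X us D xs + hoch_right (hoch_inner F) X us D xs + hoch_inner (hoch_right F) X us D xs = 0"
proof -
  let ?Y = "target U X us" and ?P = "total_pull X us" and ?S = "pull_list A us"
  have X: "X \<in> Obj U" and Y: "?Y \<in> Obj U" using us by (auto intro: composable_source composable_target)
  note P = between_pull_total[OF us] and S = between_pull_list[OF us]
  note Pob = linear_functor_ob[OF P] and Sob = linear_functor_ob[OF S]
  show "hoch_inner (hoch_inner F) X us D xs = 0"
    unfolding hoch_inner_def using inner_bd_inner_bd paste_cmp_assoc[OF Y xs] by blast
  show "hoch_left (hoch_left F) X us D xs + hoch_left (hoch_inner F) X us D xs + hoch_inner (hoch_left F) X us D xs = 0"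
  proof -
    consider "xs = []" | x D1 where "xs = [(x, D1)]" | x D1 y D2 ys where "xs = (x, D1) # (y, D2) # ys"
      by (metis list.exhaust surj_pair)
    then show ?thesis
    proof cases
      case (3 x D1 y D2 ys)
      have ar: "D \<in> ob ?Y" "D1 \<in> ob ?Y" "D2 \<in> ob ?Y" "x \<in> hom ?Y D1 D" "y \<in> hom ?Y D2 D1" "arrows ?Y D2 ys"
        using xs 3 by (auto dest: chain_vertex)
      have "lf X (FMor ?P (cmp ?Y x y)) (F X us D2 ys) = lf X (FMor ?P x) (lf X (FMor ?P y) (F X us D2 ys))"
        unfolding linear_functor_cmp[OF P ar(3,2,1,5,4)]
        by (rule lf_cmp[OF X Sob[OF arrows_start[OF ar(6)]] Pob[OF ar(3)] Pob[OF ar(2)] Pob[OF ar(1)]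
              cochain_valuesD[OF F us ar(6)] linear_functor_mor[OF P ar(3,2,5)] linear_functor_mor[OF P ar(2,1,4)]])
      then show ?thesis
        by (simp add: 3 hoch_left_def hoch_inner_def inner_bd_Cons lin_inner_bd)
    qed (auto simp: hoch_left_def hoch_inner_def)
  qed
  show "hoch_left (hoch_right F) X us D xs + hoch_right (hoch_left F) X us D xs = 0"
  proof (cases "length xs < 2")
    case True
    then show ?thesis by (cases xs; cases "tl xs") (auto simp: hoch_left_def hoch_right_def)
  next
    case False
    then obtain x D1 y D2 ys where xs': "xs = (x, D1) # ys @ [(y, D2)]"
      by (cases xs; cases "tl xs" rule: rev_cases) auto
    have ar: "D \<in> ob ?Y" "D1 \<in> ob ?Y" "x \<in> hom ?Y D1 D" "arrows ?Y D1 ys" "y \<in> hom ?Y D2 (start D1 ys)" "D2 \<in> ob ?Y"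
      using xs xs' by (auto simp: chain_append dest: chain_vertex)
    have "rf X (lf X (FMor ?P x) (F X us D1 ys)) (FMor ?S y) = lf X (FMor ?P x) (rf X (F X us D1 ys) (FMor ?S y))"
      by (rule rf_lf[OF X Sob[OF ar(6)] Sob[OF arrows_start[OF ar(4)]] Pob[OF ar(2)] Pob[OF ar(1)]
            cochain_valuesD[OF F us ar(4)] linear_functor_mor[OF S ar(6) arrows_start[OF ar(4)] ar(5)]
            linear_functor_mor[OF P ar(2,1,3)]])
    then show ?thesis
      by (simp add: xs' hoch_left_def hoch_right_def lin_signed lin_uminus butlast_append signed_Suc)
  qed
  show "hoch_right (hoch_right F) X us D xs + hoch_right (hoch_inner F) X us D xs + hoch_inner (hoch_right F) X us D xs = 0"
  proof -
    consider "xs = []" | x D1 where "xs = [(x, D1)]" | ys x D1 y D2 where "xs = (ys @ [(x, D1)]) @ [(y, D2)]"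
      by (metis append_butlast_last_id list.exhaust surj_pair append_Nil)
    then show ?thesis
    proof cases
      case (3 ys x D1 y D2)
      let ?zs = "ys @ [(x, D1)]"
      have ar: "arrows ?Y D ys" "x \<in> hom ?Y D1 (start D ys)" "y \<in> hom ?Y D2 D1" "D1 \<in> ob ?Y" "D2 \<in> ob ?Y" "D \<in> ob ?Y"
        using xs 3 by (auto simp: chain_append dest: chain_vertex)
      note st = arrows_start[OF ar(1)]
      have "rf X (F X us D ys) (FMor ?S (cmp ?Y x y)) = rf X (rf X (F X us D ys) (FMor ?S x)) (FMor ?S y)"
        unfolding linear_functor_cmp[OF S ar(5,4) st ar(3,2)]
        by (rule rf_cmp[OF X Sob[OF ar(5)] Sob[OF ar(4)] Sob[OF st] Pob[OF ar(6)] cochain_valuesD[OF F us ar(1)]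
              linear_functor_mor[OF S ar(5,4,3)] linear_functor_mor[OF S ar(4) st ar(2)]])
      moreover have "inner_bd (paste (cmp ?Y)) (\<lambda>c. signed (Suc (length c)) (rf X (F X us D c) (FMor ?S y))) ?zs =
          signed (length ?zs) (inner_bd (paste (cmp ?Y)) (\<lambda>c. rf X (F X us D c) (FMor ?S y)) ?zs)"
        by (rule inner_bd_length_signed)
      ultimately show ?thesis
        unfolding 3 hoch_inner_def inner_bd_snoc[OF snoc_eq_iff_butlast[THEN iffD1, OF refl, THEN conjunct1]]
        by (simp add: hoch_right_def hoch_inner_def lin_inner_bd lin_signed lin_uminus butlast_append signed_signed signed_Suc)
          (simp add: signed_def)?
    qed (auto simp: hoch_right_def hoch_inner_def)
  qed
qed

text \<open>The simplicial identities without the last face; they hold up to the cocycle condition and the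
  compatibility of restriction with the structure isomorphisms.\<close>

lemma simp_simp:
  assumes F: "cochain_values F" and us: "composable U X us" and xs: "arrows (target U X us) D xs"
  shows "simp_first (simp_first F) X us D xs + simp_first (simp_inner F) X us D xs + simp_inner (simp_first F) X us D xs = 0"
    and "simp_inner (simp_inner F) X us D xs = 0"
proof -
  let ?st = "start D xs"
  have X: "X \<in> Obj U" using us by (auto intro: composable_source)
  have st: "?st \<in> ob (target U X us)" and D: "D \<in> ob (target U X us)"
    using xs by (auto intro: arrows_start arrows_vertex)
  show "simp_inner (simp_inner F) X us D xs = 0"
  proof (cases "length us < 2")
    case True
    then show ?thesis by (auto simp: simp_inner_def)
  next
    case False
    then obtain n where n: "length us = Suc (Suc n)" by (metis Suc_1 less_2_cases_iff not0_implies_Suc One_nat_def)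
    define f where "f i j = rf X (rf X (F X (merge_arrows U j (merge_arrows U i us)) D xs)
      (twist_at A j (merge_arrows U i us) ?st)) (twist_at A i us ?st)" for i j
    have "simp_inner (simp_inner F) X us D xs =
        signed (length us + length xs) (\<Sum>i<Suc n. signed (Suc i) (signed (Suc n + length xs) (\<Sum>j<n. signed (Suc j) (f i j))))"
      unfolding simp_inner_def f_def
      by (intro arg_cong[where f = "signed _"] sum.cong) (auto simp: n length_contract lin_signed lin_sum)
    also have "\<dots> = signed (Suc n + length us + length xs + length xs) (\<Sum>i<Suc n. \<Sum>j<n. signed (i + j) (f i j))"
      unfolding signed_sum signed_signed by (intro sum.cong) (auto simp: signed_def)
    also have "(\<Sum>i<Suc n. \<Sum>j<n. signed (i + j) (f i j)) = 0"
    proof (rule simplicial_cancellation)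
      fix i j assume ij: "i \<le> j" "j < n"
      have l: "Suc i < length us" "Suc (Suc j) < length us" "Suc j < length us"
        "Suc j < length (merge_arrows U i us)" "Suc i < length (merge_arrows U (Suc j) us)"
        using ij n by (auto simp: length_contract)
      note c1 = composable_merge[OF l(1) us] and c2 = composable_merge[OF l(2) us]
      note c11 = composable_merge[OF l(4) c1] and c22 = composable_merge[OF l(5) c2]
      note t1 = target_merge[OF l(1) us] and t2 = target_merge[OF l(2) us]
      note t11 = target_merge[OF l(4) c1, unfolded t1] and t22 = target_merge[OF l(5) c2, unfolded t2]
      have mm: "merge_arrows U j (merge_arrows U i us) = merge_arrows U i (merge_arrows U (Suc j) us)"
        by (rule merge_merge[OF ij(1) l(2) us])
      have v: "valued X (FOb (pull_list A (merge_arrows U j (merge_arrows U i us))) ?st)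
          (FOb (total_pull X us) D) (F X (merge_arrows U j (merge_arrows U i us)) D xs)"
        using cochain_valuesD[OF F c11, of D xs] xs
        by (simp add: t11 composite_merge[OF l(4) c1] composite_merge[OF l(1) us])
      have o: "FOb (pull_list A us) ?st \<in> ob X" "FOb (pull_list A (merge_arrows U i us)) ?st \<in> ob X"
        "FOb (pull_list A (merge_arrows U (Suc j) us)) ?st \<in> ob X"
        "FOb (pull_list A (merge_arrows U j (merge_arrows U i us))) ?st \<in> ob X" "FOb (total_pull X us) D \<in> ob X"
        using st D us c1 c2 c11 t1 t2 t11 by (auto intro!: pull_list_ob pull_total_ob)
      have h: "twist_at A i us ?st \<in> hom X (FOb (pull_list A us) ?st) (FOb (pull_list A (merge_arrows U i us)) ?st)"
        "twist_at A j (merge_arrows U i us) ?st \<in> hom X (FOb (pull_list A (merge_arrows U i us)) ?st)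
          (FOb (pull_list A (merge_arrows U j (merge_arrows U i us))) ?st)"
        "twist_at A (Suc j) us ?st \<in> hom X (FOb (pull_list A us) ?st) (FOb (pull_list A (merge_arrows U (Suc j) us)) ?st)"
        "twist_at A i (merge_arrows U (Suc j) us) ?st \<in> hom X (FOb (pull_list A (merge_arrows U (Suc j) us)) ?st)
          (FOb (pull_list A (merge_arrows U j (merge_arrows U i us))) ?st)"
        using twist_at_hom[OF l(1) us st] twist_at_hom[OF l(4) c1] twist_at_hom[OF l(2) us st]
          twist_at_hom[OF l(5) c2] st t1 t2 mm by auto
      show "f i j = f (Suc j) i"
        unfolding f_def mm[symmetric]
        unfolding rf_cmp[OF X o(1,2,4,5) v h(1,2), symmetric] rf_cmp[OF X o(1,3,4,5) v h(3,4), symmetric]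
          twist_at_twist_at[OF ij(1) l(2) us st] ..
    qed
    finally show ?thesis by simp
  qed
  show "simp_first (simp_first F) X us D xs + simp_first (simp_inner F) X us D xs + simp_inner (simp_first F) X us D xs = 0"
  proof -
    consider "us = []" | u where "us = [u]" | u v ws where "us = u # v # ws"
      by (metis list.exhaust)
    then show ?thesis
    proof cases
      case (3 u v ws)
      let ?W = "Cod U u" and ?V = "Cod U v"
      have uv: "u \<in> Arr U" "v \<in> Arr U" "Dom U u = X" "Dom U v = ?W" "composable U ?V ws" "composable U ?W (v # ws)"
        "composable U X ([u] @ [v] @ ws)" "composable U X ([Cmp U v u] @ ws)" "composable U X ([u] @ v # ws)"
        "composable U ?W ([v] @ ws)" "Cod U (Cmp U v u) = ?V" "Cmp U v u \<in> Arr U" "Dom U (Cmp U v u) = X" "?W \<in> Obj U"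
        using us 3 by (auto simp: cmp_closed cod_closed)
      have DV: "D \<in> ob (target U ?V ws)" "?st \<in> ob (target U ?V ws)" using D st 3 by auto
      have xsV: "arrows (target U ?V ws) D xs" using xs 3 by simp
      note Fv = cochain_valuesD[OF F uv(5) xsV]
      let ?PD = "FOb (total_pull ?V ws) D" and ?LS = "FOb (pull_list A ws) ?st"
      have oV: "?PD \<in> ob ?V" "?LS \<in> ob ?V" using uv DV by (auto intro: pull_list_ob pull_total_ob)
      have oW: "FOb (Pull A v) ?PD \<in> ob ?W" "FOb (Pull A v) ?LS \<in> ob ?W"
        using oV uv linear_functor_ob[OF pull[of v]] by auto
      have oX: "FOb (Pull A u) (FOb (Pull A v) ?PD) \<in> ob X" "FOb (Pull A u) (FOb (Pull A v) ?LS) \<in> ob X"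
        using oW uv linear_functor_ob[OF pull[of u]] by auto
      have oC: "FOb (Pull A (Cmp U v u)) ?PD \<in> ob X" "FOb (Pull A (Cmp U v u)) ?LS \<in> ob X"
        using oV uv linear_functor_ob[OF pull[of "Cmp U v u"]] by auto
      have oWt: "FOb (total_pull ?W (v # ws)) D \<in> ob ?W" using pull_total_ob[OF uv(6)] DV by simp
      have oXt: "FOb (total_pull X us) D \<in> ob X" using pull_total_ob[OF us] D by simp
      have vv: "valued ?W (FOb (Pull A v) ?LS) (FOb (Pull A v) ?PD) (mf v (F ?V ws D xs))"
        by (rule valued_mf[OF uv(2,4) oV(2,1) Fv])
      have uvv: "valued X (FOb (Pull A u) (FOb (Pull A v) ?LS)) (FOb (Pull A u) (FOb (Pull A v) ?PD)) (mf u (mf v (F ?V ws D xs)))"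
        by (rule valued_mf[OF uv(1,3) oW(2,1) vv])
      have vc: "valued X (FOb (Pull A (Cmp U v u)) ?LS) (FOb (Pull A (Cmp U v u)) ?PD) (mf (Cmp U v u) (F ?V ws D xs))"
        by (rule valued_mf) (use uv oV Fv in auto)
      have s1: "composite U X [u] = u" "composite U ?W [v] = v" "composite U X [Cmp U v u] = Cmp U v u"
        using uv by (auto simp: composite_single simp del: composite.simps)
      have hv: "split_twist ?W [v] ws D \<in> hom ?W (FOb (Pull A v) ?PD) (FOb (total_pull ?W (v # ws)) D)"
        using split_twist_hom[OF uv(10), of D] DV by (simp add: s1 del: composite.simps)
      have hu: "split_twist X [u] (v # ws) D \<in> hom X (FOb (Pull A u) (FOb (total_pull ?W (v # ws)) D)) (FOb (total_pull X us) D)"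
        using split_twist_hom[OF uv(9), of D] DV 3 by (simp add: s1 del: composite.simps)
      have huv: "split_twist X [Cmp U v u] ws D \<in> hom X (FOb (Pull A (Cmp U v u)) ?PD) (FOb (total_pull X us) D)"
        using split_twist_hom[OF uv(8), of D] DV 3 uv composite_merge[of 0 us X] us
        by (simp add: s1 del: composite.simps)
      have tw: "Twist A v u ?PD \<in> hom X (FOb (Pull A u) (FOb (Pull A v) ?PD)) (FOb (Pull A (Cmp U v u)) ?PD)"
        "Twist A v u ?LS \<in> hom X (FOb (Pull A u) (FOb (Pull A v) ?LS)) (FOb (Pull A (Cmp U v u)) ?LS)"
        using natural_transD(1)[OF natural_twist[of v u]] uv oV by auto
      have uW: "FOb (Pull A u) (FOb (total_pull ?W (v # ws)) D) \<in> ob X"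
        using linear_functor_ob[OF pull[of u]] oWt uv by auto
      have hvu: "FMor (Pull A u) (split_twist ?W [v] ws D) \<in> hom X (FOb (Pull A u) (FOb (Pull A v) ?PD)) (FOb (Pull A u) (FOb (total_pull ?W (v # ws)) D))"
        using linear_functor_mor[OF pull[of u] _ _ hv] oW oWt uv by auto
      have coc: "cmp X (split_twist X [Cmp U v u] ws D) (Twist A v u ?PD) =
          cmp X (split_twist X [u] (v # ws) D) (FMor (Pull A u) (split_twist ?W [v] ws D))"
        using split_twist_cocycle[OF uv(7), of D] DV s1 uv(11) cmp_assoc[of "Idn U ?V" v u] cmp_idn_left[of "Cmp U v u"] uv
        by (simp add: composite_single cmp_idn_left)
      have e1: "simp_first (simp_first F) X us D xs = - rf X (lf X (split_twist X [Cmp U v u] ws D) (mf (Cmp U v u) (F ?V ws D xs))) (Twist A v u ?LS)"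
      proof -
        have "simp_first (simp_first F) X us D xs =
            - lf X (split_twist X [u] (v # ws) D) (mf u (lf ?W (split_twist ?W [v] ws D) (mf v (F ?V ws D xs))))"
          by (simp add: simp_first_def 3 lin_signed signed_signed signed_Suc signed_twice del: composite.simps)
             (simp add: signed_def)?
        also have "mf u (lf ?W (split_twist ?W [v] ws D) (mf v (F ?V ws D xs))) =
            lf X (FMor (Pull A u) (split_twist ?W [v] ws D)) (mf u (mf v (F ?V ws D xs)))"
          by (rule mf_lf[OF uv(1,3) oW(2,1) oWt vv hv])
        also have "lf X (split_twist X [u] (v # ws) D) \<dots> =
            lf X (cmp X (split_twist X [Cmp U v u] ws D) (Twist A v u ?PD)) (mf u (mf v (F ?V ws D xs)))"
          unfolding coc by (rule lf_cmp[OF X oX(2,1) uW oXt uvv hvu hu, symmetric])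
        also have "\<dots> = lf X (split_twist X [Cmp U v u] ws D) (lf X (Twist A v u ?PD) (mf u (mf v (F ?V ws D xs))))"
          by (rule lf_cmp[OF X oX(2,1) oC(1) oXt uvv tw(1) huv])
        also have "lf X (Twist A v u ?PD) (mf u (mf v (F ?V ws D xs))) =
            rf X (mf (Cmp U v u) (F ?V ws D xs)) (Twist A v u ?LS)"
          by (rule mf_twist[OF uv(2,1,4,3) oV(2,1) Fv, symmetric])
        also have "lf X (split_twist X [Cmp U v u] ws D) \<dots> =
            rf X (lf X (split_twist X [Cmp U v u] ws D) (mf (Cmp U v u) (F ?V ws D xs))) (Twist A v u ?LS)"
          by (rule rf_lf[OF X oX(2) oC(2,1) oXt vc tw(2) huv, symmetric])
        finally show ?thesis .
      qed
      let ?n = "length us + length xs"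
      define R where "R i = lf X (split_twist X [u] (v # ws) D) (mf u (rf ?W (F ?W (merge_arrows U i (v # ws)) D xs) (twist_at A i (v # ws) ?st)))" for i
      have e2: "simp_first (simp_inner F) X us D xs = - (\<Sum>i<length ws. signed (Suc i) (R i))"
      proof -
        have "simp_first (simp_inner F) X us D xs = signed ?n (signed (?n - 1) (\<Sum>i<length ws. signed (Suc i) (R i)))"
          by (simp add: simp_first_def simp_inner_def 3 R_def lin_signed lin_sum del: composite.simps)
        then show ?thesis by (simp add: signed_signed signed_odd 3)
      qed
      have e3: "simp_inner (simp_first F) X us D xs =
          rf X (lf X (split_twist X [Cmp U v u] ws D) (mf (Cmp U v u) (F ?V ws D xs))) (Twist A v u ?LS)
          + (\<Sum>i<length ws. signed (Suc i) (R i))"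
      proof -
        have R: "rf X (lf X (split_twist X [u] (merge_arrows U i (v # ws)) D) (mf u (F ?W (merge_arrows U i (v # ws)) D xs)))
            (FMor (Pull A u) (twist_at A i (v # ws) ?st)) = R i" if "i < length ws" for i
        proof -
          have l: "Suc i < length (v # ws)" using that by simp
          note c = composable_merge[OF l uv(6)] and t = target_merge[OF l uv(6)] and cc = composite_merge[OF l uv(6)]
          have xt: "arrows (target U ?W (merge_arrows U i (v # ws))) D xs" "D \<in> ob (target U ?W (merge_arrows U i (v # ws)))"
              "?st \<in> ob (target U ?W (merge_arrows U i (v # ws)))"
            using xsV DV t by auto
          note Fm = cochain_valuesD[OF F c xt(1), unfolded cc]
          have o: "FOb (pull_list A (merge_arrows U i (v # ws))) ?st \<in> ob ?W" "FOb (pull_list A (v # ws)) ?st \<in> ob ?W"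
            using pull_list_ob[OF c xt(3)] pull_list_ob[OF uv(6)] DV by auto
          note uo = linear_functor_ob[OF pull[OF uv(1)], unfolded uv(3)]
          have tm: "twist_at A i (v # ws) ?st \<in> hom ?W (FOb (pull_list A (v # ws)) ?st) (FOb (pull_list A (merge_arrows U i (v # ws))) ?st)"
            using twist_at_hom[OF l uv(6)] DV by simp
          have "rf X (lf X (split_twist X [u] (v # ws) D) (mf u (F ?W (merge_arrows U i (v # ws)) D xs)))
              (FMor (Pull A u) (twist_at A i (v # ws) ?st)) =
            lf X (split_twist X [u] (v # ws) D) (rf X (mf u (F ?W (merge_arrows U i (v # ws)) D xs))
              (FMor (Pull A u) (twist_at A i (v # ws) ?st)))"
            by (rule rf_lf[OF X uo[OF o(2)] uo[OF o(1)] uW oXt valued_mf[OF uv(1,3) o(1) oWt Fm]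
                  linear_functor_mor[OF pull[OF uv(1)] o(2,1) tm, unfolded uv(3)] hu])
          also have "rf X (mf u (F ?W (merge_arrows U i (v # ws)) D xs)) (FMor (Pull A u) (twist_at A i (v # ws) ?st)) =
              mf u (rf ?W (F ?W (merge_arrows U i (v # ws)) D xs) (twist_at A i (v # ws) ?st))"
            by (rule mf_rf[OF uv(1,3) o(2,1) oWt Fm tm, symmetric])
          finally show ?thesis using t cc by (simp add: R_def del: composite.simps)
        qed
        have "simp_inner (simp_first F) X us D xs =
          signed ?n (\<Sum>i<Suc (length ws). signed (Suc i) (rf X (simp_first F X (merge_arrows U i us) D xs) (twist_at A i us ?st)))"
          by (simp add: simp_inner_def 3)
        also have "\<dots> = signed ?n (signed (Suc 0) (rf X (simp_first F X (merge_arrows U 0 us) D xs) (twist_at A 0 us ?st)) +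
           (\<Sum>i<length ws. signed (Suc (Suc i)) (rf X (simp_first F X (merge_arrows U (Suc i) us) D xs) (twist_at A (Suc i) us ?st))))"
          by (simp only: sum.lessThan_Suc_shift)
        also have "simp_first F X (merge_arrows U 0 us) D xs = signed (?n - 1)
            (lf X (split_twist X [Cmp U v u] ws D) (mf (Cmp U v u) (F ?V ws D xs)))"
          using uv(11) by (simp add: 3 simp_first_def del: composite.simps)
        also have "(\<Sum>i<length ws. signed (Suc (Suc i)) (rf X (simp_first F X (merge_arrows U (Suc i) us) D xs) (twist_at A (Suc i) us ?st))) =
            signed (?n - 1) (\<Sum>i<length ws. signed (Suc (Suc i)) (R i))"
          unfolding signed_sum
          by (rule sum.cong) (auto simp: 3 simp_first_def length_contract lin_signed R[symmetric] signed_commute simp del: composite.simps)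
        finally show ?thesis
          using 3 uv(11) by (simp add: lin_signed signed_add signed_diff signed_signed signed_even signed_odd signed_Suc sum_negf)
      qed
      show ?thesis unfolding e1 e2 e3 by simp
    qed (auto simp: simp_first_def simp_inner_def)
  qed
qed

lemma twist_at_natural:
  "Suc i < length us \<Longrightarrow> composable U X us \<Longrightarrow> B \<in> ob (target U X us) \<Longrightarrow> B' \<in> ob (target U X us) \<Longrightarrow>
    f \<in> hom (target U X us) B B' \<Longrightarrow>
    cmp X (FMor (pull_list A (merge_arrows U i us)) f) (twist_at A i us B) =
    cmp X (twist_at A i us B') (FMor (pull_list A us) f)"
  by (rule natural_transD(2)[OF natural_twist_at])

text \<open>The first face carries the sign of the total degree, so it anticommutes with the Hochschild differential: the
  isomorphism $c^{\sigma,1}$ is natural and restriction is compatible with both actions.\<close>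

lemma hoch_simp_first:
  assumes F: "cochain_values F" and us: "composable U X us" and xs: "arrows (target U X us) D xs"
  shows "hoch_left (simp_first F) X us D xs + simp_first (hoch_left F) X us D xs = 0"
    and "hoch_inner (simp_first F) X us D xs + simp_first (hoch_inner F) X us D xs = 0"
    and "hoch_right (simp_first F) X us D xs + simp_first (hoch_right F) X us D xs = 0"
proof -
  have X: "X \<in> Obj U" using us by (auto intro: composable_source)
  have "hoch_left (simp_first F) X us D xs + simp_first (hoch_left F) X us D xs = 0 \<and>
    hoch_inner (simp_first F) X us D xs + simp_first (hoch_inner F) X us D xs = 0 \<and>
    hoch_right (simp_first F) X us D xs + simp_first (hoch_right F) X us D xs = 0"
  proof (cases us)
    case Nil
    then show ?thesis by (auto simp: hoch_left_def hoch_inner_def hoch_right_def simp_first_def inner_bd_def split: list.split)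
  next
    case (Cons u ws)
    let ?W = "Cod U u" let ?Y = "target U ?W ws" let ?T = "split_twist X [u] ws"
    have u: "u \<in> Arr U" "Dom U u = X" "composable U ?W ws" "composable U X ([u] @ ws)" using us Cons by auto
    have s1: "composite U X [u] = u" using u by (simp add: composite_single del: composite.simps)
    have xsW: "arrows ?Y D xs" using xs Cons by simp
    note P = between_pull_total[OF us] and PW = between_pull_total[OF u(3)]
    note S = between_pull_list[OF us] and SW = between_pull_list[OF u(3)]
    note uf = pull[OF u(1), unfolded u(2)]
    note uo = linear_functor_ob[OF uf]
    have T: "?T B \<in> hom X (FOb (Pull A u) (FOb (total_pull ?W ws) B)) (FOb (total_pull X us) B)" if "B \<in> ob ?Y" for B
      using split_twist_hom[OF u(4), of B] that Cons s1 by (simp del: composite.simps)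
    have Tn: "cmp X (FMor (total_pull X us) f) (?T B) = cmp X (?T B') (FMor (Pull A u) (FMor (total_pull ?W ws) f))"
      if "B \<in> ob ?Y" "B' \<in> ob ?Y" "f \<in> hom ?Y B B'" for B B' f
      using natural_transD(2)[OF natural_split_twist[OF u(4)], of B B' f] that Cons s1 by (simp del: composite.simps)
    have Po: "FOb (total_pull X us) B \<in> ob X" "FOb (total_pull ?W ws) B \<in> ob ?W" "FOb (pull_list A ws) B \<in> ob ?W"
      "FOb (pull_list A us) B \<in> ob X" if "B \<in> ob ?Y" for B
      using linear_functor_ob[OF P, of B] linear_functor_ob[OF PW, of B] linear_functor_ob[OF S, of B]
        linear_functor_ob[OF SW, of B] that Cons by auto
    have left: "hoch_left (simp_first F) X us D xs + simp_first (hoch_left F) X us D xs = 0"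
    proof (cases xs)
      case Nil
      then show ?thesis by (simp add: hoch_left_def simp_first_def split: list.split)
    next
      case (Cons p ys)
      obtain x D1 where p: "p = (x, D1)" by (cases p)
      have ar: "D \<in> ob ?Y" "D1 \<in> ob ?Y" "x \<in> hom ?Y D1 D" "arrows ?Y D1 ys"
        using xsW Cons p by (auto dest: chain_vertex)
      note Fv = cochain_valuesD[OF F u(3) ar(4)] and st = arrows_start[OF ar(4)]
      note mv = valued_mf[OF u(1,2) Po(3)[OF st] Po(2)[OF ar(2)] Fv]
      note fm = linear_functor_mor[OF PW ar(2,1,3)]
      have "lf X (FMor (total_pull X us) x) (lf X (?T D1) (mf u (F ?W ws D1 ys))) =
          lf X (cmp X (FMor (total_pull X us) x) (?T D1)) (mf u (F ?W ws D1 ys))"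
        by (rule lf_cmp[OF X uo[OF Po(3)[OF st]] uo[OF Po(2)[OF ar(2)]] Po(1)[OF ar(2)] Po(1)[OF ar(1)] mv T[OF ar(2)], symmetric])
          (use linear_functor_mor[OF P, of D1 D x] ar \<open>us = u # ws\<close> in auto)
      also have "\<dots> = lf X (?T D) (lf X (FMor (Pull A u) (FMor (total_pull ?W ws) x)) (mf u (F ?W ws D1 ys)))"
        unfolding Tn[OF ar(2,1,3)]
        by (rule lf_cmp[OF X uo[OF Po(3)[OF st]] uo[OF Po(2)[OF ar(2)]] uo[OF Po(2)[OF ar(1)]] Po(1)[OF ar(1)] mv
              linear_functor_mor[OF uf Po(2)[OF ar(2)] Po(2)[OF ar(1)] fm] T[OF ar(1)]])
      also have "lf X (FMor (Pull A u) (FMor (total_pull ?W ws) x)) (mf u (F ?W ws D1 ys)) =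
          mf u (lf ?W (FMor (total_pull ?W ws) x) (F ?W ws D1 ys))"
        by (rule mf_lf[OF u(1,2) Po(3)[OF st] Po(2)[OF ar(2)] Po(2)[OF ar(1)] Fv fm, symmetric])
      finally show ?thesis
        by (simp add: \<open>us = u # ws\<close> Cons p hoch_left_def simp_first_def lin_signed lin_uminus signed_Suc del: composite.simps)
    qed
    have inner: "hoch_inner (simp_first F) X us D xs + simp_first (hoch_inner F) X us D xs = 0"
    proof -
      let ?G = "\<lambda>c. lf X (?T D) (mf u (F ?W ws D c))"
      have "hoch_inner (simp_first F) X us D xs =
          inner_bd (paste (cmp ?Y)) (\<lambda>c. signed (length ws) (signed (Suc (length c)) (?G c))) xs"
        unfolding hoch_inner_def Cons target.simps
        by (rule inner_bd_cong) (simp add: simp_first_def signed_signed del: composite.simps)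
      also have "\<dots> = signed (length ws + length xs) (inner_bd (paste (cmp ?Y)) ?G xs)"
        by (simp only: inner_bd_signed inner_bd_length_signed) (simp only: signed_signed)
      also have "inner_bd (paste (cmp ?Y)) ?G xs = lf X (?T D) (mf u (hoch_inner F ?W ws D xs))"
        unfolding hoch_inner_def lin_inner_bd ..
      finally show ?thesis
        by (simp add: Cons simp_first_def[of "hoch_inner F"] signed_Suc del: composite.simps)
    qed
    have right: "hoch_right (simp_first F) X us D xs + simp_first (hoch_right F) X us D xs = 0"
    proof (cases xs rule: rev_cases)
      case Nil
      then show ?thesis by (simp add: hoch_right_def simp_first_def split: list.split)
    next
      case (snoc ys p)
      obtain x D1 where p: "p = (x, D1)" by (cases p)
      have ar: "arrows ?Y D ys" "x \<in> hom ?Y D1 (start D ys)" "D1 \<in> ob ?Y"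
        using xsW snoc p by (auto simp: chain_append)
      have D: "D \<in> ob ?Y" and st: "start D ys \<in> ob ?Y" using ar by (auto intro: arrows_vertex arrows_start)
      note Fv = cochain_valuesD[OF F u(3) ar(1)]
      note mv = valued_mf[OF u(1,2) Po(3)[OF st] Po(2)[OF D] Fv]
      note fm = linear_functor_mor[OF SW ar(3) st ar(2)]
      have "rf X (lf X (?T D) (mf u (F ?W ws D ys))) (FMor (Pull A u) (FMor (pull_list A ws) x)) =
          lf X (?T D) (rf X (mf u (F ?W ws D ys)) (FMor (Pull A u) (FMor (pull_list A ws) x)))"
        by (rule rf_lf[OF X uo[OF Po(3)[OF ar(3)]] uo[OF Po(3)[OF st]] uo[OF Po(2)[OF D]] Po(1)[OF D] mv
              linear_functor_mor[OF uf Po(3)[OF ar(3)] Po(3)[OF st] fm] T[OF D]])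
      also have "rf X (mf u (F ?W ws D ys)) (FMor (Pull A u) (FMor (pull_list A ws) x)) =
          mf u (rf ?W (F ?W ws D ys) (FMor (pull_list A ws) x))"
        by (rule mf_rf[OF u(1,2) Po(3)[OF ar(3)] Po(3)[OF st] Po(2)[OF D] Fv fm, symmetric])
      finally show ?thesis
        by (simp add: Cons snoc p hoch_right_def simp_first_def lin_signed lin_uminus signed_signed signed_Suc del: composite.simps)
           (simp add: signed_def)
    qed
    show ?thesis using left inner right by blast
  qed
  then show "hoch_left (simp_first F) X us D xs + simp_first (hoch_left F) X us D xs = 0"
    and "hoch_inner (simp_first F) X us D xs + simp_first (hoch_inner F) X us D xs = 0"
    and "hoch_right (simp_first F) X us D xs + simp_first (hoch_right F) X us D xs = 0" by blast+
qed

text \<open>As for the first face, now by naturality of the isomorphisms $\epsilon^{\sigma,i}$.\<close>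

lemma hoch_simp_inner:
  assumes F: "cochain_values F" and us: "composable U X us" and xs: "arrows (target U X us) D xs"
  shows "hoch_left (simp_inner F) X us D xs + simp_inner (hoch_left F) X us D xs = 0"
    and "hoch_inner (simp_inner F) X us D xs + simp_inner (hoch_inner F) X us D xs = 0"
    and "hoch_right (simp_inner F) X us D xs + simp_inner (hoch_right F) X us D xs = 0"
proof -
  let ?Y = "target U X us" and ?m = "\<lambda>i. merge_arrows U i us"
  have X: "X \<in> Obj U" and Y: "?Y \<in> Obj U" using us by (auto intro: composable_source composable_target)
  note P = between_pull_total[OF us] and S = between_pull_list[OF us]
  note Po = linear_functor_ob[OF P] and So = linear_functor_ob[OF S]
  have m: "composable U X (?m i)" "target U X (?m i) = ?Y" "composite U X (?m i) = composite U X us"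
    if "i < length us - 1" for i
    using that us by (auto intro: composable_merge simp: target_merge composite_merge)
  have mS: "between ?Y X (pull_list A (?m i))" if "i < length us - 1" for i
    using between_pull_list[OF m(1)[OF that]] m(2)[OF that] by simp
  have tw: "twist_at A i us B \<in> hom X (FOb (pull_list A us) B) (FOb (pull_list A (?m i)) B)"
    if "i < length us - 1" "B \<in> ob ?Y" for i B using twist_at_hom[of i us X B] that us by auto
  have Fv: "valued X (FOb (pull_list A (?m i)) (start D xs)) (FOb (total_pull X us) D) (F X (?m i) D xs)"
    if "i < length us - 1" "arrows ?Y D xs" for i D xs
    using cochain_valuesD[OF F m(1)[OF that(1)], of D xs] m[OF that(1)] that(2) by simp
  show "hoch_left (simp_inner F) X us D xs + simp_inner (hoch_left F) X us D xs = 0"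
  proof (cases xs)
    case Nil
    then show ?thesis by (simp add: hoch_left_def simp_inner_def)
  next
    case (Cons p ys)
    obtain x D1 where p: "p = (x, D1)" by (cases p)
    have ar: "D \<in> ob ?Y" "D1 \<in> ob ?Y" "x \<in> hom ?Y D1 D" "arrows ?Y D1 ys"
      using xs Cons p by (auto dest: chain_vertex)
    note st = arrows_start[OF ar(4)]
    have "rf X (lf X (FMor (total_pull X us) x) (F X (?m i) D1 ys)) (twist_at A i us (start D1 ys)) =
        lf X (FMor (total_pull X us) x) (rf X (F X (?m i) D1 ys) (twist_at A i us (start D1 ys)))"
      if i: "i < length us - 1" for i
      by (rule rf_lf[OF X So[OF st] linear_functor_ob[OF mS[OF i] st] Po[OF ar(2)] Po[OF ar(1)] Fv[OF i ar(4)]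
            tw[OF i st] linear_functor_mor[OF P ar(2,1,3)]])
    then show ?thesis
      by (simp add: hoch_left_def simp_inner_def Cons p lin_signed lin_sum m signed_Suc)
  qed
  show "hoch_inner (simp_inner F) X us D xs + simp_inner (hoch_inner F) X us D xs = 0"
  proof -
    let ?G = "\<lambda>c. \<Sum>i<length us - 1. signed (Suc i) (rf X (F X (?m i) D c) (twist_at A i us (start D xs)))"
    have "hoch_inner (simp_inner F) X us D xs =
        inner_bd (paste (cmp ?Y)) (\<lambda>c. signed (length us + 1) (signed (Suc (length c)) (?G c))) xs"
      unfolding hoch_inner_def inner_bd_def
      by (rule sum.cong) (auto simp: simp_inner_def start_contract signed_signed)
    also have "\<dots> = signed (length us + 1) (signed (length xs) (inner_bd (paste (cmp ?Y)) ?G xs))"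
      by (simp only: inner_bd_signed inner_bd_length_signed)
    also have "inner_bd (paste (cmp ?Y)) ?G xs = (\<Sum>i<length us - 1. signed (Suc i)
        (rf X (hoch_inner F X (?m i) D xs) (twist_at A i us (start D xs))))"
    proof -
      have "inner_bd (paste (cmp ?Y)) ?G xs = (\<Sum>i<length us - 1. inner_bd (paste (cmp ?Y))
          (\<lambda>c. signed (Suc i) (rf X (F X (?m i) D c) (twist_at A i us (start D xs)))) xs)"
        unfolding inner_bd_def signed_sum by (rule sum.swap)
      also have "\<dots> = (\<Sum>i<length us - 1. signed (Suc i)
        (rf X (hoch_inner F X (?m i) D xs) (twist_at A i us (start D xs))))"
        by (rule sum.cong) (auto simp: inner_bd_signed hoch_inner_def lin_inner_bd m)
      finally show ?thesis .
    qed
    finally show ?thesis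
      by (simp add: simp_inner_def[of "hoch_inner F"] signed_signed signed_Suc)
  qed
  show "hoch_right (simp_inner F) X us D xs + simp_inner (hoch_right F) X us D xs = 0"
  proof (cases xs rule: rev_cases)
    case Nil
    then show ?thesis by (simp add: hoch_right_def simp_inner_def)
  next
    case (snoc ys p)
    obtain x D1 where p: "p = (x, D1)" by (cases p)
    have ar: "arrows ?Y D ys" "x \<in> hom ?Y D1 (start D ys)" "D1 \<in> ob ?Y"
      using xs snoc p by (auto simp: chain_append)
    have D: "D \<in> ob ?Y" and st: "start D ys \<in> ob ?Y" using ar by (auto intro: arrows_vertex arrows_start)
    have "rf X (rf X (F X (?m i) D ys) (twist_at A i us (start D ys))) (FMor (pull_list A us) x) =
        rf X (rf X (F X (?m i) D ys) (FMor (pull_list A (?m i)) x)) (twist_at A i us D1)"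
      if i: "i < length us - 1" for i
    proof -
      note mo = linear_functor_ob[OF mS[OF i]]
      have "rf X (rf X (F X (?m i) D ys) (twist_at A i us (start D ys))) (FMor (pull_list A us) x) =
          rf X (F X (?m i) D ys) (cmp X (twist_at A i us (start D ys)) (FMor (pull_list A us) x))"
        by (rule rf_cmp[OF X So[OF ar(3)] So[OF st] mo[OF st] Po[OF D] Fv[OF i ar(1)]
              linear_functor_mor[OF S ar(3) st ar(2)] tw[OF i st], symmetric])
      also have "cmp X (twist_at A i us (start D ys)) (FMor (pull_list A us) x) =
          cmp X (FMor (pull_list A (?m i)) x) (twist_at A i us D1)"
        using twist_at_natural[of i us X D1 "start D ys" x] i us ar st by simp
      also have "rf X (F X (?m i) D ys) \<dots> =
          rf X (rf X (F X (?m i) D ys) (FMor (pull_list A (?m i)) x)) (twist_at A i us D1)"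
        by (rule rf_cmp[OF X So[OF ar(3)] mo[OF ar(3)] mo[OF st] Po[OF D] Fv[OF i ar(1)]
              tw[OF i ar(3)] linear_functor_mor[OF mS[OF i] ar(3) st ar(2)]])
      finally show ?thesis .
    qed
    then have eq: "(\<Sum>i<length us - 1. signed (Suc i) (rf X (rf X (F X (?m i) D ys) (twist_at A i us (start D ys))) (FMor (pull_list A us) x)))
       = (\<Sum>i<length us - 1. signed (Suc i) (rf X (rf X (F X (?m i) D ys) (FMor (pull_list A (?m i)) x)) (twist_at A i us D1)))"
      (is "?L = ?R")
      by (intro sum.cong) auto
    have l: "hoch_right (simp_inner F) X us D xs = signed (length xs) (signed (length us + length ys) ?L)"
      unfolding hoch_right_def simp_inner_def by (simp only: snoc p) (simp add: lin_signed lin_sum)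
    have "simp_inner (hoch_right F) X us D xs =
        signed (length us + length xs) (\<Sum>i<length us - 1. signed (length xs) (signed (Suc i)
          (rf X (rf X (F X (?m i) D ys) (FMor (pull_list A (?m i)) x)) (twist_at A i us D1))))"
      unfolding hoch_right_def simp_inner_def
      by (simp only: snoc p) (simp add: lin_signed signed_commute)
    also have "\<dots> = signed (length us + length xs) (signed (length xs) ?R)"
      by (simp only: signed_sum)
    finally have r: "simp_inner (hoch_right F) X us D xs = signed (length us + length xs) (signed (length xs) ?R)" .
    show ?thesis
      unfolding l r eq signed_signed by (intro signed_opposite) (auto simp: snoc)
  qed
qed

end

section \<open>Cancellations involving the path part\<close>

lemma shuffle_sum_path_sum:
  "shuffle_sum act_ob act_mor act_nat (\<lambda>c. path_sum U A us (F c)) D xs T ys =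
    path_sum U A us (\<lambda>r. shuffle_sum act_ob act_mor act_nat (\<lambda>c. F c r) D xs T ys)"
  by (simp only: path_sum_def shuffle_sum_sum shuffle_sum_signed)

lemma shuffle_sum_length_signed:
  "shuffle_sum act_ob act_mor act_nat (\<lambda>c. signed (length c) (F c)) D xs T ys =
    signed (length xs + length ys) (shuffle_sum act_ob act_mor act_nat F D xs T ys)"
proof -
  have "shuffle_sum act_ob act_mor act_nat (\<lambda>c. signed (length c) (F c)) D xs T ys =
    shuffle_sum act_ob act_mor act_nat (\<lambda>c. signed (length xs + length ys) (F c)) D xs T ys"
    by (rule shuffle_sum_cong) (simp add: shuffles_of_length)
  then show ?thesis by (simp only: shuffle_sum_signed)
qed

context prestack_bimodule
begin

lemma split_composable:
  assumes "composable U X us"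
  shows "composable U X (take p us)" "composable U (target U X (take p us)) (drop p us)"
    "target U (target U X (take p us)) (drop p us) = target U X us"
    "composable U X (take p us @ drop p us)"
  using assms composable_append[of X "take p us" "drop p us"] target_append[of X "take p us" "drop p us"]
  by (simp_all del: target_append)

lemma shuffles_arrows:
  assumes c: "(D, xs, T, r, c) \<in> shuffles_of FOb FMor (\<lambda>\<eta> B. \<eta> B)"
    and xs: "arrows Y D xs" and r: "chain (between Y V) (natural Y V) T r"
  shows "arrows V (FOb T D) c"
  by (rule shuffles_of_chain[OF c xs r])
     (auto intro: linear_functor_ob linear_functor_mor natural_transD(1))

lemma path_arrows:
  assumes "composable U V ws" "r \<in> paths (length ws)"
  shows "chain (between (target U V ws) V) (natural (target U V ws) V) (total_pull V ws) (path_chain U A ws r)"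
    and "start (total_pull V ws) (path_chain U A ws r) = pull_list A ws"
  using path_chain_chain[OF assms(2,1)] by auto

lemma valued_shuffles_along_path:
  assumes F: "\<And>c. arrows V (FOb (total_pull V ws) D) c \<Longrightarrow> start (FOb (total_pull V ws) D) c = FOb (pull_list A ws) (start D xs) \<Longrightarrow>
      valued X B E (F c)"
    and ws: "composable U V ws" and xs: "arrows (target U V ws) D xs"
    and r: "r \<in> paths (length ws)"
  shows "valued X B E (\<Sigma>sh F D xs (total_pull V ws) (path_chain U A ws r))"
proof (rule valued_shuffle_sum)
  fix c assume c: "(D, xs, total_pull V ws, path_chain U A ws r, c) \<in> shuffles_of FOb FMor (\<lambda>\<eta> B. \<eta> B)"
  show "valued X B E (F c)"
    by (rule F) (use shuffles_arrows[OF c xs path_arrows(1)[OF ws r]] shuffles_of_start[OF c] path_arrows(2)[OF ws r] in auto)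
qed

lemma valued_path_inner:
  assumes F: "cochain_values F" and us: "composable U X us" and xs: "arrows (target U X us) D xs"
  shows "valued X (FOb (pull_list A us) (start D xs))
      (FOb (total_pull X (take p us)) (FOb (total_pull (target U X (take p us)) (drop p us)) D))
    (path_sum U A (drop p us) (\<lambda>r. \<Sigma>sh
        (F X (take p us) (FOb (total_pull (target U X (take p us)) (drop p us)) D)) D xs
        (total_pull (target U X (take p us)) (drop p us)) r))"
proof (rule valued_path_sum, rule valued_shuffles_along_path)
  note c = split_composable[OF us, of p]
  fix c assume "arrows (target U X (take p us)) (FOb (total_pull (target U X (take p us)) (drop p us)) D) c"
    and "start (FOb (total_pull (target U X (take p us)) (drop p us)) D) c = FOb (pull_list A (drop p us)) (start D xs)"
  then show "valued X (FOb (pull_list A us) (start D xs))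
      (FOb (total_pull X (take p us)) (FOb (total_pull (target U X (take p us)) (drop p us)) D))
      (F X (take p us) (FOb (total_pull (target U X (take p us)) (drop p us)) D) c)"
    using cochain_valuesD[OF F c(1)] pull_list_append[of A "take p us" "drop p us"] by fastforce
qed (use split_composable[OF us, of p] xs in auto)

lemma split_objects:
  assumes us: "composable U X us" and D: "D \<in> ob (target U X us)"
  shows "FOb (total_pull (target U X (take p us)) (drop p us)) D \<in> ob (target U X (take p us))"
    and "FOb (total_pull X (take p us)) (FOb (total_pull (target U X (take p us)) (drop p us)) D) \<in> ob X"
    and "split_twist X (take p us) (drop p us) D \<in> hom X
      (FOb (total_pull X (take p us)) (FOb (total_pull (target U X (take p us)) (drop p us)) D)) (FOb (total_pull X us) D)"
proof -
  note c = split_composable[OF us, of p]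
  show o: "FOb (total_pull (target U X (take p us)) (drop p us)) D \<in> ob (target U X (take p us))"
    using pull_total_ob[OF c(2)] D c(3) by simp
  show "FOb (total_pull X (take p us)) (FOb (total_pull (target U X (take p us)) (drop p us)) D) \<in> ob X"
    by (rule pull_total_ob[OF c(1) o])
  show "split_twist X (take p us) (drop p us) D \<in> hom X
      (FOb (total_pull X (take p us)) (FOb (total_pull (target U X (take p us)) (drop p us)) D)) (FOb (total_pull X us) D)"
    using split_twist_hom[OF c(4), of D] D by simp
qed

text \<open>The terms in which a shuffle begins with the last step of the path, and the Hochschild differential takes
  that step off and lets it act on the left.\<close>

definition front_term where
  "front_term p F X us D xs = (let L = take p us; R = drop p us; V = target U X L in
     signed (length xs) (lf X (split_twist X L R D) (path_sum U A R (\<lambda>r. case r of [] \<Rightarrow> 0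
       | (y, T') # r' \<Rightarrow> lf X (FMor (total_pull X L) (y D)) (\<Sigma>sh (F X L (FOb T' D)) D xs T' r')))))"

text \<open>The first entry of a shuffle is an arrow or a step of the path. In the first case the arrow can be moved
  through the structure isomorphism, by naturality, which gives the left term of the Hochschild differential.\<close>

lemma path_term_hoch_left:
  assumes F: "cochain_values F" and us: "composable U X us" and xs: "arrows (target U X us) D xs"
  shows "path_term p (hoch_left F) X us D xs = hoch_left (path_term p F) X us D xs + front_term p F X us D xs"
proof -
  let ?L = "take p us" and ?R = "drop p us" let ?V = "target U X ?L" let ?T = "total_pull ?V ?R"
  let ?c = "split_twist X ?L ?R" and ?P = "total_pull X ?L"
  let ?X = "case xs of [] \<Rightarrow> 0 | (x, D') # xs' \<Rightarrow> lf X (FMor ?P (FMor ?T x))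
      (path_sum U A ?R (\<lambda>r. \<Sigma>sh (F X ?L (FOb ?T D')) D' xs' ?T r))"
  let ?Y = "path_sum U A ?R (\<lambda>r. case r of [] \<Rightarrow> 0
       | (y, T') # r' \<Rightarrow> lf X (FMor ?P (y D)) (\<Sigma>sh (F X ?L (FOb T' D)) D xs T' r'))"
  note c = split_composable[OF us, of p]
  have X: "X \<in> Obj U" using us by (rule composable_source)
  have "path_sum U A ?R (\<lambda>r. \<Sigma>sh (hoch_left F X ?L (FOb ?T D)) D xs ?T r) =
      path_sum U A ?R (\<lambda>r. (case xs of [] \<Rightarrow> 0 | (x, D') # xs' \<Rightarrow> lf X (FMor ?P (FMor ?T x)) (\<Sigma>sh (F X ?L (FOb ?T D')) D' xs' ?T r))
       + signed (length xs) (case r of [] \<Rightarrow> 0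
       | (y, T') # r' \<Rightarrow> lf X (FMor ?P (y D)) (\<Sigma>sh (F X ?L (FOb T' D)) D xs T' r')))"
    by (rule path_sum_cong, subst shuffle_sum_front) (auto simp: hoch_left_def lin_shuffle_sum split: list.split)
  also have "\<dots> = ?X + signed (length xs) ?Y"
    by (simp only: path_sum_add path_sum_signed) (auto simp: lin_path_sum split: list.split)
  finally have e: "path_term p (hoch_left F) X us D xs = lf X (?c D) ?X + front_term p F X us D xs"
    by (simp add: path_term_def lin_add lin_signed front_term_def Let_def)
  have "lf X (?c D) ?X = hoch_left (path_term p F) X us D xs"
  proof (cases xs)
    case Nil
    then show ?thesis by (simp add: hoch_left_def)
  next
    case (Cons q ys)
    obtain x D1 where q: "q = (x, D1)" by (cases q)
    have ar: "D \<in> ob (target U X us)" "D1 \<in> ob (target U X us)" "x \<in> hom (target U X us) D1 D" "arrows (target U X us) D1 ys"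
      using xs Cons q by (auto dest: chain_vertex)
    note st = arrows_start[OF ar(4)]
    note so = split_objects[OF us ar(1), of p] and so1 = split_objects[OF us ar(2), of p]
    have T: "between (target U X us) ?V ?T" using between_pull_total[OF c(2)] c(3) by simp
    have h: "FMor ?P (FMor ?T x) \<in> hom X (FOb ?P (FOb ?T D1)) (FOb ?P (FOb ?T D))"
      using linear_functor_mor[OF between_pull_total[OF c(1)] so1(1) so(1) linear_functor_mor[OF T ar(2,1,3)]] .
    note v = valued_path_inner[OF F us ar(4), of p]
    have "lf X (?c D) (lf X (FMor ?P (FMor ?T x)) (path_sum U A ?R (\<lambda>r. \<Sigma>sh (F X ?L (FOb ?T D1)) D1 ys ?T r))) =
        lf X (cmp X (?c D) (FMor ?P (FMor ?T x))) (path_sum U A ?R (\<lambda>r. \<Sigma>sh (F X ?L (FOb ?T D1)) D1 ys ?T r))"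
      by (rule lf_cmp[OF X pull_list_ob[OF us st] so1(2) so(2) pull_total_ob[OF us ar(1)] v h so(3), symmetric])
    also have "cmp X (?c D) (FMor ?P (FMor ?T x)) = cmp X (FMor (total_pull X us) x) (?c D1)"
      using natural_transD(2)[OF natural_split_twist[OF c(4)], of D1 D x] ar by simp
    also have "lf X \<dots> (path_sum U A ?R (\<lambda>r. \<Sigma>sh (F X ?L (FOb ?T D1)) D1 ys ?T r)) =
        lf X (FMor (total_pull X us) x) (path_term p F X us D1 ys)"
      unfolding path_term_def
      by (rule lf_cmp[OF X pull_list_ob[OF us st] so1(2) pull_total_ob[OF us ar(2)] pull_total_ob[OF us ar(1)] v so1(3)
            linear_functor_mor[OF between_pull_total[OF us] ar(2,1,3)]])
    finally show ?thesis by (simp add: Cons q hoch_left_def)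
  qed
  then show ?thesis using e by simp
qed

lemma path_part_hoch_left:
  assumes "cochain_values F" "composable U X us" "arrows (target U X us) D xs"
  shows "path_part (hoch_left F) X us D xs + hoch_left (path_part F) X us D xs =
    signed (length xs) (\<Sum>p<length us. front_term p F X us D xs)"
proof -
  have "hoch_left (path_part F) X us D xs = - signed (length xs) (\<Sum>p<length us. hoch_left (path_term p F) X us D xs)"
    by (cases xs) (auto simp: hoch_left_def path_part_def lin_signed lin_sum signed_Suc)
  then show ?thesis
    by (simp add: path_part_def path_term_hoch_left[OF assms] sum.distrib signed_add)
qed

text \<open>The terms of the square of the path part: \<open>us\<close> is cut at \<open>p < j\<close>, and the shuffles of the arrows with a path
  of the last part are shuffled with a path of the middle part.\<close>

definition double_term where
  "double_term p j F X us D xs = (let L = take p us; N = drop p (take j us); R = drop j us; V = target U X L;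
     W = target U X (take j us) in
     lf X (split_twist X (take j us) R D) (lf X (split_twist X L N (FOb (total_pull W R) D))
       (path_sum U A R (\<lambda>s. path_sum U A N (\<lambda>r. \<Sigma>sh (\<lambda>c. \<Sigma>sh
          (F X L (FOb (total_pull V N) (FOb (total_pull W R) D))) (FOb (total_pull W R) D) c (total_pull V N) r)
          D xs (total_pull W R) s)))))"

text \<open>The inner path part sees a simplex as long as the shuffle, that is, with the arrows of \<open>xs\<close> and the
  steps of the outer path, which accounts for the sign.\<close>

lemma path_part_path_part:
  assumes F: "cochain_values F" and us: "composable U X us" and xs: "arrows (target U X us) D xs"
  shows "path_part (path_part F) X us D xs =
    signed (length xs) (\<Sum>j<length us. \<Sum>p<j. signed (length xs + (length us - j - 1)) (double_term p j F X us D xs))"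
proof -
  have "path_term j (path_part F) X us D xs =
      (\<Sum>p<j. signed (length xs + (length us - j - 1)) (double_term p j F X us D xs))" if j: "j < length us" for j
  proof -
    let ?R = "drop j us" let ?W = "target U X (take j us)" let ?S = "total_pull ?W ?R" let ?E = "FOb ?S D"
    let ?G = "\<lambda>c. \<Sum>p<j. path_term p F X (take j us) ?E c"
    have "path_sum U A ?R (\<lambda>s. \<Sigma>sh (path_part F X (take j us) ?E) D xs ?S s) =
        path_sum U A ?R (\<lambda>s. \<Sigma>sh (\<lambda>c. signed (length c) (?G c)) D xs ?S s)"
      using j by (simp add: path_part_def[abs_def])
    also have "\<dots> = signed (length us - j - 1) (signed (length xs) (path_sum U A ?R (\<lambda>s. \<Sigma>sh ?G D xs ?S s)))"
    proof -
      have "path_sum U A ?R (\<lambda>s. \<Sigma>sh (\<lambda>c. signed (length c) (?G c)) D xs ?S s) =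
          path_sum U A ?R (\<lambda>s. signed (length s) (signed (length xs) (\<Sigma>sh ?G D xs ?S s)))"
        by (simp only: shuffle_sum_length_signed signed_signed add.commute)
      then show ?thesis
        by (simp only: path_sum_length_signed path_sum_signed length_drop)
    qed
    finally show ?thesis
      using j unfolding path_term_def[of j]
      by (simp add: lin_signed signed_signed shuffle_sum_sum path_sum_sum lin_sum signed_sum double_term_def Let_def
          path_term_def[abs_def] lin_path_sum lin_shuffle_sum shuffle_sum_path_sum min_absorb1 add.commute)
  qed
  then show ?thesis
    by (simp add: path_part_def[of "path_part F"])
qed

text \<open>By \<open>path_sum_split\<close>, the last step of a path is $c$ for a cut at some \<open>j\<close>, and the remaining steps
  are a shuffle of paths of the two parts. Associativity of shuffles turns the shuffles of arrows with these into
  iterated shuffles, and the cocycle condition identifies the two structure isomorphisms in front.\<close>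

lemma front_term_double_term:
  assumes F: "cochain_values F" and us: "composable U X us" and xs: "arrows (target U X us) D xs" and p: "p < length us"
  shows "front_term p F X us D xs =
    (\<Sum>j\<in>{Suc p..<length us}. signed (length xs) (signed (length us - j) (double_term p j F X us D xs)))"
proof -
  let ?L = "take p us" and ?R = "drop p us" let ?V = "target U X ?L"
  let ?P = "total_pull X ?L"
  let ?F = "\<lambda>r. case r of [] \<Rightarrow> 0
       | (y, T') # r' \<Rightarrow> lf X (FMor ?P (y D)) (\<Sigma>sh (F X ?L (FOb T' D)) D xs T' r')"
  have X: "X \<in> Obj U" using us by (rule composable_source)
  have D: "D \<in> ob (target U X us)" and st: "start D xs \<in> ob (target U X us)"
    using xs by (auto intro: arrows_vertex arrows_start)
  note c = split_composable[OF us, of p]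
  show ?thesis
  proof (cases "length ?R < 2")
    case True
    then have "length ?R = 1" using p by simp
    then obtain u where "?R = [u]" by (cases ?R) auto
    moreover have "{Suc p..<length us} = {}" using True by auto
    ultimately show ?thesis by (simp add: front_term_def)
  next
    case False
    then obtain m where m: "length ?R = Suc (Suc m)" by (metis Suc_1 less_2_cases_iff not0_implies_Suc One_nat_def)
    have step: "lf X (split_twist X ?L ?R D) (split_sum ?V (take i ?R) (drop i ?R)
        (\<lambda>d. ?F (split_head ?V (take i ?R) (drop i ?R) # d))) = double_term p (i + p) F X us D xs" for i
    proof -
      let ?j = "i + p"
      let ?N = "drop p (take ?j us)" and ?Q = "drop ?j us" and ?W = "target U X (take ?j us)"
      have tk: "take i ?R = ?N" "drop i ?R = ?Q" by (auto simp: drop_take add.commute)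
      have e0: "take ?j us = ?L @ ?N"
        using append_take_drop_id[of p "take ?j us"] by (simp add: min_def)
      have e1: "us = ?L @ ?N @ ?Q" using append_take_drop_id[of ?j us] e0 by (metis append.assoc)
      have e2: "?R = ?N @ ?Q" using e1 append_take_drop_id[of p us] by (metis same_append_eq)
      have W: "target U ?V ?N = ?W" using target_append[of X ?L ?N] e0 by metis
      let ?S = "total_pull ?W ?Q" and ?T = "total_pull ?V ?N"
      let ?E = "FOb ?S D"
      have cj: "composable U X (?L @ ?N @ ?Q)" using us by (subst (asm) e1)
      have cs: "composable U ?V (?N @ ?Q)" "composable U ?V ?N" "composable U ?W ?Q" "composable U X (?L @ ?N)"
        using cj W by (simp_all add: composable_append)
      have tQ: "target U ?W ?Q = target U X us" using split_composable(3)[OF us] .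
      define z where "z = path_sum U A ?Q (\<lambda>s. path_sum U A ?N (\<lambda>r. \<Sigma>sh (\<lambda>c. \<Sigma>sh
          (F X ?L (FOb ?T ?E)) ?E c ?T r) D xs ?S s))"
      have ED: "?E \<in> ob ?W" using split_objects(1)[OF us D] .
      have oT: "FOb ?T ?E \<in> ob ?V" using pull_total_ob[OF cs(2)] ED W by simp
      have oP: "FOb ?P (FOb ?T ?E) \<in> ob X" using pull_total_ob[OF c(1) oT] .
      have vz: "valued X (FOb (pull_list A us) (start D xs)) (FOb ?P (FOb ?T ?E)) z"
        unfolding z_def
      proof (rule valued_path_sum, rule valued_path_sum, rule valued_shuffles_along_path)
        fix r c assume r: "r \<in> paths (length ?N)" and cc: "arrows ?W ?E c"
          and sc: "start ?E c = FOb (pull_list A ?Q) (start D xs)"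
        show "valued X (FOb (pull_list A us) (start D xs)) (FOb ?P (FOb ?T ?E))
            (\<Sigma>sh (F X ?L (FOb ?T ?E)) ?E c ?T (path_chain U A ?N r))"
        proof (rule valued_shuffles_along_path)
          fix c' assume c': "arrows ?V (FOb ?T ?E) c'" "start (FOb ?T ?E) c' = FOb (pull_list A ?N) (start ?E c)"
          have "FOb (pull_list A us) (start D xs) = FOb (pull_list A ?L) (FOb (pull_list A ?N) (FOb (pull_list A ?Q) (start D xs)))"
            by (subst e1) (simp add: pull_list_append)
          then show "valued X (FOb (pull_list A us) (start D xs)) (FOb ?P (FOb ?T ?E)) (F X ?L (FOb ?T ?E) c')"
            using cochain_valuesD[OF F c(1) c'(1)] c'(2) sc by simp
        qed (use cs cc W r in auto)
      qed (use cs xs tQ in auto)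
      have "split_sum ?V ?N ?Q (\<lambda>d. ?F (split_head ?V ?N ?Q # d)) = lf X (FMor ?P (split_twist ?V ?N ?Q D)) z"
        unfolding z_def split_path_sum_def W
        apply (subst shuffle_sum_assoc[where ?ob4.0 = FOb and ?ac4.0 = FMor and ?na4.0 = "\<lambda>\<eta> B. \<eta> B" and oc = comp_lfun
            and acc = whisker_act and nac = whisker_nat])
        by (auto simp: lin_path_sum lin_shuffle_sum)
      then have "lf X (split_twist X ?L ?R D) (split_sum ?V ?N ?Q (\<lambda>d. ?F (split_head ?V ?N ?Q # d))) =
          lf X (split_twist X ?L (?N @ ?Q) D) (lf X (FMor ?P (split_twist ?V ?N ?Q D)) z)"
        using e2 by simp
      also have "\<dots> = lf X (cmp X (split_twist X ?L (?N @ ?Q) D) (FMor ?P (split_twist ?V ?N ?Q D))) z"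
      proof (rule lf_cmp[symmetric, OF X pull_list_ob[OF us st] oP _ pull_total_ob[OF us D] vz])
        have DV: "D \<in> ob (target U ?V (?N @ ?Q))" using D c(3) e2 by simp
        show o: "FOb ?P (FOb (total_pull ?V (?N @ ?Q)) D) \<in> ob X"
          using pull_total_ob[OF c(1) pull_total_ob[OF cs(1) DV]] .
        show "FMor ?P (split_twist ?V ?N ?Q D) \<in> hom X (FOb ?P (FOb ?T ?E)) (FOb ?P (FOb (total_pull ?V (?N @ ?Q)) D))"
          using linear_functor_mor[OF between_pull_total[OF c(1)] _ pull_total_ob[OF cs(1) DV] split_twist_hom[OF cs(1) DV]] oT W
          by simp
        show "split_twist X ?L (?N @ ?Q) D \<in> hom X (FOb ?P (FOb (total_pull ?V (?N @ ?Q)) D)) (FOb (total_pull X us) D)"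
          using split_objects(3)[OF us D, of p] e2 by simp
      qed
      also have "cmp X (split_twist X ?L (?N @ ?Q) D) (FMor ?P (split_twist ?V ?N ?Q D)) =
          cmp X (split_twist X (take ?j us) ?Q D) (split_twist X ?L ?N ?E)"
        using split_twist_cocycle[OF cj, of D] D e0 e1 by simp
      also have "lf X \<dots> z = lf X (split_twist X (take ?j us) ?Q D) (lf X (split_twist X ?L ?N ?E) z)"
      proof (rule lf_cmp[OF X pull_list_ob[OF us st] oP _ pull_total_ob[OF us D] vz])
        show "FOb (total_pull X (take ?j us)) ?E \<in> ob X" using split_objects(2)[OF us D] .
        show "split_twist X (take ?j us) ?Q D \<in> hom X (FOb (total_pull X (take ?j us)) ?E) (FOb (total_pull X us) D)"
          using split_objects(3)[OF us D] .
        show "split_twist X ?L ?N ?E \<in> hom X (FOb ?P (FOb ?T ?E)) (FOb (total_pull X (take ?j us)) ?E)"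
          using split_twist_hom[OF cs(4), of ?E] ED W e0 by simp
      qed
      finally show ?thesis unfolding tk by (simp add: double_term_def Let_def z_def)
    qed
    have "front_term p F X us D xs = signed (length xs) (\<Sum>i\<in>{1..Suc m}. signed (length ?R - i)
        (lf X (split_twist X ?L ?R D) (split_sum ?V (take i ?R) (drop i ?R)
        (\<lambda>d. ?F (split_head ?V (take i ?R) (drop i ?R) # d)))))"
      unfolding front_term_def Let_def path_sum_split[OF c(2) m] lin_sum lin_signed ..
    also have "\<dots> = (\<Sum>i\<in>{1..Suc m}. signed (length xs) (signed (length us - (i + p)) (double_term p (i + p) F X us D xs)))"
      unfolding signed_sum step by (simp add: add.commute)
    also have "\<dots> = (\<Sum>j\<in>{Suc p..<length us}. signed (length xs) (signed (length us - j) (double_term p j F X us D xs)))"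
      by (rule sum.reindex_bij_witness[where i = "\<lambda>j. j - p" and j = "\<lambda>i. i + p"]) (use m in auto)
    finally show ?thesis .
  qed
qed

lemma path_part_left_cancel:
  assumes "cochain_values F" "composable U X us" "arrows (target U X us) D xs"
  shows "path_part (hoch_left F) X us D xs + hoch_left (path_part F) X us D xs + path_part (path_part F) X us D xs = 0"
proof -
  let ?n = "length us"
  let ?f = "\<lambda>j p. signed (?n - j) (double_term p j F X us D xs)"
  have "(\<Sum>p<?n. front_term p F X us D xs) = signed (length xs) (\<Sum>p<?n. \<Sum>j\<in>{Suc p..<?n}. ?f j p)"
    using front_term_double_term[OF assms] by (simp add: signed_sum)
  also have "(\<Sum>p<?n. \<Sum>j\<in>{Suc p..<?n}. ?f j p) = (\<Sum>j<?n. \<Sum>p<j. ?f j p)"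
    unfolding sum.Sigma[OF finite_lessThan ballI[OF finite_atLeastLessThan]] sum.Sigma[OF finite_lessThan ballI[OF finite_lessThan]]
    by (rule sum.reindex_bij_witness[where i = "\<lambda>(j, p). (p, j)" and j = "\<lambda>(p, j). (j, p)"]) auto
  finally have 1: "path_part (hoch_left F) X us D xs + hoch_left (path_part F) X us D xs = (\<Sum>j<?n. \<Sum>p<j. ?f j p)"
    unfolding path_part_hoch_left[OF assms] by simp
  have "path_part (path_part F) X us D xs = (\<Sum>j<?n. \<Sum>p<j. - ?f j p)"
    unfolding path_part_path_part[OF assms] signed_sum signed_signed
  proof (intro sum.cong refl)
    fix j p assume "j \<in> {..<?n}"
    then have "?n - j = Suc (?n - j - 1)" by simp
    then have "signed (?n - j) z = - signed (?n - j - 1) z" for z :: "'m \<Rightarrow>\<^sub>0 int" by (metis signed_Suc)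
    then show "signed (length xs + (length xs + (?n - j - 1))) (double_term p j F X us D xs) = - ?f j p"
      by (simp add: signed_signed[symmetric])
  qed
  then show ?thesis using 1 by (simp add: sum_negf)
qed

text \<open>By the Leibniz rule, the inner faces of the shuffles are shuffles of inner faces of \<open>xs\<close> and of
  inner faces of paths, and the latter cancel.\<close>

lemma path_part_hoch_inner:
  assumes F: "cochain_values F" and us: "composable U X us" and xs: "arrows (target U X us) D xs"
  shows "path_part (hoch_inner F) X us D xs + hoch_inner (path_part F) X us D xs = 0"
proof -
  let ?Y = "target U X us"
  have "path_term p (hoch_inner F) X us D xs = inner_bd (paste (cmp ?Y)) (path_term p F X us D) xs" for p
  proof -
    let ?L = "take p us" and ?R = "drop p us" let ?V = "target U X ?L" let ?T = "total_pull ?V ?R"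
    let ?F = "F X ?L (FOb ?T D)"
    note c = split_composable[OF us, of p]
    have V: "?V \<in> Obj U" using composable_target[OF c(1)] .
    have "path_sum U A ?R (\<lambda>r. \<Sigma>sh (hoch_inner F X ?L (FOb ?T D)) D xs ?T r) =
      path_sum U A ?R (\<lambda>r. inner_bd (paste (cmp ?Y)) (\<lambda>xs'. \<Sigma>sh ?F D xs' ?T r) xs +
        signed (length xs) (inner_bd (paste (vcomp ?V)) (\<lambda>r'. \<Sigma>sh ?F D xs ?T r') r))"
    proof (rule path_sum_cong)
      fix r assume r: "r \<in> paths (length ?R)"
      note rc = path_arrows(1)[OF c(2) r, unfolded c(3)]
      have "\<Sigma>sh (inner_bd (paste (cmp ?V)) ?F) D xs ?T (path_chain U A ?R r) =
        inner_bd (paste (cmp ?Y)) (\<lambda>xs'. \<Sigma>sh ?F D xs' ?T (path_chain U A ?R r)) xs +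
        signed (length xs) (inner_bd (paste (vcomp ?V)) (\<lambda>r'. \<Sigma>sh ?F D xs ?T r') (path_chain U A ?R r))"
        by (rule shuffle_sum_inner_bd[OF xs rc])
          (auto intro: linear_functor_cmp natural_transD(2) simp: vcomp_def)
      then show "\<Sigma>sh (hoch_inner F X ?L (FOb ?T D)) D xs ?T (path_chain U A ?R r) =
        inner_bd (paste (cmp ?Y)) (\<lambda>xs'. \<Sigma>sh ?F D xs' ?T (path_chain U A ?R r)) xs +
        signed (length xs) (inner_bd (paste (vcomp ?V)) (\<lambda>r'. \<Sigma>sh ?F D xs ?T r') (path_chain U A ?R r))"
        by (simp add: hoch_inner_def[abs_def])
    qed
    also have "\<dots> = inner_bd (paste (cmp ?Y)) (\<lambda>xs'. path_sum U A ?R (\<lambda>r. \<Sigma>sh ?F D xs' ?T r)) xs +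
        signed (length xs) (path_sum U A ?R (inner_bd (paste (vcomp ?V)) (\<lambda>r'. \<Sigma>sh ?F D xs ?T r')))"
      by (simp only: path_sum_add path_sum_signed) (simp only: inner_bd_def[of "paste (cmp ?Y)"] path_sum_sum path_sum_signed)
    also have "path_sum U A ?R (inner_bd (paste (vcomp ?V)) (\<lambda>r'. \<Sigma>sh ?F D xs ?T r')) = 0"
      by (rule path_sum_inner_bd[OF c(2)]) (rule shuffle_sum_agree, assumption, use xs c(3) in auto)
    finally show ?thesis
      by (simp add: path_term_def[abs_def] lin_inner_bd)
  qed
  then have "path_part (hoch_inner F) X us D xs =
      signed (length xs) (\<Sum>p<length us. inner_bd (paste (cmp ?Y)) (path_term p F X us D) xs)"
    by (simp add: path_part_def)
  also have "(\<Sum>p<length us. inner_bd (paste (cmp ?Y)) (path_term p F X us D) xs) =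
      inner_bd (paste (cmp ?Y)) (\<lambda>c. \<Sum>p<length us. path_term p F X us D c) xs"
    unfolding inner_bd_def signed_sum by (rule sum.swap)
  also have "signed (length xs) \<dots> = - hoch_inner (path_part F) X us D xs"
    unfolding hoch_inner_def path_part_def[abs_def]
    using inner_bd_length_signed[of "paste (cmp ?Y)" "\<lambda>c. \<Sum>p<length us. path_term p F X us D c" xs]
    by (simp add: inner_bd_uminus signed_Suc)
  finally show ?thesis by simp
qed

text \<open>The terms in which a shuffle ends with the first step of the path, and the Hochschild differential takes that
  step off and lets it act on the right.\<close>

definition back_term where
  "back_term p F X us D xs = (let L = take p us; R = drop p us; T = total_pull (target U X L) R in
     lf X (split_twist X L R D) (path_sum U A R (\<lambda>r. if r = [] then 0 else
       signed (length xs + length r) (\<Sigma>sh (\<lambda>c. rf X (F X L (FOb T D) c)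
         (FMor (pull_list A L) (fst (last r) (start D xs)))) D xs T (butlast r)))))"

lemma path_term_hoch_right:
  assumes F: "cochain_values F" and us: "composable U X us" and xs: "arrows (target U X us) D xs"
  shows "path_term p (hoch_right F) X us D xs = hoch_right (path_term p F) X us D xs + back_term p F X us D xs"
proof -
  let ?L = "take p us" and ?R = "drop p us" let ?V = "target U X ?L" let ?T = "total_pull ?V ?R"
  let ?c = "split_twist X ?L ?R" and ?F = "F X ?L (FOb ?T D)"
  let ?a = "FMor (pull_list A us) (fst (last xs))"
  let ?z = "path_sum U A ?R (\<lambda>r. \<Sigma>sh ?F D (butlast xs) ?T r)"
  let ?B = "\<lambda>r. if r = [] then 0 else
       signed (length xs + length r) (\<Sigma>sh (\<lambda>c. rf X (?F c)
         (FMor (pull_list A ?L) (fst (last r) (start D xs)))) D xs ?T (butlast r))"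
  note c = split_composable[OF us, of p]
  have X: "X \<in> Obj U" using us by (rule composable_source)
  have e: "\<Sigma>sh (hoch_right F X ?L (FOb ?T D)) D xs ?T r =
      (if xs = [] then 0 else signed (length xs) (rf X (\<Sigma>sh ?F D (butlast xs) ?T r) ?a)) + ?B r"
    if "start ?T r = pull_list A ?R" for r
  proof -
    have p: "FMor (pull_list A ?L) (FMor (pull_list A ?R) f) = FMor (pull_list A us) f" for f
      using pull_list_append[of A ?L ?R] by simp
    have 1: "signed (length s) (\<Sigma>sh (\<lambda>c. signed (Suc (length c)) (G c)) D (butlast xs) ?T s)
        = signed (length xs) (\<Sigma>sh G D (butlast xs) ?T s)" if "xs \<noteq> []" for s and G :: "_ \<Rightarrow> 'm \<Rightarrow>\<^sub>0 int"
    proof -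
      have "length xs = Suc (length (butlast xs))" using that by (cases xs) auto
      then show ?thesis
        unfolding signed_Suc[of "length _"] shuffle_sum_uminus shuffle_sum_length_signed
        by (auto simp: signed_def simp del: length_butlast)
    qed
    note nil_case = 1[of "[]", unfolded list.size signed_0]
    have 2: "\<Sigma>sh (\<lambda>c. signed (Suc (length c)) (G c)) D xs ?T (butlast r)
        = signed (length xs + length r) (\<Sigma>sh G D xs ?T (butlast r))" if "r \<noteq> []" for G :: "_ \<Rightarrow> 'm \<Rightarrow>\<^sub>0 int"
    proof -
      have "length xs + length r = Suc (length xs + length (butlast r))" using that by (cases r) auto
      then show ?thesis
        unfolding signed_Suc[of "length _"] shuffle_sum_uminus shuffle_sum_length_signed by (simp only: signed_Suc)
    qed
    show ?thesis
      by (subst shuffle_sum_back, unfold that) (auto simp: hoch_right_def p 1 nil_case 2 lin_shuffle_sum)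
  qed
  have "path_sum U A ?R (\<lambda>r. \<Sigma>sh (hoch_right F X ?L (FOb ?T D)) D xs ?T r) =
    path_sum U A ?R (\<lambda>r. (if xs = [] then 0 else signed (length xs) (rf X (\<Sigma>sh ?F D (butlast xs) ?T r) ?a)) + ?B r)"
    by (rule path_sum_cong) (rule e[OF path_arrows(2)[OF c(2)]])
  also have "\<dots> = (if xs = [] then 0 else signed (length xs) (rf X ?z ?a)) + path_sum U A ?R ?B"
    by (simp only: path_sum_add) (simp add: lin_path_sum path_sum_signed)
  finally have "path_term p (hoch_right F) X us D xs =
      (if xs = [] then 0 else signed (length xs) (lf X (?c D) (rf X ?z ?a))) + back_term p F X us D xs"
    by (simp add: path_term_def lin_add lin_signed back_term_def Let_def)
  moreover have "lf X (?c D) (rf X ?z ?a) = rf X (path_term p F X us D (butlast xs)) ?a" if ne: "xs \<noteq> []"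
  proof -
    obtain ys x D1 where x: "xs = ys @ [(x, D1)]" using ne by (cases xs rule: rev_cases) auto
    have ar: "arrows (target U X us) D ys" "x \<in> hom (target U X us) D1 (start D ys)" "D1 \<in> ob (target U X us)"
      using xs x by (auto simp: chain_append)
    have D: "D \<in> ob (target U X us)" and st: "start D ys \<in> ob (target U X us)"
      using ar by (auto intro: arrows_vertex arrows_start)
    note so = split_objects[OF us D, of p]
    show ?thesis
      unfolding path_term_def x
      using rf_lf[OF X pull_list_ob[OF us ar(3)] pull_list_ob[OF us st] so(2) pull_total_ob[OF us D]
          valued_path_inner[OF F us ar(1)] linear_functor_mor[OF between_pull_list[OF us] ar(3) st ar(2)] so(3)]
      by simp
  qed
  ultimately show ?thesis by (simp add: hoch_right_def)
qed

text \<open>The path part evaluated on an inner face of the simplex; both the last Hochschild term and the inner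
  simplicial faces produce such terms.\<close>

definition merge_term where
  "merge_term i p F X us D xs = rf X (path_term p F X (merge_arrows U i us) D xs) (twist_at A i us (start D xs))"

lemma lf_rf_merge:
  assumes F: "cochain_values F" and us: "composable U X us" and xs: "arrows (target U X us) D xs"
    and i: "Suc i < length us"
  shows "merge_term i p F X us D xs = (let L = take p (merge_arrows U i us); R = drop p (merge_arrows U i us); T = total_pull (target U X L) R in
    lf X (split_twist X L R D) (rf X (path_sum U A R (\<lambda>r. \<Sigma>sh (F X L (FOb T D)) D xs T r)) (twist_at A i us (start D xs))))"
proof -
  let ?m = "merge_arrows U i us"
  have X: "X \<in> Obj U" using us by (rule composable_source)
  have D: "D \<in> ob (target U X us)" and st: "start D xs \<in> ob (target U X us)"
    using xs by (auto intro: arrows_vertex arrows_start)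
  note m = composable_merge[OF i us] and t = target_merge[OF i us]
  have D': "D \<in> ob (target U X ?m)" and st': "start D xs \<in> ob (target U X ?m)" and xs': "arrows (target U X ?m) D xs"
    using D st xs t by auto
  note so = split_objects[OF m D', of p]
  show ?thesis
    unfolding merge_term_def path_term_def Let_def
    by (rule rf_lf[OF X pull_list_ob[OF us st] pull_list_ob[OF m st'] so(2) pull_total_ob[OF m D']
          valued_path_inner[OF F m xs'] twist_at_hom[OF i us st] so(3)])
qed

lemma take_drop_merge_right:
  assumes "p \<le> i" "Suc i < length us"
  shows "take p (merge_arrows U i us) = take p us" "drop p (merge_arrows U i us) = merge_arrows U (i - p) (drop p us)"
proof -
  have "merge_arrows U i us = take p us @ merge_arrows U (i - p) (drop p us)"
    using contract_append2'[of "take p us" i "\<lambda>u v. Cmp U v u" "drop p us"] assms by (simp add: min_absorb2)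
  then show "take p (merge_arrows U i us) = take p us" "drop p (merge_arrows U i us) = merge_arrows U (i - p) (drop p us)"
    using assms by (auto simp: min_absorb2)
qed

lemma take_drop_merge_left:
  assumes "Suc i < p" "p \<le> length us"
  shows "take (p - 1) (merge_arrows U i us) = merge_arrows U i (take p us)" "drop (p - 1) (merge_arrows U i us) = drop p us"
proof -
  have "merge_arrows U i us = merge_arrows U i (take p us) @ drop p us"
    using contract_append[of i "take p us" "\<lambda>u v. Cmp U v u" "drop p us"] assms by simp
  moreover have "length (merge_arrows U i (take p us)) = p - 1" using assms by (simp add: length_contract)
  ultimately show "take (p - 1) (merge_arrows U i us) = merge_arrows U i (take p us)" "drop (p - 1) (merge_arrows U i us) = drop p us"
    by auto
qed

text \<open>The first step of a path of the last part merges two of its arrows, and what remains is a path of the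
  merged part. So these are inner faces of the simplex to the right of the cut.\<close>

lemma back_term_merge_term:
  assumes F: "cochain_values F" and us: "composable U X us" and xs: "arrows (target U X us) D xs" and p: "p < length us"
  shows "back_term p F X us D xs =
    (\<Sum>i<length us - 1 - p. signed (length xs + (length us - 1 - p) + Suc i) (merge_term (p + i) p F X us D xs))"
proof -
  let ?L = "take p us" and ?R = "drop p us" let ?V = "target U X ?L" let ?T = "total_pull ?V ?R"
  let ?F = "F X ?L (FOb ?T D)"
  let ?tw = "\<lambda>i. twist_at A (p + i) us (start D xs)"
  note c = split_composable[OF us, of p]
  show ?thesis
  proof (cases "length ?R < 2")
    case True
    then have "length ?R = 1" using p by simp
    then obtain u where "?R = [u]" by (cases ?R) auto
    moreover have "length us - 1 - p = 0" using True by auto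
    ultimately show ?thesis by (simp add: back_term_def)
  next
    case False
    then obtain m where m: "length ?R = Suc (Suc m)" by (metis Suc_1 less_2_cases_iff not0_implies_Suc One_nat_def)
    have n: "length us - 1 - p = Suc m" using m by simp
    have tw: "FMor (pull_list A ?L) (twist_at A i ?R (start D xs)) = ?tw i" for i
      using twist_at_append2[of A ?L i ?R] p by (simp add: min_absorb2)
    have "path_sum U A ?R (\<lambda>r. if r = [] then 0 else
       signed (length xs + length r) (\<Sigma>sh (\<lambda>c. rf X (?F c)
         (FMor (pull_list A ?L) (fst (last r) (start D xs)))) D xs ?T (butlast r))) =
      (\<Sum>i<Suc m. signed (Suc i) (path_sum U A (merge_arrows U i ?R) (\<lambda>c. signed (length c)
        (signed (Suc (length xs)) (\<Sigma>sh (\<lambda>c. rf X (?F c) (?tw i)) D xs ?T c)))))"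
      unfolding path_sum_rec[OF m] by (simp add: tw signed_signed add.commute)
    also have "\<dots> = (\<Sum>i<Suc m. signed (length xs + Suc m + Suc i)
        (rf X (path_sum U A (merge_arrows U i ?R) (\<Sigma>sh ?F D xs ?T)) (?tw i)))"
    proof (rule sum.cong[OF refl])
      fix i assume "i \<in> {..<Suc m}"
      then have l: "length (merge_arrows U i ?R) - 1 = m" using m by (simp add: length_contract)
      show "signed (Suc i) (path_sum U A (merge_arrows U i ?R) (\<lambda>c. signed (length c)
        (signed (Suc (length xs)) (\<Sigma>sh (\<lambda>c. rf X (?F c) (?tw i)) D xs ?T c)))) =
        signed (length xs + Suc m + Suc i) (rf X (path_sum U A (merge_arrows U i ?R) (\<Sigma>sh ?F D xs ?T)) (?tw i))"
        unfolding path_sum_length_signed path_sum_signed l lin_path_sum lin_shuffle_sum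
        by (simp only: signed_signed) (simp add: ac_simps)
    qed
    finally have "back_term p F X us D xs = (\<Sum>i<Suc m. signed (length xs + Suc m + Suc i)
        (lf X (split_twist X ?L ?R D) (rf X (path_sum U A (merge_arrows U i ?R) (\<Sigma>sh ?F D xs ?T)) (?tw i))))"
      by (simp only: back_term_def Let_def lin_sum lin_signed)
    also have "\<dots> = (\<Sum>i<Suc m. signed (length xs + Suc m + Suc i) (merge_term (p + i) p F X us D xs))"
    proof (intro sum.cong refl arg_cong[where f = "signed _"])
      fix i assume "i \<in> {..<Suc m}"
      then have i: "Suc (p + i) < length us" "Suc i < length ?R" using m n by auto
      show "lf X (split_twist X ?L ?R D) (rf X (path_sum U A (merge_arrows U i ?R) (\<Sigma>sh ?F D xs ?T)) (?tw i)) =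
          merge_term (p + i) p F X us D xs"
        unfolding lf_rf_merge[OF F us xs i(1)]
        using take_drop_merge_right[OF _ i(1), of p] composite_merge[OF i(2) c(2)] by (simp add: Let_def)
    qed
    finally show ?thesis by (simp only: n)
  qed
qed

text \<open>Inner faces of the initial part are inner faces of the simplex to the left of the cut.\<close>

lemma path_term_simp_inner:
  assumes F: "cochain_values F" and us: "composable U X us" and xs: "arrows (target U X us) D xs" and p: "p < length us"
  shows "path_term p (simp_inner F) X us D xs =
    (\<Sum>i<p - 1. signed (length xs + (length us - 1) + Suc i) (merge_term i (p - 1) F X us D xs))"
proof -
  let ?L = "take p us" and ?R = "drop p us" let ?V = "target U X ?L" let ?T = "total_pull ?V ?R"
  let ?tw = "\<lambda>i. twist_at A i us (start D xs)" and ?m = "\<lambda>i. merge_arrows U i ?L"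
  note c = split_composable[OF us, of p]
  have lL: "length ?L = p" using p by simp
  have "path_sum U A ?R (\<lambda>r. \<Sigma>sh (simp_inner F X ?L (FOb ?T D)) D xs ?T r) =
      path_sum U A ?R (\<lambda>r. \<Sigma>sh (\<lambda>d. signed (length d) (signed p
        (\<Sum>i<p - 1. signed (Suc i) (rf X (F X (?m i) (FOb ?T D) d) (?tw i))))) D xs ?T r)"
  proof (rule path_sum_cong, rule shuffle_sum_cong)
    fix r d assume r: "r \<in> paths (length ?R)"
      and d: "(D, xs, ?T, path_chain U A ?R r, d) \<in> shuffles_of FOb FMor (\<lambda>\<eta> B. \<eta> B)"
    have st: "start (FOb ?T D) d = FOb (pull_list A ?R) (start D xs)"
      using shuffles_of_start[OF d] path_arrows(2)[OF c(2) r] by simp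
    have tw: "twist_at A i ?L (FOb (pull_list A ?R) (start D xs)) = ?tw i" if "i < p - 1" for i
    proof -
      have "Suc i < length ?L" using that lL by simp
      then show ?thesis using twist_at_append1[of i ?L A ?R] by simp
    qed
    show "simp_inner F X ?L (FOb ?T D) d = signed (length d) (signed p
        (\<Sum>i<p - 1. signed (Suc i) (rf X (F X (?m i) (FOb ?T D) d) (?tw i))))"
      unfolding simp_inner_def st lL by (simp add: tw signed_signed add.commute)
  qed
  also have "\<dots> = (\<Sum>i<p - 1. signed (length xs + (length us - 1) + Suc i)
      (rf X (path_sum U A ?R (\<lambda>r. \<Sigma>sh (F X (?m i) (FOb ?T D)) D xs ?T r)) (?tw i)))"
  proof -
    have "path_sum U A ?R (\<lambda>r. \<Sigma>sh (\<lambda>d. signed (length d) (G d)) D xs ?T r) =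
        signed (length xs + (length us - p - 1)) (path_sum U A ?R (\<lambda>r. \<Sigma>sh G D xs ?T r))"
      for G :: "_ \<Rightarrow> 'm \<Rightarrow>\<^sub>0 int"
    proof -
      have "path_sum U A ?R (\<lambda>r. \<Sigma>sh (\<lambda>d. signed (length d) (G d)) D xs ?T r) =
          path_sum U A ?R (\<lambda>r. signed (length r) (signed (length xs) (\<Sigma>sh G D xs ?T r)))"
        by (simp only: shuffle_sum_length_signed) (simp only: signed_signed add.commute)
      then show ?thesis
        by (simp only: path_sum_length_signed path_sum_signed length_drop) (simp only: signed_signed add.commute)
    qed
    moreover have "length xs + (length us - p - 1) + p = length xs + (length us - 1)" using p by simp
    ultimately show ?thesis
      by (simp only: shuffle_sum_signed path_sum_signed shuffle_sum_sum path_sum_sum lin_path_sum lin_shuffle_sum signed_sum)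
        (simp only: signed_signed add.assoc[symmetric])
  qed
  finally have "path_term p (simp_inner F) X us D xs = (\<Sum>i<p - 1. signed (length xs + (length us - 1) + Suc i)
      (lf X (split_twist X ?L ?R D) (rf X (path_sum U A ?R (\<lambda>r. \<Sigma>sh (F X (?m i) (FOb ?T D)) D xs ?T r)) (?tw i))))"
    by (simp only: path_term_def lin_sum lin_signed)
  also have "\<dots> = (\<Sum>i<p - 1. signed (length xs + (length us - 1) + Suc i) (merge_term i (p - 1) F X us D xs))"
  proof (intro sum.cong refl arg_cong[where f = "signed _"])
    fix i assume "i \<in> {..<p - 1}"
    then have i: "Suc i < p" "Suc i < length us" "Suc i < length ?L" using p by auto
    show "lf X (split_twist X ?L ?R D) (rf X (path_sum U A ?R (\<lambda>r. \<Sigma>sh (F X (?m i) (FOb ?T D)) D xs ?T r)) (?tw i)) =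
        merge_term i (p - 1) F X us D xs"
      unfolding lf_rf_merge[OF F us xs i(2)] take_drop_merge_left[OF i(1) less_imp_le[OF p]] Let_def
        target_merge[OF i(3) c(1)] composite_merge[OF i(3) c(1)] ..
  qed
  finally show ?thesis .
qed

text \<open>Inner faces to the left and to the right of the cut make up all inner faces.\<close>

lemma sum_square_triangles:
  fixes f :: "nat \<Rightarrow> nat \<Rightarrow> 'g::ab_group_add"
  shows "(\<Sum>i<n. \<Sum>p<n. f i p) = (\<Sum>p<Suc n. \<Sum>i<p - 1. f i (p - 1)) + (\<Sum>p<Suc n. \<Sum>i<n - p. f (p + i) p)"
proof -
  have "(\<Sum>i<n. \<Sum>p<n. f i p) = (\<Sum>p<n. (\<Sum>i<p. f i p) + (\<Sum>i<n - p. f (p + i) p))"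
  proof (subst sum.swap, rule sum.cong[OF refl])
    fix p assume "p \<in> {..<n}"
    then have "{..<n} = {..<p} \<union> {p..<n}" "{..<p} \<inter> {p..<n} = {}" by auto
    then have "(\<Sum>i<n. f i p) = (\<Sum>i<p. f i p) + (\<Sum>i\<in>{p..<n}. f i p)" by (simp add: sum.union_disjoint)
    also have "(\<Sum>i\<in>{p..<n}. f i p) = (\<Sum>i<n - p. f (p + i) p)"
      by (rule sum.reindex_bij_witness[where i = "\<lambda>i. p + i" and j = "\<lambda>i. i - p"]) auto
    finally show "(\<Sum>i<n. f i p) = (\<Sum>i<p. f i p) + (\<Sum>i<n - p. f (p + i) p)" .
  qed
  moreover have "(\<Sum>p<n. \<Sum>i<p. f i p) = (\<Sum>p<Suc n. \<Sum>i<p - 1. f i (p - 1))"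
    by (simp only: sum.lessThan_Suc_shift) simp
  ultimately show ?thesis by (simp add: sum.distrib sum.lessThan_Suc)
qed

lemma path_part_right_cancel:
  assumes F: "cochain_values F" and us: "composable U X us" and xs: "arrows (target U X us) D xs"
  shows "path_part (hoch_right F) X us D xs + hoch_right (path_part F) X us D xs +
    path_part (simp_inner F) X us D xs + simp_inner (path_part F) X us D xs = 0"
proof (cases us)
  case Nil
  then show ?thesis by (simp add: path_part_def simp_inner_def hoch_right_def)
next
  case (Cons u ws)
  define n where "n = length ws"
  have n: "length us = Suc n" by (simp add: Cons n_def)
  let ?f = "\<lambda>i p. signed (n + Suc i) (merge_term i p F X us D xs)"
  have "hoch_right (path_part F) X us D xs = - signed (length xs) (\<Sum>p<Suc n. hoch_right (path_term p F) X us D xs)"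
    by (cases xs rule: rev_cases) (auto simp: hoch_right_def path_part_def lin_signed lin_sum signed_Suc sum_negf signed_sum[symmetric] n)
  then have "path_part (hoch_right F) X us D xs + hoch_right (path_part F) X us D xs =
      signed (length xs) (\<Sum>p<Suc n. back_term p F X us D xs)"
    by (simp add: path_part_def path_term_hoch_right[OF F us xs] sum.distrib signed_add n)
  also have "\<dots> = (\<Sum>p<Suc n. \<Sum>i<n - p. signed (n - p + Suc i) (merge_term (p + i) p F X us D xs))"
    unfolding signed_sum
  proof (rule sum.cong[OF refl])
    fix p assume "p \<in> {..<Suc n}"
    then have p: "p < length us" "length us - 1 - p = n - p" using n by auto
    show "signed (length xs) (back_term p F X us D xs) =
        (\<Sum>i<n - p. signed (n - p + Suc i) (merge_term (p + i) p F X us D xs))"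
      unfolding back_term_merge_term[OF F us xs p(1)] p(2) signed_sum signed_signed
      by (intro sum.cong refl signed_cong_parity) (simp only: even_add, blast)
  qed
  also have "\<dots> = (\<Sum>p<Suc n. \<Sum>i<n - p. ?f (p + i) p)"
  proof (intro sum.cong refl signed_cong_parity)
    fix p i assume "p \<in> {..<Suc n}"
    then have "n + Suc (p + i) = n - p + Suc i + 2 * p" by simp
    then show "even (n - p + Suc i) = even (n + Suc (p + i))" by simp blast
  qed
  finally have 1: "path_part (hoch_right F) X us D xs + hoch_right (path_part F) X us D xs =
      (\<Sum>p<Suc n. \<Sum>i<n - p. ?f (p + i) p)" .
  have 2: "path_part (simp_inner F) X us D xs = (\<Sum>p<Suc n. \<Sum>i<p - 1. ?f i (p - 1))"
    unfolding path_part_def signed_sum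
    unfolding n
  proof (rule sum.cong[OF refl])
    fix p assume "p \<in> {..<Suc n}"
    then have p: "p < length us" "length us - 1 = n" using n by auto
    show "signed (length xs) (path_term p (simp_inner F) X us D xs) = (\<Sum>i<p - 1. ?f i (p - 1))"
      unfolding path_term_simp_inner[OF F us xs p(1)] p(2) signed_sum signed_signed
      by (intro sum.cong refl signed_cong_parity) (simp only: even_add, blast)
  qed
  have "simp_inner (path_part F) X us D xs = (\<Sum>i<n. \<Sum>p<n. signed (Suc n + length xs) (signed (Suc i) (signed (length xs)
      (merge_term i p F X us D xs))))"
    by (simp add: simp_inner_def path_part_def n length_contract lin_signed lin_sum signed_sum merge_term_def)
  also have "\<dots> = (\<Sum>i<n. \<Sum>p<n. - ?f i p)"
    by (intro sum.cong) (auto simp: signed_def)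
  finally have 3: "simp_inner (path_part F) X us D xs = - (\<Sum>i<n. \<Sum>p<n. ?f i p)"
    by (simp add: sum_negf)
  show ?thesis
    (* The faces with p <= i come from 1, those with i < p from 2, and 3 contains all of them. *)
    unfolding 1 2 3 sum_square_triangles[of ?f n] by simp
qed

lemma path_term_simp_first:
  assumes F: "cochain_values F" and us: "composable U X (u # ws)" and xs: "arrows (target U X (u # ws)) D xs"
    and p: "p < length ws"
  shows "path_term (Suc p) (simp_first F) X (u # ws) D xs =
    signed (length xs + length ws) (lf X (split_twist X [u] ws D) (mf u (path_term p F (Cod U u) ws D xs)))"
proof -
  let ?W = "Cod U u" and ?L = "take p ws" and ?R = "drop p ws" let ?V = "target U ?W ?L" let ?T = "total_pull ?V ?R"
  let ?z = "path_sum U A ?R (\<lambda>r. \<Sigma>sh (F ?W ?L (FOb ?T D)) D xs ?T r)"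
  let ?Y = "target U ?W ws"
  have u: "u \<in> Arr U" "Dom U u = X" "composable U ?W ws" using us by auto
  have X: "X \<in> Obj U" using us by (rule composable_source)
  note c = split_composable[OF u(3), of p]
  have xsW: "arrows ?Y D xs" using xs by simp
  have D: "D \<in> ob ?Y" and st: "start D xs \<in> ob ?Y" using xsW by (auto intro: arrows_vertex arrows_start)
  note so = split_objects[OF u(3) D, of p]
  note vz = valued_path_inner[OF F u(3) xsW, of p]
  note oS = pull_list_ob[OF u(3) st]
  note muz = valued_mf[OF u(1,2) oS so(2) vz]
  note uo = linear_functor_ob[OF pull[OF u(1)], unfolded u(2)]
  have s1: "composite U X [u] = u" using u by (simp add: composite_single del: composite.simps)
  have w: "ws = ?L @ ?R" by simp
  have cc: "composable U X ([u] @ ?L @ ?R)" "composable U X ([u] @ ws)" "composable U X ([u] @ ?L)"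
    using us c by auto
  have DD: "D \<in> ob (target U X ([u] @ ?L @ ?R))" "D \<in> ob (target U X ([u] @ ws))" "FOb ?T D \<in> ob (target U X ([u] @ ?L))"
    using D so(1) by auto
  have oX: "FOb (total_pull X (u # ws)) D \<in> ob X" using pull_total_ob[OF us] D by simp
  have oL: "FOb (total_pull X (u # ?L)) (FOb ?T D) \<in> ob X" using pull_total_ob[OF cc(3) DD(3)] by simp
  have h1: "split_twist X [u] ?L (FOb ?T D) \<in> hom X (FOb (Pull A u) (FOb (total_pull ?W ?L) (FOb ?T D))) (FOb (total_pull X (u # ?L)) (FOb ?T D))"
    using split_twist_hom[OF cc(3) DD(3)] s1 by (simp del: composite.simps)
  have h2: "split_twist X (u # ?L) ?R D \<in> hom X (FOb (total_pull X (u # ?L)) (FOb ?T D)) (FOb (total_pull X (u # ws)) D)"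
    using split_twist_hom[of X "u # ?L" ?R D] cc(1) DD(1) by (simp del: composite.simps)
  have h3: "FMor (Pull A u) (split_twist ?W ?L ?R D) \<in> hom X (FOb (Pull A u) (FOb (total_pull ?W ?L) (FOb ?T D)))
      (FOb (Pull A u) (FOb (total_pull ?W ws) D))"
    using linear_functor_mor[OF pull[OF u(1)] so(2) pull_total_ob[OF u(3) D] so(3)] u by simp
  have h4: "split_twist X [u] ws D \<in> hom X (FOb (Pull A u) (FOb (total_pull ?W ws) D)) (FOb (total_pull X (u # ws)) D)"
    using split_twist_hom[OF cc(2) DD(2)] s1 by (simp del: composite.simps)
  have coc: "cmp X (split_twist X (u # ?L) ?R D) (split_twist X [u] ?L (FOb ?T D)) =
      cmp X (split_twist X [u] ws D) (FMor (Pull A u) (split_twist ?W ?L ?R D))"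
    using split_twist_cocycle[OF cc(1) DD(1)] s1 by (simp del: composite.simps)
  have "path_sum U A ?R (\<lambda>r. \<Sigma>sh (simp_first F X (u # ?L) (FOb ?T D)) D xs ?T r) =
      path_sum U A ?R (\<lambda>r. signed (length r) (signed (length xs + Suc p) (\<Sigma>sh (\<lambda>d.
        lf X (split_twist X [u] ?L (FOb ?T D)) (mf u (F ?W ?L (FOb ?T D) d))) D xs ?T r)))"
  proof -
    have "\<Sigma>sh (simp_first F X (u # ?L) (FOb ?T D)) D xs ?T r =
      \<Sigma>sh (\<lambda>d. signed (length d) (signed (Suc p) (lf X (split_twist X [u] ?L (FOb ?T D)) (mf u (F ?W ?L (FOb ?T D) d))))) D xs ?T r" for r
      using p by (simp add: simp_first_def[abs_def] signed_signed min_absorb2 add.commute del: composite.simps)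
    then show ?thesis
      by (simp only: shuffle_sum_length_signed shuffle_sum_signed) (simp only: signed_signed ac_simps)
  qed
  also have "\<dots> = signed (length ws - p - 1 + (length xs + Suc p)) (lf X (split_twist X [u] ?L (FOb ?T D)) (mf u ?z))"
    by (simp only: path_sum_length_signed path_sum_signed lin_path_sum lin_shuffle_sum length_drop) (simp only: signed_signed)
  also have "length ws - p - 1 + (length xs + Suc p) = length xs + length ws" using p by simp
  finally have "path_term (Suc p) (simp_first F) X (u # ws) D xs =
      signed (length xs + length ws) (lf X (split_twist X (u # ?L) ?R D) (lf X (split_twist X [u] ?L (FOb ?T D)) (mf u ?z)))"
    by (simp add: path_term_def lin_signed del: composite.simps)
  also have "lf X (split_twist X (u # ?L) ?R D) (lf X (split_twist X [u] ?L (FOb ?T D)) (mf u ?z)) =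
      lf X (cmp X (split_twist X (u # ?L) ?R D) (split_twist X [u] ?L (FOb ?T D))) (mf u ?z)"
    by (rule lf_cmp[OF X uo[OF oS] uo[OF so(2)] oL oX muz h1 h2, symmetric])
  also have "\<dots> = lf X (split_twist X [u] ws D) (lf X (FMor (Pull A u) (split_twist ?W ?L ?R D)) (mf u ?z))"
    unfolding coc
    by (rule lf_cmp[OF X uo[OF oS] uo[OF so(2)] uo[OF pull_total_ob[OF u(3) D]] oX muz h3 h4])
  also have "lf X (FMor (Pull A u) (split_twist ?W ?L ?R D)) (mf u ?z) = mf u (path_term p F ?W ws D xs)"
    unfolding path_term_def
    by (rule mf_lf[OF u(1,2) oS so(2) pull_total_ob[OF u(3) D] vz so(3), symmetric])
  finally show ?thesis .
qed

text \<open>Taking off the first arrow and cutting off a last part commute, by the cocycle condition and because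
  restriction is compatible with the left action. A cut at 0 leaves no first arrow to take off, so the remaining cuts
  correspond to those of the simplex without its first arrow.\<close>

lemma path_part_simp_first:
  assumes F: "cochain_values F" and us: "composable U X us" and xs: "arrows (target U X us) D xs"
  shows "path_part (simp_first F) X us D xs + simp_first (path_part F) X us D xs = 0"
proof (cases us)
  case Nil
  then show ?thesis by (simp add: path_part_def simp_first_def)
next
  case (Cons u ws)
  let ?G = "\<lambda>p. lf X (split_twist X [u] ws D) (mf u (path_term p F (Cod U u) ws D xs))"
  have "path_part (simp_first F) X us D xs = signed (length xs) (\<Sum>p<length ws. path_term (Suc p) (simp_first F) X us D xs)"
    unfolding path_part_def Cons length_Cons sum.lessThan_Suc_shift
    by (simp add: path_term_def[of 0] simp_first_def[abs_def])
  also have "\<dots> = signed (length xs) (\<Sum>p<length ws. signed (length xs + length ws) (?G p))"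
    using path_term_simp_first[OF F us[unfolded Cons] xs[unfolded Cons]] by (simp add: Cons del: composite.simps)
  also have "\<dots> = signed (length ws) (\<Sum>p<length ws. ?G p)"
    by (simp only: signed_sum[symmetric] signed_signed) (auto simp: signed_def)
  finally have 1: "path_part (simp_first F) X us D xs = signed (length ws) (\<Sum>p<length ws. ?G p)" .
  have "simp_first (path_part F) X us D xs = signed (length us + length xs) (signed (length xs) (\<Sum>p<length ws. ?G p))"
    by (simp add: simp_first_def path_part_def Cons lin_signed lin_sum del: composite.simps)
  also have "\<dots> = - signed (length ws) (\<Sum>p<length ws. ?G p)"
    by (simp add: Cons signed_def)
  finally show ?thesis using 1 by simp
qed

text \<open>The 36 products of the six pieces, in groups that cancel by the preceding lemmas.\<close>

theorem formal_d_formal_d: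
  assumes F: "cochain_values F" and us: "composable U X us" and xs: "arrows (target U X us) D xs"
  shows "formal_d (formal_d F) X us D xs = 0"
proof -
  have add: "hoch_left (\<lambda>X us D xs. f X us D xs + g X us D xs) X us D xs = hoch_left f X us D xs + hoch_left g X us D xs"
    "hoch_inner (\<lambda>X us D xs. f X us D xs + g X us D xs) X us D xs = hoch_inner f X us D xs + hoch_inner g X us D xs"
    "hoch_right (\<lambda>X us D xs. f X us D xs + g X us D xs) X us D xs = hoch_right f X us D xs + hoch_right g X us D xs"
    "simp_first (\<lambda>X us D xs. f X us D xs + g X us D xs) X us D xs = simp_first f X us D xs + simp_first g X us D xs"
    "simp_inner (\<lambda>X us D xs. f X us D xs + g X us D xs) X us D xs = simp_inner f X us D xs + simp_inner g X us D xs"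
    "path_part (\<lambda>X us D xs. f X us D xs + g X us D xs) X us D xs = path_part f X us D xs + path_part g X us D xs"
    for f g :: "('o, 'u, 'a, 'f, 'm \<Rightarrow>\<^sub>0 int) formal_cochain"
    by (auto simp: hoch_left_def hoch_inner_def hoch_right_def simp_first_def simp_inner_def path_part_def path_term_def
        lin_add signed_add inner_bd_add sum.distrib shuffle_sum_add path_sum_add split: list.split)
  have fd: "formal_d F = (\<lambda>X us D xs. hoch_left F X us D xs + hoch_inner F X us D xs + hoch_right F X us D xs
     + simp_first F X us D xs + simp_inner F X us D xs + path_part F X us D xs)"
    by (simp add: formal_d_def[abs_def])
  have "formal_d (formal_d F) X us D xs =
      (hoch_left (hoch_left F) X us D xs + hoch_left (hoch_inner F) X us D xs + hoch_inner (hoch_left F) X us D xs)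
    + hoch_inner (hoch_inner F) X us D xs
    + (hoch_left (hoch_right F) X us D xs + hoch_right (hoch_left F) X us D xs)
    + (hoch_right (hoch_right F) X us D xs + hoch_right (hoch_inner F) X us D xs + hoch_inner (hoch_right F) X us D xs)
    + (simp_first (simp_first F) X us D xs + simp_first (simp_inner F) X us D xs + simp_inner (simp_first F) X us D xs)
    + simp_inner (simp_inner F) X us D xs
    + (hoch_left (simp_first F) X us D xs + simp_first (hoch_left F) X us D xs)
    + (hoch_inner (simp_first F) X us D xs + simp_first (hoch_inner F) X us D xs)
    + (hoch_right (simp_first F) X us D xs + simp_first (hoch_right F) X us D xs)
    + (hoch_left (simp_inner F) X us D xs + simp_inner (hoch_left F) X us D xs)
    + (hoch_inner (simp_inner F) X us D xs + simp_inner (hoch_inner F) X us D xs)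
    + (hoch_right (simp_inner F) X us D xs + simp_inner (hoch_right F) X us D xs)
    + (path_part (hoch_left F) X us D xs + hoch_left (path_part F) X us D xs + path_part (path_part F) X us D xs)
    + (path_part (hoch_inner F) X us D xs + hoch_inner (path_part F) X us D xs)
    + (path_part (hoch_right F) X us D xs + hoch_right (path_part F) X us D xs
      + path_part (simp_inner F) X us D xs + simp_inner (path_part F) X us D xs)
    + (path_part (simp_first F) X us D xs + simp_first (path_part F) X us D xs)"
    unfolding formal_d_def[of "formal_d F"] unfolding fd add by (simp only: ac_simps)
  then show ?thesis
    by (simp only: hoch_hoch[OF assms] simp_simp[OF assms] hoch_simp_first[OF assms] hoch_simp_inner[OF assms]
      path_part_left_cancel[OF assms] path_part_hoch_inner[OF assms] path_part_right_cancel[OF assms]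
      path_part_simp_first[OF assms] add_0)
qed

end

section \<open>Evaluation of formal sums\<close>

text \<open>Summands outside the carrier are dropped, so that evaluation is additive on all formal sums and not
  only on those with entries in the module.\<close>

definition evaluate :: "('k, 'm) module \<Rightarrow> ('m \<Rightarrow>\<^sub>0 int) \<Rightarrow> 'm" where
  "evaluate N c = (\<Oplus>\<^bsub>N\<^esub>x\<in>Poly_Mapping.keys c \<inter> carrier N. [Poly_Mapping.lookup c x] \<cdot>\<^bsub>N\<^esub> x)"

context abelian_group
begin

lemma add_pow_int_zero [simp]: "[(0::int)] \<cdot> x = \<zero>"
  and add_pow_int_one [simp]: "x \<in> carrier G \<Longrightarrow> [(1::int)] \<cdot> x = x"
  and add_pow_int_closed [intro, simp]: "x \<in> carrier G \<Longrightarrow> [(n::int)] \<cdot> x \<in> carrier G"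
  and add_pow_int_add: "x \<in> carrier G \<Longrightarrow> [(m + n::int)] \<cdot> x = [m] \<cdot> x \<oplus> [n] \<cdot> x"
  and add_pow_int_neg: "x \<in> carrier G \<Longrightarrow> [(- n::int)] \<cdot> x = \<ominus> ([n] \<cdot> x)"
  using group.int_pow_closed[OF a_group, of x n] group.int_pow_mult[OF a_group, of x m n]
    group.int_pow_neg[OF a_group, of x n] group.int_pow_1[OF a_group, of x]
  by (simp_all add: add_pow_def a_inv_def)

lemma evaluate_superset:
  fixes c :: "'a \<Rightarrow>\<^sub>0 int"
  assumes "finite K" "Poly_Mapping.keys c \<inter> carrier G \<subseteq> K" "K \<subseteq> carrier G"
  shows "(\<Oplus>x\<in>Poly_Mapping.keys c \<inter> carrier G. [Poly_Mapping.lookup c x] \<cdot> x) = (\<Oplus>x\<in>K. [Poly_Mapping.lookup c x] \<cdot> x)"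
proof (rule add.finprod_mono_neutral_cong_left)
  fix i assume "i \<in> K - (Poly_Mapping.keys c \<inter> carrier G)"
  then have "Poly_Mapping.lookup c i = 0" "i \<in> carrier G" using assms by (auto simp: in_keys_iff)
  then show "[Poly_Mapping.lookup c i] \<cdot> i = \<zero>" by simp
qed (use assms in auto)

end

lemma evaluate_add:
  assumes "abelian_group N"
  shows "evaluate N (a + b) = evaluate N a \<oplus>\<^bsub>N\<^esub> evaluate N b"
proof -
  interpret N: abelian_group N by fact
  let ?K = "(Poly_Mapping.keys a \<union> Poly_Mapping.keys b) \<inter> carrier N"
  have f: "finite ?K" "?K \<subseteq> carrier N" by auto
  have "evaluate N (a + b) = (\<Oplus>\<^bsub>N\<^esub>x\<in>?K. [Poly_Mapping.lookup (a + b) x] \<cdot>\<^bsub>N\<^esub> x)"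
    unfolding evaluate_def by (rule N.evaluate_superset) (use f keys_add[of a b] in auto)
  also have "\<dots> = (\<Oplus>\<^bsub>N\<^esub>x\<in>?K. [Poly_Mapping.lookup a x] \<cdot>\<^bsub>N\<^esub> x \<oplus>\<^bsub>N\<^esub> [Poly_Mapping.lookup b x] \<cdot>\<^bsub>N\<^esub> x)"
    by (rule N.add.finprod_cong') (auto simp: lookup_add N.add_pow_int_add)
  also have "\<dots> = (\<Oplus>\<^bsub>N\<^esub>x\<in>?K. [Poly_Mapping.lookup a x] \<cdot>\<^bsub>N\<^esub> x) \<oplus>\<^bsub>N\<^esub> (\<Oplus>\<^bsub>N\<^esub>x\<in>?K. [Poly_Mapping.lookup b x] \<cdot>\<^bsub>N\<^esub> x)"
    by (rule N.finsum_addf) auto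
  also have "(\<Oplus>\<^bsub>N\<^esub>x\<in>?K. [Poly_Mapping.lookup a x] \<cdot>\<^bsub>N\<^esub> x) = evaluate N a"
    unfolding evaluate_def by (rule N.evaluate_superset[symmetric]) (use f in auto)
  also have "(\<Oplus>\<^bsub>N\<^esub>x\<in>?K. [Poly_Mapping.lookup b x] \<cdot>\<^bsub>N\<^esub> x) = evaluate N b"
    unfolding evaluate_def by (rule N.evaluate_superset[symmetric]) (use f in auto)
  finally show ?thesis .
qed

lemma evaluate_closed: "abelian_group N \<Longrightarrow> evaluate N a \<in> carrier N"
proof -
  assume "abelian_group N"
  then interpret N: abelian_group N .
  show ?thesis unfolding evaluate_def by (rule N.finsum_closed) auto
qed

lemma evaluate_zero: "abelian_group N \<Longrightarrow> evaluate N 0 = \<zero>\<^bsub>N\<^esub>"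
  unfolding evaluate_def using abelian_monoid.finsum_empty[of N] by (simp add: abelian_group_def)

lemma evaluate_of: "abelian_group N \<Longrightarrow> x \<in> carrier N \<Longrightarrow> evaluate N (frag_of x) = x"
proof -
  assume "abelian_group N" and x: "x \<in> carrier N"
  then interpret N: abelian_group N by simp
  have "{x} \<inter> carrier N = {x}" using x by auto
  then show ?thesis using x by (simp add: evaluate_def)
qed

lemma evaluate_uminus: "abelian_group N \<Longrightarrow> evaluate N (- a) = \<ominus>\<^bsub>N\<^esub> evaluate N a"
proof -
  assume N: "abelian_group N"
  then interpret N: abelian_group N .
  have "evaluate N (- a) \<oplus>\<^bsub>N\<^esub> evaluate N a = \<zero>\<^bsub>N\<^esub>"
    using evaluate_add[OF N, of "- a" a] evaluate_zero[OF N] by simp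
  then show ?thesis
    by (metis N N.minus_equality evaluate_closed)
qed

lemma evaluate_signed: "abelian_group N \<Longrightarrow> evaluate N (signed n a) = [((- 1 :: int) ^ n)] \<cdot>\<^bsub>N\<^esub> evaluate N a"
proof -
  assume N: "abelian_group N"
  then interpret N: abelian_group N .
  have c: "evaluate N a \<in> carrier N" by (rule evaluate_closed[OF N])
  show ?thesis
    using c by (cases "even n") (auto simp: signed_def evaluate_uminus[OF N] N.add_pow_int_neg)
qed

lemma evaluate_sum:
  "abelian_group N \<Longrightarrow> finite I \<Longrightarrow> evaluate N (sum f I) = (\<Oplus>\<^bsub>N\<^esub>i\<in>I. evaluate N (f i))"
proof -
  assume N: "abelian_group N" and I: "finite I"
  interpret N: abelian_group N by (rule N)
  from I show ?thesis
    by (induction I rule: finite_induct) (auto simp: evaluate_zero[OF N] evaluate_add[OF N] evaluate_closed[OF N])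
qed

lemma evaluate_lin:
  assumes N: "abelian_group N" and N': "abelian_group N'" and g: "g \<in> carrier N \<rightarrow> carrier N'"
    and add: "\<And>x y. x \<in> carrier N \<Longrightarrow> y \<in> carrier N \<Longrightarrow> g (x \<oplus>\<^bsub>N\<^esub> y) = g x \<oplus>\<^bsub>N'\<^esub> g y"
    and c: "Poly_Mapping.keys c \<subseteq> carrier N"
  shows "evaluate N' (extend_linearly g c) = g (evaluate N c)"
proof -
  interpret N: abelian_group N by fact
  interpret N': abelian_group N' by fact
  have z: "g \<zero>\<^bsub>N\<^esub> = \<zero>\<^bsub>N'\<^esub>"
  proof -
    have "g \<zero>\<^bsub>N\<^esub> \<oplus>\<^bsub>N'\<^esub> g \<zero>\<^bsub>N\<^esub> = g \<zero>\<^bsub>N\<^esub>" using add[of "\<zero>\<^bsub>N\<^esub>" "\<zero>\<^bsub>N\<^esub>"] by simp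
    then show ?thesis using g by (metis N'.add.r_cancel_one' N.zero_closed Pi_iff)
  qed
  have m: "g (\<ominus>\<^bsub>N\<^esub> x) = \<ominus>\<^bsub>N'\<^esub> g x" if "x \<in> carrier N" for x
  proof -
    have "g (\<ominus>\<^bsub>N\<^esub> x) \<oplus>\<^bsub>N'\<^esub> g x = \<zero>\<^bsub>N'\<^esub>" using add[of "\<ominus>\<^bsub>N\<^esub> x" x] that z by (simp add: N.l_neg)
    then show ?thesis
      by (rule N'.minus_equality[symmetric]) (use g that in \<open>auto simp: Pi_iff\<close>)
  qed
  show ?thesis
    using c
  proof (induction c rule: frag_induction)
    case zero
    then show ?case by (simp add: evaluate_zero[OF N] evaluate_zero[OF N'] z)
  next
    case (one x)
    then show ?case using g by (simp add: evaluate_of[OF N] evaluate_of[OF N'] Pi_iff)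
  next
    case (diff a b)
    have "evaluate N' (extend_linearly g (a + - b)) = g (evaluate N (a + - b))"
      using diff
      by (simp only: lin_add lin_uminus evaluate_add[OF N'] evaluate_add[OF N] evaluate_uminus[OF N'] evaluate_uminus[OF N])
        (simp add: add m evaluate_closed[OF N])
    then show ?case by simp
  qed
qed

section \<open>Shuffle permutations as words\<close>

abbreviation trues :: "bool list \<Rightarrow> nat" where "trues w \<equiv> length (filter (\<lambda>b. b) w)"
abbreviation falses :: "bool list \<Rightarrow> nat" where "falses w \<equiv> length (filter Not w)"

text \<open>A shuffle is a word with \<open>m\<close> letters \<open>True\<close>, the positions of arrows, and \<open>l\<close> letters
  \<open>False\<close>, the positions of transformations. The inversions below are the pairs of a transformation
  before an arrow.\<close>

definition words :: "nat \<Rightarrow> nat \<Rightarrow> bool list set" where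
  "words m l = {w. trues w = m \<and> falses w = l}"

fun inversions :: "bool list \<Rightarrow> nat" where
  "inversions [] = 0"
| "inversions (b # w) = (if b then 0 else trues w) + inversions w"

lemma words_length: "w \<in> words m l \<Longrightarrow> length w = m + l"
  unfolding words_def using sum_length_filter_compl[of "\<lambda>b. b" w] by auto

lemma finite_words [simp]: "finite (words m l)"
  using finite_lists_length_eq[of "UNIV :: bool set" "m + l"]
  by (rule finite_subset[rotated]) (auto simp: words_length)

lemma words_0_0: "words 0 0 = {[]}"
  by (auto dest: words_length) (simp add: words_def)

lemma words_Suc_0: "words (Suc m) 0 = Cons True ` words m 0"
proof -
  have "w \<in> Cons True ` words m 0" if "w \<in> words (Suc m) 0" for w
    using that by (cases w) (auto simp: words_def split: if_splits)
  then show ?thesis by (auto simp: words_def)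
qed

lemma words_0_Suc: "words 0 (Suc l) = Cons False ` words 0 l"
proof -
  have "w \<in> Cons False ` words 0 l" if "w \<in> words 0 (Suc l)" for w
    using that by (cases w) (auto simp: words_def split: if_splits)
  then show ?thesis by (auto simp: words_def)
qed

lemma words_Suc_Suc: "words (Suc m) (Suc l) = Cons True ` words m (Suc l) \<union> Cons False ` words (Suc m) l"
proof -
  have "w \<in> Cons True ` words m (Suc l) \<union> Cons False ` words (Suc m) l" if "w \<in> words (Suc m) (Suc l)" for w
    using that by (cases w) (auto simp: words_def split: if_splits)
  then show ?thesis by (auto simp: words_def)
qed

fun word_chain where
  "word_chain ob ac na D ((x, D') # xs) T ys (True # w) = (ac T x, ob T D') # word_chain ob ac na D' xs T ys w"
| "word_chain ob ac na D xs T ((y, T') # ys) (False # w) = (na y D, ob T' D) # word_chain ob ac na D xs T' ys w"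
| "word_chain ob ac na D xs T ys _ = []"

lemma shuffle_sum_words:
  fixes F :: "('z \<times> 'e) list \<Rightarrow> 'g::ab_group_add"
  shows "shuffle_sum ob ac na F D xs T ys =
    (\<Sum>w\<in>words (length xs) (length ys). signed (inversions w) (F (word_chain ob ac na D xs T ys w)))"
proof (induction D xs T ys arbitrary: F rule: pair_list_induct2)
  case (Nil_Nil D T)
  then show ?case by (simp add: words_0_0)
next
  case (Cons_Nil D x D' xs T)
  show ?case by (simp add: Cons_Nil words_Suc_0 sum.reindex)
next
  case (Nil_Cons D T y T' ys)
  have "signed (trues w + inversions w) z = signed (inversions w) z" if "w \<in> words 0 l" for w l and z :: 'g
    using that by (simp add: words_def)
  then show ?case by (simp add: Nil_Cons words_0_Suc sum.reindex)
next
  case (Cons_Cons D x D' xs T y T' ys)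
  let ?A = "(x, D') # xs" and ?B = "(y, T') # ys"
  have "(\<Sum>w\<in>words (length ?A) (length ?B). signed (inversions w) (F (word_chain ob ac na D ?A T ?B w))) =
    (\<Sum>w\<in>Cons True ` words (length xs) (length ?B). signed (inversions w) (F (word_chain ob ac na D ?A T ?B w))) +
    (\<Sum>w\<in>Cons False ` words (length ?A) (length ys). signed (inversions w) (F (word_chain ob ac na D ?A T ?B w)))"
    by (simp only: list.size add_0_right add_Suc_right words_Suc_Suc, rule sum.union_disjoint) auto
  also have "(\<Sum>w\<in>Cons True ` words (length xs) (length ?B). signed (inversions w) (F (word_chain ob ac na D ?A T ?B w))) =
      shuffle_sum ob ac na (\<lambda>c. F ((ac T x, ob T D') # c)) D' xs T ?B"
    by (simp add: Cons_Cons.IH(1) sum.reindex)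
  also have "(\<Sum>w\<in>Cons False ` words (length ?A) (length ys). signed (inversions w) (F (word_chain ob ac na D ?A T ?B w))) =
      (\<Sum>w\<in>words (length ?A) (length ys). signed (length ?A) (signed (inversions w)
        (F ((na y D, ob T' D) # word_chain ob ac na D ?A T' ys w))))"
    by (simp only: sum.reindex[OF inj_on_Cons1] o_def inversions.simps)
      (rule sum.cong, auto simp: words_def signed_signed)
  also have "\<dots> = signed (length ?A) (shuffle_sum ob ac na (\<lambda>c. F ((na y D, ob T' D) # c)) D ?A T' ys)"
    by (simp only: Cons_Cons.IH(2) signed_sum)
  finally show ?case by (simp del: words_def)
qed

lemma word_chain_length:
  "w \<in> words (length xs) (length ys) \<Longrightarrow> length (word_chain ob ac na D xs T ys w) = length w"
proof (induction w arbitrary: D xs T ys)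
  case (Cons b w)
  then show ?case
    by (cases b; cases xs; cases ys) (auto simp: words_def)
qed auto

lemma word_chain_nth:
  assumes "w \<in> words (length xs) (length ys)" "x < length w"
  shows "word_chain ob ac na D xs T ys w ! x =
    (if w ! x then ac ((T # map snd ys) ! falses (take x w)) (fst (xs ! trues (take x w)))
      else na (fst (ys ! falses (take x w))) ((D # map snd xs) ! trues (take x w)),
     ob ((T # map snd ys) ! falses (take (Suc x) w)) ((D # map snd xs) ! trues (take (Suc x) w)))"
  using assms
proof (induction w arbitrary: D xs T ys x)
  case (Cons b w)
  show ?case
  proof (cases b)
    case True
    with Cons.prems obtain a D' xs' where xs: "xs = (a, D') # xs'" by (cases xs) (auto simp: words_def)
    have w: "w \<in> words (length xs') (length ys)" using Cons.prems True xs by (simp add: words_def)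
    show ?thesis
    proof (cases x)
      case (Suc x')
      then show ?thesis using Cons.IH[OF w, of x' D' T] Cons.prems True xs by simp
    qed (use True xs in simp)
  next
    case False
    with Cons.prems obtain y T' ys' where ys: "ys = (y, T') # ys'" by (cases ys) (auto simp: words_def)
    have w: "w \<in> words (length xs) (length ys')" using Cons.prems False ys by (simp add: words_def)
    show ?thesis
    proof (cases x)
      case (Suc x')
      then show ?thesis using Cons.IH[OF w, of x' D T'] Cons.prems False ys by (cases xs) simp_all
    qed (use False ys in \<open>cases xs; simp\<close>)
  qed
qed simp

lemma words_snoc:
  "w @ [b] \<in> words m l \<longleftrightarrow> (if b then m > 0 \<and> w \<in> words (m - 1) l else l > 0 \<and> w \<in> words m (l - 1))"
  by (auto simp: words_def)

lemma words_eq_snoc: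
  assumes "m + l > 0"
  shows "words m l = (if l > 0 then (\<lambda>w. w @ [False]) ` words m (l - 1) else {}) \<union>
    (if m > 0 then (\<lambda>w. w @ [True]) ` words (m - 1) l else {})" (is "_ = ?R")
proof
  show "words m l \<subseteq> ?R"
  proof
    fix w assume w: "w \<in> words m l"
    then have "w \<noteq> []" using assms words_length[of w m l] by auto
    then obtain v b where v: "w = v @ [b]" by (metis rev_exhaust)
    show "w \<in> ?R" using w unfolding v words_snoc by (cases b) auto
  qed
  show "?R \<subseteq> words m l" by (auto simp: words_snoc)
qed

lemma inversions_snoc: "inversions (w @ [b]) = inversions w + (if b then falses w else 0)"
  by (induction w) auto

text \<open>The entries \<open>1, \<dots>, m\<close> of a shuffle permutation are the arrows; positions count from 1, letters from 0.\<close>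

definition word_of :: "nat \<Rightarrow> nat \<Rightarrow> (nat \<Rightarrow> nat) \<Rightarrow> bool list" where
  "word_of m l \<beta> = map (\<lambda>x. inv_into UNIV \<beta> (Suc x) \<le> m) [0..<m + l]"

lemma length_word_of [simp]: "length (word_of m l \<beta>) = m + l"
  by (simp add: word_of_def)

text \<open>The cycle that moves the entry \<open>m\<close> to the last position \<open>m + l\<close>. Composing with it extends a shuffle of
  \<open>m - 1\<close> and \<open>l\<close> entries by an arrow in last position, and its sign is the one of moving past \<open>l\<close> entries.\<close>

fun cycle_up :: "nat \<Rightarrow> nat \<Rightarrow> nat \<Rightarrow> nat" where
  "cycle_up m 0 = id"
| "cycle_up m (Suc l) = transpose (m + l) (m + Suc l) \<circ> cycle_up m l"

lemma cycle_up_eq: "cycle_up m l i = (if i = m then m + l else if m < i \<and> i \<le> m + l then i - 1 else i)"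
  by (induction l) (auto simp: transpose_def)

lemma cycle_up_permutes: "0 < m \<Longrightarrow> cycle_up m l permutes {1..m + l}"
proof (induction l)
  case (Suc l)
  have "cycle_up m l permutes {1..m + Suc l}"
    by (rule permutes_subset[OF Suc.IH[OF Suc.prems]]) auto
  moreover have "transpose (m + l) (m + Suc l) permutes {1..m + Suc l}"
    by (rule permutes_swap_id) (use Suc.prems in auto)
  ultimately show ?case unfolding cycle_up.simps by (rule permutes_compose)
qed (simp add: permutes_id)

lemma permutation_cycle_up: "permutation (cycle_up m l)"
proof (induction l)
  case (Suc l)
  then show ?case unfolding cycle_up.simps by (intro permutation_compose permutation_swap_id)
qed simp

lemma sign_cycle_up: "sign (cycle_up m l) = (- 1) ^ l"
proof (induction l)
  case (Suc l)
  then show ?case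
    unfolding cycle_up.simps by (subst sign_compose) (auto intro: permutation_swap_id permutation_cycle_up simp: sign_swap_id)
qed (simp add: sign_id)

lemma inv_cycle_up: "inv_into UNIV (cycle_up m l) j = (if j = m + l then m else if m \<le> j \<and> j < m + l then j + 1 else j)"
proof -
  have "bij (cycle_up m l)" using permutation_cycle_up by (simp add: permutation)
  moreover have "cycle_up m l (if j = m + l then m else if m \<le> j \<and> j < m + l then j + 1 else j) = j"
    by (auto simp: cycle_up_eq)
  ultimately show ?thesis by (intro inv_f_eq bij_is_inj)
qed

lemma shuffle_permsD:
  assumes "\<beta> \<in> shuffle_perms m l"
  shows "\<beta> permutes {1..m + l}" "\<And>i j. 1 \<le> i \<Longrightarrow> i < j \<Longrightarrow> j \<le> m \<Longrightarrow> \<beta> i < \<beta> j"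
    "\<And>i j. m < i \<Longrightarrow> i < j \<Longrightarrow> j \<le> m + l \<Longrightarrow> \<beta> i < \<beta> j"
  using assms unfolding shuffle_perms_def by (auto simp: strict_mono_on_def)

lemma shuffle_permsI:
  assumes "\<beta> permutes {1..m + l}" "\<And>i j. 1 \<le> i \<Longrightarrow> i < j \<Longrightarrow> j \<le> m \<Longrightarrow> \<beta> i < \<beta> j"
    "\<And>i j. m < i \<Longrightarrow> i < j \<Longrightarrow> j \<le> m + l \<Longrightarrow> \<beta> i < \<beta> j"
  shows "\<beta> \<in> shuffle_perms m l"
  using assms unfolding shuffle_perms_def by (auto simp: strict_mono_on_def)

lemma permutes_drop_last:
  assumes "\<beta> permutes {1..Suc n}" "\<beta> (Suc n) = Suc n"
  shows "\<beta> permutes {1..n}"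
  by (rule permutes_superset[OF assms(1)]) (use assms in \<open>auto simp: le_Suc_eq\<close>)

lemma shuffle_perms_last_right:
  "{\<beta> \<in> shuffle_perms m (Suc l). \<beta> (m + Suc l) = m + Suc l} = shuffle_perms m l"
proof (intro Set.set_eqI iffI)
  fix \<beta> assume "\<beta> \<in> {\<beta> \<in> shuffle_perms m (Suc l). \<beta> (m + Suc l) = m + Suc l}"
  then have b: "\<beta> \<in> shuffle_perms m (Suc l)" "\<beta> (Suc (m + l)) = Suc (m + l)" by auto
  show "\<beta> \<in> shuffle_perms m l"
    using permutes_drop_last[of \<beta> "m + l"] shuffle_permsD[OF b(1)] b(2) by (intro shuffle_permsI) auto
next
  fix \<beta> assume b: "\<beta> \<in> shuffle_perms m l"
  have f: "\<beta> (Suc (m + l)) = Suc (m + l)"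
    using shuffle_permsD(1)[OF b] by (auto simp: permutes_def)
  have le: "\<beta> i \<le> m + l" if "1 \<le> i" "i \<le> m + l" for i
    using permutes_in_image[OF shuffle_permsD(1)[OF b], of i] that by auto
  have "\<beta> \<in> shuffle_perms m (Suc l)"
  proof (rule shuffle_permsI)
    show "\<beta> permutes {1..m + Suc l}" by (rule permutes_subset[OF shuffle_permsD(1)[OF b]]) auto
    show "\<beta> i < \<beta> j" if "m < i" "i < j" "j \<le> m + Suc l" for i j
      using that shuffle_permsD(3)[OF b, of i j] le[of i] f by (cases "j = Suc (m + l)") auto
  qed (use shuffle_permsD(2)[OF b] in auto)
  then show "\<beta> \<in> {\<beta> \<in> shuffle_perms m (Suc l). \<beta> (m + Suc l) = m + Suc l}" using f by simp
qed

lemma shuffle_perms_last_left: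
  "bij_betw (\<lambda>\<gamma>. \<gamma> \<circ> cycle_up (Suc m) l) (shuffle_perms m l)
    {\<beta> \<in> shuffle_perms (Suc m) l. \<beta> (Suc m) = Suc m + l}"
proof (rule bij_betw_byWitness[where f' = "\<lambda>\<beta>. \<beta> \<circ> inv_into UNIV (cycle_up (Suc m) l)"])
  let ?k = "cycle_up (Suc m) l"
  have bij: "bij ?k" using permutation_cycle_up by (simp add: permutation)
  show "\<forall>\<gamma>\<in>shuffle_perms m l. (\<gamma> \<circ> ?k) \<circ> inv_into UNIV ?k = \<gamma>"
    using bij by (auto simp: fun_eq_iff surj_f_inv_f bij_is_surj)
  show "\<forall>\<beta>\<in>{\<beta> \<in> shuffle_perms (Suc m) l. \<beta> (Suc m) = Suc m + l}. (\<beta> \<circ> inv_into UNIV ?k) \<circ> ?k = \<beta>"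
    using bij by (auto simp: fun_eq_iff inv_f_f bij_is_inj)
  show "(\<lambda>\<gamma>. \<gamma> \<circ> ?k) ` shuffle_perms m l \<subseteq> {\<beta> \<in> shuffle_perms (Suc m) l. \<beta> (Suc m) = Suc m + l}"
  proof (intro image_subsetI CollectI conjI)
    fix \<gamma> assume g: "\<gamma> \<in> shuffle_perms m l"
    have f: "\<gamma> (Suc (m + l)) = Suc (m + l)"
      using shuffle_permsD(1)[OF g] by (auto simp: permutes_def)
    show "(\<gamma> \<circ> ?k) (Suc m) = Suc m + l" by (simp add: cycle_up_eq f)
    have le: "\<gamma> i \<le> m + l" if "1 \<le> i" "i \<le> m + l" for i
      using permutes_in_image[OF shuffle_permsD(1)[OF g], of i] that by auto
    show "\<gamma> \<circ> ?k \<in> shuffle_perms (Suc m) l"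
    proof (rule shuffle_permsI)
      show "\<gamma> \<circ> ?k permutes {1..Suc m + l}"
        by (intro permutes_compose cycle_up_permutes permutes_subset[OF shuffle_permsD(1)[OF g]]) auto
      show "(\<gamma> \<circ> ?k) i < (\<gamma> \<circ> ?k) j" if "1 \<le> i" "i < j" "j \<le> Suc m" for i j
        using that shuffle_permsD(2)[OF g, of i j] le[of i] f
        by (cases "j = Suc m") (auto simp: cycle_up_eq less_Suc_eq_le)
      show "(\<gamma> \<circ> ?k) i < (\<gamma> \<circ> ?k) j" if "Suc m < i" "i < j" "j \<le> Suc m + l" for i j
        using that shuffle_permsD(3)[OF g, of "i - 1" "j - 1"] by (auto simp: cycle_up_eq)
    qed
  qed
  show "(\<lambda>\<beta>. \<beta> \<circ> inv_into UNIV ?k) ` {\<beta> \<in> shuffle_perms (Suc m) l. \<beta> (Suc m) = Suc m + l} \<subseteq> shuffle_perms m l"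
  proof (intro image_subsetI)
    fix \<beta> assume "\<beta> \<in> {\<beta> \<in> shuffle_perms (Suc m) l. \<beta> (Suc m) = Suc m + l}"
    then have b: "\<beta> \<in> shuffle_perms (Suc m) l" "\<beta> (Suc m) = Suc (m + l)" by auto
    show "\<beta> \<circ> inv_into UNIV ?k \<in> shuffle_perms m l"
    proof (rule shuffle_permsI)
      show "\<beta> \<circ> inv_into UNIV ?k permutes {1..m + l}"
      proof (rule permutes_drop_last)
        show "\<beta> \<circ> inv_into UNIV ?k permutes {1..Suc (m + l)}"
          using permutes_compose[OF permutes_inv[OF cycle_up_permutes[of "Suc m" l]] shuffle_permsD(1)[OF b(1)]] by simp
        show "(\<beta> \<circ> inv_into UNIV ?k) (Suc (m + l)) = Suc (m + l)" by (simp add: inv_cycle_up b(2))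
      qed
      show "(\<beta> \<circ> inv_into UNIV ?k) i < (\<beta> \<circ> inv_into UNIV ?k) j" if "1 \<le> i" "i < j" "j \<le> m" for i j
        using that shuffle_permsD(2)[OF b(1), of i j] by (simp add: inv_cycle_up)
      show "(\<beta> \<circ> inv_into UNIV ?k) i < (\<beta> \<circ> inv_into UNIV ?k) j" if "m < i" "i < j" "j \<le> m + l" for i j
        using that shuffle_permsD(3)[OF b(1), of "i + 1" "j + 1"] by (simp add: inv_cycle_up)
    qed
  qed
qed

lemma shuffle_perms_last:
  assumes b: "\<beta> \<in> shuffle_perms m l" and "m + l > 0"
  shows "(m > 0 \<and> \<beta> m = m + l) \<or> (l > 0 \<and> \<beta> (m + l) = m + l)"
proof -
  note p = shuffle_permsD(1)[OF b]
  obtain i where i: "i \<in> {1..m + l}" "\<beta> i = m + l"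
    using permutes_image[OF p] assms(2) by (metis atLeastAtMost_iff imageE One_nat_def Suc_leI order_refl)
  have le: "\<beta> j \<le> m + l" if "j \<in> {1..m + l}" for j
    using permutes_in_image[OF p, of j] that by auto
  show ?thesis
  proof (cases "i \<le> m")
    case True
    then have "i = m" using shuffle_permsD(2)[OF b, of i m] le[of m] i by (cases "i < m") auto
    then show ?thesis using i True by auto
  next
    case False
    then have "i = m + l" using shuffle_permsD(3)[OF b, of i "m + l"] le[of "m + l"] i by (cases "i < m + l") auto
    then show ?thesis using i False by auto
  qed
qed

text \<open>By induction on the length. The last position of a shuffle holds the last transformation or the last arrow;
  removing it leaves a shorter shuffle, with the same sign in the first case, and in the second case with the sign
  changed by the \<open>l\<close> transformations that the arrow was moved past.\<close>

theorem shuffle_perms_words: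
  "bij_betw (word_of m l) (shuffle_perms m l) (words m l)
    \<and> (\<forall>\<beta>\<in>shuffle_perms m l. sign \<beta> = (- 1) ^ inversions (word_of m l \<beta>))"
proof (induction "m + l" arbitrary: m l rule: less_induct)
  case less
  show ?case
  proof (cases "m + l = 0")
    case True
    have "shuffle_perms 0 0 = {id}" by (auto simp: shuffle_perms_def permutes_empty strict_mono_on_def)
    then show ?thesis using True by (simp add: word_of_def words_0_0 sign_id bij_betw_def)
  next
    case False
    let ?A = "if m > 0 then {\<beta> \<in> shuffle_perms m l. \<beta> m = m + l} else {}"
    let ?R = "if l > 0 then {\<beta> \<in> shuffle_perms m l. \<beta> (m + l) = m + l} else {}"
    let ?WA = "if m > 0 then (\<lambda>w. w @ [True]) ` words (m - 1) l else {}"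
    let ?WR = "if l > 0 then (\<lambda>w. w @ [False]) ` words m (l - 1) else {}"
    have split: "shuffle_perms m l = ?R \<union> ?A" using shuffle_perms_last[of _ m l] False by auto
    have R: "bij_betw (word_of m l) ?R ?WR \<and> (\<forall>\<beta>\<in>?R. sign \<beta> = (- 1) ^ inversions (word_of m l \<beta>))"
    proof (cases l)
      case (Suc l')
      note ih = less[of m l'] and eq = shuffle_perms_last_right[of m l']
      have w: "word_of m l \<beta> = word_of m l' \<beta> @ [False]" if "\<beta> \<in> shuffle_perms m l'" for \<beta>
      proof -
        have "\<beta> (m + l) = m + l" "bij \<beta>" using shuffle_permsD(1)[OF that] permutes_bij by (auto simp: permutes_not_in Suc)
        then have "inv_into UNIV \<beta> (m + l) = m + l" by (intro inv_f_eq bij_is_inj)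
        then show ?thesis by (simp add: word_of_def Suc)
      qed
      have "bij_betw (word_of m l) (shuffle_perms m l') ((\<lambda>w. w @ [False]) ` words m l') \<longleftrightarrow>
          bij_betw ((\<lambda>w. w @ [False]) \<circ> word_of m l') (shuffle_perms m l') ((\<lambda>w. w @ [False]) ` words m l')"
        by (rule bij_betw_cong) (simp add: w)
      moreover have "bij_betw ((\<lambda>w. w @ [False]) \<circ> word_of m l') (shuffle_perms m l') ((\<lambda>w. w @ [False]) ` words m l')"
        using ih Suc by (intro bij_betw_trans[of "word_of m l'" _ "words m l'"]) (auto simp: bij_betw_def inj_on_def)
      ultimately show ?thesis using eq ih Suc w by (auto simp: inversions_snoc)
    qed (simp add: bij_betw_def)
    have A: "bij_betw (word_of m l) ?A ?WA \<and> (\<forall>\<beta>\<in>?A. sign \<beta> = (- 1) ^ inversions (word_of m l \<beta>))"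
    proof (cases m)
      case (Suc m')
      let ?k = "\<lambda>\<gamma>. \<gamma> \<circ> cycle_up m l"
      note ih = less[of m' l] and kb = shuffle_perms_last_left[of m' l, folded Suc]
      have w: "word_of m l (?k \<gamma>) = word_of m' l \<gamma> @ [True]" if g: "\<gamma> \<in> shuffle_perms m' l" for \<gamma>
      proof -
        note p = shuffle_permsD(1)[OF g]
        have bij: "bij \<gamma>" "bij (cycle_up m l)" using p permutes_bij permutation_cycle_up by (auto simp: permutation)
        have inv: "inv_into UNIV (?k \<gamma>) x = inv_into UNIV (cycle_up m l) (inv_into UNIV \<gamma> x)" for x
          using o_inv_distrib[OF bij] by simp
        have f: "inv_into UNIV \<gamma> (m + l) = m + l"
          using permutes_inv[OF p] by (auto simp: permutes_def Suc)
        have r: "inv_into UNIV \<gamma> x \<in> {1..m' + l}" if "x \<in> {1..m' + l}" for x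
          using permutes_in_image[OF permutes_inv[OF p]] that by blast
        have "inv_into UNIV (?k \<gamma>) x \<le> m \<longleftrightarrow> inv_into UNIV \<gamma> x \<le> m'" if "x \<in> {1..m' + l}" for x
          unfolding inv inv_cycle_up using r[OF that] by (auto simp: Suc)
        moreover have "inv_into UNIV (?k \<gamma>) (m + l) = m" by (simp add: inv inv_cycle_up f)
        ultimately show ?thesis by (simp add: word_of_def Suc)
      qed
      have "bij_betw (word_of m l) {\<beta> \<in> shuffle_perms m l. \<beta> m = m + l} ((\<lambda>w. w @ [True]) ` words m' l) \<longleftrightarrow>
          bij_betw (word_of m l \<circ> ?k) (shuffle_perms m' l) ((\<lambda>w. w @ [True]) ` words m' l)"
        by (rule bij_betw_comp_iff[OF kb])
      also have "\<dots> \<longleftrightarrow> bij_betw ((\<lambda>w. w @ [True]) \<circ> word_of m' l) (shuffle_perms m' l) ((\<lambda>w. w @ [True]) ` words m' l)"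
        by (rule bij_betw_cong) (simp add: w)
      also have "\<dots>"
        using ih Suc by (intro bij_betw_trans[of "word_of m' l" _ "words m' l"]) (auto simp: bij_betw_def inj_on_def)
      finally have b: "bij_betw (word_of m l) {\<beta> \<in> shuffle_perms m l. \<beta> m = m + l} ((\<lambda>w. w @ [True]) ` words m' l)" .
      have "sign \<beta> = (- 1) ^ inversions (word_of m l \<beta>)" if "\<beta> \<in> {\<beta> \<in> shuffle_perms m l. \<beta> m = m + l}" for \<beta>
      proof -
        have "\<beta> \<in> ?k ` shuffle_perms m' l" using that bij_betw_imp_surj_on[OF kb] by simp
        then obtain \<gamma> where g: "\<gamma> \<in> shuffle_perms m' l" "\<beta> = ?k \<gamma>" by (rule imageE) simp
        have "permutation \<gamma>" unfolding permutation_permutes using shuffle_permsD(1)[OF g(1)] by auto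
        then have "sign \<beta> = sign \<gamma> * (- 1) ^ l"
          using g(2) sign_compose[of \<gamma> "cycle_up m l"] permutation_cycle_up sign_cycle_up by simp
        moreover have "falses (word_of m' l \<gamma>) = l"
          using ih g(1) Suc by (auto simp: bij_betw_def words_def)
        ultimately show ?thesis using ih g Suc w[OF g(1)] by (simp add: inversions_snoc power_add)
      qed
      then show ?thesis using b Suc by simp
    qed (simp add: bij_betw_def)
    have "?WR \<inter> ?WA = {}" by auto
    then have "bij_betw (word_of m l) (?R \<union> ?A) (?WR \<union> ?WA)" using R A by (intro bij_betw_combine) auto
    then have "bij_betw (word_of m l) (shuffle_perms m l) (words m l)"
      using split words_eq_snoc[of m l] False by simp
    moreover have "\<forall>\<beta>\<in>shuffle_perms m l. sign \<beta> = (- 1) ^ inversions (word_of m l \<beta>)"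
    proof (rule ballI)
      fix \<beta> assume b: "\<beta> \<in> shuffle_perms m l"
      then have "\<beta> \<in> ?R \<or> \<beta> \<in> ?A" using shuffle_perms_last[OF b] False by auto
      then show "sign \<beta> = (- 1) ^ inversions (word_of m l \<beta>)"
        using bspec[OF conjunct2[OF R]] bspec[OF conjunct2[OF A]] by (elim disjE)
    qed
    ultimately show ?thesis by blast
  qed
qed

section \<open>Shuffled simplices as chains\<close>

text \<open>Chains are listed from the target, the objects of a simplex from the source.\<close>

definition vertices :: "'d \<Rightarrow> ('x \<times> 'd) list \<Rightarrow> 'd list" where
  "vertices D xs = rev (D # map snd xs)"

lemma length_vertices [simp]: "length (vertices D xs) = Suc (length xs)"
  by (simp add: vertices_def)

lemma hd_vertices [simp]: "hd (vertices D xs) = start D xs"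
  by (simp add: vertices_def start_def hd_rev)

lemma last_vertices [simp]: "last (vertices D xs) = D"
  by (simp add: vertices_def)

lemma vertices_nth: "i \<le> length xs \<Longrightarrow> vertices D xs ! (length xs - i) = (D # map snd xs) ! i"
  unfolding vertices_def by (subst rev_nth) auto

lemma chain_nth:
  "chain V H D xs \<longleftrightarrow> (\<forall>i<Suc (length xs). V ((D # map snd xs) ! i)) \<and>
    (\<forall>i<length xs. H (map snd xs ! i) ((D # map snd xs) ! i) (map fst xs ! i))"
proof (induction xs arbitrary: D)
  case (Cons p xs)
  obtain x D' where p: "p = (x, D')" by (cases p)
  show ?case
    by (auto simp: p Cons.IH All_less_Suc2)
qed auto

lemma as_before_word:
  assumes b: "\<beta> \<in> shuffle_perms m l" and x: "x \<le> m + l"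
  shows "as_before m \<beta> (Suc x) = trues (take x (word_of m l \<beta>))"
    and "rs_before m l \<beta> (Suc x) = falses (take x (word_of m l \<beta>))"
proof -
  note p = shuffle_permsD(1)[OF b]
  have bij: "bij \<beta>" using p by (rule permutes_bij)
  have inv: "inv_into UNIV \<beta> (\<beta> i) = i" "\<beta> (inv_into UNIV \<beta> i) = i" for i
    using bij by (auto simp: inv_f_f bij_is_inj surj_f_inv_f bij_is_surj)
  have im: "\<beta> i \<in> {1..m + l}" if "i \<in> {1..m + l}" for i using permutes_in_image[OF p] that by blast
  have im': "inv_into UNIV \<beta> i \<in> {1..m + l}" if "i \<in> {1..m + l}" for i
    using permutes_in_image[OF permutes_inv[OF p]] that by blast
  have nth: "word_of m l \<beta> ! j = (inv_into UNIV \<beta> (Suc j) \<le> m)" if "j < x" for j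
    using that x by (simp add: word_of_def)
  have "trues (take x (word_of m l \<beta>)) = card {j. j < x \<and> inv_into UNIV \<beta> (Suc j) \<le> m}"
    using x nth by (auto simp: length_filter_conv_card intro!: arg_cong[where f = card])
  also have "\<dots> = card {i \<in> {1..m}. \<beta> i < Suc x}"
  proof (rule bij_betw_same_card, rule bij_betw_byWitness[where f' = "\<lambda>i. \<beta> i - 1"])
    show "(\<lambda>j. inv_into UNIV \<beta> (Suc j)) ` {j. j < x \<and> inv_into UNIV \<beta> (Suc j) \<le> m} \<subseteq> {i \<in> {1..m}. \<beta> i < Suc x}"
      using im' x by (fastforce simp: inv)
    show "(\<lambda>i. \<beta> i - 1) ` {i \<in> {1..m}. \<beta> i < Suc x} \<subseteq> {j. j < x \<and> inv_into UNIV \<beta> (Suc j) \<le> m}"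
    proof (intro image_subsetI CollectI conjI)
      fix i assume i: "i \<in> {i \<in> {1..m}. \<beta> i < Suc x}"
      then have "1 \<le> \<beta> i" using im[of i] by auto
      then show "\<beta> i - 1 < x" "inv_into UNIV \<beta> (Suc (\<beta> i - 1)) \<le> m" using i inv by auto
    qed
    show "\<forall>a\<in>{i \<in> {1..m}. \<beta> i < Suc x}. inv_into UNIV \<beta> (Suc (\<beta> a - 1)) = a"
    proof
      fix i assume i: "i \<in> {i \<in> {1..m}. \<beta> i < Suc x}"
      then have "1 \<le> \<beta> i" using im[of i] by auto
      then show "inv_into UNIV \<beta> (Suc (\<beta> i - 1)) = i" using inv by auto
    qed
  qed (simp add: inv)
  finally show "as_before m \<beta> (Suc x) = trues (take x (word_of m l \<beta>))" by (simp add: as_before_def)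
  have "falses (take x (word_of m l \<beta>)) = card {j. j < x \<and> \<not> inv_into UNIV \<beta> (Suc j) \<le> m}"
    using x nth by (auto simp: length_filter_conv_card intro!: arg_cong[where f = card])
  also have "\<dots> = card {i \<in> {m + 1..m + l}. \<beta> i < Suc x}"
  proof (rule bij_betw_same_card, rule bij_betw_byWitness[where f' = "\<lambda>i. \<beta> i - 1"])
    show "(\<lambda>j. inv_into UNIV \<beta> (Suc j)) ` {j. j < x \<and> \<not> inv_into UNIV \<beta> (Suc j) \<le> m} \<subseteq> {i \<in> {m + 1..m + l}. \<beta> i < Suc x}"
      using im' x by (fastforce simp: inv)
    show "(\<lambda>i. \<beta> i - 1) ` {i \<in> {m + 1..m + l}. \<beta> i < Suc x} \<subseteq> {j. j < x \<and> \<not> inv_into UNIV \<beta> (Suc j) \<le> m}"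
    proof (intro image_subsetI CollectI conjI)
      fix i assume i: "i \<in> {i \<in> {m + 1..m + l}. \<beta> i < Suc x}"
      then have "1 \<le> \<beta> i" using im[of i] by auto
      then show "\<beta> i - 1 < x" "\<not> inv_into UNIV \<beta> (Suc (\<beta> i - 1)) \<le> m" using i inv by auto
    qed
    show "\<forall>a\<in>{i \<in> {m + 1..m + l}. \<beta> i < Suc x}. inv_into UNIV \<beta> (Suc (\<beta> a - 1)) = a"
    proof
      fix i assume i: "i \<in> {i \<in> {m + 1..m + l}. \<beta> i < Suc x}"
      then have "1 \<le> \<beta> i" using im[of i] by auto
      then show "inv_into UNIV \<beta> (Suc (\<beta> i - 1)) = i" using inv by auto
    qed
  qed (simp add: inv)
  finally show "rs_before m l \<beta> (Suc x) = falses (take x (word_of m l \<beta>))" by (simp add: rs_before_def)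
qed

text \<open>The arrows in positions before the one of the \<open>i\<close>-th arrow are the first \<open>i - 1\<close>
  arrows, because shuffles are increasing; likewise for the transformations.\<close>

lemma before_index:
  assumes b: "\<beta> \<in> shuffle_perms m l" and i: "1 \<le> i" "i \<le> m + l"
  shows "i \<le> m \<Longrightarrow> as_before m \<beta> (\<beta> i) = i - 1" and "m < i \<Longrightarrow> rs_before m l \<beta> (\<beta> i) = i - m - 1"
proof -
  have a: "\<beta> j < \<beta> i \<longleftrightarrow> j < i" if "1 \<le> j" "j \<le> m" "i \<le> m" for j
    using that shuffle_permsD(2)[OF b, of i j] shuffle_permsD(2)[OF b, of j i] i
    by (cases j i rule: linorder_cases) auto
  have r: "\<beta> j < \<beta> i \<longleftrightarrow> j < i" if "m < j" "j \<le> m + l" "m < i" for j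
    using that shuffle_permsD(3)[OF b, of i j] shuffle_permsD(3)[OF b, of j i] i
    by (cases j i rule: linorder_cases) auto
  show "as_before m \<beta> (\<beta> i) = i - 1" if "i \<le> m"
  proof -
    have "{j \<in> {1..m}. \<beta> j < \<beta> i} = {1..<i}" using a that by auto
    then show ?thesis by (simp add: as_before_def)
  qed
  show "rs_before m l \<beta> (\<beta> i) = i - m - 1" if "m < i"
  proof -
    have "{j \<in> {m + 1..m + l}. \<beta> j < \<beta> i} = {m + 1..<i}" using r that i by auto
    then show ?thesis by (simp add: rs_before_def)
  qed
qed

abbreviation mor_word_chain where
  "mor_word_chain \<equiv> word_chain FOb FMor (\<lambda>\<eta> B. \<eta> B)"

lemma word_of_words: "\<beta> \<in> shuffle_perms m l \<Longrightarrow> word_of m l \<beta> \<in> words m l"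
  using shuffle_perms_words[of m l] by (auto simp: bij_betw_def)

lemma trues_take_le: "w \<in> words m l \<Longrightarrow> trues (take x w) \<le> m"
  and falses_take_le: "w \<in> words m l \<Longrightarrow> falses (take x w) \<le> l"
proof -
  assume w: "w \<in> words m l"
  have "w = take x w @ drop x w" by simp
  then have "trues w = trues (take x w) + trues (drop x w)" "falses w = falses (take x w) + falses (drop x w)"
    by (metis filter_append length_append)+
  then show "trues (take x w) \<le> m" "falses (take x w) \<le> l" using w by (auto simp: words_def)
qed

text \<open>The entry of a shuffled simplex in a given position depends on the numbers of arrows and transformations
  before it. These numbers are prefix counts of the word of the permutation, and the same counts describe how far the
  recursion along the word has advanced in the two chains.\<close>

lemma shuffle_arrows_word_chain:
  fixes c :: "(('a \<Rightarrow> 'f) \<times> ('a, 'f) lfun) list"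
  assumes b: "\<beta> \<in> shuffle_perms (length xs) (length c)"
  shows "shuffle_arrows \<beta> (vertices T c) (map fst c) (vertices D xs) (map fst xs) =
      map fst (mor_word_chain D xs T c (word_of (length xs) (length c) \<beta>))"
    and "shuffle_objects \<beta> (vertices T c) (map fst c) (vertices D xs) (map fst xs) =
      vertices (FOb T D) (mor_word_chain D xs T c (word_of (length xs) (length c) \<beta>))"
proof -
  let ?m = "length xs" and ?l = "length c"
  let ?w = "word_of ?m ?l \<beta>"
  let ?W = "mor_word_chain D xs T c ?w"
  note w = word_of_words[OF b] and p = shuffle_permsD(1)[OF b]
  have lW: "length ?W = ?m + ?l" using word_chain_length[OF w] by simp
  have bij: "bij \<beta>" using p by (rule permutes_bij)
  have inv: "\<beta> (inv_into UNIV \<beta> i) = i" for i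
    using bij by (auto simp: surj_f_inv_f bij_is_surj)
  show "shuffle_arrows \<beta> (vertices T c) (map fst c) (vertices D xs) (map fst xs) = map fst ?W"
  proof (rule nth_equalityI)
    show "length (shuffle_arrows \<beta> (vertices T c) (map fst c) (vertices D xs) (map fst xs)) = length (map fst ?W)"
      by (simp add: shuffle_arrows_def lW Let_def del: upt_Suc)
    fix x assume "x < length (shuffle_arrows \<beta> (vertices T c) (map fst c) (vertices D xs) (map fst xs))"
    then have x: "x < ?m + ?l" by (simp add: shuffle_arrows_def Let_def del: upt_Suc)
    let ?i = "inv_into UNIV \<beta> (Suc x)"
    have i: "?i \<in> {1..?m + ?l}"
      using permutes_in_image[OF permutes_inv[OF p], of "Suc x"] x by auto
    have wx: "?w ! x = (?i \<le> ?m)" using x by (simp add: word_of_def)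
    note bw = as_before_word[OF b less_imp_le[OF x]]
    have arr: "shuffle_arrows \<beta> (vertices T c) (map fst c) (vertices D xs) (map fst xs) ! x =
        (if ?i \<le> ?m then FMor (vertices T c ! (?l - rs_before ?m ?l \<beta> (Suc x))) (map fst xs ! (?i - 1))
         else (map fst c ! (?i - ?m - 1)) (vertices D xs ! (?m - as_before ?m \<beta> (Suc x))))"
      using x by (simp add: shuffle_arrows_def Let_def del: upt_Suc)
    show "shuffle_arrows \<beta> (vertices T c) (map fst c) (vertices D xs) (map fst xs) ! x = map fst ?W ! x"
    proof (cases "?i \<le> ?m")
      case True
      have t: "trues (take x ?w) = ?i - 1"
        using before_index(1)[OF b, of ?i] i True bw(1) by (simp add: inv)
      then have "trues (take x ?w) < ?m" using i True by auto
      then show ?thesis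
        using x lW True wx t i
        by (simp add: arr word_chain_nth[OF w] bw(2) vertices_nth[OF falses_take_le[OF w]])
    next
      case False
      have t: "falses (take x ?w) = ?i - ?m - 1"
        using before_index(2)[OF b, of ?i] i False bw(2) by (simp add: inv)
      then have "falses (take x ?w) < ?l" using i False by auto
      then show ?thesis
        using x lW False wx t i
        by (simp add: arr word_chain_nth[OF w] bw(1) vertices_nth[OF trues_take_le[OF w]])
    qed
  qed
  show "shuffle_objects \<beta> (vertices T c) (map fst c) (vertices D xs) (map fst xs) = vertices (FOb T D) ?W"
  proof (rule nth_equalityI)
    show "length (shuffle_objects \<beta> (vertices T c) (map fst c) (vertices D xs) (map fst xs)) = length (vertices (FOb T D) ?W)"
      by (simp add: shuffle_objects_def lW Let_def del: upt_Suc)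
    fix j assume "j < length (shuffle_objects \<beta> (vertices T c) (map fst c) (vertices D xs) (map fst xs))"
    then have j: "j \<le> ?m + ?l" by (simp add: shuffle_objects_def Let_def del: upt_Suc)
    let ?x = "?m + ?l - j"
    have x: "?x \<le> ?m + ?l" by simp
    have "shuffle_objects \<beta> (vertices T c) (map fst c) (vertices D xs) (map fst xs) ! j =
        FOb (vertices T c ! (?l - rs_before ?m ?l \<beta> (Suc ?x))) (vertices D xs ! (?m - as_before ?m \<beta> (Suc ?x)))"
      using j by (simp add: shuffle_objects_def Let_def Suc_diff_le del: upt_Suc)
    also have "\<dots> = FOb ((T # map snd c) ! falses (take ?x ?w)) ((D # map snd xs) ! trues (take ?x ?w))"
      unfolding as_before_word[OF b x] by (simp add: vertices_nth falses_take_le[OF w] trues_take_le[OF w])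
    also have "\<dots> = (FOb T D # map snd ?W) ! ?x"
      using lW by (cases ?x) (auto simp: word_chain_nth[OF w])
    also have "\<dots> = vertices (FOb T D) ?W ! j"
      using vertices_nth[of ?x ?W "FOb T D"] lW j by simp
    finally show "shuffle_objects \<beta> (vertices T c) (map fst c) (vertices D xs) (map fst xs) ! j = vertices (FOb T D) ?W ! j" .
  qed
qed

lemma sum_shuffle_perms:
  fixes F :: "('f \<times> 'a) list \<Rightarrow> 'g::ab_group_add" and c :: "(('a \<Rightarrow> 'f) \<times> ('a, 'f) lfun) list"
  shows "\<Sigma>sh F D xs T c = (\<Sum>\<beta>\<in>shuffle_perms (length xs) (length c).
    signed (inversions (word_of (length xs) (length c) \<beta>)) (F (mor_word_chain D xs T c (word_of (length xs) (length c) \<beta>))))"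
  unfolding shuffle_sum_words
  by (rule sum.reindex_bij_betw[symmetric]) (use shuffle_perms_words in blast)

section \<open>Multilinear formal cochains\<close>

lemma linear_mapsD:
  assumes "f \<in> linear_maps k M N"
  shows "x \<in> carrier M \<Longrightarrow> f x \<in> carrier N"
    and "x \<in> carrier M \<Longrightarrow> y \<in> carrier M \<Longrightarrow> f (x \<oplus>\<^bsub>M\<^esub> y) = f x \<oplus>\<^bsub>N\<^esub> f y"
    and "r \<in> carrier k \<Longrightarrow> x \<in> carrier M \<Longrightarrow> f (r \<odot>\<^bsub>M\<^esub> x) = r \<odot>\<^bsub>N\<^esub> f x"
  using assms by (auto simp: linear_maps_def)

lemma linear_mapsI:
  assumes "\<And>x. x \<in> carrier M \<Longrightarrow> f x \<in> carrier N"
    and "\<And>x y. x \<in> carrier M \<Longrightarrow> y \<in> carrier M \<Longrightarrow> f (x \<oplus>\<^bsub>M\<^esub> y) = f x \<oplus>\<^bsub>N\<^esub> f y"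
    and "\<And>r x. r \<in> carrier k \<Longrightarrow> x \<in> carrier M \<Longrightarrow> f (r \<odot>\<^bsub>M\<^esub> x) = r \<odot>\<^bsub>N\<^esub> f x"
  shows "f \<in> linear_maps k M N"
  using assms by (auto simp: linear_maps_def)

lemma linear_maps_cong:
  assumes M: "module k M" and f: "f \<in> linear_maps k M N" and eq: "\<And>x. x \<in> carrier M \<Longrightarrow> f x = g x"
  shows "g \<in> linear_maps k M N"
proof -
  interpret M: module k M by fact
  show ?thesis
    by (rule linear_mapsI) (use linear_mapsD[OF f] in \<open>auto simp: eq[symmetric]\<close>)
qed

lemma linear_maps_zero: "module k N \<Longrightarrow> (\<lambda>x. \<zero>\<^bsub>N\<^esub>) \<in> linear_maps k M N"
proof -
  assume "module k N"
  then interpret N: module k N .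
  show ?thesis by (rule linear_mapsI) auto
qed

lemma linear_maps_add:
  assumes N: "module k N" and f: "f \<in> linear_maps k M N" and g: "g \<in> linear_maps k M N"
  shows "(\<lambda>x. f x \<oplus>\<^bsub>N\<^esub> g x) \<in> linear_maps k M N"
proof -
  interpret N: module k N by fact
  show ?thesis
    by (rule linear_mapsI) (use linear_mapsD[OF f] linear_mapsD[OF g] in \<open>auto simp: N.smult_r_distr N.a_ac\<close>)
qed

lemma linear_maps_uminus:
  assumes N: "module k N" and f: "f \<in> linear_maps k M N"
  shows "(\<lambda>x. \<ominus>\<^bsub>N\<^esub> f x) \<in> linear_maps k M N"
proof -
  interpret N: module k N by fact
  show ?thesis
    by (rule linear_mapsI) (use linear_mapsD[OF f] in \<open>auto simp: N.smult_r_minus N.minus_add\<close>)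
qed

lemma linear_maps_id: "(\<lambda>x. x) \<in> linear_maps k M M"
  by (auto simp: linear_maps_def)

definition replace_arrow :: "nat \<Rightarrow> 'f \<Rightarrow> ('f \<times> 'a) list \<Rightarrow> ('f \<times> 'a) list" where
  "replace_arrow i x xs = xs[i := (x, snd (xs ! i))]"

lemma map_snd_replace [simp]: "map snd (replace_arrow i x xs) = map snd xs"
  by (cases "i < length xs") (auto simp: replace_arrow_def map_update list_update_same_conv list_update_beyond)

lemma map_fst_replace [simp]: "map fst (replace_arrow i x xs) = (map fst xs)[i := x]"
  by (simp add: replace_arrow_def map_update)

lemma length_replace [simp]: "length (replace_arrow i x xs) = length xs"
  by (simp add: replace_arrow_def)

lemma replace_Cons [simp]:
  "replace_arrow 0 x (p # xs) = (x, snd p) # xs"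
  "replace_arrow (Suc i) x (p # xs) = p # replace_arrow i x xs"
  by (simp_all add: replace_arrow_def)

lemma start_replace [simp]: "start D (replace_arrow i x xs) = start D xs"
  by (simp add: start_def)

context prestack_bimodule
begin

lemma bim_group: "X \<in> Obj U \<Longrightarrow> B \<in> ob X \<Longrightarrow> D \<in> ob X \<Longrightarrow> abelian_group (Bim M X B D)"
  using bim_module by (blast dest: module.axioms)

lemma hom_modules: "X \<in> Obj U \<Longrightarrow> B \<in> ob X \<Longrightarrow> D \<in> ob X \<Longrightarrow> module k (LHom (Cat A X) B D)"
  using linear_category.hom_module[OF cat] by blast

lemma evaluate_lf:
  assumes "X \<in> Obj U" "B \<in> ob X" "D \<in> ob X" "E \<in> ob X" "b \<in> hom X D E" "valued X B D c"
  shows "evaluate (Bim M X B E) (lf X b c) = lact M X b (evaluate (Bim M X B D) c)"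
  by (rule evaluate_lin) (use assms lact_linear_right[OF assms(1-5)] in \<open>auto simp: bim_group valued_def linear_maps_def\<close>)

lemma evaluate_rf:
  assumes "X \<in> Obj U" "B \<in> ob X" "D \<in> ob X" "E \<in> ob X" "a \<in> hom X B D" "valued X D E c"
  shows "evaluate (Bim M X B E) (rf X c a) = ract M X (evaluate (Bim M X D E) c) a"
  by (rule evaluate_lin[where g = "\<lambda>x. ract M X x a"])
    (use assms ract_linear_left[OF assms(1-5)] in \<open>auto simp: bim_group valued_def linear_maps_def\<close>)

lemma evaluate_mf:
  assumes "u \<in> Arr U" "Dom U u = X" "B \<in> ob (Cod U u)" "D \<in> ob (Cod U u)" "valued (Cod U u) B D c"
  shows "evaluate (Bim M X (FOb (Pull A u) B) (FOb (Pull A u) D)) (mf u c) = Res M u (evaluate (Bim M (Cod U u) B D) c)"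
  by (rule evaluate_lin)
    (use assms res_linear[OF assms(1,3,4)] linear_functor_ob[OF pull[OF assms(1)]] in
      \<open>auto simp: bim_group cod_closed dom_closed valued_def linear_maps_def\<close>)

abbreviation arrow_module where
  "arrow_module Y D xs i \<equiv> LHom (Cat A Y) (map snd xs ! i) ((D # map snd xs) ! i)"

text \<open>Linearity of the evaluated cochain in each arrow of the simplex \<open>xs\<close>, the others being kept. Formal sums
  themselves do not depend linearly on the arrows, only their evaluations do. Only the linear structure of the hom
  modules is involved, so the objects of the simplex stay fixed.\<close>

definition linear_at where
  "linear_at Y D X B E h xs \<longleftrightarrow> valued X B E (h xs) \<and>
     (\<forall>i<length xs. (\<forall>x\<in>carrier (arrow_module Y D xs i). valued X B E (h (replace_arrow i x xs))) \<and>
       (\<lambda>x. evaluate (Bim M X B E) (h (replace_arrow i x xs))) \<in> linear_maps k (arrow_module Y D xs i) (Bim M X B E))"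

lemma linear_at_cong:
  assumes "linear_at Y D X B E h xs" "\<And>ys. map snd ys = map snd xs \<Longrightarrow> h ys = h' ys"
  shows "linear_at Y D X B E h' xs"
  using assms(1) assms(2)[of xs] assms(2)[OF map_snd_replace] by (simp add: linear_at_def)

context
  fixes X B E
  assumes XBE: "X \<in> Obj U" "B \<in> ob X" "E \<in> ob X"
begin

lemma linear_at_zero: "linear_at Y D X B E (\<lambda>xs. 0) xs"
  by (auto simp: linear_at_def evaluate_zero[OF bim_group[OF XBE]] intro: linear_maps_zero[OF bim_module[OF XBE]])

lemma linear_at_add:
  "linear_at Y D X B E f xs \<Longrightarrow> linear_at Y D X B E g xs \<Longrightarrow> linear_at Y D X B E (\<lambda>xs. f xs + g xs) xs"
  by (auto simp: linear_at_def evaluate_add[OF bim_group[OF XBE]] intro!: valued_add linear_maps_add[OF bim_module[OF XBE]])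

lemma linear_at_uminus: "linear_at Y D X B E f xs \<Longrightarrow> linear_at Y D X B E (\<lambda>xs. - f xs) xs"
  by (auto simp: linear_at_def evaluate_uminus[OF bim_group[OF XBE]] intro!: valued_uminus linear_maps_uminus[OF bim_module[OF XBE]])

lemma linear_at_signed: "linear_at Y D X B E f xs \<Longrightarrow> linear_at Y D X B E (\<lambda>xs. signed n (f xs)) xs"
  by (cases "even n") (auto simp: signed_def linear_at_uminus)

lemma linear_at_sum:
  "(\<And>i. i \<in> I \<Longrightarrow> linear_at Y D X B E (f i) xs) \<Longrightarrow> linear_at Y D X B E (\<lambda>xs. \<Sum>i\<in>I. f i xs) xs"
  by (induction I rule: infinite_finite_induct) (auto simp: linear_at_zero intro!: linear_at_add)

end

lemma arrow_module_module:
  assumes "Y \<in> Obj U" "arrows Y D xs" "i < length xs"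
  shows "module k (arrow_module Y D xs i)"
proof -
  have "\<forall>j<Suc (length xs). (D # map snd xs) ! j \<in> ob Y" using assms(2) by (simp add: chain_nth)
  from this[rule_format, of i] this[rule_format, of "Suc i"] show ?thesis
    using assms by (auto intro!: hom_modules)
qed

lemma arrows_replace:
  assumes "arrows Y D xs" "x \<in> carrier (arrow_module Y D xs i)" "i < length xs"
  shows "arrows Y D (replace_arrow i x xs)"
  using assms unfolding chain_nth by (auto simp: nth_list_update)

lemma linear_at_lf:
  assumes Y: "Y \<in> Obj U" "arrows Y D xs" and X: "X \<in> Obj U" "B \<in> ob X" "E \<in> ob X" "E' \<in> ob X" and b: "b \<in> hom X E E'"
    and h: "linear_at Y D X B E h xs"
  shows "linear_at Y D X B E' (\<lambda>xs. lf X b (h xs)) xs"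
  unfolding linear_at_def
proof (intro conjI allI impI ballI)
  show "valued X B E' (lf X b (h xs))" using h by (auto simp: linear_at_def intro!: valued_lf[OF X b])
  fix i assume i: "i < length xs"
  show "valued X B E' (lf X b (h (replace_arrow i x xs)))" if "x \<in> carrier (arrow_module Y D xs i)" for x
    using h that i by (auto simp: linear_at_def intro!: valued_lf[OF X b])
  show "(\<lambda>x. evaluate (Bim M X B E') (lf X b (h (replace_arrow i x xs)))) \<in> linear_maps k (arrow_module Y D xs i) (Bim M X B E')"
    by (rule linear_maps_cong[OF arrow_module_module[OF Y i]
          linear_maps_compose[OF _ lact_linear_right[OF X b], of "\<lambda>x. evaluate (Bim M X B E) (h (replace_arrow i x xs))"]])
      (use h i in \<open>auto simp: linear_at_def evaluate_lf[OF X b]\<close>)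
qed

lemma linear_at_rf:
  assumes Y: "Y \<in> Obj U" "arrows Y D xs" and X: "X \<in> Obj U" "B \<in> ob X" "B' \<in> ob X" "E \<in> ob X" and a: "a \<in> hom X B B'"
    and h: "linear_at Y D X B' E h xs"
  shows "linear_at Y D X B E (\<lambda>xs. rf X (h xs) a) xs"
  unfolding linear_at_def
proof (intro conjI allI impI ballI)
  show "valued X B E (rf X (h xs) a)" using h by (auto simp: linear_at_def intro!: valued_rf[OF X a])
  fix i assume i: "i < length xs"
  show "valued X B E (rf X (h (replace_arrow i x xs)) a)" if "x \<in> carrier (arrow_module Y D xs i)" for x
    using h that i by (auto simp: linear_at_def intro!: valued_rf[OF X a])
  show "(\<lambda>x. evaluate (Bim M X B E) (rf X (h (replace_arrow i x xs)) a)) \<in> linear_maps k (arrow_module Y D xs i) (Bim M X B E)"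
    by (rule linear_maps_cong[OF arrow_module_module[OF Y i]
          linear_maps_compose[OF _ ract_linear_left[OF X a], of "\<lambda>x. evaluate (Bim M X B' E) (h (replace_arrow i x xs))"]])
      (use h i in \<open>auto simp: linear_at_def evaluate_rf[OF X a]\<close>)
qed

lemma linear_at_mf:
  assumes Y: "Y \<in> Obj U" "arrows Y D xs" and u: "u \<in> Arr U" "Dom U u = X" "B \<in> ob (Cod U u)" "E \<in> ob (Cod U u)"
    and h: "linear_at Y D (Cod U u) B E h xs"
  shows "linear_at Y D X (FOb (Pull A u) B) (FOb (Pull A u) E) (\<lambda>xs. mf u (h xs)) xs"
  unfolding linear_at_def
proof (intro conjI allI impI ballI)
  show "valued X (FOb (Pull A u) B) (FOb (Pull A u) E) (mf u (h xs))"
    using h by (auto simp: linear_at_def intro!: valued_mf[OF u])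
  fix i assume i: "i < length xs"
  show "valued X (FOb (Pull A u) B) (FOb (Pull A u) E) (mf u (h (replace_arrow i x xs)))"
    if "x \<in> carrier (arrow_module Y D xs i)" for x
    using h that i by (auto simp: linear_at_def intro!: valued_mf[OF u])
  show "(\<lambda>x. evaluate (Bim M X (FOb (Pull A u) B) (FOb (Pull A u) E)) (mf u (h (replace_arrow i x xs)))) \<in>
      linear_maps k (arrow_module Y D xs i) (Bim M X (FOb (Pull A u) B) (FOb (Pull A u) E))"
    by (rule linear_maps_cong[OF arrow_module_module[OF Y i]
          linear_maps_compose[OF _ res_linear[OF u(1,3,4), unfolded u(2)], of "\<lambda>x. evaluate (Bim M (Cod U u) B E) (h (replace_arrow i x xs))"]])
      (use h i in \<open>auto simp: linear_at_def evaluate_mf[OF u]\<close>)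
qed

text \<open>If replacing an arrow of \<open>xs\<close> changes a single arrow of the simplex \<open>g xs\<close>, and that by a linear map,
  then linearity is inherited. This covers faces, pullbacks and shuffles.\<close>

lemma linear_at_substitute:
  assumes Y: "Y \<in> Obj U" "arrows Y D xs" and h: "linear_at Y' D' X B E h (g xs)"
    and g: "\<And>i. i < length xs \<Longrightarrow> \<exists>j f. j < length (g xs) \<and>
      f \<in> linear_maps k (arrow_module Y D xs i) (arrow_module Y' D' (g xs) j) \<and>
      (\<forall>x\<in>carrier (arrow_module Y D xs i). g (replace_arrow i x xs) = replace_arrow j (f x) (g xs))"
  shows "linear_at Y D X B E (\<lambda>xs. h (g xs)) xs"
  unfolding linear_at_def
proof (intro conjI allI impI)
  show "valued X B E (h (g xs))" using h by (simp add: linear_at_def)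
  fix i assume i: "i < length xs"
  obtain j f where j: "j < length (g xs)" and f: "f \<in> linear_maps k (arrow_module Y D xs i) (arrow_module Y' D' (g xs) j)"
    and e: "\<And>x. x \<in> carrier (arrow_module Y D xs i) \<Longrightarrow> g (replace_arrow i x xs) = replace_arrow j (f x) (g xs)"
    using g[OF i] by auto
  show "\<forall>x\<in>carrier (arrow_module Y D xs i). valued X B E (h (g (replace_arrow i x xs)))"
    using h j linear_mapsD(1)[OF f] by (simp add: linear_at_def e)
  show "(\<lambda>x. evaluate (Bim M X B E) (h (g (replace_arrow i x xs)))) \<in> linear_maps k (arrow_module Y D xs i) (Bim M X B E)"
    by (rule linear_maps_cong[OF arrow_module_module[OF Y i]
          linear_maps_compose[OF f, of "\<lambda>y. evaluate (Bim M X B E) (h (replace_arrow j y (g xs)))"]])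
      (use h j in \<open>auto simp: linear_at_def e\<close>)
qed

end

lemma map_snd_contract:
  "Suc i < length xs \<Longrightarrow> map snd (contract (paste m) i xs) = take i (map snd xs) @ drop (Suc i) (map snd xs)"
proof (induction i arbitrary: xs)
  case 0
  then obtain x B y E ys where "xs = (x, B) # (y, E) # ys" by (cases xs; cases "tl xs") auto
  then show ?case by simp
next
  case (Suc i)
  then obtain p ys where "xs = p # ys" by (cases xs) auto
  then show ?case using Suc by simp
qed

text \<open>Merging is bilinear, so replacing an arrow before merging replaces one arrow after merging, by a
  composite if the arrow was involved.\<close>

lemma contract_replace:
  "Suc i < length xs \<Longrightarrow> j < length xs \<Longrightarrow> contract (paste m) i (replace_arrow j x xs) =
    replace_arrow (if j \<le> i then j else j - 1)
      (if j = i then m x (fst (xs ! Suc i)) else if j = Suc i then m (fst (xs ! i)) x else x) (contract (paste m) i xs)"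
proof (induction i arbitrary: xs j)
  case 0
  then obtain a B b E ys where xs: "xs = (a, B) # (b, E) # ys" by (cases xs; cases "tl xs") auto
  show ?case
  proof (cases j)
    case (Suc j')
    then show ?thesis by (cases j') (auto simp: xs replace_arrow_def)
  qed (simp add: xs)
next
  case (Suc i)
  then obtain p ys where xs: "xs = p # ys" by (cases xs) auto
  show ?case
  proof (cases j)
    case 0
    then show ?thesis by (cases p) (simp add: xs)
  next
    case (Suc j')
    then show ?thesis using Suc.IH[of ys j'] Suc.prems by (cases j') (auto simp: xs)
  qed
qed

text \<open>Each arrow of \<open>xs\<close> occurs exactly once in a shuffle, with some functor of the path applied.\<close>

lemma word_chain_replace:
  assumes "w \<in> words (length xs) (length c)" "i < length xs"
  shows "\<exists>j T'. j < length w \<and> T' \<in> set (T # map snd c) \<and>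
    map snd (mor_word_chain D xs T c w) ! j = FOb T' (map snd xs ! i) \<and>
    (FOb T D # map snd (mor_word_chain D xs T c w)) ! j = FOb T' ((D # map snd xs) ! i) \<and>
    (\<forall>x. mor_word_chain D (replace_arrow i x xs) T c w = replace_arrow j (FMor T' x) (mor_word_chain D xs T c w))"
  using assms
proof (induction w arbitrary: D xs T c i)
  case Nil
  then show ?case by (simp add: words_def)
next
  case (Cons b w)
  show ?case
  proof (cases b)
    case True
    with Cons.prems obtain a D' xs' where xs: "xs = (a, D') # xs'" by (cases xs) (auto simp: words_def)
    have w: "w \<in> words (length xs') (length c)" using Cons.prems True xs by (simp add: words_def)
    show ?thesis
    proof (cases i)
      case 0
      show ?thesis
        by (rule exI[of _ 0], rule exI[of _ T]) (simp add: 0 xs True)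
    next
      case (Suc i')
      then have "i' < length xs'" using Cons.prems xs by simp
      from Cons.IH[OF w this, of T D'] obtain j T' where "j < length w" "T' \<in> set (T # map snd c)"
        "map snd (mor_word_chain D' xs' T c w) ! j = FOb T' (map snd xs' ! i')"
        "(FOb T D' # map snd (mor_word_chain D' xs' T c w)) ! j = FOb T' ((D' # map snd xs') ! i')"
        "\<forall>x. mor_word_chain D' (replace_arrow i' x xs') T c w = replace_arrow j (FMor T' x) (mor_word_chain D' xs' T c w)"
        by blast
      then show ?thesis
        by (intro exI[of _ "Suc j"] exI[of _ T']) (simp add: Suc xs True)
    qed
  next
    case False
    with Cons.prems obtain y T1 c' where c: "c = (y, T1) # c'" by (cases c) (auto simp: words_def)
    have w: "w \<in> words (length xs) (length c')" using Cons.prems False c by (simp add: words_def)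
    from Cons.IH[OF w Cons.prems(2), of T1 D] obtain j T' where j: "j < length w" "T' \<in> set (T1 # map snd c')"
      "map snd (mor_word_chain D xs T1 c' w) ! j = FOb T' (map snd xs ! i)"
      "(FOb T1 D # map snd (mor_word_chain D xs T1 c' w)) ! j = FOb T' ((D # map snd xs) ! i)"
      "\<forall>x. mor_word_chain D (replace_arrow i x xs) T1 c' w = replace_arrow j (FMor T' x) (mor_word_chain D xs T1 c' w)"
      by blast
    have F: "mor_word_chain D zs T ((y, T1) # c') (False # w) = (y D, FOb T1 D) # mor_word_chain D zs T1 c' w" for zs
      by (cases zs) auto
    from j show ?thesis
      by (intro exI[of _ "Suc j"] exI[of _ T']) (auto simp: c False F)
  qed
qed

lemma word_chain_shuffles_of:
  "w \<in> words (length xs) (length ys) \<Longrightarrow> (D, xs, T, ys, word_chain ob ac na D xs T ys w) \<in> shuffles_of ob ac na"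
proof (induction w arbitrary: D xs T ys)
  case Nil
  then show ?case by (auto simp: words_def intro: shuffles_of.intros)
next
  case (Cons b w)
  show ?case
  proof (cases b)
    case True
    with Cons.prems obtain a D' xs' where xs: "xs = (a, D') # xs'" by (cases xs) (auto simp: words_def)
    have "w \<in> words (length xs') (length ys)" using Cons.prems True xs by (simp add: words_def)
    then show ?thesis using Cons.IH[of xs' ys D' T] xs True by (auto intro: shuffles_of.intros)
  next
    case False
    with Cons.prems obtain y T1 c' where c: "ys = (y, T1) # c'" by (cases ys) (auto simp: words_def)
    have w: "w \<in> words (length xs) (length c')" using Cons.prems False c by (simp add: words_def)
    have F: "word_chain ob ac na D xs T ((y, T1) # c') (False # w) = (na y D, ob T1 D) # word_chain ob ac na D xs T1 c' w"
      by (cases xs) auto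
    have b: "b = False" using False by simp
    show ?thesis unfolding c b F by (intro shuffles_of.intros(3) Cons.IH w)
  qed
qed

lemma chain_set: "chain V H T c \<Longrightarrow> T' \<in> set (T # map snd c) \<Longrightarrow> V T'"
proof (induction c arbitrary: T)
  case (Cons p c)
  then show ?case using Cons.IH[of "snd p"] by (cases p) (simp, blast)
qed simp

context prestack_bimodule
begin

definition multilinear where
  "multilinear F \<longleftrightarrow> (\<forall>X us D xs. composable U X us \<longrightarrow> arrows (target U X us) D xs \<longrightarrow>
     linear_at (target U X us) D X (FOb (pull_list A us) (start D xs)) (FOb (total_pull X us) D) (F X us D) xs)"

lemma multilinearD:
  "multilinear F \<Longrightarrow> composable U X us \<Longrightarrow> arrows (target U X us) D xs \<Longrightarrow>
     linear_at (target U X us) D X (FOb (pull_list A us) (start D xs)) (FOb (total_pull X us) D) (F X us D) xs"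
  unfolding multilinear_def by blast

lemma multilinear_values: "multilinear F \<Longrightarrow> cochain_values F"
  unfolding multilinear_def cochain_values_def linear_at_def by blast

lemma linear_at_hoch_left:
  assumes F: "multilinear F" and us: "composable U X us" and xs: "arrows (target U X us) D xs"
  shows "linear_at (target U X us) D X (FOb (pull_list A us) (start D xs)) (FOb (total_pull X us) D) (hoch_left F X us D) xs"
proof -
  let ?Y = "target U X us" and ?B = "FOb (pull_list A us) (start D xs)" and ?E = "FOb (total_pull X us) D"
  have X: "X \<in> Obj U" and Y: "?Y \<in> Obj U" using us by (auto intro: composable_source composable_target)
  note P = between_pull_total[OF us]
  have B: "?B \<in> ob X" using pull_list_ob[OF us arrows_start[OF xs]] .
  have E: "?E \<in> ob X" using pull_total_ob[OF us arrows_vertex[OF xs]] .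
  show ?thesis
  proof (cases xs)
    case Nil
    show ?thesis
      by (rule linear_at_cong[OF linear_at_zero[OF X B E]]) (simp add: Nil hoch_left_def)
  next
    case (Cons p zs)
    obtain x0 D1 where p: "p = (x0, D1)" by (cases p)
    have ar: "D \<in> ob ?Y" "D1 \<in> ob ?Y" "x0 \<in> hom ?Y D1 D" "arrows ?Y D1 zs"
      using xs Cons p by (auto dest: chain_vertex)
    have st: "start D xs = start D1 zs" by (simp add: Cons p)
    have E1: "FOb (total_pull X us) D1 \<in> ob X" using pull_total_ob[OF us ar(2)] .
    note G = multilinearD[OF F us ar(4), folded st]
    note h0 = linear_functor_mor[OF P ar(2,1,3)]
    note L = linear_at_lf[OF Y ar(4) X B E1 E h0 G]
    have v: "valued X ?B (FOb (total_pull X us) D1) (F X us D1 zs)" using G by (simp add: linear_at_def)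
    have rep: "fst (hd (replace_arrow 0 x xs)) = x" "tl (replace_arrow 0 x xs) = zs" for x
      by (simp_all add: Cons p)
    have am: "arrow_module ?Y D xs 0 = LHom (Cat A ?Y) D1 D" by (simp add: Cons p)
    have ami: "arrow_module ?Y D xs (Suc i) = arrow_module ?Y D1 zs i" for i by (simp add: Cons p)
    have repi: "fst (hd (replace_arrow (Suc i) x xs)) = x0" "tl (replace_arrow (Suc i) x xs) = replace_arrow i x zs" for i x
      by (simp_all add: Cons p)
    have lz: "length xs = Suc (length zs)" by (simp add: Cons)
    have "linear_at ?Y D X ?B ?E (\<lambda>ys. lf X (FMor (total_pull X us) (fst (hd ys))) (F X us D1 (tl ys))) xs"
      unfolding linear_at_def
    proof (intro conjI allI impI)
      show "valued X ?B ?E (lf X (FMor (total_pull X us) (fst (hd xs))) (F X us D1 (tl xs)))"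
        using L unfolding linear_at_def by (simp only: Cons p list.sel fst_conv)
      fix i assume i: "i < length xs"
      show "\<forall>x\<in>carrier (arrow_module ?Y D xs i). valued X ?B ?E
          (lf X (FMor (total_pull X us) (fst (hd (replace_arrow i x xs)))) (F X us D1 (tl (replace_arrow i x xs))))"
      proof (cases i)
        case 0
        show ?thesis
          unfolding 0 rep am by (intro ballI valued_lf[OF X B E1 E _ v] linear_functor_mor[OF P ar(2,1)])
      next
        case (Suc i')
        have "i' < length zs" using i Suc lz by simp
        then show ?thesis using L unfolding Suc ami repi linear_at_def by blast
      qed
      show "(\<lambda>x. evaluate (Bim M X ?B ?E) (lf X (FMor (total_pull X us) (fst (hd (replace_arrow i x xs))))
          (F X us D1 (tl (replace_arrow i x xs))))) \<in> linear_maps k (arrow_module ?Y D xs i) (Bim M X ?B ?E)"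
      proof (cases i)
        case 0
        have "(\<lambda>x. lact M X (FMor (total_pull X us) x) (evaluate (Bim M X ?B (FOb (total_pull X us) D1)) (F X us D1 zs)))
            \<in> linear_maps k (LHom (Cat A ?Y) D1 D) (Bim M X ?B ?E)"
          using linear_maps_compose[OF linear_functor_lin[OF P ar(2,1)]
              lact_linear_left[OF X B E1 E evaluate_closed[OF bim_group[OF X B E1]]]] .
        then show ?thesis
          unfolding 0 rep am
          by (rule linear_maps_cong[OF hom_modules[OF Y ar(2,1)]])
            (simp add: evaluate_lf[OF X B E1 E linear_functor_mor[OF P ar(2,1)] v])
      next
        case (Suc i')
        have "i' < length zs" using i Suc lz by simp
        then show ?thesis using L unfolding Suc ami repi linear_at_def by blast
      qed
    qed
    then show ?thesis
      by (rule linear_at_cong) (auto simp: Cons p hoch_left_def)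
  qed
qed

lemma linear_at_hoch_right:
  assumes F: "multilinear F" and us: "composable U X us" and xs: "arrows (target U X us) D xs"
  shows "linear_at (target U X us) D X (FOb (pull_list A us) (start D xs)) (FOb (total_pull X us) D) (hoch_right F X us D) xs"
proof -
  let ?Y = "target U X us" and ?B = "FOb (pull_list A us) (start D xs)" and ?E = "FOb (total_pull X us) D"
  have X: "X \<in> Obj U" and Y: "?Y \<in> Obj U" using us by (auto intro: composable_source composable_target)
  note S = between_pull_list[OF us]
  have B: "?B \<in> ob X" using pull_list_ob[OF us arrows_start[OF xs]] .
  have E: "?E \<in> ob X" using pull_total_ob[OF us arrows_vertex[OF xs]] .
  show ?thesis
  proof (cases xs rule: rev_cases)
    case Nil
    show ?thesis
      by (rule linear_at_cong[OF linear_at_zero[OF X B E]]) (simp add: Nil hoch_right_def)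
  next
    case (snoc zs p)
    obtain x0 D1 where p: "p = (x0, D1)" by (cases p)
    have ar: "arrows ?Y D zs" "x0 \<in> hom ?Y D1 (start D zs)" "D1 \<in> ob ?Y"
      using xs snoc p by (auto simp: chain_append)
    note st = arrows_start[OF ar(1)]
    have B1: "FOb (pull_list A us) (start D zs) \<in> ob X" using pull_list_ob[OF us st] .
    have Bx: "?B = FOb (pull_list A us) D1" by (simp add: snoc p)
    note G = multilinearD[OF F us ar(1)]
    note h0 = linear_functor_mor[OF S ar(3) st ar(2), folded Bx]
    note L = linear_at_rf[OF Y ar(1) X B B1 E h0 G]
    have v: "valued X (FOb (pull_list A us) (start D zs)) ?E (F X us D zs)" using G by (simp add: linear_at_def)
    have am: "arrow_module ?Y D xs (length zs) = LHom (Cat A ?Y) D1 (start D zs)"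
      by (auto simp: snoc p nth_append nth_Cons' start_def last_conv_nth)
    have ami: "arrow_module ?Y D xs i = arrow_module ?Y D zs i" if "i < length zs" for i
      using that by (auto simp: snoc nth_append nth_Cons')
    have rep: "replace_arrow (length zs) x xs = zs @ [(x, D1)]" for x
      by (simp add: replace_arrow_def snoc p)
    have repi: "replace_arrow i x xs = replace_arrow i x zs @ [p]" if "i < length zs" for i x
      using that by (simp add: replace_arrow_def snoc list_update_append nth_append)
    have "linear_at ?Y D X ?B ?E (\<lambda>ys. rf X (F X us D (butlast ys)) (FMor (pull_list A us) (fst (last ys)))) xs"
      unfolding linear_at_def
    proof (intro conjI allI impI)
      show "valued X ?B ?E (rf X (F X us D (butlast xs)) (FMor (pull_list A us) (fst (last xs))))"
        using L by (simp add: snoc p linear_at_def)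
      fix i assume i: "i < length xs"
      show "\<forall>x\<in>carrier (arrow_module ?Y D xs i). valued X ?B ?E
          (rf X (F X us D (butlast (replace_arrow i x xs))) (FMor (pull_list A us) (fst (last (replace_arrow i x xs)))))"
      proof (cases "i < length zs")
        case False
        then have "i = length zs" using i snoc by simp
        then show ?thesis
          using linear_functor_mor[OF S ar(3) st, folded Bx]
          by (auto simp: rep am intro!: valued_rf[OF X B B1 E _ v])
      next
        case True
        then show ?thesis using L unfolding ami[OF True] by (simp add: repi p linear_at_def)
      qed
      show "(\<lambda>x. evaluate (Bim M X ?B ?E) (rf X (F X us D (butlast (replace_arrow i x xs)))
          (FMor (pull_list A us) (fst (last (replace_arrow i x xs)))))) \<in> linear_maps k (arrow_module ?Y D xs i) (Bim M X ?B ?E)"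
      proof (cases "i < length zs")
        case False
        then have il: "i = length zs" using i snoc by simp
        have "(\<lambda>x. ract M X (evaluate (Bim M X (FOb (pull_list A us) (start D zs)) ?E) (F X us D zs)) (FMor (pull_list A us) x))
            \<in> linear_maps k (LHom (Cat A ?Y) D1 (start D zs)) (Bim M X ?B ?E)"
          using linear_maps_compose[OF linear_functor_lin[OF S ar(3) st, folded Bx]
              ract_linear_right[OF X B B1 E evaluate_closed[OF bim_group[OF X B1 E]]]] .
        then show ?thesis
          unfolding il am
          by (rule linear_maps_cong[OF hom_modules[OF Y ar(3) st]])
            (simp add: rep evaluate_rf[OF X B B1 E linear_functor_mor[OF S ar(3) st, folded Bx] v])
      next
        case True
        then show ?thesis using L unfolding ami[OF True] by (simp add: repi p linear_at_def)
      qed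
    qed
    then have "linear_at ?Y D X ?B ?E (\<lambda>ys. signed (length xs) (rf X (F X us D (butlast ys)) (FMor (pull_list A us) (fst (last ys))))) xs"
      by (rule linear_at_signed[OF X B E])
    then show ?thesis
    proof (rule linear_at_cong)
      fix ys :: "('f \<times> 'a) list" assume "map snd ys = map snd xs"
      then have "length ys = length xs" "ys \<noteq> []" using snoc by (metis length_map, auto)
      then show "signed (length xs) (rf X (F X us D (butlast ys)) (FMor (pull_list A us) (fst (last ys)))) = hoch_right F X us D ys"
        by (simp add: hoch_right_def)
    qed
  qed
qed

lemma linear_at_hoch_inner:
  assumes F: "multilinear F" and us: "composable U X us" and xs: "arrows (target U X us) D xs"
  shows "linear_at (target U X us) D X (FOb (pull_list A us) (start D xs)) (FOb (total_pull X us) D) (hoch_inner F X us D) xs"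
proof -
  let ?Y = "target U X us" and ?B = "FOb (pull_list A us) (start D xs)" and ?E = "FOb (total_pull X us) D"
  have X: "X \<in> Obj U" and Y: "?Y \<in> Obj U" using us by (auto intro: composable_source composable_target)
  have B: "?B \<in> ob X" using pull_list_ob[OF us arrows_start[OF xs]] .
  have E: "?E \<in> ob X" using pull_total_ob[OF us arrows_vertex[OF xs]] .
  interpret C: linear_category k "Cat A ?Y" using cat[OF Y] .
  have "linear_at ?Y D X ?B ?E (\<lambda>ys. F X us D (contract (paste (cmp ?Y)) n ys)) xs" if n: "Suc n < length xs" for n
  proof (rule linear_at_substitute[OF Y xs])
    let ?c = "contract (paste (cmp ?Y)) n"
    show "linear_at ?Y D X ?B ?E (F X us D) (?c xs)"
      using multilinearD[OF F us arrows_contract[OF Y n xs]] by (simp add: start_contract[OF n])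
    fix i assume i: "i < length xs"
    let ?f = "\<lambda>x. if i = n then cmp ?Y x (fst (xs ! Suc n)) else if i = Suc n then cmp ?Y (fst (xs ! n)) x else x"
    let ?j = "if i \<le> n then i else i - 1"
    have v: "\<And>j. j < Suc (length xs) \<Longrightarrow> (D # map snd xs) ! j \<in> ob ?Y"
      and h: "\<And>j. j < length xs \<Longrightarrow> fst (xs ! j) \<in> hom ?Y (map snd xs ! j) ((D # map snd xs) ! j)"
      using xs by (auto simp: chain_nth)
    have s: "\<And>j. j < length xs \<Longrightarrow> map snd xs ! j \<in> ob ?Y" using v[of "Suc _"] by auto
    have mc: "map snd (?c xs) ! ?j = (if i = n then map snd xs ! Suc n else map snd xs ! i)"
      "(D # map snd (?c xs)) ! ?j = (if i = Suc n then (D # map snd xs) ! n else (D # map snd xs) ! i)"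
    proof -
      consider "i \<le> n" | "i = Suc n" | j where "i = Suc (Suc j)" "n \<le> j"
        by (metis not_less_eq_eq le_antisym Suc_le_D Suc_le_mono)
      then show "map snd (?c xs) ! ?j = (if i = n then map snd xs ! Suc n else map snd xs ! i)"
        "(D # map snd (?c xs)) ! ?j = (if i = Suc n then (D # map snd xs) ! n else (D # map snd xs) ! i)"
        using n i unfolding map_snd_contract[OF n] by (cases; auto simp: nth_append nth_Cons' min_def)+
    qed
    have "?f \<in> linear_maps k (arrow_module ?Y D xs i) (arrow_module ?Y D (?c xs) ?j)"
    proof -
      consider "i = n" | "i = Suc n" | "i \<noteq> n" "i \<noteq> Suc n" by blast
      then show ?thesis
      proof cases
        case 1
        have "(\<lambda>x. cmp ?Y x (fst (xs ! Suc n))) \<in> linear_maps k (arrow_module ?Y D xs n) (LHom (Cat A ?Y) (map snd xs ! Suc n) ((D # map snd xs) ! n))"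
          using C.comp_linear_left[OF s[OF n] s[of n] v[of n], of "fst (xs ! Suc n)"] h[OF n] n by simp
        then show ?thesis unfolding mc using 1 by simp
      next
        case 2
        have "(\<lambda>x. cmp ?Y (fst (xs ! n)) x) \<in> linear_maps k (arrow_module ?Y D xs (Suc n)) (LHom (Cat A ?Y) (map snd xs ! Suc n) ((D # map snd xs) ! n))"
          using C.comp_linear_right[OF s[OF n] s[of n] v[of n], of "fst (xs ! n)"] h[of n] n by simp
        then show ?thesis unfolding mc using 2 by simp
      next
        case 3
        then show ?thesis unfolding mc by (simp add: linear_maps_id)
      qed
    qed
    moreover have "?j < length (?c xs)" using n i by (auto simp: length_contract)
    ultimately show "\<exists>j f. j < length (?c xs) \<and> f \<in> linear_maps k (arrow_module ?Y D xs i) (arrow_module ?Y D (?c xs) j) \<and>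
        (\<forall>x\<in>carrier (arrow_module ?Y D xs i). ?c (replace_arrow i x xs) = replace_arrow j (f x) (?c xs))"
      using contract_replace[OF n i, of "cmp ?Y"] by blast
  qed
  then have "linear_at ?Y D X ?B ?E (\<lambda>ys. \<Sum>n<length xs - 1. signed (Suc n) (F X us D (contract (paste (cmp ?Y)) n ys))) xs"
    by (intro linear_at_sum[OF X B E] linear_at_signed[OF X B E]) auto
  then show ?thesis
  proof (rule linear_at_cong)
    fix ys :: "('f \<times> 'a) list" assume "map snd ys = map snd xs"
    then have "length ys = length xs" by (metis length_map)
    then show "(\<Sum>n<length xs - 1. signed (Suc n) (F X us D (contract (paste (cmp ?Y)) n ys))) = hoch_inner F X us D ys"
      by (simp add: hoch_inner_def inner_bd_def)
  qed
qed

lemma linear_at_simp_first: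
  assumes F: "multilinear F" and us: "composable U X us" and xs: "arrows (target U X us) D xs"
  shows "linear_at (target U X us) D X (FOb (pull_list A us) (start D xs)) (FOb (total_pull X us) D) (simp_first F X us D) xs"
proof -
  let ?Y = "target U X us" and ?B = "FOb (pull_list A us) (start D xs)" and ?E = "FOb (total_pull X us) D"
  have X: "X \<in> Obj U" and Y: "?Y \<in> Obj U" using us by (auto intro: composable_source composable_target)
  have B: "?B \<in> ob X" using pull_list_ob[OF us arrows_start[OF xs]] .
  have E: "?E \<in> ob X" using pull_total_ob[OF us arrows_vertex[OF xs]] .
  show ?thesis
  proof (cases us)
    case Nil
    show ?thesis
      by (rule linear_at_cong[OF linear_at_zero[OF X B E]]) (simp add: Nil simp_first_def)
  next
    case (Cons u ws)
    have u: "u \<in> Arr U" "Dom U u = X" "composable U (Cod U u) ws" using us Cons by auto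
    have YW: "?Y = target U (Cod U u) ws" by (simp add: Cons)
    note xsW = xs[unfolded YW]
    note G = multilinearD[OF F u(3) xsW, folded YW]
    have D: "D \<in> ob ?Y" and st: "start D xs \<in> ob ?Y" using xs by (auto intro: arrows_vertex arrows_start)
    note o1 = pull_list_ob[OF u(3) st[unfolded YW]] and o2 = pull_total_ob[OF u(3) D[unfolded YW]]
    have o3: "FOb (Pull A u) (FOb (total_pull (Cod U u) ws) D) \<in> ob X"
      using linear_functor_ob[OF pull[OF u(1)] o2] u by simp
    have B': "FOb (Pull A u) (FOb (pull_list A ws) (start D xs)) = ?B" by (simp add: Cons)
    have t: "split_twist X [u] ws D \<in> hom X (FOb (Pull A u) (FOb (total_pull (Cod U u) ws) D)) ?E"
      using split_twist_hom[of X "[u]" ws D] us D u composite_single[of u X]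
      by (simp add: Cons del: composite.simps)
    have "linear_at ?Y D X ?B ?E (\<lambda>ys. signed (length us + length xs) (lf X (split_twist X [u] ws D) (mf u (F (Cod U u) ws D ys)))) xs"
      using linear_at_signed[OF X B E linear_at_lf[OF Y xs X B o3 E t linear_at_mf[OF Y xs u(1,2) o1 o2 G, unfolded B']]] .
    then show ?thesis
    proof (rule linear_at_cong)
      fix ys :: "('f \<times> 'a) list" assume "map snd ys = map snd xs"
      then have "length ys = length xs" by (metis length_map)
      then show "signed (length us + length xs) (lf X (split_twist X [u] ws D) (mf u (F (Cod U u) ws D ys))) = simp_first F X us D ys"
        by (simp add: simp_first_def Cons del: composite.simps)
    qed
  qed
qed

lemma linear_at_simp_inner:
  assumes F: "multilinear F" and us: "composable U X us" and xs: "arrows (target U X us) D xs"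
  shows "linear_at (target U X us) D X (FOb (pull_list A us) (start D xs)) (FOb (total_pull X us) D) (simp_inner F X us D) xs"
proof -
  let ?Y = "target U X us" and ?B = "FOb (pull_list A us) (start D xs)" and ?E = "FOb (total_pull X us) D"
  have X: "X \<in> Obj U" and Y: "?Y \<in> Obj U" using us by (auto intro: composable_source composable_target)
  have st: "start D xs \<in> ob ?Y" using xs by (rule arrows_start)
  have B: "?B \<in> ob X" using pull_list_ob[OF us st] .
  have E: "?E \<in> ob X" using pull_total_ob[OF us arrows_vertex[OF xs]] .
  have "linear_at ?Y D X ?B ?E (\<lambda>ys. rf X (F X (merge_arrows U i us) D ys) (twist_at A i us (start D xs))) xs"
    if i: "Suc i < length us" for i
  proof -
    note m = composable_merge[OF i us] and t = target_merge[OF i us] and c = composite_merge[OF i us]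
    have B': "FOb (pull_list A (merge_arrows U i us)) (start D xs) \<in> ob X" using pull_list_ob[OF m, unfolded t, OF st] .
    show ?thesis
      using linear_at_rf[OF Y xs X B B' E twist_at_hom[OF i us st]] multilinearD[OF F m, unfolded t c, OF xs] .
  qed
  then have "linear_at ?Y D X ?B ?E (\<lambda>ys. signed (length us + length xs)
     (\<Sum>i<length us - 1. signed (Suc i) (rf X (F X (merge_arrows U i us) D ys) (twist_at A i us (start D xs))))) xs"
    by (intro linear_at_sum[OF X B E] linear_at_signed[OF X B E]) auto
  then show ?thesis
  proof (rule linear_at_cong)
    fix ys :: "('f \<times> 'a) list" assume ys: "map snd ys = map snd xs"
    then have "length ys = length xs" by (metis length_map)
    moreover have "start D ys = start D xs" using ys by (simp add: start_def)
    ultimately show "signed (length us + length xs)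
     (\<Sum>i<length us - 1. signed (Suc i) (rf X (F X (merge_arrows U i us) D ys) (twist_at A i us (start D xs)))) = simp_inner F X us D ys"
      by (simp add: simp_inner_def)
  qed
qed

lemma linear_at_path_term:
  assumes F: "multilinear F" and us: "composable U X us" and xs: "arrows (target U X us) D xs"
  shows "linear_at (target U X us) D X (FOb (pull_list A us) (start D xs)) (FOb (total_pull X us) D) (path_term p F X us D) xs"
proof -
  let ?Y = "target U X us" and ?B = "FOb (pull_list A us) (start D xs)" and ?E = "FOb (total_pull X us) D"
  let ?L = "take p us" and ?R = "drop p us" let ?V = "target U X ?L" let ?T = "total_pull ?V ?R"
  let ?TD = "FOb ?T D" let ?PTD = "FOb (total_pull X ?L) ?TD"
  have X: "X \<in> Obj U" and Y: "?Y \<in> Obj U" using us by (auto intro: composable_source composable_target)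
  have D: "D \<in> ob ?Y" and st: "start D xs \<in> ob ?Y" using xs by (auto intro: arrows_vertex arrows_start)
  have B: "?B \<in> ob X" using pull_list_ob[OF us st] .
  have E: "?E \<in> ob X" using pull_total_ob[OF us D] .
  note c = split_composable[OF us, of p] and so = split_objects[OF us D, of p]
  let ?c = "\<lambda>r. path_chain U A ?R r"
  have "linear_at ?Y D X ?B ?PTD (\<lambda>ys. F X ?L ?TD (mor_word_chain D ys ?T (?c r) w)) xs"
    if r: "r \<in> paths (length ?R)" and w: "w \<in> words (length xs) (length (?c r))" for r w
  proof (rule linear_at_substitute[OF Y xs])
    let ?g = "\<lambda>ys. mor_word_chain D ys ?T (?c r) w"
    note rc = path_arrows[OF c(2) r, unfolded c(3)]
    note sh = word_chain_shuffles_of[OF w, of D ?T FOb FMor "\<lambda>\<eta> B. \<eta> B"]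
    have ar: "arrows ?V ?TD (?g xs)" using shuffles_arrows[OF sh xs rc(1)] .
    have sg: "start ?TD (?g xs) = FOb (pull_list A ?R) (start D xs)" using shuffles_of_start[OF sh] rc(2) by simp
    have "FOb (pull_list A ?L) (start ?TD (?g xs)) = ?B"
      using sg pull_list_append[of A ?L ?R] by simp
    then show "linear_at ?V ?TD X ?B ?PTD (F X ?L ?TD) (?g xs)"
      using multilinearD[OF F c(1) ar] by simp
    fix i assume i: "i < length xs"
    obtain j T' where j: "j < length w" "T' \<in> set (?T # map snd (?c r))"
      "map snd (?g xs) ! j = FOb T' (map snd xs ! i)" "(?TD # map snd (?g xs)) ! j = FOb T' ((D # map snd xs) ! i)"
      "\<forall>x. ?g (replace_arrow i x xs) = replace_arrow j (FMor T' x) (?g xs)"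
      using word_chain_replace[OF w i, of ?T D] by blast
    have T': "between ?Y ?V T'" by (rule chain_set[OF rc(1) j(2)])
    have v: "\<And>j. j < Suc (length xs) \<Longrightarrow> (D # map snd xs) ! j \<in> ob ?Y" using xs by (simp add: chain_nth)
    have "FMor T' \<in> linear_maps k (arrow_module ?Y D xs i) (arrow_module ?V ?TD (?g xs) j)"
      unfolding j(3,4) using linear_functor_lin[OF T' v[of "Suc i"] v[of i]] i by simp
    then show "\<exists>j f. j < length (?g xs) \<and> f \<in> linear_maps k (arrow_module ?Y D xs i) (arrow_module ?V ?TD (?g xs) j) \<and>
        (\<forall>x\<in>carrier (arrow_module ?Y D xs i). ?g (replace_arrow i x xs) = replace_arrow j (f x) (?g xs))"
      using j word_chain_length[OF w, of FOb FMor "\<lambda>\<eta> B. \<eta> B" D ?T] by (intro exI[of _ j] exI[of _ "FMor T'"]) auto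
  qed
  then have "linear_at ?Y D X ?B ?PTD (\<lambda>ys. \<Sum>r\<in>paths (length ?R). signed (sum_list r)
      (\<Sum>w\<in>words (length xs) (length (?c r)). signed (inversions w) (F X ?L ?TD (mor_word_chain D ys ?T (?c r) w)))) xs"
    by (intro linear_at_sum[OF X B so(2)] linear_at_signed[OF X B so(2)])
  then have "linear_at ?Y D X ?B ?E (\<lambda>ys. lf X (split_twist X ?L ?R D) (\<Sum>r\<in>paths (length ?R). signed (sum_list r)
      (\<Sum>w\<in>words (length xs) (length (?c r)). signed (inversions w) (F X ?L ?TD (mor_word_chain D ys ?T (?c r) w))))) xs"
    by (rule linear_at_lf[OF Y xs X B so(2) E so(3)])
  then show ?thesis
  proof (rule linear_at_cong)
    fix ys :: "('f \<times> 'a) list" assume "map snd ys = map snd xs"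
    then have "length ys = length xs" by (metis length_map)
    then show "lf X (split_twist X ?L ?R D) (\<Sum>r\<in>paths (length ?R). signed (sum_list r)
      (\<Sum>w\<in>words (length xs) (length (?c r)). signed (inversions w) (F X ?L ?TD (mor_word_chain D ys ?T (?c r) w))))
      = path_term p F X us D ys"
      by (simp only: path_term_def path_sum_def shuffle_sum_words)
  qed
qed

theorem multilinear_formal_d:
  assumes F: "multilinear F"
  shows "multilinear (formal_d F)"
  unfolding multilinear_def
proof (intro allI impI)
  fix X us D xs assume us: "composable U X us" and xs: "arrows (target U X us) D xs"
  let ?Y = "target U X us" and ?B = "FOb (pull_list A us) (start D xs)" and ?E = "FOb (total_pull X us) D"
  have X: "X \<in> Obj U" using us by (rule composable_source)
  have B: "?B \<in> ob X" using pull_list_ob[OF us arrows_start[OF xs]] .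
  have E: "?E \<in> ob X" using pull_total_ob[OF us arrows_vertex[OF xs]] .
  have "linear_at ?Y D X ?B ?E (\<lambda>ys. signed (length xs) (\<Sum>p<length us. path_term p F X us D ys)) xs"
    by (intro linear_at_signed[OF X B E] linear_at_sum[OF X B E] linear_at_path_term[OF F us xs])
  then have "linear_at ?Y D X ?B ?E (path_part F X us D) xs"
  proof (rule linear_at_cong)
    fix ys :: "('f \<times> 'a) list" assume "map snd ys = map snd xs"
    then have "length ys = length xs" by (metis length_map)
    then show "signed (length xs) (\<Sum>p<length us. path_term p F X us D ys) = path_part F X us D ys"
      by (simp add: path_part_def)
  qed
  then show "linear_at ?Y D X ?B ?E (formal_d F X us D) xs"
    unfolding formal_d_def
    by (intro linear_at_add[OF X B E] linear_at_hoch_left linear_at_hoch_inner linear_at_hoch_right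
        linear_at_simp_first linear_at_simp_inner F us xs)
qed

end

section \<open>Simplices and cochains in terms of chains\<close>

lemma contract_split:
  "Suc i < length xs \<Longrightarrow> contract m i xs = take i xs @ [m (xs ! i) (xs ! Suc i)] @ drop (Suc (Suc i)) xs"
proof (induction i arbitrary: xs)
  case 0
  then obtain x y ys where "xs = x # y # ys" by (cases xs; cases "tl xs") auto
  then show ?case by simp
next
  case (Suc i)
  then obtain p ys where "xs = p # ys" by (cases xs) auto
  then show ?case using Suc by simp
qed

lemma target_last: "target U X us = (if us = [] then X else Cod U (last us))"
  by (induction us arbitrary: X) auto

lemma vertex_target: "i \<le> length us \<Longrightarrow> vertex U (X, us) i = target U X (take i us)"
  by (cases i) (auto simp: vertex_def target_last take_Suc_conv_app_nth)

lemma last_vertex_target: "last_vertex U (X, us) = target U X us"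
  by (simp add: last_vertex_def vertex_target)

lemma Lpart_pair: "Lpart i (X, us) = (X, take i us)"
  and Rpart_pair: "i \<le> length us \<Longrightarrow> Rpart U i (X, us) = (target U X (take i us), drop i us)"
  by (simp_all add: Lpart_def Rpart_def vertex_target)

lemma face_first: "face U 0 (X, u # us) = (Cod U u, us)"
  and face_inner: "Suc i < length us \<Longrightarrow> face U (Suc i) (X, us) = (X, merge_arrows U i us)"
  and face_last: "us \<noteq> [] \<Longrightarrow> face U (length us) (X, us) = (X, butlast us)"
  by (simp_all add: face_def vertex_def contract_split)

lemma eps_twist_at: "Suc i < length us \<Longrightarrow> eps A (X, us) (Suc i) = twist_at A i us"
proof (induction i arbitrary: us)
  case 0
  then obtain u v vs where "us = u # v # vs" by (cases us; cases "tl us") auto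
  then show ?case by (auto simp: eps_def)
next
  case (Suc i)
  then obtain u vs where us: "us = u # vs" by (cases us) auto
  then show ?case using Suc.IH[of vs] Suc.prems by (auto simp: eps_def fun_eq_iff Let_def)
qed

lemma path_sign_sum: "path_sign r = (- 1) ^ sum_list r"
  by (induction r) (simp_all add: power_add)

lemma path_nats_chain: "r \<in> paths (length us) \<Longrightarrow> path_nats U A (X, us) r = map fst (path_chain U A us r)"
proof (induction r arbitrary: us)
  case (Cons i r)
  then obtain n where n: "length us = Suc (Suc n)" by (cases "length us" rule: paths.cases) auto
  then obtain j where j: "i = Suc j" "Suc j < length us" "r \<in> paths (Suc n)" using Cons.prems by (cases i) auto
  then show ?case using Cons.IH[of "merge_arrows U j us"] n
    by (simp add: face_inner eps_twist_at length_contract)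
qed simp

context small_category
begin

lemma nerve_composable: "(X, us) \<in> nerve U p \<longleftrightarrow> composable U X us \<and> length us = p"
proof -
  have "(X \<in> Obj U \<and> set us \<subseteq> Arr U \<and> (\<forall>i<length us. Dom U (us ! i) = vertex U (X, us) i)) \<longleftrightarrow> composable U X us"
  proof (induction us arbitrary: X)
    case (Cons u us)
    have "vertex U (X, u # us) (Suc i) = vertex U (Cod U u, us) i" for i
      by (cases i) (simp_all add: vertex_def)
    moreover have "vertex U (X, u # us) 0 = X" by (simp add: vertex_def)
    ultimately show ?case using Cons[of "Cod U u"]
      by (auto simp: All_less_Suc2 cod_closed dom_closed)
  qed simp
  then show ?thesis by (auto simp: nerve_def)
qed

lemma total_composite:
  assumes "composable U X us"
  shows "total U (X, us) = composite U X us"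
proof -
  have "foldl (\<lambda>v u. Cmp U u v) w us = Cmp U (composite U (Cod U w) us) w" if "w \<in> Arr U" "composable U (Cod U w) us" for w
    using that
  proof (induction us arbitrary: w)
    case (Cons u us)
    then show ?case
      using cmp_closed[of u w] cmp_assoc[of "composite U (Cod U u) us" u w] composite_closed[of "Cod U u" us] by simp
  qed (simp add: cmp_idn_left)
  from this[of "Idn U X"] show ?thesis
    using assms composite_closed[OF assms] idn_closed[OF composable_source[OF assms]]
      cmp_idn_right[of "composite U X us"] by (auto simp: total_def)
qed

end

context prestack
begin

lemma pull_total_composite: "composable U X us \<Longrightarrow> pull_total U A (X, us) = Pull A (composite U X us)"
  by (simp add: pull_total_def total_composite)

lemma path_functors_chain:
  assumes "r \<in> paths (length us)" "composable U X us"
  shows "path_functors U A (X, us) r = vertices (Pull A (composite U X us)) (path_chain U A us r)"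
  using assms
proof (induction r arbitrary: us)
  case Nil
  then have "length us = 1" by (cases "length us" rule: paths.cases) auto
  then obtain u where "us = [u]" by (cases us) auto
  then show ?case using Nil composite_pull_single[of u X] by (simp add: vertices_def)
next
  case (Cons i r)
  then obtain n where n: "length us = Suc (Suc n)" by (cases "length us" rule: paths.cases) auto
  then obtain j where j: "i = Suc j" "Suc j < length us" "r \<in> paths (Suc n)" using Cons.prems by (cases i) auto
  then show ?case using Cons.IH[of "merge_arrows U j us"] n Cons.prems composable_merge[of j us X] composite_merge[of j us X]
    by (simp add: face_inner length_contract vertices_def)
qed

text \<open>In the degenerate cases one of the two composites is an identity, and the structure isomorphism is an
  identity by the normalization of prestacks.\<close>

lemma csplit_split_twist:
  assumes us: "composable U X us" and p: "p \<le> length us" and B: "B \<in> ob (target U X us)"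
  shows "csplit U A (X, us) p B = Twist A (composite U (target U X (take p us)) (drop p us)) (composite U X (take p us)) B"
proof -
  have c: "composable U X (take p us)" "composable U (target U X (take p us)) (drop p us)"
    using us composable_append[of X "take p us" "drop p us"] by auto
  note a = composite_closed[OF us]
  consider "p = 0" | "p = length us" | "0 < p" "p < length us" using p by linarith
  then show ?thesis
  proof cases
    case 1
    then show ?thesis using twist_id_right[of "composite U X us" B] a B us by (simp add: csplit_def pull_total_composite)
  next
    case 2
    then show ?thesis using twist_id_left[of "composite U X us" B] a B us by (simp add: csplit_def pull_total_composite)
  next
    case 3
    then show ?thesis using c by (simp add: csplit_def Lpart_pair Rpart_pair total_composite)
  qed
qed

end

lemma homs_vertices:
  "homs C (vertices D xs) = map (\<lambda>i. LHom C (map snd xs ! i) ((D # map snd xs) ! i)) [0..<length xs]"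
proof (rule nth_equalityI)
  fix i assume "i < length (homs C (vertices D xs))"
  then have i: "i < length xs" by (simp add: homs_def Let_def del: upt_Suc)
  then have "length xs - Suc i + 1 = length xs - i" by simp
  then show "homs C (vertices D xs) ! i = map (\<lambda>i. LHom C (map snd xs ! i) ((D # map snd xs) ! i)) [0..<length xs] ! i"
    using i vertices_nth[of "Suc i" xs D] vertices_nth[of i xs D] by (simp add: homs_def Let_def del: upt_Suc)
qed (simp add: homs_def Let_def del: upt_Suc)

text \<open>Every simplex of the category is given by a chain: pair each arrow with its source.\<close>

lemma vertices_cases:
  assumes "As \<in> objects C q" "as \<in> tuples (homs C As)"
  obtains D xs where "As = vertices D xs" "as = map fst xs" "length xs = q"
proof -
  have l: "length As = Suc q" "length as = q"
    using assms by (auto simp: objects_def tuples_def homs_def dest: list_all2_lengthD)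
  then obtain D Ds where D: "rev As = D # Ds" by (cases "rev As") auto
  then have "length Ds = q" using l by (metis length_rev length_Cons Suc_inject)
  moreover have "As = rev (D # Ds)" using D by (metis rev_rev_ident)
  ultimately show ?thesis using that[of D "zip as Ds"] l by (simp add: vertices_def)
qed

context prestack_bimodule
begin

lemma arrows_vertices:
  "arrows Y D xs \<longleftrightarrow> vertices D xs \<in> objects (Cat A Y) (length xs) \<and> map fst xs \<in> tuples (homs (Cat A Y) (vertices D xs))"
proof -
  have "set (vertices D xs) \<subseteq> ob Y \<longleftrightarrow> (\<forall>i<Suc (length xs). (D # map snd xs) ! i \<in> ob Y)"
    unfolding vertices_def set_rev subset_eq all_set_conv_all_nth by simp
  then show ?thesis unfolding chain_nth homs_vertices
    by (auto simp: objects_def tuples_def list_all2_conv_all_nth)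
qed

lemma coeffs_vertices:
  "composable U X us \<Longrightarrow> coeffs U A M (X, us) (vertices D xs) =
    Bim M X (FOb (pull_list A us) (start D xs)) (FOb (total_pull X us) D)"
  by (simp add: coeffs_def pull_total_composite)

lemma cochain_indices:
  assumes "\<sigma> \<in> nerve U p" "As \<in> objects (Cat A (last_vertex U \<sigma>)) q" "as \<in> tuples (homs (Cat A (last_vertex U \<sigma>)) As)"
  obtains X us D xs where "\<sigma> = (X, us)" "composable U X us" "length us = p" "arrows (target U X us) D xs"
    "length xs = q" "As = vertices D xs" "as = map fst xs"
proof -
  obtain X us where s: "\<sigma> = (X, us)" by (cases \<sigma>)
  obtain D xs where xs: "As = vertices D xs" "as = map fst xs" "length xs = q" using vertices_cases[OF assms(2,3)] .
  show ?thesis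
    using that[OF s _ _ _ xs(3,1,2)] assms xs unfolding s last_vertex_target nerve_composable arrows_vertices by auto
qed

lemma indices_cochain:
  assumes "composable U X us" "arrows (target U X us) D xs"
  shows "(X, us) \<in> nerve U (length us)" "vertices D xs \<in> objects (Cat A (last_vertex U (X, us))) (length xs)"
    "map fst xs \<in> tuples (homs (Cat A (last_vertex U (X, us))) (vertices D xs))"
  using assms unfolding arrows_vertices by (auto simp: nerve_composable last_vertex_target)

lemma gs_restrict_apply:
  assumes "composable U X us" "arrows (target U X us) D xs" "length us + length xs = n"
  shows "gs_restrict U A n \<Phi> (length us, length xs) (X, us) (vertices D xs) (map fst xs) =
    \<Phi> (length us, length xs) (X, us) (vertices D xs) (map fst xs)"
  using indices_cochain[OF assms(1,2)] assms(3) by (simp add: gs_restrict_def bidegrees_def)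

lemma gs_restrict_cong:
  assumes "\<And>X us D xs. composable U X us \<Longrightarrow> arrows (target U X us) D xs \<Longrightarrow> length us + length xs = n \<Longrightarrow>
    \<Phi> (length us, length xs) (X, us) (vertices D xs) (map fst xs) = \<Psi> (length us, length xs) (X, us) (vertices D xs) (map fst xs)"
  shows "gs_restrict U A n \<Phi> = gs_restrict U A n \<Psi>"
  unfolding gs_restrict_def
proof (intro restrict_ext)
  fix pq \<sigma> As as
  assume pq: "pq \<in> bidegrees n" and i: "\<sigma> \<in> nerve U (fst pq)" "As \<in> objects (Cat A (last_vertex U \<sigma>)) (snd pq)"
    "as \<in> tuples (homs (Cat A (last_vertex U \<sigma>)) As)"
  obtain X us D xs where x: "\<sigma> = (X, us)" "composable U X us" "length us = fst pq" "arrows (target U X us) D xs"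
    "length xs = snd pq" "As = vertices D xs" "as = map fst xs" using cochain_indices[OF i] .
  have "pq = (length us, length xs)" "length us + length xs = n" using x(3,5) pq by (auto simp: bidegrees_def)
  then show "\<Phi> pq \<sigma> As as = \<Psi> pq \<sigma> As as" using assms[OF x(2,4)] x by simp
qed

text \<open>A cochain is homogeneous, a formal cochain has values in all total degrees. Only those of total degree
  \<open>n\<close> are compared, but \<open>G\<close> has to be multilinear throughout.\<close>

definition represents where
  "represents n G \<Phi> \<longleftrightarrow> multilinear G \<and> (\<forall>X us D xs. composable U X us \<longrightarrow> arrows (target U X us) D xs \<longrightarrow>
     length us + length xs = n \<longrightarrow> evaluate (coeffs U A M (X, us) (vertices D xs)) (G X us D xs) =
       \<Phi> (length us, length xs) (X, us) (vertices D xs) (map fst xs))"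

lemma representsD:
  "represents n G \<Phi> \<Longrightarrow> composable U X us \<Longrightarrow> arrows (target U X us) D xs \<Longrightarrow> length us + length xs = n \<Longrightarrow>
    evaluate (Bim M X (FOb (pull_list A us) (start D xs)) (FOb (total_pull X us) D)) (G X us D xs) =
       \<Phi> (length us, length xs) (X, us) (vertices D xs) (map fst xs)"
  unfolding represents_def by (metis coeffs_vertices)

lemma represents_restrict: "represents n G \<Phi> \<Longrightarrow> represents n G (gs_restrict U A n \<Phi>)"
  unfolding represents_def by (auto simp: gs_restrict_apply)

lemma vertices_replace [simp]: "vertices D (replace_arrow i x xs) = vertices D xs"
  by (simp add: vertices_def)

text \<open>Each value of the cochain is taken as a formal sum with one summand.\<close>

lemma CGS_represented:
  assumes "\<Phi> \<in> CGS k U A M n"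
  shows "represents n (\<lambda>X us D xs. if length us + length xs = n
    then frag_of (\<Phi> (length us, length xs) (X, us) (vertices D xs) (map fst xs)) else 0) \<Phi>" (is "represents n ?G \<Phi>")
proof -
  have m: "\<Phi> (length us, length xs) (X, us) (vertices D xs) \<in>
      multilinear_maps k (homs (Cat A (target U X us)) (vertices D xs))
        (Bim M X (FOb (pull_list A us) (start D xs)) (FOb (total_pull X us) D))"
    if us: "composable U X us" and xs: "arrows (target U X us) D xs" and n: "length us + length xs = n" for X us D xs
  proof -
    have "\<Phi> (length us, length xs) \<in> Cpq k U A M (length us) (length xs)"
      using PiE_mem[OF assms[unfolded CGS_def], of "(length us, length xs)"] n by (simp add: bidegrees_def)
    from PiE_mem[OF PiE_mem[OF this[unfolded Cpq_def] indices_cochain(1)[OF us xs]] indices_cochain(2)[OF us xs]]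
    show ?thesis by (simp add: last_vertex_target coeffs_vertices[OF us])
  qed
  have v: "\<Phi> (length us, length xs) (X, us) (vertices D xs) (map fst xs) \<in>
      carrier (Bim M X (FOb (pull_list A us) (start D xs)) (FOb (total_pull X us) D))"
    if us: "composable U X us" and xs: "arrows (target U X us) D xs" and n: "length us + length xs = n" for X us D xs
    using m[OF us xs n] indices_cochain(3)[OF us xs] by (auto simp: multilinear_maps_def last_vertex_target)
  have g: "abelian_group (Bim M X (FOb (pull_list A us) (start D xs)) (FOb (total_pull X us) D))"
    "X \<in> Obj U" "FOb (pull_list A us) (start D xs) \<in> ob X" "FOb (total_pull X us) D \<in> ob X"
    if us: "composable U X us" and xs: "arrows (target U X us) D xs" for X us D xs
    using bim_group[OF composable_source[OF us] pull_list_ob[OF us arrows_start[OF xs]] pull_total_ob[OF us arrows_vertex[OF xs]]]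
      composable_source[OF us] pull_list_ob[OF us arrows_start[OF xs]] pull_total_ob[OF us arrows_vertex[OF xs]] by auto
  have "multilinear ?G" unfolding multilinear_def
  proof (intro allI impI)
    fix X us D xs assume us: "composable U X us" and xs: "arrows (target U X us) D xs"
    let ?B = "FOb (pull_list A us) (start D xs)" and ?E = "FOb (total_pull X us) D"
    show "linear_at (target U X us) D X ?B ?E (?G X us D) xs"
    proof (cases "length us + length xs = n")
      case False
      then show ?thesis
        by (intro linear_at_cong[OF linear_at_zero[OF g(2-4)[OF us xs]]]) (metis length_map)
    next
      case n: True
      show ?thesis unfolding linear_at_def
      proof (intro conjI allI impI ballI)
        show "valued X ?B ?E (?G X us D xs)" using v[OF us xs n] n by (simp add: valued_def)
        fix i assume i: "i < length xs"
        have a: "arrows (target U X us) D (replace_arrow i x xs)" if "x \<in> carrier (arrow_module (target U X us) D xs i)" for x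
          using arrows_replace[OF xs that i] .
        show "valued X ?B ?E (?G X us D (replace_arrow i x xs))" if x: "x \<in> carrier (arrow_module (target U X us) D xs i)" for x
          using v[OF us a[OF x]] n by (simp add: valued_def)
        have "(\<lambda>x. \<Phi> (length us, length xs) (X, us) (vertices D xs) ((map fst xs)[i := x])) \<in>
            linear_maps k (arrow_module (target U X us) D xs i) (Bim M X ?B ?E)"
          using m[OF us xs n] indices_cochain(3)[OF us xs] i
          by (auto simp: multilinear_maps_def last_vertex_target homs_vertices)
        then show "(\<lambda>x. evaluate (Bim M X ?B ?E) (?G X us D (replace_arrow i x xs))) \<in>
            linear_maps k (arrow_module (target U X us) D xs i) (Bim M X ?B ?E)"
        proof (rule linear_maps_cong[OF arrow_module_module[OF composable_target[OF us] xs i]])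
          fix x assume x: "x \<in> carrier (arrow_module (target U X us) D xs i)"
          show "\<Phi> (length us, length xs) (X, us) (vertices D xs) ((map fst xs)[i := x]) =
            evaluate (Bim M X ?B ?E) (?G X us D (replace_arrow i x xs))"
            using v[OF us a[OF x]] n evaluate_of[OF g(1)[OF us xs]] by simp
        qed
      qed
    qed
  qed
  then show ?thesis unfolding represents_def
    by (auto simp: coeffs_vertices evaluate_of[OF g(1) v])
qed

lemma represented_CGS:
  assumes r: "represents n G \<Phi>"
  shows "gs_restrict U A n \<Phi> \<in> CGS k U A M n"
proof -
  have l: "linear_at (target U X us) D X (FOb (pull_list A us) (start D xs)) (FOb (total_pull X us) D) (G X us D) xs"
    if us: "composable U X us" and xs: "arrows (target U X us) D xs" for X us D xs
    using r multilinearD[OF _ us xs] unfolding represents_def by blast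
  have g: "abelian_group (Bim M X (FOb (pull_list A us) (start D xs)) (FOb (total_pull X us) D))"
    if us: "composable U X us" and xs: "arrows (target U X us) D xs" for X us D xs
    using bim_group[OF composable_source[OF us] pull_list_ob[OF us arrows_start[OF xs]] pull_total_ob[OF us arrows_vertex[OF xs]]] .
  have "(\<lambda>as\<in>tuples (homs (Cat A (last_vertex U \<sigma>)) As). \<Phi> (p, q) \<sigma> As as) \<in>
      multilinear_maps k (homs (Cat A (last_vertex U \<sigma>)) As) (coeffs U A M \<sigma> As)" (is "?f \<in> _")
    if pq: "p + q = n" and s: "\<sigma> \<in> nerve U p" and As: "As \<in> objects (Cat A (last_vertex U \<sigma>)) q" for p q \<sigma> As
    unfolding multilinear_maps_def
  proof (intro CollectI conjI ballI allI impI)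
    show "?f \<in> tuples (homs (Cat A (last_vertex U \<sigma>)) As) \<rightarrow>\<^sub>E carrier (coeffs U A M \<sigma> As)"
      unfolding restrict_PiE_iff
    proof
      fix as assume "as \<in> tuples (homs (Cat A (last_vertex U \<sigma>)) As)"
      from cochain_indices[OF s As this] obtain X us D xs where x: "\<sigma> = (X, us)" "composable U X us" "length us = p"
        "arrows (target U X us) D xs" "length xs = q" "As = vertices D xs" "as = map fst xs" .
      show "\<Phi> (p, q) \<sigma> As as \<in> carrier (coeffs U A M \<sigma> As)"
        using representsD[OF r x(2,4)] evaluate_closed[OF g[OF x(2,4)], of "G X us D xs"] pq x by (simp add: coeffs_vertices)
    qed
    fix as i assume as: "as \<in> tuples (homs (Cat A (last_vertex U \<sigma>)) As)" and i: "i < length (homs (Cat A (last_vertex U \<sigma>)) As)"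
    from cochain_indices[OF s As as] obtain X us D xs where x: "\<sigma> = (X, us)" "composable U X us" "length us = p"
        "arrows (target U X us) D xs" "length xs = q" "As = vertices D xs" "as = map fst xs" .
    have i': "i < length xs" using i x by (simp add: homs_vertices)
    have h: "homs (Cat A (last_vertex U \<sigma>)) As ! i = arrow_module (target U X us) D xs i"
      using i' x by (simp add: homs_vertices last_vertex_target)
    have c: "coeffs U A M \<sigma> As = Bim M X (FOb (pull_list A us) (start D xs)) (FOb (total_pull X us) D)"
      using x by (simp add: coeffs_vertices)
    have "(\<lambda>y. evaluate (coeffs U A M \<sigma> As) (G X us D (replace_arrow i y xs))) \<in>
        linear_maps k (arrow_module (target U X us) D xs i) (coeffs U A M \<sigma> As)"
      using l[OF x(2,4)] i' unfolding c linear_at_def by blast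
    then show "(\<lambda>y. ?f (as[i := y])) \<in> linear_maps k (homs (Cat A (last_vertex U \<sigma>)) As ! i) (coeffs U A M \<sigma> As)"
      unfolding h
    proof (rule linear_maps_cong[OF arrow_module_module[OF composable_target[OF x(2)] x(4) i']])
      fix y assume y: "y \<in> carrier (arrow_module (target U X us) D xs i)"
      note a = arrows_replace[OF x(4) y i']
      show "evaluate (coeffs U A M \<sigma> As) (G X us D (replace_arrow i y xs)) = ?f (as[i := y])"
        using representsD[OF r x(2) a] indices_cochain(3)[OF x(2) a] pq x c by (simp add: last_vertex_target)
    qed
  qed
  then show ?thesis
    unfolding CGS_def gs_restrict_def restrict_PiE_iff Cpq_def by (auto simp: bidegrees_def restrict_PiE_iff)
qed

end

section \<open>The differential as an evaluation of the formal differential\<close>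

lemma vertices_contract:
  assumes "Suc i < length xs"
  shows "vertices D (contract (paste m) i xs) =
    take (length xs - Suc i) (vertices D xs) @ drop (length xs - i) (vertices D xs)"
proof -
  have "length xs - (length xs - Suc i) = Suc i" "Suc (length xs) - (length xs - i) = Suc i"
    "Suc (length xs) - (length xs - Suc i) = Suc (Suc i)"
    using assms by auto
  then show ?thesis
    unfolding vertices_def map_snd_contract[OF assms] take_rev drop_rev by simp
qed

lemma map_fst_contract:
  assumes "Suc i < length xs"
  shows "map fst (contract (paste m) i xs) =
    take i (map fst xs) @ [m (map fst xs ! i) (map fst xs ! Suc i)] @ drop (Suc (Suc i)) (map fst xs)"
  using assms by (simp add: contract_split paste_def take_map drop_map)

lemma shuffle_sum_no_nats:
  "shuffle_sum act_ob act_mor act_nat F D xs T [] = F (map (\<lambda>(x, B). (act_mor T x, act_ob T B)) xs)"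
proof (induction xs arbitrary: F D)
  case (Cons p xs)
  then show ?case by (cases p) simp
qed simp

context prestack_bimodule
begin

lemma gs_restrict_idem: "gs_restrict U A n (gs_restrict U A n \<Phi>) = gs_restrict U A n \<Phi>"
  by (rule gs_restrict_cong) (simp add: gs_restrict_apply)

lemma evaluate_hoch:
  assumes r: "represents n G \<Phi>" and us: "composable U X us" and xs: "arrows (target U X us) D xs"
    and n: "length us + length xs = Suc n" and q: "length xs = Suc q"
  shows "evaluate (Bim M X (FOb (pull_list A us) (start D xs)) (FOb (total_pull X us) D))
      (hoch_left G X us D xs + hoch_inner G X us D xs + hoch_right G X us D xs) =
    d_hoch U A M q (\<Phi> (length us, q)) (X, us) (vertices D xs) (map fst xs)"
proof -
  let ?Y = "target U X us" and ?B = "FOb (pull_list A us) (start D xs)" and ?E = "FOb (total_pull X us) D"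
  let ?N = "Bim M X ?B ?E"
  have m: "multilinear G" using r by (simp add: represents_def)
  note rD = representsD[OF r] and cv = cochain_valuesD[OF multilinear_values[OF m] us]
  have X: "X \<in> Obj U" and Y: "?Y \<in> Obj U" using us by (auto intro: composable_source composable_target)
  note P = between_pull_total[OF us] and Q = between_pull_list[OF us]
  have B: "?B \<in> ob X" using pull_list_ob[OF us arrows_start[OF xs]] .
  have E: "?E \<in> ob X" using pull_total_ob[OF us arrows_vertex[OF xs]] .
  note N = bim_group[OF X B E]
  interpret N: abelian_group ?N by (rule N)
  have l: "evaluate ?N (hoch_left G X us D xs) = lact M X (FMor (pull_total U A (X, us)) (hd (map fst xs)))
      (\<Phi> (length us, q) (X, us) (butlast (vertices D xs)) (tl (map fst xs)))"
  proof -
    obtain x D' zs where z: "xs = (x, D') # zs" using q by (cases xs) auto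
    have ar: "D \<in> ob ?Y" "D' \<in> ob ?Y" "x \<in> hom ?Y D' D" "arrows ?Y D' zs"
      using xs z by (auto dest: chain_vertex)
    have v: "valued X ?B (FOb (total_pull X us) D') (G X us D' zs)" using cv[OF ar(4)] by (simp add: z)
    have "butlast (vertices D xs) = vertices D' zs" by (simp add: z vertices_def butlast_append)
    moreover have "length us + length zs = n" "length zs = q" using n q z by auto
    ultimately show ?thesis
      using evaluate_lf[OF X B pull_total_ob[OF us ar(2)] E linear_functor_mor[OF P ar(2,1,3)] v] rD[OF us ar(4)]
      by (simp add: z hoch_left_def pull_total_composite[OF us])
  qed
  have rt: "evaluate ?N (hoch_right G X us D xs) = [((- 1 :: int) ^ (q + 1))] \<cdot>\<^bsub>?N\<^esub>
      ract M X (\<Phi> (length us, q) (X, us) (tl (vertices D xs)) (butlast (map fst xs))) (FMor (pull_list A us) (last (map fst xs)))"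
  proof -
    obtain zs y B' where z: "xs = zs @ [(y, B')]" using q by (cases xs rule: rev_cases) auto
    have ar: "arrows ?Y D zs" "y \<in> hom ?Y B' (start D zs)" "B' \<in> ob ?Y"
      using xs z by (simp_all add: chain_append)
    have s: "start D xs = B'" by (simp add: z)
    have v: "valued X (FOb (pull_list A us) (start D zs)) ?E (G X us D zs)" by (rule cv[OF ar(1)])
    have "tl (vertices D xs) = vertices D zs" "butlast (map fst xs) = map fst zs" by (simp_all add: z vertices_def)
    moreover have "length us + length zs = n" "length zs = q" using n q z by auto
    ultimately have e: "evaluate (Bim M X (FOb (pull_list A us) (start D zs)) ?E) (G X us D zs) =
        \<Phi> (length us, q) (X, us) (tl (vertices D xs)) (butlast (map fst xs))"
      using rD[OF us ar(1)] by simp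
    have h: "hoch_right G X us D xs = signed (q + 1) (rf X (G X us D zs) (FMor (pull_list A us) y))"
      using q by (simp add: z hoch_right_def)
    have l: "last (map fst xs) = y" by (simp add: z)
    show ?thesis
      unfolding h l evaluate_signed[OF N] evaluate_rf[OF X B pull_list_ob[OF us arrows_start[OF ar(1)]] E
          linear_functor_mor[OF Q ar(3) arrows_start[OF ar(1)] ar(2), folded s] v] e by (rule refl)
  qed
  have i: "evaluate ?N (hoch_inner G X us D xs) = (\<Oplus>\<^bsub>?N\<^esub>i\<in>{1..q}. [((- 1 :: int) ^ i)] \<cdot>\<^bsub>?N\<^esub>
      \<Phi> (length us, q) (X, us) (take (q + 1 - i) (vertices D xs) @ drop (q + 2 - i) (vertices D xs))
        (take (i - 1) (map fst xs) @ [cmp ?Y (map fst xs ! (i - 1)) (map fst xs ! i)] @ drop (i + 1) (map fst xs)))" (is "_ = finsum _ ?f _")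
  proof -
    have f: "evaluate ?N (signed (Suc i) (G X us D (contract (paste (cmp ?Y)) i xs))) = ?f (Suc i)" if "i < q" for i
    proof -
      have i: "Suc i < length xs" using that q by simp
      have lc: "length (contract (paste (cmp ?Y)) i xs) = q" using i q by (simp add: length_contract)
      have "evaluate ?N (G X us D (contract (paste (cmp ?Y)) i xs)) = \<Phi> (length us, q) (X, us)
        (vertices D (contract (paste (cmp ?Y)) i xs)) (map fst (contract (paste (cmp ?Y)) i xs))"
        using rD[OF us arrows_contract[OF Y i xs]] n q unfolding lc by (simp add: start_contract[OF i])
      then show ?thesis
        unfolding evaluate_signed[OF N] vertices_contract[OF i] map_fst_contract[OF i] by (simp add: q)
    qed
    have "hoch_inner G X us D xs = (\<Sum>i\<in>{1..q}. signed i (G X us D (contract (paste (cmp ?Y)) (i - 1) xs)))"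
      unfolding hoch_inner_def inner_bd_def using q
      by (auto intro!: sum.reindex_bij_witness[where i = "\<lambda>i. i - 1" and j = Suc])
    then have "evaluate ?N (hoch_inner G X us D xs) =
        (\<Oplus>\<^bsub>?N\<^esub>i\<in>{1..q}. evaluate ?N (signed i (G X us D (contract (paste (cmp ?Y)) (i - 1) xs))))"
      using evaluate_sum[OF N, of "{1..q}"] by simp
    also have "\<dots> = finsum ?N ?f {1..q}"
    proof (rule N.finsum_cong')
      show g: "evaluate ?N (signed i (G X us D (contract (paste (cmp ?Y)) (i - 1) xs))) = ?f i" if "i \<in> {1..q}" for i
        using f[of "i - 1"] that by (cases i) auto
      show "?f \<in> {1..q} \<rightarrow> carrier ?N" using evaluate_closed[OF N] g by (metis (lifting) Pi_I)
    qed simp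
    finally show ?thesis .
  qed
  show ?thesis
    unfolding evaluate_add[OF N] l rt i d_hoch_def
    by (simp add: Let_def coeffs_vertices[OF us] last_vertex_target)
qed

lemma evaluate_simp:
  assumes r: "represents n G \<Phi>" and us: "composable U X us" and xs: "arrows (target U X us) D xs"
    and n: "length us + length xs = Suc n" and p: "length us = Suc p"
  shows "evaluate (Bim M X (FOb (pull_list A us) (start D xs)) (FOb (total_pull X us) D))
      (simp_first G X us D xs + simp_inner G X us D xs + signed (length xs) (path_term p G X us D xs)) =
    [((- 1 :: int) ^ (p + length xs + 1))] \<cdot>\<^bsub>coeffs U A M (X, us) (vertices D xs)\<^esub>
      d_simp U A M p (\<Phi> (p, length xs)) (X, us) (vertices D xs) (map fst xs)"
proof -
  let ?Y = "target U X us" and ?B = "FOb (pull_list A us) (start D xs)" and ?E = "FOb (total_pull X us) D"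
  let ?N = "Bim M X ?B ?E"
  have m: "multilinear G" using r by (simp add: represents_def)
  note rD = representsD[OF r] and cv = cochain_valuesD[OF multilinear_values[OF m]]
  have X: "X \<in> Obj U" and Y: "?Y \<in> Obj U" using us by (auto intro: composable_source composable_target)
  have B: "?B \<in> ob X" using pull_list_ob[OF us arrows_start[OF xs]] .
  have E: "?E \<in> ob X" using pull_total_ob[OF us arrows_vertex[OF xs]] .
  have D: "D \<in> ob ?Y" and st: "start D xs \<in> ob ?Y" using xs by (auto intro: arrows_vertex arrows_start)
  note N = bim_group[OF X B E]
  interpret N: abelian_group ?N by (rule N)
  obtain u ws where U: "us = u # ws" using p by (cases us) auto
  have u: "u \<in> Arr U" "Dom U u = X" "composable U (Cod U u) ws" using us U by auto
  have YW: "?Y = target U (Cod U u) ws" by (simp add: U)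
  note xsW = xs[unfolded YW]
  note csp = csplit_split_twist[OF us _ D]
  let ?a = "lf X (split_twist X [u] ws D) (mf u (G (Cod U u) ws D xs))"
  let ?b = "\<Sum>i<p. signed (Suc i) (rf X (G X (merge_arrows U i us) D xs) (twist_at A i us (start D xs)))"
  let ?c = "path_term p G X us D xs"
  have a: "evaluate ?N ?a = lact M X (csplit U A (X, us) 1 D) (Res M (us ! 0) (\<Phi> (p, length xs) (face U 0 (X, us)) (vertices D xs) (map fst xs)))"
  proof -
    note o1 = pull_list_ob[OF u(3) st[unfolded YW]] and o2 = pull_total_ob[OF u(3) D[unfolded YW]]
    have o3: "FOb (Pull A u) (FOb (total_pull (Cod U u) ws) D) \<in> ob X"
      using linear_functor_ob[OF pull[OF u(1)] o2] u by simp
    have B': "FOb (Pull A u) (FOb (pull_list A ws) (start D xs)) = ?B" by (simp add: U)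
    have t: "split_twist X [u] ws D \<in> hom X (FOb (Pull A u) (FOb (total_pull (Cod U u) ws) D)) ?E"
      using split_twist_hom[of X "[u]" ws D] us D u composite_single[of u X]
      by (simp add: U del: composite.simps)
    note v = cv[OF u(3) xsW]
    have "csplit U A (X, us) 1 D = split_twist X [u] ws D" using csp[of 1] by (simp add: U del: composite.simps)
    then show ?thesis
      using evaluate_lf[OF X B o3 E t valued_mf[OF u(1,2) o1 o2 v, unfolded B']] evaluate_mf[OF u(1,2) o1 o2 v] rD[OF u(3) xsW] n p
      by (simp add: U face_first del: composite.simps)
  qed
  have b: "evaluate ?N ?b = (\<Oplus>\<^bsub>?N\<^esub>i\<in>{1..p}. [((- 1 :: int) ^ i)] \<cdot>\<^bsub>?N\<^esub>
      ract M X (\<Phi> (p, length xs) (face U i (X, us)) (vertices D xs) (map fst xs)) (eps A (X, us) i (start D xs)))" (is "_ = finsum _ ?f _")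
  proof -
    have f: "evaluate ?N (signed (Suc i) (rf X (G X (merge_arrows U i us) D xs) (twist_at A i us (start D xs)))) = ?f (Suc i)"
      if "i < p" for i
    proof -
      have i: "Suc i < length us" using that p by simp
      note cm = composable_merge[OF i us] and tm = target_merge[OF i us] and km = composite_merge[OF i us]
      have xm: "arrows (target U X (merge_arrows U i us)) D xs" using xs tm by simp
      have lm: "length (merge_arrows U i us) = p" using i p by (simp add: length_contract)
      have tw: "twist_at A i us (start D xs) \<in> hom X ?B (FOb (pull_list A (merge_arrows U i us)) (start D xs))"
        using natural_transD(1)[OF natural_twist_at[OF i us] st] .
      note v = cv[OF cm xm, unfolded km]
      show ?thesis
        using evaluate_rf[OF X B pull_list_ob[OF cm arrows_start[OF xm]] E tw v] rD[OF cm xm, unfolded lm km] n p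
        unfolding evaluate_signed[OF N] by (simp add: face_inner[OF i] eps_twist_at[OF i])
    qed
    have "?b = (\<Sum>i\<in>{1..p}. signed i (rf X (G X (merge_arrows U (i - 1) us) D xs) (twist_at A (i - 1) us (start D xs))))"
      by (auto intro!: sum.reindex_bij_witness[where i = "\<lambda>i. i - 1" and j = Suc])
    then have "evaluate ?N ?b = (\<Oplus>\<^bsub>?N\<^esub>i\<in>{1..p}. evaluate ?N (signed i (rf X (G X (merge_arrows U (i - 1) us) D xs) (twist_at A (i - 1) us (start D xs)))))"
      using evaluate_sum[OF N, of "{1..p}"] by simp
    also have "\<dots> = finsum ?N ?f {1..p}"
    proof (rule N.finsum_cong')
      show g: "evaluate ?N (signed i (rf X (G X (merge_arrows U (i - 1) us) D xs) (twist_at A (i - 1) us (start D xs)))) = ?f i"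
        if "i \<in> {1..p}" for i
        using f[of "i - 1"] that by (cases i) auto
      show "?f \<in> {1..p} \<rightarrow> carrier ?N" using evaluate_closed[OF N] g by (metis (lifting) Pi_I)
    qed simp
    finally show ?thesis .
  qed
  have c: "evaluate ?N ?c = lact M X (csplit U A (X, us) p D)
      (\<Phi> (p, length xs) (face U (p + 1) (X, us)) (map (FOb (Pull A (us ! p))) (vertices D xs)) (map (FMor (Pull A (us ! p))) (map fst xs)))"
  proof -
    let ?L = "take p us" let ?V = "target U X ?L" let ?u = "us ! p"
    have R: "drop p us = [?u]" using p by (metis Cons_nth_drop_Suc drop_all lessI order_refl)
    note c = split_composable[OF us, of p, unfolded R] and so = split_objects[OF us D, of p, unfolded R]
    have u: "?u \<in> Arr U" "Dom U ?u = ?V" "Cod U ?u = ?Y" using c by auto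
    have T: "total_pull ?V [?u] = Pull A ?u" using composite_single[OF u(1)] by (simp del: composite.simps)
    let ?T = "Pull A ?u" let ?zs = "map (\<lambda>(x, B). (FMor ?T x, FOb ?T B)) xs"
    have P: "between ?Y ?V ?T" using pull[OF u(1)] u by simp
    have z: "arrows ?V (FOb ?T D) ?zs \<and> start (FOb ?T D) ?zs = FOb ?T (start D xs)"
      using xs
    proof (induction xs arbitrary: D)
      case Nil
      then show ?case using linear_functor_ob[OF P] by simp
    next
      case (Cons p xs)
      then show ?case using linear_functor_ob[OF P] linear_functor_mor[OF P] by (cases p) (auto dest: chain_vertex)
    qed
    have vz: "vertices (FOb ?T D) ?zs = map (FOb ?T) (vertices D xs)" "map fst ?zs = map (FMor ?T) (map fst xs)"
      by (auto simp: vertices_def rev_map)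
    have lL: "length ?L = p" using p by simp
    have BB: "FOb (pull_list A ?L) (FOb ?T (start D xs)) = ?B"
      using pull_list_append[of A ?L "[?u]"] append_take_drop_id[of p us] R by simp
    have "?c = lf X (split_twist X ?L [?u] D) (G X ?L (FOb ?T D) ?zs)"
      by (simp add: path_term_def R T shuffle_sum_no_nats del: composite.simps)
    moreover have "csplit U A (X, us) p D = split_twist X ?L [?u] D" using csp[of p] p R by simp
    moreover have "face U (p + 1) (X, us) = (X, ?L)" using face_last[of us U X] p by (cases "us = []") (auto simp: butlast_conv_take)
    moreover have "valued X ?B (FOb (total_pull X ?L) (FOb ?T D)) (G X ?L (FOb ?T D) ?zs)"
      using cv[OF c(1) z[THEN conjunct1]] z BB by simp
    ultimately show ?thesis
      using evaluate_lf[OF X B so(2) E so(3), of "G X ?L (FOb ?T D) ?zs"] rD[OF c(1) z[THEN conjunct1]] z BB n p lL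
      unfolding T by (simp add: vz del: map_map composite.simps)
  qed
  have "simp_first G X us D xs + simp_inner G X us D xs + signed (length xs) ?c =
      signed (p + length xs + 1) (?a + ?b + signed (p + 1) ?c)"
    using p by (simp add: simp_first_def simp_inner_def U signed_add signed_signed del: composite.simps signed_Suc_Suc)
      (simp add: signed_def)
  then show ?thesis
    unfolding d_simp_def Let_def fst_conv snd_conv last_vertices hd_vertices coeffs_vertices[OF us] a[symmetric] b[symmetric] c[symmetric]
    by (simp only: evaluate_signed[OF N] evaluate_add[OF N])
qed

end

lemma minus_one_power_mult: "((- 1 :: int) ^ a) * (- 1) ^ b * (- 1) ^ c = (- 1) ^ (c + a + b)"
  by (simp add: power_add)

context prestack_bimodule
begin

text \<open>The sign of a summand collects the three factors of its definition: the sum of the choices of the path,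
  the inversions of the shuffle, and the number of arrows.\<close>

lemma evaluate_path:
  assumes r: "represents n G \<Phi>" and us: "composable U X us" and xs: "arrows (target U X us) D xs"
    and n: "length us + length xs = Suc n" and p: "length us = p + j" and j: "2 \<le> j" and q: "q + 1 = length xs + j"
  shows "evaluate (Bim M X (FOb (pull_list A us) (start D xs)) (FOb (total_pull X us) D))
      (signed (length xs) (path_term p G X us D xs)) =
    d_high U A M j p q (\<Phi> (p, q)) (X, us) (vertices D xs) (map fst xs)"
proof -
  let ?Y = "target U X us" and ?B = "FOb (pull_list A us) (start D xs)" and ?E = "FOb (total_pull X us) D"
  let ?L = "take p us" and ?R = "drop p us" let ?V = "target U X ?L" let ?T = "total_pull ?V ?R"
  let ?TD = "FOb ?T D" let ?PTD = "FOb (total_pull X ?L) ?TD"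
  let ?N = "Bim M X ?B ?E" and ?t = "split_twist X ?L ?R D"
  have m: "multilinear G" using r by (simp add: represents_def)
  note rD = representsD[OF r] and cv = cochain_valuesD[OF multilinear_values[OF m]]
  have X: "X \<in> Obj U" and Y: "?Y \<in> Obj U" using us by (auto intro: composable_source composable_target)
  have B: "?B \<in> ob X" using pull_list_ob[OF us arrows_start[OF xs]] .
  have E: "?E \<in> ob X" using pull_total_ob[OF us arrows_vertex[OF xs]] .
  have D: "D \<in> ob ?Y" using xs by (rule arrows_vertex)
  note N = bim_group[OF X B E]
  interpret N: abelian_group ?N by (rule N)
  note c = split_composable[OF us, of p] and so = split_objects[OF us D, of p]
  have lR: "length ?R = j" and lL: "length ?L = p" using p by auto
  let ?c = "\<lambda>r. path_chain U A ?R r"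
  let ?w = "word_of (length xs) (j - 1)"
  let ?g = "\<lambda>r \<beta>. mor_word_chain D xs ?T (?c r) (?w \<beta>)"
  let ?S = "shuffle_perms (length xs) (j - 1)"
  let ?h = "\<lambda>r \<beta>. signed (length xs + sum_list r + inversions (?w \<beta>)) (lf X ?t (G X ?L ?TD (?g r \<beta>)))"
  have lc: "length (?c r) = j - 1" if "r \<in> paths j" for r
    using that by (simp add: length_path_chain_paths)
  have "signed (length xs) (path_term p G X us D xs) = (\<Sum>r\<in>paths j. \<Sum>\<beta>\<in>?S. ?h r \<beta>)"
    unfolding path_term_def path_sum_def lR
    by (simp add: sum_shuffle_perms lc lin_simps signed_sum signed_signed add.assoc)
  then have "evaluate ?N (signed (length xs) (path_term p G X us D xs)) = evaluate ?N (\<Sum>r\<in>paths j. \<Sum>\<beta>\<in>?S. ?h r \<beta>)"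
    by simp
  also have "\<dots> = (\<Oplus>\<^bsub>?N\<^esub>r\<in>paths j. evaluate ?N (\<Sum>\<beta>\<in>?S. ?h r \<beta>))"
    by (rule evaluate_sum[OF N]) simp
  also have "\<dots> = (\<Oplus>\<^bsub>?N\<^esub>r\<in>paths j. \<Oplus>\<^bsub>?N\<^esub>\<beta>\<in>?S. [(path_sign r * sign \<beta> * (- 1) ^ length xs)] \<cdot>\<^bsub>?N\<^esub>
         lact M X (csplit U A (X, us) p D) (\<Phi> (p, q) (X, ?L)
              (shuffle_objects \<beta> (path_functors U A (?V, ?R) r) (path_nats U A (?V, ?R) r) (vertices D xs) (map fst xs))
              (shuffle_arrows \<beta> (path_functors U A (?V, ?R) r) (path_nats U A (?V, ?R) r) (vertices D xs) (map fst xs))))"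
    (is "_ = finsum _ (\<lambda>r. finsum _ (?f r) _) _")
  proof -
    have e: "evaluate ?N (?h r \<beta>) = ?f r \<beta>" if r: "r \<in> paths j" and b: "\<beta> \<in> ?S" for r \<beta>
    proof -
      have rR: "r \<in> paths (length ?R)" using r lR by simp
      have w: "?w \<beta> \<in> words (length xs) (length (?c r))" using word_of_words[OF b] lc[OF r] by simp
      note rc = path_arrows[OF c(2) rR, unfolded c(3)]
      note sh = word_chain_shuffles_of[OF w, of D ?T FOb FMor "\<lambda>\<eta> B. \<eta> B"]
      have ar: "arrows ?V ?TD (?g r \<beta>)" using shuffles_arrows[OF sh xs rc(1)] .
      have sg: "FOb (pull_list A ?L) (start ?TD (?g r \<beta>)) = ?B"
        using shuffles_of_start[OF sh] rc(2) pull_list_append[of A ?L ?R] by simp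
      have lg: "length (?g r \<beta>) = q"
        using word_chain_length[OF w, of FOb FMor "\<lambda>\<eta> B. \<eta> B" D ?T] q j by simp
      have v: "valued X ?B ?PTD (G X ?L ?TD (?g r \<beta>))" using cv[OF c(1) ar] sg by simp
      have "length ?L + length (?g r \<beta>) = n" using lL lg n p q by simp
      then have G: "evaluate (Bim M X ?B ?PTD) (G X ?L ?TD (?g r \<beta>)) =
          \<Phi> (p, q) (X, ?L) (vertices ?TD (?g r \<beta>)) (map fst (?g r \<beta>))"
        using rD[OF c(1) ar] unfolding sg lg lL by simp
      have b': "\<beta> \<in> shuffle_perms (length xs) (length (?c r))" using b lc[OF r] by simp
      have s: "sign \<beta> = (- 1) ^ inversions (?w \<beta>)" using shuffle_perms_words[of "length xs" "j - 1"] b by blast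
      have cs: "csplit U A (X, us) p D = ?t" using csplit_split_twist[OF us _ D, of p] p by simp
      show ?thesis
        unfolding evaluate_signed[OF N] evaluate_lf[OF X B so(2) E so(3) v] G path_functors_chain[OF rR c(2)]
          path_nats_chain[OF rR] shuffle_arrows_word_chain[OF b'] lc[OF r] s path_sign_sum cs minus_one_power_mult by (rule refl)
    qed
    have f: "?f r \<in> ?S \<rightarrow> carrier ?N" if "r \<in> paths j" for r
      using evaluate_closed[OF N] e[OF that] by (metis (lifting) Pi_I)
    have e2: "evaluate ?N (\<Sum>\<beta>\<in>?S. ?h r \<beta>) = finsum ?N (?f r) ?S" if r: "r \<in> paths j" for r
    proof -
      have "finite ?S"
        using finite_permutations[of "{1..length xs + (j - 1)}"] by (rule finite_subset[rotated]) (auto simp: shuffle_perms_def)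
      then have "evaluate ?N (\<Sum>\<beta>\<in>?S. ?h r \<beta>) = (\<Oplus>\<^bsub>?N\<^esub>\<beta>\<in>?S. evaluate ?N (?h r \<beta>))"
        by (rule evaluate_sum[OF N])
      also have "\<dots> = finsum ?N (?f r) ?S"
        by (rule N.finsum_cong'[OF refl f[OF r] e[OF r]])
      finally show ?thesis .
    qed
    show ?thesis
      by (rule N.finsum_cong'[OF refl Pi_I e2]) (rule N.finsum_closed[OF f])
  qed
  also have "\<dots> = d_high U A M j p q (\<Phi> (p, q)) (X, us) (vertices D xs) (map fst xs)"
  proof -
    have t: "q + 1 - j = length xs" using q by simp
    show ?thesis
      unfolding d_high_def t Let_def coeffs_vertices[OF us] last_vertices fst_conv
        Rpart_pair[of p us U X, OF le_add1[of p j, folded p]] Lpart_pair ..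
  qed
  finally show ?thesis .
qed

text \<open>For fixed target bidegree, a component of the differential is determined by \<open>j\<close>; the formal
  differential is regrouped accordingly, the cut at \<open>p\<close> contributing to the component with \<open>j = length us - p\<close>.\<close>

lemma evaluate_formal_d:
  assumes r: "represents n G \<Phi>" and us: "composable U X us" and xs: "arrows (target U X us) D xs"
    and n: "length us + length xs = Suc n"
  shows "evaluate (Bim M X (FOb (pull_list A us) (start D xs)) (FOb (total_pull X us) D)) (formal_d G X us D xs) =
    finsum (coeffs U A M (X, us) (vertices D xs)) (\<lambda>(j, p, q). d_comp U A M j p q (\<Phi> (p, q)) (X, us) (vertices D xs) (map fst xs))
       {(j, p, q). j \<le> q + 1 \<and> p + j = length us \<and> q + 1 - j = length xs}" (is "evaluate ?N _ = finsum _ ?f ?I")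
proof -
  have X: "X \<in> Obj U" using us by (rule composable_source)
  note N = bim_group[OF X pull_list_ob[OF us arrows_start[OF xs]] pull_total_ob[OF us arrows_vertex[OF xs]]]
  interpret N: abelian_group ?N by (rule N)
  let ?p = "length us" and ?q = "length xs"
  let ?h = "\<lambda>j. if j = 0 then hoch_left G X us D xs + hoch_inner G X us D xs + hoch_right G X us D xs
    else if j = 1 then simp_first G X us D xs + simp_inner G X us D xs + signed ?q (path_term (?p - 1) G X us D xs)
    else signed ?q (path_term (?p - j) G X us D xs)"
  let ?J = "{j. j \<le> ?p \<and> (j = 0 \<longrightarrow> 0 < ?q)}"
  let ?i = "\<lambda>j. (j, ?p - j, ?q + j - 1)"
  (* For j = 0 the source bidegree exists only if there is an arrow to be removed. *)
  have I: "?I = ?i ` ?J"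
  proof (intro Set.set_eqI iffI)
    fix x assume "x \<in> ?I"
    then obtain j p q where x: "x = (j, p, q)" "j \<le> q + 1" "p + j = ?p" "q + 1 - j = ?q" by auto
    then have "x = ?i j" "j \<in> ?J" by auto
    then show "x \<in> ?i ` ?J" by blast
  qed auto
  have e: "evaluate ?N (?h (fst x)) = ?f x" if "x \<in> ?I" for x
  proof -
    obtain j p q where x: "x = (j, p, q)" by (cases x)
    then have jpq: "j \<le> q + 1" "p + j = ?p" "q + 1 - j = ?q" using that by auto
    then have q: "q + 1 = ?q + j" by simp
    consider "j = 0" | "j = 1" | "2 \<le> j" by linarith
    then show ?thesis
    proof cases
      case 1
      then show ?thesis using evaluate_hoch[OF r us xs n, of q] jpq q by (simp add: x d_comp_def)
    next
      case 2
      then have "?p - Suc 0 = p" using jpq by simp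
      then show ?thesis using evaluate_simp[OF r us xs n, of p] 2 jpq q by (simp add: x d_comp_def)
    next
      case 3
      then have "?p - j = p" using jpq by simp
      then show ?thesis using evaluate_path[OF r us xs n _ 3 q, of p] jpq 3 by (simp add: x d_comp_def)
    qed
  qed
  have h0: "?h 0 = 0" if "?q = 0"
    using that by (simp add: hoch_left_def hoch_inner_def hoch_right_def)
  have "(\<Sum>x\<in>?I. ?h (fst x)) = (\<Sum>j\<in>?J. ?h j)"
    unfolding I by (subst sum.reindex) (auto simp: inj_on_def cong: if_cong)
  also have "\<dots> = (\<Sum>j\<le>?p. ?h j)"
    using h0 by (intro sum.mono_neutral_left) auto
  also have "\<dots> = ?h 0 + (\<Sum>i<?p. ?h (Suc i))" by (rule sum.atMost_shift)
  also have "(\<Sum>i<?p. ?h (Suc i)) = simp_first G X us D xs + simp_inner G X us D xs + path_part G X us D xs"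
  proof (cases ?p)
    case 0
    then show ?thesis by (simp add: simp_first_def simp_inner_def path_part_def)
  next
    case (Suc p)
    have "path_part G X us D xs = (\<Sum>i<?p. signed ?q (path_term (?p - Suc i) G X us D xs))"
      unfolding path_part_def signed_sum by (rule sum.nat_diff_reindex[symmetric])
    then show ?thesis
      unfolding Suc sum.lessThan_Suc_shift by (simp add: Suc add.assoc)
  qed
  finally have "formal_d G X us D xs = (\<Sum>x\<in>?I. ?h (fst x))"
    by (simp add: formal_d_def add.assoc)
  then have "evaluate ?N (formal_d G X us D xs) = evaluate ?N (\<Sum>x\<in>?I. ?h (fst x))" by (rule arg_cong)
  also have "\<dots> = (\<Oplus>\<^bsub>?N\<^esub>x\<in>?I. evaluate ?N (?h (fst x)))"
  proof (rule evaluate_sum[OF N])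
    have "?J \<subseteq> {..?p}" by auto
    then have "finite ?J" by (rule finite_subset) simp
    then show "finite ?I" unfolding I by (rule finite_imageI)
  qed
  also have "\<dots> = finsum ?N ?f ?I"
  proof (rule N.finsum_cong'[OF refl Pi_I e])
    show "?f x \<in> carrier ?N" if "x \<in> ?I" for x
      unfolding e[OF that, symmetric] by (rule evaluate_closed[OF N])
  qed
  finally show ?thesis by (simp only: coeffs_vertices[OF us])
qed

text \<open>Hence the differential maps cochains to cochains, multilinearity being inherited from the formal
  differential, and its square is represented by the square of the formal differential.\<close>

lemma represents_gs_d:
  assumes r: "represents n G \<Phi>"
  shows "represents (n + 1) (formal_d G) (gs_d U A M n \<Phi>)" and "gs_d U A M n \<Phi> \<in> CGS k U A M (n + 1)"
proof -
  have "represents (n + 1) (formal_d G) (\<lambda>(p', q') \<sigma> As as.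
     finsum (coeffs U A M \<sigma> As) (\<lambda>(j, p, q). d_comp U A M j p q (\<Phi> (p, q)) \<sigma> As as)
       {(j, p, q). j \<le> q + 1 \<and> p + j = p' \<and> q + 1 - j = q'})" (is "represents _ _ ?\<Psi>")
    unfolding represents_def
  proof (intro conjI allI impI)
    show "multilinear (formal_d G)" using r multilinear_formal_d unfolding represents_def by blast
    fix X us D xs assume us: "composable U X us" and xs: "arrows (target U X us) D xs" and n: "length us + length xs = n + 1"
    show "evaluate (coeffs U A M (X, us) (vertices D xs)) (formal_d G X us D xs) =
        ?\<Psi> (length us, length xs) (X, us) (vertices D xs) (map fst xs)"
      using evaluate_formal_d[OF r us xs] n by (simp add: coeffs_vertices[OF us])
  qed
  then show "represents (n + 1) (formal_d G) (gs_d U A M n \<Phi>)" "gs_d U A M n \<Phi> \<in> CGS k U A M (n + 1)"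
    unfolding gs_d_def by (rule represents_restrict, rule represented_CGS)
qed

lemma gs_d_squared:
  assumes "\<Phi> \<in> CGS k U A M n"
  shows "gs_d U A M (n + 1) (gs_d U A M n \<Phi>) = gs_zero U A M (n + 2)"
proof -
  obtain G where r: "represents n G \<Phi>" using CGS_represented[OF assms] by blast
  have r2: "represents (n + 1 + 1) (formal_d (formal_d G)) (gs_d U A M (n + 1) (gs_d U A M n \<Phi>))"
    by (intro represents_gs_d(1) r)
  have c: "cochain_values G" using r multilinear_values unfolding represents_def by blast
  have "gs_restrict U A (n + 2) (gs_d U A M (n + 1) (gs_d U A M n \<Phi>)) = gs_zero U A M (n + 2)"
    unfolding gs_zero_def
  proof (rule gs_restrict_cong)
    fix X us D xs assume us: "composable U X us" and xs: "arrows (target U X us) D xs" and n: "length us + length xs = n + 2"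
    note N = bim_group[OF composable_source[OF us] pull_list_ob[OF us arrows_start[OF xs]] pull_total_ob[OF us arrows_vertex[OF xs]]]
    show "gs_d U A M (n + 1) (gs_d U A M n \<Phi>) (length us, length xs) (X, us) (vertices D xs) (map fst xs) =
      \<zero>\<^bsub>coeffs U A M (X, us) (vertices D xs)\<^esub>"
      using representsD[OF r2 us xs] n formal_d_formal_d[OF c us xs] evaluate_zero[OF N] by (simp add: coeffs_vertices[OF us])
  qed
  moreover have "gs_restrict U A (n + 2) (gs_d U A M (n + 1) (gs_d U A M n \<Phi>)) = gs_d U A M (n + 1) (gs_d U A M n \<Phi>)"
    by (simp add: gs_d_def gs_restrict_idem)
  ultimately show ?thesis by simp
qed

end

theorem theorem3p8:
  fixes k :: "'k ring" and U :: "('o, 'u) category"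
    and A :: "('k, 'o, 'u, 'a, 'f) prestack_data"
    and M :: "('k, 'o, 'u, 'a, 'f, 'm) bimodule_data"
  assumes "cring k" and "small_category U" and "prestack k U A" and "prestack_bimodule k U A M"
  shows "\<forall>n. gs_d U A M n \<in> CGS k U A M n \<rightarrow> CGS k U A M (n + 1) \<and>
    (\<forall>\<Phi>\<in>CGS k U A M n. gs_d U A M (n + 1) (gs_d U A M n \<Phi>) = gs_zero U A M (n + 2))"
proof -
  interpret prestack_bimodule k U A M by (rule assms(4))
  show ?thesis using represents_gs_d(2)[OF CGS_represented] gs_d_squared by blast
qed

end
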